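(* The functor $R\mapsto\mathbf{R}$ from directed restriction species to decomposition spaces and CULF functors (sending a directed restriction species to its decomposition space of layered $R$-structures) extends to a functor from monoidal directed restriction species and their morphisms to monoidal decomposition spaces and CULF monoidal functors.
   Context: Conventions: functors into groupoids $\mathbf{Grpd}$ (in particular simplicial groupoids $\Delta^{\mathrm{op}}\to\mathbf{Grpd}$) are pseudo-functors, transformations are pseudo-natural, pullbacks are homotopy pullbacks. A map of posets $f:K\to P$ is convex if for all $a,b\in K$ and $fa\le x\le fb$ in $P$ there is a unique $k\in K$ with $a\le k\le b$ and $fk=x$. $\mathbb{C}$ is the category of finite posets and convex maps; it is symmetric monoidal under disjoint union. A directed restriction species is a pseudo-functor $R:\mathbb{C}^{\mathrm{op}}\to\mathbf{Grpd}$ with locally finite values (all automorphism groups finite), or equivalently a right fibration (cartesian fibration with groupoid fibres) $\mathbb{R}\to\mathbb{C}$; morphisms are pseudo-natural transformations, equivalently morphisms of right fibrations over $\mathbb{C}$. For $K\subset P$ convex and $X\in R[P]$, $X|K\in R[K]$ is the restriction. A monoidal directed restriction species is a directed restriction species $\mathbb{R}\to\mathbb{C}$ for which the total category $\mathbb{R}$ has a monoidal structure $\sqcup$ and the right fibration is a strong monoidal functor. A morphism of these is a strong monoidal functor which is also a morphism of right fibrations. $\Delta$ has objects $[n]=\{0,\dots,n\}$. A map $a:[m]\to[n]$ is generic if $a(0)=0$ and $a(m)=n$, and free if $a(i+1)=a(i)+1$ for $0\le i\le m-1$; every map factors uniquely as generic followed by free, and generic and free maps admit pushouts along each other. A decomposition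 space is a simplicial groupoid sending generic–free pushouts in $\Delta$ to pullbacks. A simplicial map is CULF if its naturality squares on all generic maps are pullbacks. A monoidal decomposition space is a decomposition space $\mathbf{X}$ with a functor $\otimes:\mathbf{X}\times\mathbf{X}\to\mathbf{X}$ required to be a monoidal structure and to be CULF. $\underline{\Delta}$ has objects $\underline n=\{1,\dots,n\}$, $n\ge0$, and monotone maps. A generic map $g:[n]\to[m]$ corresponds to $\underline g:\underline m\to\underline n$ sending $j$ to the unique $i$ with $g(i-1)<j\le g(i)$. A free map $f:[n]\to[m]$, $f(i)=i+c$, with $n\ge1$, corresponds to $\underline f:\underline n\to\underline m$, $i\mapsto i+c$; every map $[0]\to[m]$ corresponds to $\underline 0\to\underline m$. Given $R$, $\mathbf{R}_n$ is the groupoid of triples $(P,\ell,X)$ with $P$ a finite poset, $\ell:P\to\underline n$ a monotone map and $X\in R[P]$, with morphisms the isomorphisms of $R$-structures whose underlying poset isomorphism is over $\underline n$. A generic map $g:[n]\to[m]$ acts by $(P,\ell,X)\mapsto(P,\underline g\circ\ell,X)$; a free map $f:[n]\to[m]$ acts by $(P,\ell,X)\mapsto(P',\ell',X|P')$ where $\ell':P'\to\underline n$ is the pullback of $\ell$ along $\underline f$. A morphism $\phi:R'\to R$ induces $(P,\ell,X)\mapsto(P,\ell,\phi(X))$. For a monoidal $R$, the monoidal structure on $\mathbf{R}$ is given in degree $n$ by $\sqcup$ on $R$-structures, the disjoint union of underlying posets carrying the layering to $\underline n$ induced from those of the two summands. *)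

theory Defs
  imports Main "HOL-Library.FuncSet"
begin

section \<open>Categories, functors, natural transformations\<close>

record ('o, 'a) cat =
  Ob :: "'o set"
  Ar :: "'a set"
  Src :: "'a \<Rightarrow> 'o"
  Tgt :: "'a \<Rightarrow> 'o"
  Ide :: "'o \<Rightarrow> 'a"
  Cmp :: "'a \<Rightarrow> 'a \<Rightarrow> 'a"  (infixr "\<cdot>\<index>" 75)

definition hom :: "('o, 'a) cat \<Rightarrow> 'o \<Rightarrow> 'o \<Rightarrow> 'a set" where
  "hom C x y = {a \<in> Ar C. Src C a = x \<and> Tgt C a = y}"

definition category :: "('o, 'a) cat \<Rightarrow> bool" where
  "category C \<longleftrightarrow>
     (\<forall>a\<in>Ar C. Src C a \<in> Ob C \<and> Tgt C a \<in> Ob C) \<and>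
     (\<forall>x\<in>Ob C. Ide C x \<in> hom C x x) \<and>
     (\<forall>x y z. \<forall>a\<in>hom C x y. \<forall>b\<in>hom C y z. b \<cdot>\<^bsub>C\<^esub> a \<in> hom C x z) \<and>
     (\<forall>x y. \<forall>a\<in>hom C x y. a \<cdot>\<^bsub>C\<^esub> Ide C x = a \<and> Ide C y \<cdot>\<^bsub>C\<^esub> a = a) \<and>
     (\<forall>w x y z. \<forall>a\<in>hom C w x. \<forall>b\<in>hom C x y. \<forall>c\<in>hom C y z.
        c \<cdot>\<^bsub>C\<^esub> (b \<cdot>\<^bsub>C\<^esub> a) = (c \<cdot>\<^bsub>C\<^esub> b) \<cdot>\<^bsub>C\<^esub> a)"

definition inverses :: "('o, 'a) cat \<Rightarrow> 'a \<Rightarrow> 'a \<Rightarrow> bool" where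
  "inverses C a b \<longleftrightarrow> a \<in> Ar C \<and> b \<in> hom C (Tgt C a) (Src C a) \<and>
     b \<cdot>\<^bsub>C\<^esub> a = Ide C (Src C a) \<and> a \<cdot>\<^bsub>C\<^esub> b = Ide C (Tgt C a)"

definition is_iso :: "('o, 'a) cat \<Rightarrow> 'a \<Rightarrow> bool" where
  "is_iso C a \<longleftrightarrow> (\<exists>b. inverses C a b)"

definition inv_ar :: "('o, 'a) cat \<Rightarrow> 'a \<Rightarrow> 'a" where
  "inv_ar C a = (THE b. inverses C a b)"

definition groupoid :: "('o, 'a) cat \<Rightarrow> bool" where
  "groupoid C \<longleftrightarrow> category C \<and> (\<forall>a\<in>Ar C. is_iso C a)"

definition pushout :: "('o, 'a) cat \<Rightarrow> 'a \<Rightarrow> 'a \<Rightarrow> 'a \<Rightarrow> 'a \<Rightarrow> bool" where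
  "pushout C f g g' f' \<longleftrightarrow>
     f \<in> Ar C \<and> g \<in> Ar C \<and> Src C f = Src C g \<and>
     (\<exists>l. g' \<in> hom C (Tgt C f) l \<and> f' \<in> hom C (Tgt C g) l \<and> g' \<cdot>\<^bsub>C\<^esub> f = f' \<cdot>\<^bsub>C\<^esub> g \<and>
       (\<forall>w. \<forall>u\<in>hom C (Tgt C f) w. \<forall>v\<in>hom C (Tgt C g) w. u \<cdot>\<^bsub>C\<^esub> f = v \<cdot>\<^bsub>C\<^esub> g \<longrightarrow>
          (\<exists>!h. h \<in> hom C l w \<and> h \<cdot>\<^bsub>C\<^esub> g' = u \<and> h \<cdot>\<^bsub>C\<^esub> f' = v)))"

text \<open>Functors are extensional functions, so that equality of functors is equality in HOL.\<close>

record ('o, 'a, 'p, 'b) ftor =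
  OM :: "'o \<Rightarrow> 'p"
  AM :: "'a \<Rightarrow> 'b"

definition is_functor :: "('o, 'a) cat \<Rightarrow> ('p, 'b) cat \<Rightarrow> ('o, 'a, 'p, 'b) ftor \<Rightarrow> bool" where
  "is_functor C D F \<longleftrightarrow>
     OM F \<in> Ob C \<rightarrow>\<^sub>E Ob D \<and> AM F \<in> Ar C \<rightarrow>\<^sub>E Ar D \<and>
     (\<forall>a\<in>Ar C. Src D (AM F a) = OM F (Src C a) \<and> Tgt D (AM F a) = OM F (Tgt C a)) \<and>
     (\<forall>x\<in>Ob C. AM F (Ide C x) = Ide D (OM F x)) \<and>
     (\<forall>a\<in>Ar C. \<forall>b\<in>Ar C. Tgt C a = Src C b \<longrightarrow> AM F (b \<cdot>\<^bsub>C\<^esub> a) = AM F b \<cdot>\<^bsub>D\<^esub> AM F a)"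

definition id_ftor :: "('o, 'a) cat \<Rightarrow> ('o, 'a, 'o, 'a) ftor" where
  "id_ftor C = \<lparr>OM = (\<lambda>x\<in>Ob C. x), AM = (\<lambda>a\<in>Ar C. a)\<rparr>"

definition comp_ftor :: "('o, 'a) cat \<Rightarrow> ('p, 'b, 'q, 'c) ftor \<Rightarrow> ('o, 'a, 'p, 'b) ftor
    \<Rightarrow> ('o, 'a, 'q, 'c) ftor" where
  "comp_ftor C G F = \<lparr>OM = compose (Ob C) (OM G) (OM F), AM = compose (Ar C) (AM G) (AM F)\<rparr>"

definition is_nat :: "('o, 'a) cat \<Rightarrow> ('p, 'b) cat \<Rightarrow> ('o, 'a, 'p, 'b) ftor \<Rightarrow> ('o, 'a, 'p, 'b) ftor
    \<Rightarrow> ('o \<Rightarrow> 'b) \<Rightarrow> bool" where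
  "is_nat C D F G t \<longleftrightarrow>
     (\<forall>x\<in>Ob C. t x \<in> hom D (OM F x) (OM G x)) \<and>
     (\<forall>a\<in>Ar C. t (Tgt C a) \<cdot>\<^bsub>D\<^esub> AM F a = AM G a \<cdot>\<^bsub>D\<^esub> t (Src C a))"

definition is_nat_iso :: "('o, 'a) cat \<Rightarrow> ('p, 'b) cat \<Rightarrow> ('o, 'a, 'p, 'b) ftor
    \<Rightarrow> ('o, 'a, 'p, 'b) ftor \<Rightarrow> ('o \<Rightarrow> 'b) \<Rightarrow> bool" where
  "is_nat_iso C D F G t \<longleftrightarrow> is_nat C D F G t \<and> (\<forall>x\<in>Ob C. is_iso D (t x))"

definition is_equivalence :: "('o, 'a) cat \<Rightarrow> ('p, 'b) cat \<Rightarrow> ('o, 'a, 'p, 'b) ftor \<Rightarrow> bool" where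
  "is_equivalence C D F \<longleftrightarrow> is_functor C D F \<and>
     (\<forall>x\<in>Ob C. \<forall>y\<in>Ob C. bij_betw (AM F) (hom C x y) (hom D (OM F x) (OM F y))) \<and>
     (\<forall>z\<in>Ob D. \<exists>x\<in>Ob C. \<exists>a\<in>hom D (OM F x) z. is_iso D a)"

definition unit_cat :: "(unit, unit) cat" where
  "unit_cat = \<lparr>Ob = UNIV, Ar = UNIV, Src = (\<lambda>_. ()), Tgt = (\<lambda>_. ()), Ide = (\<lambda>_. ()), Cmp = (\<lambda>_ _. ())\<rparr>"

definition prod_cat :: "('o, 'a) cat \<Rightarrow> ('p, 'b) cat \<Rightarrow> ('o \<times> 'p, 'a \<times> 'b) cat" where
  "prod_cat C D = \<lparr>Ob = Ob C \<times> Ob D, Ar = Ar C \<times> Ar D,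
     Src = (\<lambda>(a, b). (Src C a, Src D b)), Tgt = (\<lambda>(a, b). (Tgt C a, Tgt D b)),
     Ide = (\<lambda>(x, y). (Ide C x, Ide D y)),
     Cmp = (\<lambda>(a', b') (a, b). (a' \<cdot>\<^bsub>C\<^esub> a, b' \<cdot>\<^bsub>D\<^esub> b))\<rparr>"

definition prod_ftor :: "('o, 'a) cat \<Rightarrow> ('o2, 'a2) cat \<Rightarrow> ('o, 'a, 'p, 'b) ftor
    \<Rightarrow> ('o2, 'a2, 'p2, 'b2) ftor \<Rightarrow> ('o \<times> 'o2, 'a \<times> 'a2, 'p \<times> 'p2, 'b \<times> 'b2) ftor" where
  "prod_ftor C D F G =
     \<lparr>OM = (\<lambda>(x, y)\<in>Ob C \<times> Ob D. (OM F x, OM G y)), AM = (\<lambda>(a, b)\<in>Ar C \<times> Ar D. (AM F a, AM G b))\<rparr>"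


section \<open>Homotopy pullbacks of groupoids\<close>

definition iso_comma :: "('o, 'a) cat \<Rightarrow> ('p, 'b) cat \<Rightarrow> ('q, 'c) cat
    \<Rightarrow> ('o, 'a, 'q, 'c) ftor \<Rightarrow> ('p, 'b, 'q, 'c) ftor
    \<Rightarrow> ('o \<times> 'p \<times> 'c, ('o \<times> 'p \<times> 'c) \<times> ('a \<times> 'b) \<times> ('o \<times> 'p \<times> 'c)) cat" where
  "iso_comma A B C U V =
     (let obs = {(x, y, c). x \<in> Ob A \<and> y \<in> Ob B \<and> c \<in> hom C (OM U x) (OM V y) \<and> is_iso C c} in
     \<lparr>Ob = obs,
      Ar = {((x, y, c), (a, b), (x', y', c')) | x y c a b x' y' c'.
              (x, y, c) \<in> obs \<and> (x', y', c') \<in> obs \<and> a \<in> hom A x x' \<and> b \<in> hom B y y' \<and>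
              AM V b \<cdot>\<^bsub>C\<^esub> c = c' \<cdot>\<^bsub>C\<^esub> AM U a},
      Src = fst, Tgt = (\<lambda>(_, _, z). z),
      Ide = (\<lambda>(x, y, c). ((x, y, c), (Ide A x, Ide B y), (x, y, c))),
      Cmp = (\<lambda>(_, (a', b'), z) (w, (a, b), _). (w, (a' \<cdot>\<^bsub>A\<^esub> a, b' \<cdot>\<^bsub>B\<^esub> b), z))\<rparr>)"

text \<open>A square of groupoids with sides \<open>P : L \<rightarrow> A\<close>, \<open>Q : L \<rightarrow> B\<close>, \<open>U : A \<rightarrow> C\<close>, \<open>V : B \<rightarrow> C\<close>,
  filled by a natural isomorphism \<open>t : U P \<rightarrow> V Q\<close>, is a homotopy pullback if the comparison
  functor to the iso-comma groupoid is an equivalence.\<close>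

definition hpullback :: "('k, 'd) cat \<Rightarrow> ('o, 'a) cat \<Rightarrow> ('p, 'b) cat \<Rightarrow> ('q, 'c) cat
    \<Rightarrow> ('k, 'd, 'o, 'a) ftor \<Rightarrow> ('k, 'd, 'p, 'b) ftor
    \<Rightarrow> ('o, 'a, 'q, 'c) ftor \<Rightarrow> ('p, 'b, 'q, 'c) ftor \<Rightarrow> ('k \<Rightarrow> 'c) \<Rightarrow> bool" where
  "hpullback L A B C P Q U V t \<longleftrightarrow>
     is_functor L A P \<and> is_functor L B Q \<and> is_functor A C U \<and> is_functor B C V \<and>
     is_nat_iso L C (comp_ftor L U P) (comp_ftor L V Q) t \<and>
     (let k = (\<lambda>x. (OM P x, OM Q x, t x)) in
       is_equivalence L (iso_comma A B C U V)
         \<lparr>OM = (\<lambda>x\<in>Ob L. k x), AM = (\<lambda>a\<in>Ar L. (k (Src L a), (AM P a, AM Q a), k (Tgt L a)))\<rparr>)"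


section \<open>Monoidal categories and strong monoidal functors\<close>

record ('o, 'a) monoidal =
  Tns :: "('o \<times> 'o, 'a \<times> 'a, 'o, 'a) ftor"
  Unt :: 'o
  Asc :: "'o \<Rightarrow> 'o \<Rightarrow> 'o \<Rightarrow> 'a"
  Lun :: "'o \<Rightarrow> 'a"
  Run :: "'o \<Rightarrow> 'a"

abbreviation tns_ob :: "('o, 'a) monoidal \<Rightarrow> 'o \<Rightarrow> 'o \<Rightarrow> 'o"  ("_ \<otimes>\<index> _" [71, 70] 70) where
  "x \<otimes>\<^bsub>M\<^esub> y \<equiv> OM (Tns M) (x, y)"

abbreviation tns_ar :: "('o, 'a) monoidal \<Rightarrow> 'a \<Rightarrow> 'a \<Rightarrow> 'a"  ("_ \<odot>\<index> _" [81, 80] 80) where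
  "a \<odot>\<^bsub>M\<^esub> b \<equiv> AM (Tns M) (a, b)"

definition monoidal_category :: "('o, 'a) cat \<Rightarrow> ('o, 'a) monoidal \<Rightarrow> bool" where
  "monoidal_category C M \<longleftrightarrow>
     category C \<and> is_functor (prod_cat C C) C (Tns M) \<and> Unt M \<in> Ob C \<and>
     (\<forall>x\<in>Ob C. \<forall>y\<in>Ob C. \<forall>z\<in>Ob C.
        Asc M x y z \<in> hom C ((x \<otimes>\<^bsub>M\<^esub> y) \<otimes>\<^bsub>M\<^esub> z) (x \<otimes>\<^bsub>M\<^esub> (y \<otimes>\<^bsub>M\<^esub> z)) \<and> is_iso C (Asc M x y z)) \<and>
     (\<forall>x\<in>Ob C. Lun M x \<in> hom C (Unt M \<otimes>\<^bsub>M\<^esub> x) x \<and> is_iso C (Lun M x)) \<and>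
     (\<forall>x\<in>Ob C. Run M x \<in> hom C (x \<otimes>\<^bsub>M\<^esub> Unt M) x \<and> is_iso C (Run M x)) \<and>
     (\<forall>a\<in>Ar C. \<forall>b\<in>Ar C. \<forall>c\<in>Ar C.
        Asc M (Tgt C a) (Tgt C b) (Tgt C c) \<cdot>\<^bsub>C\<^esub> ((a \<odot>\<^bsub>M\<^esub> b) \<odot>\<^bsub>M\<^esub> c)
        = (a \<odot>\<^bsub>M\<^esub> (b \<odot>\<^bsub>M\<^esub> c)) \<cdot>\<^bsub>C\<^esub> Asc M (Src C a) (Src C b) (Src C c)) \<and>
     (\<forall>a\<in>Ar C. Lun M (Tgt C a) \<cdot>\<^bsub>C\<^esub> (Ide C (Unt M) \<odot>\<^bsub>M\<^esub> a) = a \<cdot>\<^bsub>C\<^esub> Lun M (Src C a)) \<and>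
     (\<forall>a\<in>Ar C. Run M (Tgt C a) \<cdot>\<^bsub>C\<^esub> (a \<odot>\<^bsub>M\<^esub> Ide C (Unt M)) = a \<cdot>\<^bsub>C\<^esub> Run M (Src C a)) \<and>
     (\<forall>w\<in>Ob C. \<forall>x\<in>Ob C. \<forall>y\<in>Ob C. \<forall>z\<in>Ob C.
        Asc M w x (y \<otimes>\<^bsub>M\<^esub> z) \<cdot>\<^bsub>C\<^esub> Asc M (w \<otimes>\<^bsub>M\<^esub> x) y z
        = (Ide C w \<odot>\<^bsub>M\<^esub> Asc M x y z) \<cdot>\<^bsub>C\<^esub> Asc M w (x \<otimes>\<^bsub>M\<^esub> y) z \<cdot>\<^bsub>C\<^esub> (Asc M w x y \<odot>\<^bsub>M\<^esub> Ide C z)) \<and>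
     (\<forall>x\<in>Ob C. \<forall>y\<in>Ob C.
        (Ide C x \<odot>\<^bsub>M\<^esub> Lun M y) \<cdot>\<^bsub>C\<^esub> Asc M x (Unt M) y = Run M x \<odot>\<^bsub>M\<^esub> Ide C y)"

record ('o, 'a, 'p, 'b) mftor =
  Und :: "('o, 'a, 'p, 'b) ftor"
  Mul :: "'o \<times> 'o \<Rightarrow> 'b"
  Uni :: 'b

definition strong_monoidal :: "('o, 'a) cat \<Rightarrow> ('o, 'a) monoidal \<Rightarrow> ('p, 'b) cat \<Rightarrow> ('p, 'b) monoidal
    \<Rightarrow> ('o, 'a, 'p, 'b) mftor \<Rightarrow> bool" where
  "strong_monoidal C M D N F \<longleftrightarrow>
     is_functor C D (Und F) \<and>
     Mul F \<in> extensional (Ob C \<times> Ob C) \<and>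
     is_nat_iso (prod_cat C C) D
       (comp_ftor (prod_cat C C) (Tns N) (prod_ftor C C (Und F) (Und F)))
       (comp_ftor (prod_cat C C) (Und F) (Tns M)) (Mul F) \<and>
     Uni F \<in> hom D (Unt N) (OM (Und F) (Unt M)) \<and> is_iso D (Uni F) \<and>
     (\<forall>x\<in>Ob C. \<forall>y\<in>Ob C. \<forall>z\<in>Ob C.
        AM (Und F) (Asc M x y z) \<cdot>\<^bsub>D\<^esub> Mul F (x \<otimes>\<^bsub>M\<^esub> y, z) \<cdot>\<^bsub>D\<^esub> (Mul F (x, y) \<odot>\<^bsub>N\<^esub> Ide D (OM (Und F) z))
        = Mul F (x, y \<otimes>\<^bsub>M\<^esub> z) \<cdot>\<^bsub>D\<^esub> (Ide D (OM (Und F) x) \<odot>\<^bsub>N\<^esub> Mul F (y, z))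
            \<cdot>\<^bsub>D\<^esub> Asc N (OM (Und F) x) (OM (Und F) y) (OM (Und F) z)) \<and>
     (\<forall>x\<in>Ob C.
        AM (Und F) (Lun M x) \<cdot>\<^bsub>D\<^esub> Mul F (Unt M, x) \<cdot>\<^bsub>D\<^esub> (Uni F \<odot>\<^bsub>N\<^esub> Ide D (OM (Und F) x))
        = Lun N (OM (Und F) x)) \<and>
     (\<forall>x\<in>Ob C.
        AM (Und F) (Run M x) \<cdot>\<^bsub>D\<^esub> Mul F (x, Unt M) \<cdot>\<^bsub>D\<^esub> (Ide D (OM (Und F) x) \<odot>\<^bsub>N\<^esub> Uni F)
        = Run N (OM (Und F) x))"

definition id_mftor :: "('o, 'a) cat \<Rightarrow> ('o, 'a) monoidal \<Rightarrow> ('o, 'a, 'o, 'a) mftor" where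
  "id_mftor C M = \<lparr>Und = id_ftor C, Mul = (\<lambda>(x, y)\<in>Ob C \<times> Ob C. Ide C (x \<otimes>\<^bsub>M\<^esub> y)), Uni = Ide C (Unt M)\<rparr>"

definition comp_mftor :: "('o, 'a) cat \<Rightarrow> ('q, 'c) cat \<Rightarrow> ('p, 'b, 'q, 'c) mftor \<Rightarrow> ('o, 'a, 'p, 'b) mftor
    \<Rightarrow> ('o, 'a, 'q, 'c) mftor" where
  "comp_mftor C E G F =
     \<lparr>Und = comp_ftor C (Und G) (Und F),
      Mul = (\<lambda>(x, y)\<in>Ob C \<times> Ob C.
        AM (Und G) (Mul F (x, y)) \<cdot>\<^bsub>E\<^esub> Mul G (OM (Und F) x, OM (Und F) y)),
      Uni = AM (Und G) (Uni F) \<cdot>\<^bsub>E\<^esub> Uni G\<rparr>"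


section \<open>The simplex category\<close>

text \<open>A map \<open>[m] \<rightarrow> [n]\<close> is a triple \<open>(m, a, n)\<close>.\<close>

type_synonym dmap = "nat \<times> (nat \<Rightarrow> nat) \<times> nat"

definition Delta :: "(nat, dmap) cat" where
  "Delta = \<lparr>Ob = UNIV,
     Ar = {(m, a, n) | m a n. a \<in> {0..m} \<rightarrow>\<^sub>E {0..n} \<and> mono_on {0..m} a},
     Src = (\<lambda>(m, a, n). m), Tgt = (\<lambda>(m, a, n). n),
     Ide = (\<lambda>n. (n, \<lambda>i\<in>{0..n}. i, n)),
     Cmp = (\<lambda>(_, b, l) (m, a, _). (m, compose {0..m} b a, l))\<rparr>"

fun generic_map :: "dmap \<Rightarrow> bool" where
  "generic_map (m, a, n) \<longleftrightarrow> (m, a, n) \<in> Ar Delta \<and> a 0 = 0 \<and> a m = n"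

fun free_map :: "dmap \<Rightarrow> bool" where
  "free_map (m, a, n) \<longleftrightarrow> (m, a, n) \<in> Ar Delta \<and> (\<forall>i<m. a (i + 1) = a i + 1)"

text \<open>The generic-free factorisation: \<open>f = free_part f \<circ> generic_part f\<close>.\<close>

fun generic_part :: "dmap \<Rightarrow> dmap" where
  "generic_part (m, a, n) = (m, \<lambda>i\<in>{0..m}. a i - a 0, a m - a 0)"

fun free_part :: "dmap \<Rightarrow> dmap" where
  "free_part (m, a, n) = (a m - a 0, \<lambda>i\<in>{0..a m - a 0}. i + a 0, n)"

fun under_generic :: "dmap \<Rightarrow> nat \<Rightarrow> nat" where
  "under_generic (n, g, m) = (\<lambda>j\<in>{1..m}. THE i. i \<in> {1..n} \<and> g (i - 1) < j \<and> j \<le> g i)"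

fun under_free :: "dmap \<Rightarrow> nat \<Rightarrow> nat" where
  "under_free (n, f, m) = (\<lambda>i\<in>{1..n}. i + f 0)"


section \<open>Simplicial groupoids and decomposition spaces\<close>

text \<open>A simplicial groupoid is a pseudo-functor from the opposite of \<open>Delta\<close> to groupoids. Its coherence
  isomorphisms are \<open>PU X n x : x \<rightarrow> X(id) x\<close> and \<open>PC X g f x : X(f) (X(g) x) \<rightarrow> X(g f) x\<close>.\<close>

record ('o, 'a) sgpd =
  Val :: "nat \<Rightarrow> ('o, 'a) cat"
  Act :: "dmap \<Rightarrow> ('o, 'a, 'o, 'a) ftor"
  PU :: "nat \<Rightarrow> 'o \<Rightarrow> 'a"
  PC :: "dmap \<Rightarrow> dmap \<Rightarrow> 'o \<Rightarrow> 'a"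

definition simplicial_groupoid :: "('o, 'a) sgpd \<Rightarrow> bool" where
  "simplicial_groupoid X \<longleftrightarrow>
     (\<forall>n. groupoid (Val X n)) \<and>
     (\<forall>i j. \<forall>f\<in>hom Delta i j. is_functor (Val X j) (Val X i) (Act X f)) \<and>
     (\<forall>n. is_nat_iso (Val X n) (Val X n) (id_ftor (Val X n)) (Act X (Ide Delta n)) (PU X n)) \<and>
     (\<forall>i j k. \<forall>f\<in>hom Delta i j. \<forall>g\<in>hom Delta j k.
        is_nat_iso (Val X k) (Val X i) (comp_ftor (Val X k) (Act X f) (Act X g))
          (Act X (g \<cdot>\<^bsub>Delta\<^esub> f)) (PC X g f)) \<and>
     (\<forall>i j. \<forall>f\<in>hom Delta i j. \<forall>x\<in>Ob (Val X j).
        PC X f (Ide Delta i) x \<cdot>\<^bsub>Val X i\<^esub> PU X i (OM (Act X f) x) = Ide (Val X i) (OM (Act X f) x) \<and>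
        PC X (Ide Delta j) f x \<cdot>\<^bsub>Val X i\<^esub> AM (Act X f) (PU X j x) = Ide (Val X i) (OM (Act X f) x)) \<and>
     (\<forall>i j k l. \<forall>f\<in>hom Delta i j. \<forall>g\<in>hom Delta j k. \<forall>h\<in>hom Delta k l. \<forall>x\<in>Ob (Val X l).
        PC X h (g \<cdot>\<^bsub>Delta\<^esub> f) x \<cdot>\<^bsub>Val X i\<^esub> PC X g f (OM (Act X h) x)
        = PC X (h \<cdot>\<^bsub>Delta\<^esub> g) f x \<cdot>\<^bsub>Val X i\<^esub> AM (Act X f) (PC X h g x))"

text \<open>A simplicial map is a pseudo-natural transformation. Its structure isomorphisms are
  \<open>Cel F f x : F (X(f) x) \<rightarrow> Y(f) (F x)\<close>; they are extensional, so that composition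
  of simplicial maps is strictly unital and associative.\<close>

record ('o, 'a, 'p, 'b) sgmap =
  Cpt :: "nat \<Rightarrow> ('o, 'a, 'p, 'b) ftor"
  Cel :: "dmap \<Rightarrow> 'o \<Rightarrow> 'b"

definition simplicial_map :: "('o, 'a) sgpd \<Rightarrow> ('p, 'b) sgpd \<Rightarrow> ('o, 'a, 'p, 'b) sgmap \<Rightarrow> bool" where
  "simplicial_map X Y F \<longleftrightarrow>
     (\<forall>n. is_functor (Val X n) (Val Y n) (Cpt F n)) \<and>
     Cel F \<in> extensional (Ar Delta) \<and>
     (\<forall>i j. \<forall>f\<in>hom Delta i j.
        Cel F f \<in> extensional (Ob (Val X j)) \<and>
        is_nat_iso (Val X j) (Val Y i) (comp_ftor (Val X j) (Cpt F i) (Act X f))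
          (comp_ftor (Val X j) (Act Y f) (Cpt F j)) (Cel F f)) \<and>
     (\<forall>n. \<forall>x\<in>Ob (Val X n).
        Cel F (Ide Delta n) x \<cdot>\<^bsub>Val Y n\<^esub> AM (Cpt F n) (PU X n x) = PU Y n (OM (Cpt F n) x)) \<and>
     (\<forall>i j k. \<forall>f\<in>hom Delta i j. \<forall>g\<in>hom Delta j k. \<forall>x\<in>Ob (Val X k).
        Cel F (g \<cdot>\<^bsub>Delta\<^esub> f) x \<cdot>\<^bsub>Val Y i\<^esub> AM (Cpt F i) (PC X g f x)
        = PC Y g f (OM (Cpt F k) x) \<cdot>\<^bsub>Val Y i\<^esub> AM (Act Y f) (Cel F g x)
            \<cdot>\<^bsub>Val Y i\<^esub> Cel F f (OM (Act X g) x))"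

definition id_sgmap :: "('o, 'a) sgpd \<Rightarrow> ('o, 'a, 'o, 'a) sgmap" where
  "id_sgmap X = \<lparr>Cpt = (\<lambda>n. id_ftor (Val X n)),
     Cel = (\<lambda>f\<in>Ar Delta. \<lambda>x\<in>Ob (Val X (Tgt Delta f)). Ide (Val X (Src Delta f)) (OM (Act X f) x))\<rparr>"

definition comp_sgmap :: "('o, 'a) sgpd \<Rightarrow> ('q, 'c) sgpd \<Rightarrow> ('p, 'b, 'q, 'c) sgmap
    \<Rightarrow> ('o, 'a, 'p, 'b) sgmap \<Rightarrow> ('o, 'a, 'q, 'c) sgmap" where
  "comp_sgmap X Z G F = \<lparr>Cpt = (\<lambda>n. comp_ftor (Val X n) (Cpt G n) (Cpt F n)),
     Cel = (\<lambda>f\<in>Ar Delta. \<lambda>x\<in>Ob (Val X (Tgt Delta f)).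
       Cel G f (OM (Cpt F (Tgt Delta f)) x) \<cdot>\<^bsub>Val Z (Src Delta f)\<^esub> AM (Cpt G (Src Delta f)) (Cel F f x))\<rparr>"

text \<open>The 2-cell of the square attached to \<open>g' f = f' g\<close> is the composite
  \<open>X(f) X(g') x \<rightarrow> X(g' f) x = X(f' g) x \<rightarrow> X(g) X(f') x\<close>.\<close>

definition decomposition_space :: "('o, 'a) sgpd \<Rightarrow> bool" where
  "decomposition_space X \<longleftrightarrow> simplicial_groupoid X \<and>
     (\<forall>f g g' f'. free_map f \<and> generic_map g \<and> pushout Delta f g g' f' \<longrightarrow>
        hpullback (Val X (Tgt Delta g')) (Val X (Tgt Delta f)) (Val X (Tgt Delta g)) (Val X (Src Delta f))
          (Act X g') (Act X f') (Act X f) (Act X g)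
          (\<lambda>x. inv_ar (Val X (Src Delta f)) (PC X f' g x) \<cdot>\<^bsub>Val X (Src Delta f)\<^esub> PC X g' f x))"

definition culf :: "('o, 'a) sgpd \<Rightarrow> ('p, 'b) sgpd \<Rightarrow> ('o, 'a, 'p, 'b) sgmap \<Rightarrow> bool" where
  "culf X Y F \<longleftrightarrow> simplicial_map X Y F \<and>
     (\<forall>i j. \<forall>g\<in>hom Delta i j. generic_map g \<longrightarrow>
        hpullback (Val X j) (Val X i) (Val Y j) (Val Y i)
          (Act X g) (Cpt F j) (Cpt F i) (Act Y g) (Cel F g))"

definition Dcmp :: "(('o, 'a) sgpd, ('o, 'a) sgpd \<times> ('o, 'a, 'o, 'a) sgmap \<times> ('o, 'a) sgpd) cat" where
  "Dcmp = \<lparr>Ob = {X. decomposition_space X},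
     Ar = {(X, F, Y) | X F Y. decomposition_space X \<and> decomposition_space Y \<and> culf X Y F},
     Src = (\<lambda>(X, F, Y). X), Tgt = (\<lambda>(X, F, Y). Y),
     Ide = (\<lambda>X. (X, id_sgmap X, X)),
     Cmp = (\<lambda>(_, G, Z) (X, F, _). (X, comp_sgmap X Z G F, Z))\<rparr>"


section \<open>Monoidal decomposition spaces\<close>

definition unit_sgpd :: "(unit, unit) sgpd" where
  "unit_sgpd = \<lparr>Val = (\<lambda>_. unit_cat), Act = (\<lambda>_. id_ftor unit_cat),
     PU = (\<lambda>_ _. ()), PC = (\<lambda>_ _ _. ())\<rparr>"

definition prod_sgpd :: "('o, 'a) sgpd \<Rightarrow> ('p, 'b) sgpd \<Rightarrow> ('o \<times> 'p, 'a \<times> 'b) sgpd" where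
  "prod_sgpd X Y = \<lparr>Val = (\<lambda>n. prod_cat (Val X n) (Val Y n)),
     Act = (\<lambda>f. prod_ftor (Val X (Tgt Delta f)) (Val Y (Tgt Delta f)) (Act X f) (Act Y f)),
     PU = (\<lambda>n (x, y). (PU X n x, PU Y n y)),
     PC = (\<lambda>g f (x, y). (PC X g f x, PC Y g f y))\<rparr>"

record ('o, 'a) msgpd =
  Base :: "('o, 'a) sgpd"
  PTns :: "('o \<times> 'o, 'a \<times> 'a, 'o, 'a) sgmap"
  PUnt :: "(unit, unit, 'o, 'a) sgmap"
  PAsc :: "nat \<Rightarrow> 'o \<Rightarrow> 'o \<Rightarrow> 'o \<Rightarrow> 'a"
  PLun :: "nat \<Rightarrow> 'o \<Rightarrow> 'a"
  PRun :: "nat \<Rightarrow> 'o \<Rightarrow> 'a"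

definition mon_at :: "('o, 'a) msgpd \<Rightarrow> nat \<Rightarrow> ('o, 'a) monoidal" where
  "mon_at X n = \<lparr>Tns = Cpt (PTns X) n, Unt = OM (Cpt (PUnt X) n) (),
     Asc = PAsc X n, Lun = PLun X n, Run = PRun X n\<rparr>"

definition act_mon :: "('o, 'a) msgpd \<Rightarrow> dmap \<Rightarrow> ('o, 'a, 'o, 'a) mftor" where
  "act_mon X f = \<lparr>Und = Act (Base X) f, Mul = Cel (PTns X) f, Uni = Cel (PUnt X) f ()\<rparr>"

text \<open>A monoidal structure on a simplicial groupoid \<open>X\<close> consists of simplicial maps \<open>X \<times> X \<rightarrow> X\<close> and
  \<open>1 \<rightarrow> X\<close> together with invertible modifications (associator and unitors) satisfying the pentagon
  and triangle equations. Strong monoidality of the functors \<open>X(f)\<close>, with the cells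
  of the tensor and unit maps as constraints, says exactly that the associators and unitors are
  modifications.\<close>

definition monoidal_sgpd :: "('o, 'a) msgpd \<Rightarrow> bool" where
  "monoidal_sgpd X \<longleftrightarrow>
     simplicial_groupoid (Base X) \<and>
     simplicial_map (prod_sgpd (Base X) (Base X)) (Base X) (PTns X) \<and>
     simplicial_map unit_sgpd (Base X) (PUnt X) \<and>
     (\<forall>n. monoidal_category (Val (Base X) n) (mon_at X n)) \<and>
     (\<forall>i j. \<forall>f\<in>hom Delta i j.
        strong_monoidal (Val (Base X) j) (mon_at X j) (Val (Base X) i) (mon_at X i) (act_mon X f))"

definition monoidal_decomposition_space :: "('o, 'a) msgpd \<Rightarrow> bool" where
  "monoidal_decomposition_space X \<longleftrightarrow>
     decomposition_space (Base X) \<and> monoidal_sgpd X \<and>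
     culf (prod_sgpd (Base X) (Base X)) (Base X) (PTns X)"

record ('o, 'a, 'p, 'b) msgmap =
  Smap :: "('o, 'a, 'p, 'b) sgmap"
  PMul :: "nat \<Rightarrow> 'o \<times> 'o \<Rightarrow> 'b"
  PUni :: "nat \<Rightarrow> 'b"

definition map_at :: "('o, 'a, 'p, 'b) msgmap \<Rightarrow> nat \<Rightarrow> ('o, 'a, 'p, 'b) mftor" where
  "map_at F n = \<lparr>Und = Cpt (Smap F) n, Mul = PMul F n, Uni = PUni F n\<rparr>"

text \<open>The last two conditions say that the constraints \<open>F x \<otimes> F y \<rightarrow> F (x \<otimes> y)\<close> and
  \<open>I \<rightarrow> F I\<close> are modifications.\<close>

definition monoidal_sgmap :: "('o, 'a) msgpd \<Rightarrow> ('p, 'b) msgpd \<Rightarrow> ('o, 'a, 'p, 'b) msgmap \<Rightarrow> bool" where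
  "monoidal_sgmap X Y F \<longleftrightarrow>
     simplicial_map (Base X) (Base Y) (Smap F) \<and>
     (\<forall>n. strong_monoidal (Val (Base X) n) (mon_at X n) (Val (Base Y) n) (mon_at Y n) (map_at F n)) \<and>
     (\<forall>i j. \<forall>f\<in>hom Delta i j. \<forall>x\<in>Ob (Val (Base X) j). \<forall>y\<in>Ob (Val (Base X) j).
        Cel (Smap F) f (x \<otimes>\<^bsub>mon_at X j\<^esub> y)
          \<cdot>\<^bsub>Val (Base Y) i\<^esub> AM (Cpt (Smap F) i) (Cel (PTns X) f (x, y))
          \<cdot>\<^bsub>Val (Base Y) i\<^esub> PMul F i (OM (Act (Base X) f) x, OM (Act (Base X) f) y)
        = AM (Act (Base Y) f) (PMul F j (x, y))
          \<cdot>\<^bsub>Val (Base Y) i\<^esub> Cel (PTns Y) f (OM (Cpt (Smap F) j) x, OM (Cpt (Smap F) j) y)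
          \<cdot>\<^bsub>Val (Base Y) i\<^esub> (Cel (Smap F) f x \<odot>\<^bsub>mon_at Y i\<^esub> Cel (Smap F) f y)) \<and>
     (\<forall>i j. \<forall>f\<in>hom Delta i j.
        Cel (Smap F) f (Unt (mon_at X j))
          \<cdot>\<^bsub>Val (Base Y) i\<^esub> AM (Cpt (Smap F) i) (Cel (PUnt X) f ()) \<cdot>\<^bsub>Val (Base Y) i\<^esub> PUni F i
        = AM (Act (Base Y) f) (PUni F j) \<cdot>\<^bsub>Val (Base Y) i\<^esub> Cel (PUnt Y) f ())"

definition id_msgmap :: "('o, 'a) msgpd \<Rightarrow> ('o, 'a, 'o, 'a) msgmap" where
  "id_msgmap X = \<lparr>Smap = id_sgmap (Base X),
     PMul = (\<lambda>n. Mul (id_mftor (Val (Base X) n) (mon_at X n))),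
     PUni = (\<lambda>n. Uni (id_mftor (Val (Base X) n) (mon_at X n)))\<rparr>"

definition comp_msgmap :: "('o, 'a) msgpd \<Rightarrow> ('q, 'c) msgpd \<Rightarrow> ('p, 'b, 'q, 'c) msgmap
    \<Rightarrow> ('o, 'a, 'p, 'b) msgmap \<Rightarrow> ('o, 'a, 'q, 'c) msgmap" where
  "comp_msgmap X Z G F = \<lparr>Smap = comp_sgmap (Base X) (Base Z) (Smap G) (Smap F),
     PMul = (\<lambda>n. Mul (comp_mftor (Val (Base X) n) (Val (Base Z) n) (map_at G n) (map_at F n))),
     PUni = (\<lambda>n. Uni (comp_mftor (Val (Base X) n) (Val (Base Z) n) (map_at G n) (map_at F n)))\<rparr>"

definition MDcmp :: "(('o, 'a) msgpd, ('o, 'a) msgpd \<times> ('o, 'a, 'o, 'a) msgmap \<times> ('o, 'a) msgpd) cat" where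
  "MDcmp = \<lparr>Ob = {X. monoidal_decomposition_space X},
     Ar = {(X, F, Y) | X F Y. monoidal_decomposition_space X \<and> monoidal_decomposition_space Y \<and>
             culf (Base X) (Base Y) (Smap F) \<and> monoidal_sgmap X Y F},
     Src = (\<lambda>(X, F, Y). X), Tgt = (\<lambda>(X, F, Y). Y),
     Ide = (\<lambda>X. (X, id_msgmap X, X)),
     Cmp = (\<lambda>(_, G, Z) (X, F, _). (X, comp_msgmap X Z G F, Z))\<rparr>"

definition forget_Dcmp :: "(('o, 'a) msgpd, ('o, 'a) msgpd \<times> ('o, 'a, 'o, 'a) msgmap \<times> ('o, 'a) msgpd,
    ('o, 'a) sgpd, ('o, 'a) sgpd \<times> ('o, 'a, 'o, 'a) sgmap \<times> ('o, 'a) sgpd) ftor" where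
  "forget_Dcmp = \<lparr>OM = (\<lambda>X\<in>Ob MDcmp. Base X),
     AM = (\<lambda>(X, F, Y)\<in>Ar MDcmp. (Base X, Smap F, Base Y))\<rparr>"


section \<open>Finite posets and convex maps\<close>

text \<open>The points of posets live in a type that contains the arbitrary type \<open>'v\<close> and is closed under binary
  sums, so that disjoint unions stay within the type. It is always infinite, hence every
  finite poset is isomorphic to one with points in it.\<close>

datatype 'v point = Pt 'v | Lft "'v point" | Rgt "'v point"

text \<open>A poset is represented by its reflexive order relation, whose field is the underlying set.\<close>

type_synonym 'v poset = "'v point rel"
type_synonym 'v pmap = "'v poset \<times> ('v point \<Rightarrow> 'v point) \<times> 'v poset"

definition convex_map :: "'v poset \<Rightarrow> ('v point \<Rightarrow> 'v point) \<Rightarrow> 'v poset \<Rightarrow> bool" where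
  "convex_map K f P \<longleftrightarrow>
     f \<in> Field K \<rightarrow>\<^sub>E Field P \<and>
     (\<forall>(a, b)\<in>K. (f a, f b) \<in> P) \<and>
     (\<forall>a\<in>Field K. \<forall>b\<in>Field K. \<forall>x. (f a, x) \<in> P \<and> (x, f b) \<in> P \<longrightarrow>
        (\<exists>!k. (a, k) \<in> K \<and> (k, b) \<in> K \<and> f k = x))"

definition Pos :: "('v poset, 'v pmap) cat" where
  "Pos = \<lparr>Ob = {P. finite P \<and> Partial_order P},
     Ar = {(K, f, P) | K f P. finite K \<and> Partial_order K \<and> finite P \<and> Partial_order P \<and> convex_map K f P},
     Src = (\<lambda>(K, f, P). K), Tgt = (\<lambda>(K, f, P). P),
     Ide = (\<lambda>P. (P, \<lambda>a\<in>Field P. a, P)),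
     Cmp = (\<lambda>(_, g, Q) (K, f, _). (K, compose (Field K) g f, Q))\<rparr>"

definition fn :: "'v pmap \<Rightarrow> 'v point \<Rightarrow> 'v point" where
  "fn u = fst (snd u)"

definition dsum :: "'v poset \<Rightarrow> 'v poset \<Rightarrow> 'v poset" where
  "dsum P Q = map_prod Lft Lft ` P \<union> map_prod Rgt Rgt ` Q"

fun copair :: "('v point \<Rightarrow> 'b) \<Rightarrow> ('v point \<Rightarrow> 'b) \<Rightarrow> 'v point \<Rightarrow> 'b" where
  "copair f g (Lft a) = f a"
| "copair f g (Rgt b) = g b"
| "copair f g (Pt v) = undefined"

fun assoc_pt :: "'v point \<Rightarrow> 'v point" where
  "assoc_pt (Lft (Lft a)) = Lft a"
| "assoc_pt (Lft (Rgt b)) = Rgt (Lft b)"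
| "assoc_pt (Rgt c) = Rgt (Rgt c)"
| "assoc_pt a = undefined"

definition dunion :: "('v poset, 'v pmap) monoidal" where
  "dunion =
     \<lparr>Tns = \<lparr>OM = (\<lambda>(P, Q)\<in>Ob Pos \<times> Ob Pos. dsum P Q),
             AM = (\<lambda>((K, f, P), (L, g, Q))\<in>Ar Pos \<times> Ar Pos.
               (dsum K L, \<lambda>a\<in>Field (dsum K L). copair (Lft \<circ> f) (Rgt \<circ> g) a, dsum P Q))\<rparr>,
      Unt = {},
      Asc = (\<lambda>P Q S. (dsum (dsum P Q) S, restrict assoc_pt (Field (dsum (dsum P Q) S)), dsum P (dsum Q S))),
      Lun = (\<lambda>P. (dsum {} P, \<lambda>a\<in>Field (dsum {} P). copair id id a, P)),
      Run = (\<lambda>P. (dsum P {}, \<lambda>a\<in>Field (dsum P {}). copair id id a, P))\<rparr>"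


section \<open>Directed restriction species\<close>

definition fibre :: "('o, 'a) cat \<Rightarrow> ('p, 'b) cat \<Rightarrow> ('o, 'a, 'p, 'b) ftor \<Rightarrow> 'p \<Rightarrow> ('o, 'a) cat" where
  "fibre E B p b = E\<lparr>Ob := {x \<in> Ob E. OM p x = b}, Ar := {a \<in> Ar E. AM p a = Ide B b}\<rparr>"

definition cartesian :: "('o, 'a) cat \<Rightarrow> ('p, 'b) cat \<Rightarrow> ('o, 'a, 'p, 'b) ftor \<Rightarrow> 'a \<Rightarrow> bool" where
  "cartesian E B p a \<longleftrightarrow> a \<in> Ar E \<and>
     (\<forall>c\<in>Ar E. \<forall>g\<in>hom B (OM p (Src E c)) (OM p (Src E a)).
        Tgt E c = Tgt E a \<and> AM p c = AM p a \<cdot>\<^bsub>B\<^esub> g \<longrightarrow>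
        (\<exists>!h. h \<in> hom E (Src E c) (Src E a) \<and> AM p h = g \<and> a \<cdot>\<^bsub>E\<^esub> h = c))"

definition right_fibration :: "('o, 'a) cat \<Rightarrow> ('p, 'b) cat \<Rightarrow> ('o, 'a, 'p, 'b) ftor \<Rightarrow> bool" where
  "right_fibration E B p \<longleftrightarrow>
     category E \<and> is_functor E B p \<and>
     (\<forall>x\<in>Ob E. \<forall>f\<in>Ar B. Tgt B f = OM p x \<longrightarrow>
        (\<exists>a. cartesian E B p a \<and> Tgt E a = x \<and> AM p a = f)) \<and>
     (\<forall>b\<in>Ob B. groupoid (fibre E B p b))"

record ('v, 'o, 'a) drs =
  Tot :: "('o, 'a) cat"
  Prj :: "('o, 'a, 'v poset, 'v pmap) ftor"

definition directed_restriction_species :: "('v, 'o, 'a) drs \<Rightarrow> bool" where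
  "directed_restriction_species R \<longleftrightarrow>
     right_fibration (Tot R) Pos (Prj R) \<and>
     (\<forall>P\<in>Ob Pos. \<forall>X\<in>Ob (fibre (Tot R) Pos (Prj R) P). finite (hom (fibre (Tot R) Pos (Prj R) P) X X))"

text \<open>Since all arrows of a right fibration are cartesian, a functor over the base automatically
  preserves cartesian arrows.\<close>

definition drs_morphism :: "('v, 'o, 'a) drs \<Rightarrow> ('v, 'p, 'b) drs \<Rightarrow> ('o, 'a, 'p, 'b) ftor \<Rightarrow> bool" where
  "drs_morphism R' R \<phi> \<longleftrightarrow>
     is_functor (Tot R') (Tot R) \<phi> \<and> comp_ftor (Tot R') (Prj R) \<phi> = Prj R'"

definition DRS :: "(('v, 'o, 'a) drs, ('v, 'o, 'a) drs \<times> ('o, 'a, 'o, 'a) ftor \<times> ('v, 'o, 'a) drs) cat" where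
  "DRS = \<lparr>Ob = {R. directed_restriction_species R},
     Ar = {(R', \<phi>, R) | R' \<phi> R. directed_restriction_species R' \<and> directed_restriction_species R \<and>
             drs_morphism R' R \<phi>},
     Src = (\<lambda>(R', \<phi>, R). R'), Tgt = (\<lambda>(R', \<phi>, R). R),
     Ide = (\<lambda>R. (R, id_ftor (Tot R), R)),
     Cmp = (\<lambda>(_, \<psi>, S) (R, \<phi>, _). (R, comp_ftor (Tot R) \<psi> \<phi>, S))\<rparr>"

record ('v, 'o, 'a) mdrs =
  Drs :: "('v, 'o, 'a) drs"
  Dsj :: "('o, 'a) monoidal"
  PrjMul :: "'o \<times> 'o \<Rightarrow> 'v pmap"
  PrjUni :: "'v pmap"

definition monoidal_drs :: "('v, 'o, 'a) mdrs \<Rightarrow> bool" where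
  "monoidal_drs R \<longleftrightarrow>
     directed_restriction_species (Drs R) \<and>
     monoidal_category (Tot (Drs R)) (Dsj R) \<and>
     strong_monoidal (Tot (Drs R)) (Dsj R) Pos dunion
       \<lparr>Und = Prj (Drs R), Mul = PrjMul R, Uni = PrjUni R\<rparr>"

text \<open>The monoidal constraints of a morphism are not required to be compatible with those of the
  fibrations: this is automatic, since every point of a poset is the image of a convex map from
  a one-point poset, which has no nontrivial automorphism.\<close>

definition MDRS :: "(('v, 'o, 'a) mdrs, ('v, 'o, 'a) mdrs \<times> ('o, 'a, 'o, 'a) mftor \<times> ('v, 'o, 'a) mdrs) cat"
  where
  "MDRS = \<lparr>Ob = {R. monoidal_drs R},
     Ar = {(R', \<phi>, R) | R' \<phi> R. monoidal_drs R' \<and> monoidal_drs R \<and>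
             strong_monoidal (Tot (Drs R')) (Dsj R') (Tot (Drs R)) (Dsj R) \<phi> \<and>
             drs_morphism (Drs R') (Drs R) (Und \<phi>)},
     Src = (\<lambda>(R', \<phi>, R). R'), Tgt = (\<lambda>(R', \<phi>, R). R),
     Ide = (\<lambda>R. (R, id_mftor (Tot (Drs R)) (Dsj R), R)),
     Cmp = (\<lambda>(_, \<psi>, S) (R, \<phi>, _). (R, comp_mftor (Tot (Drs R)) (Tot (Drs S)) \<psi> \<phi>, S))\<rparr>"

definition forget_DRS :: "(('v, 'o, 'a) mdrs, ('v, 'o, 'a) mdrs \<times> ('o, 'a, 'o, 'a) mftor \<times> ('v, 'o, 'a) mdrs,
    ('v, 'o, 'a) drs, ('v, 'o, 'a) drs \<times> ('o, 'a, 'o, 'a) ftor \<times> ('v, 'o, 'a) drs) ftor" where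
  "forget_DRS = \<lparr>OM = (\<lambda>R\<in>Ob MDRS. Drs R),
     AM = (\<lambda>(R', \<phi>, R)\<in>Ar MDRS. (Drs R', Und \<phi>, Drs R))\<rparr>"


section \<open>Restriction of structures\<close>

definition incl :: "'v poset \<Rightarrow> 'v point set \<Rightarrow> 'v pmap" where
  "incl P K = (Restr P K, \<lambda>a\<in>K. a, P)"

text \<open>The chosen cartesian lift \<open>X|K \<rightarrow> X\<close> of the inclusion of a convex subset \<open>K\<close>; the cleavage
  is normalised, so that restricting to the whole poset does nothing.\<close>

definition rlift :: "('v, 'o, 'a) drs \<Rightarrow> 'o \<Rightarrow> 'v point set \<Rightarrow> 'a" where
  "rlift R X K =
     (if K = Field (OM (Prj R) X) then Ide (Tot R) X
      else SOME a. cartesian (Tot R) Pos (Prj R) a \<and> Tgt (Tot R) a = X \<and>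
             AM (Prj R) a = incl (OM (Prj R) X) K)"

definition restr :: "('v, 'o, 'a) drs \<Rightarrow> 'o \<Rightarrow> 'v point set \<Rightarrow> 'o" where
  "restr R X K = Src (Tot R) (rlift R X K)"

text \<open>\<open>fill C b a\<close> is the unique \<open>t\<close> with \<open>b \<circ> t = a\<close>. It is only used where \<open>b\<close> is one of the lifts
  above (so is monic, lying over an injective map) and \<open>a\<close> factors through it.\<close>

definition fill :: "('o, 'a) cat \<Rightarrow> 'a \<Rightarrow> 'a \<Rightarrow> 'a" where
  "fill C b a = (THE t. t \<in> hom C (Src C a) (Src C b) \<and> b \<cdot>\<^bsub>C\<^esub> t = a)"


section \<open>The decomposition space of layered structures\<close>

type_synonym ('v, 'o) lobj = "'v poset \<times> ('v point \<Rightarrow> nat) \<times> 'o"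
type_synonym ('v, 'o, 'a) lar = "('v, 'o) lobj \<times> 'a \<times> ('v, 'o) lobj"

definition Lobj :: "('v, 'o, 'a) drs \<Rightarrow> nat \<Rightarrow> ('v, 'o) lobj set" where
  "Lobj R n = {(P, l, X) | P l X. P \<in> Ob Pos \<and> l \<in> Field P \<rightarrow>\<^sub>E {1..n} \<and> (\<forall>(a, b)\<in>P. l a \<le> l b) \<and>
     X \<in> Ob (fibre (Tot R) Pos (Prj R) P)}"

definition Lcat :: "('v, 'o, 'a) drs \<Rightarrow> nat \<Rightarrow> (('v, 'o) lobj, ('v, 'o, 'a) lar) cat" where
  "Lcat R n = \<lparr>Ob = Lobj R n,
     Ar = {((P, l, X), a, (Q, m, Y)) | P l X a Q m Y.
             (P, l, X) \<in> Lobj R n \<and> (Q, m, Y) \<in> Lobj R n \<and>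
             a \<in> hom (Tot R) X Y \<and> is_iso (Tot R) a \<and>
             (\<forall>u\<in>Field P. m (fn (AM (Prj R) a) u) = l u)},
     Src = (\<lambda>(x, a, y). x), Tgt = (\<lambda>(x, a, y). y),
     Ide = (\<lambda>(P, l, X). ((P, l, X), Ide (Tot R) X, (P, l, X))),
     Cmp = (\<lambda>(_, b, z) (x, a, _). (x, b \<cdot>\<^bsub>Tot R\<^esub> a, z))\<rparr>"

fun generic_ob :: "dmap \<Rightarrow> ('v, 'o) lobj \<Rightarrow> ('v, 'o) lobj" where
  "generic_ob g (P, l, X) = (P, compose (Field P) (under_generic g) l, X)"

definition generic_act :: "('v, 'o, 'a) drs \<Rightarrow> dmap
    \<Rightarrow> (('v, 'o) lobj, ('v, 'o, 'a) lar, ('v, 'o) lobj, ('v, 'o, 'a) lar) ftor" where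
  "generic_act R g =
     \<lparr>OM = (\<lambda>x\<in>Ob (Lcat R (Tgt Delta g)). generic_ob g x),
      AM = (\<lambda>(x, a, y)\<in>Ar (Lcat R (Tgt Delta g)). (generic_ob g x, a, generic_ob g y))\<rparr>"

text \<open>The pullback of \<open>l : P \<rightarrow> {1..m}\<close> along \<open>i \<mapsto> i + c\<close> is realised as the subposet
  \<open>window f P l\<close> of \<open>P\<close>, layered by \<open>a \<mapsto> l a - c\<close>.\<close>

definition window :: "dmap \<Rightarrow> 'v poset \<Rightarrow> ('v point \<Rightarrow> nat) \<Rightarrow> 'v point set" where
  "window f P l = {a \<in> Field P. \<exists>i\<in>{1..Src Delta f}. under_free f i = l a}"

fun free_lift :: "('v, 'o, 'a) drs \<Rightarrow> dmap \<Rightarrow> ('v, 'o) lobj \<Rightarrow> 'a" where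
  "free_lift R f (P, l, X) = rlift R X (window f P l)"

fun free_ob :: "('v, 'o, 'a) drs \<Rightarrow> dmap \<Rightarrow> ('v, 'o) lobj \<Rightarrow> ('v, 'o) lobj" where
  "free_ob R (n, f, m) (P, l, X) =
     (let K = window (n, f, m) P l in (Restr P K, \<lambda>a\<in>K. l a - f 0, restr R X K))"

definition free_act :: "('v, 'o, 'a) drs \<Rightarrow> dmap
    \<Rightarrow> (('v, 'o) lobj, ('v, 'o, 'a) lar, ('v, 'o) lobj, ('v, 'o, 'a) lar) ftor" where
  "free_act R f =
     \<lparr>OM = (\<lambda>x\<in>Ob (Lcat R (Tgt Delta f)). free_ob R f x),
      AM = (\<lambda>(x, a, y)\<in>Ar (Lcat R (Tgt Delta f)).
        (free_ob R f x, fill (Tot R) (free_lift R f y) (a \<cdot>\<^bsub>Tot R\<^esub> free_lift R f x), free_ob R f y))\<rparr>"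

definition Lact :: "('v, 'o, 'a) drs \<Rightarrow> dmap
    \<Rightarrow> (('v, 'o) lobj, ('v, 'o, 'a) lar, ('v, 'o) lobj, ('v, 'o, 'a) lar) ftor" where
  "Lact R f = comp_ftor (Lcat R (Tgt Delta f)) (generic_act R (generic_part f)) (free_act R (free_part f))"

definition Llift :: "('v, 'o, 'a) drs \<Rightarrow> dmap \<Rightarrow> ('v, 'o) lobj \<Rightarrow> 'a" where
  "Llift R f x = free_lift R (free_part f) x"

definition Lsgpd :: "('v, 'o, 'a) drs \<Rightarrow> (('v, 'o) lobj, ('v, 'o, 'a) lar) sgpd" where
  "Lsgpd R = \<lparr>Val = Lcat R, Act = Lact R,
     PU = (\<lambda>n x. (x, fill (Tot R) (Llift R (Ide Delta n) x) (Ide (Tot R) (snd (snd x))),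
       OM (Lact R (Ide Delta n)) x)),
     PC = (\<lambda>g f x. (OM (Lact R f) (OM (Lact R g) x),
       fill (Tot R) (Llift R (g \<cdot>\<^bsub>Delta\<^esub> f) x) (Llift R g x \<cdot>\<^bsub>Tot R\<^esub> Llift R f (OM (Lact R g) x)),
       OM (Lact R (g \<cdot>\<^bsub>Delta\<^esub> f)) x))\<rparr>"

fun map_ob :: "('o, 'a, 'p, 'b) ftor \<Rightarrow> ('v, 'o) lobj \<Rightarrow> ('v, 'p) lobj" where
  "map_ob \<phi> (P, l, X) = (P, l, OM \<phi> X)"

definition Lmap :: "('v, 'o, 'a) drs \<Rightarrow> ('o, 'a, 'p, 'b) ftor \<Rightarrow> ('v, 'p, 'b) drs
    \<Rightarrow> (('v, 'o) lobj, ('v, 'o, 'a) lar, ('v, 'p) lobj, ('v, 'p, 'b) lar) sgmap" where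
  "Lmap R' \<phi> R =
     \<lparr>Cpt = (\<lambda>n. \<lparr>OM = (\<lambda>x\<in>Ob (Lcat R' n). map_ob \<phi> x),
                  AM = (\<lambda>(x, a, y)\<in>Ar (Lcat R' n). (map_ob \<phi> x, AM \<phi> a, map_ob \<phi> y))\<rparr>),
      Cel = (\<lambda>f\<in>Ar Delta. \<lambda>x\<in>Ob (Lcat R' (Tgt Delta f)).
        (map_ob \<phi> (OM (Lact R' f) x),
         fill (Tot R) (Llift R f (map_ob \<phi> x)) (AM \<phi> (Llift R' f x)),
         OM (Lact R f) (map_ob \<phi> x)))\<rparr>"

definition Lay :: "(('v, 'o, 'a) drs, ('v, 'o, 'a) drs \<times> ('o, 'a, 'o, 'a) ftor \<times> ('v, 'o, 'a) drs,
    (('v, 'o) lobj, ('v, 'o, 'a) lar) sgpd,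
    (('v, 'o) lobj, ('v, 'o, 'a) lar) sgpd
      \<times> (('v, 'o) lobj, ('v, 'o, 'a) lar, ('v, 'o) lobj, ('v, 'o, 'a) lar) sgmap
      \<times> (('v, 'o) lobj, ('v, 'o, 'a) lar) sgpd) ftor" where
  "Lay = \<lparr>OM = (\<lambda>R\<in>Ob DRS. Lsgpd R), AM = (\<lambda>(R', \<phi>, R)\<in>Ar DRS. (Lsgpd R', Lmap R' \<phi> R, Lsgpd R))\<rparr>"


section \<open>The monoidal structure on layered structures\<close>

text \<open>The underlying poset of \<open>X \<squnion> Y\<close> is identified with the disjoint union of the underlying posets
  through the monoidal constraint of the fibration, and is layered accordingly.\<close>

fun Ltens_ob :: "('v, 'o, 'a) mdrs \<Rightarrow> ('v, 'o) lobj \<times> ('v, 'o) lobj \<Rightarrow> ('v, 'o) lobj" where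
  "Ltens_ob R ((P, l, X), (Q, m, Y)) =
     (let Z = X \<otimes>\<^bsub>Dsj R\<^esub> Y; W = OM (Prj (Drs R)) Z in
       (W, \<lambda>w\<in>Field W. copair l m (inv_into (Field (dsum P Q)) (fn (PrjMul R (X, Y))) w), Z))"

definition Ltens :: "('v, 'o, 'a) mdrs
    \<Rightarrow> (('v, 'o) lobj \<times> ('v, 'o) lobj, ('v, 'o, 'a) lar \<times> ('v, 'o, 'a) lar,
        ('v, 'o) lobj, ('v, 'o, 'a) lar) sgmap" where
  "Ltens R =
     \<lparr>Cpt = (\<lambda>n.
        \<lparr>OM = (\<lambda>xy\<in>Ob (Lcat (Drs R) n) \<times> Ob (Lcat (Drs R) n). Ltens_ob R xy),
         AM = (\<lambda>((x, a, x'), (y, b, y'))\<in>Ar (Lcat (Drs R) n) \<times> Ar (Lcat (Drs R) n).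
           (Ltens_ob R (x, y), a \<odot>\<^bsub>Dsj R\<^esub> b, Ltens_ob R (x', y')))\<rparr>),
      Cel = (\<lambda>f\<in>Ar Delta. \<lambda>(x, y)\<in>Ob (Lcat (Drs R) (Tgt Delta f)) \<times> Ob (Lcat (Drs R) (Tgt Delta f)).
        (Ltens_ob R (OM (Lact (Drs R) f) x, OM (Lact (Drs R) f) y),
         fill (Tot (Drs R)) (Llift (Drs R) f (Ltens_ob R (x, y)))
           (Llift (Drs R) f x \<odot>\<^bsub>Dsj R\<^esub> Llift (Drs R) f y),
         OM (Lact (Drs R) f) (Ltens_ob R (x, y))))\<rparr>"

text \<open>The poset underlying the unit is isomorphic to the empty poset, so it has only the empty layering.\<close>

definition Lunit_ob :: "('v, 'o, 'a) mdrs \<Rightarrow> ('v, 'o) lobj" where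
  "Lunit_ob R = (OM (Prj (Drs R)) (Unt (Dsj R)), \<lambda>_. undefined, Unt (Dsj R))"

definition Lunit :: "('v, 'o, 'a) mdrs \<Rightarrow> (unit, unit, ('v, 'o) lobj, ('v, 'o, 'a) lar) sgmap" where
  "Lunit R =
     \<lparr>Cpt = (\<lambda>n. \<lparr>OM = (\<lambda>_. Lunit_ob R),
                  AM = (\<lambda>_. (Lunit_ob R, Ide (Tot (Drs R)) (Unt (Dsj R)), Lunit_ob R))\<rparr>),
      Cel = (\<lambda>f\<in>Ar Delta. \<lambda>_.
        (Lunit_ob R,
         fill (Tot (Drs R)) (Llift (Drs R) f (Lunit_ob R)) (Ide (Tot (Drs R)) (Unt (Dsj R))),
         OM (Lact (Drs R) f) (Lunit_ob R)))\<rparr>"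

definition Lmsgpd :: "('v, 'o, 'a) mdrs \<Rightarrow> (('v, 'o) lobj, ('v, 'o, 'a) lar) msgpd" where
  "Lmsgpd R =
     \<lparr>Base = Lsgpd (Drs R), PTns = Ltens R, PUnt = Lunit R,
      PAsc = (\<lambda>_ x y z. (Ltens_ob R (Ltens_ob R (x, y), z),
        Asc (Dsj R) (snd (snd x)) (snd (snd y)) (snd (snd z)),
        Ltens_ob R (x, Ltens_ob R (y, z)))),
      PLun = (\<lambda>_ x. (Ltens_ob R (Lunit_ob R, x), Lun (Dsj R) (snd (snd x)), x)),
      PRun = (\<lambda>_ x. (Ltens_ob R (x, Lunit_ob R), Run (Dsj R) (snd (snd x)), x))\<rparr>"

definition Lmmap :: "('v, 'o, 'a) mdrs \<Rightarrow> ('o, 'a, 'p, 'b) mftor \<Rightarrow> ('v, 'p, 'b) mdrs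
    \<Rightarrow> (('v, 'o) lobj, ('v, 'o, 'a) lar, ('v, 'p) lobj, ('v, 'p, 'b) lar) msgmap" where
  "Lmmap R' \<phi> R =
     \<lparr>Smap = Lmap (Drs R') (Und \<phi>) (Drs R),
      PMul = (\<lambda>n. \<lambda>(x, y)\<in>Ob (Lcat (Drs R') n) \<times> Ob (Lcat (Drs R') n).
        (Ltens_ob R (map_ob (Und \<phi>) x, map_ob (Und \<phi>) y),
         Mul \<phi> (snd (snd x), snd (snd y)),
         map_ob (Und \<phi>) (Ltens_ob R' (x, y)))),
      PUni = (\<lambda>n. (Lunit_ob R, Uni \<phi>, map_ob (Und \<phi>) (Lunit_ob R')))\<rparr>"

definition MLay :: "(('v, 'o, 'a) mdrs, ('v, 'o, 'a) mdrs \<times> ('o, 'a, 'o, 'a) mftor \<times> ('v, 'o, 'a) mdrs,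
    (('v, 'o) lobj, ('v, 'o, 'a) lar) msgpd,
    (('v, 'o) lobj, ('v, 'o, 'a) lar) msgpd
      \<times> (('v, 'o) lobj, ('v, 'o, 'a) lar, ('v, 'o) lobj, ('v, 'o, 'a) lar) msgmap
      \<times> (('v, 'o) lobj, ('v, 'o, 'a) lar) msgpd) ftor" where
  "MLay = \<lparr>OM = (\<lambda>R\<in>Ob MDRS. Lmsgpd R), AM = (\<lambda>(R', \<phi>, R)\<in>Ar MDRS. (Lmsgpd R', Lmmap R' \<phi> R, Lmsgpd R))\<rparr>"

end

theory Submission
  imports Defs
begin

text \<open>The layered structures of all degrees form a category over \<open>\<Delta>\<close>: an arrow over \<open>f\<close> is an arrow of
  \<open>R\<close>-structures that identifies the source with the layers of the target in the range of \<open>f\<close>, layer by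
  layer as prescribed by \<open>f\<close>. Convex maps are injective, so all arrows of \<open>R\<close> are monic, and one arrow
  factors through another as soon as their images are nested. Hence the category over \<open>\<Delta>\<close> is a right
  fibration; the functors \<open>X(f)\<close>, the coherence isomorphisms and the cells of simplicial maps are unique
  factorisations through chosen lifts, and every coherence equation becomes an equation between arrows
  of \<open>R\<close> that can be checked after composition with a lift. Lifts of generic maps are invertible, so the
  homotopy pullback conditions reduce to statements about layerings: a layering over a generic-free
  pushout is glued from its two legs, and a layering of a disjoint union consists of layerings of the
  summands. The monoidal constraints of layered structures are those of \<open>R\<close>; they respect the layerings
  because the projection to posets is strong monoidal and, for the constraints of a morphism, by
  naturality with respect to restriction to single points.\<close>

section \<open>Categories\<close>

text \<open>The category over \<open>Delta\<close> is never built. A relation records which arrows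
  lie over which simplicial operator; composition, unique filling and chosen lifts are postulated
  for it. The same postulates hold for the product of two simplicial groupoids and for the terminal
  one, so tensor and unit are treated like any other simplicial map. A layer j is the gap between j
  - 1 and j in [n]. Over f, the gap i of the source covers the gaps between f(i - 1) and f(i) of the
  target, whence the pairs of a strict and a weak inequality. Two strictness issues shape the rest.
  Pushouts in \<open>Delta\<close> are known only by their universal property, while gluing of
  layerings needs a formula; it can be extracted because \<open>Delta\<close> has no nontrivial
  isomorphisms. And functoriality of the construction is an equality of simplicial maps including
  their cells, which follows because a filler through a monic lift is unique.\<close>

lemma hom_iff: "a \<in> hom C x y \<longleftrightarrow> a \<in> Ar C \<and> Src C a = x \<and> Tgt C a = y"
  by (auto simp: hom_def)

locale cat =
  fixes C :: "('o, 'a) cat" (structure)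
  assumes category: "category C"
begin

lemma Src_Ob [simp]: "a \<in> Ar C \<Longrightarrow> Src C a \<in> Ob C"
  and Tgt_Ob [simp]: "a \<in> Ar C \<Longrightarrow> Tgt C a \<in> Ob C"
  using category by (auto simp: category_def)

lemma Ide_Ar [simp]: "x \<in> Ob C \<Longrightarrow> Ide C x \<in> Ar C"
  and Src_Ide [simp]: "x \<in> Ob C \<Longrightarrow> Src C (Ide C x) = x"
  and Tgt_Ide [simp]: "x \<in> Ob C \<Longrightarrow> Tgt C (Ide C x) = x"
  using category by (auto simp: category_def hom_iff)

lemma cmp_hom: "a \<in> hom C x y \<Longrightarrow> b \<in> hom C y z \<Longrightarrow> b \<cdot> a \<in> hom C x z"
  using category unfolding category_def by blast

lemma cmp_Ar [simp]: "a \<in> Ar C \<Longrightarrow> b \<in> Ar C \<Longrightarrow> Src C b = Tgt C a \<Longrightarrow> b \<cdot> a \<in> Ar C"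
  and Src_cmp [simp]: "a \<in> Ar C \<Longrightarrow> b \<in> Ar C \<Longrightarrow> Src C b = Tgt C a \<Longrightarrow> Src C (b \<cdot> a) = Src C a"
  and Tgt_cmp [simp]: "a \<in> Ar C \<Longrightarrow> b \<in> Ar C \<Longrightarrow> Src C b = Tgt C a \<Longrightarrow> Tgt C (b \<cdot> a) = Tgt C b"
  using cmp_hom[of a "Src C a" "Tgt C a" b "Tgt C b"] by (auto simp: hom_iff)

lemma cmp_Ide [simp]: "a \<in> Ar C \<Longrightarrow> x = Src C a \<Longrightarrow> a \<cdot> Ide C x = a"
  and Ide_cmp [simp]: "a \<in> Ar C \<Longrightarrow> x = Tgt C a \<Longrightarrow> Ide C x \<cdot> a = a"
  using category by (auto simp: category_def hom_iff)

lemma cmp_assoc [simp]: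
  assumes "a \<in> Ar C" "b \<in> Ar C" "c \<in> Ar C" "Src C b = Tgt C a" "Src C c = Tgt C b"
  shows "(c \<cdot> b) \<cdot> a = c \<cdot> (b \<cdot> a)"
proof -
  have "\<forall>w x y z. \<forall>a\<in>hom C w x. \<forall>b\<in>hom C x y. \<forall>c\<in>hom C y z. c \<cdot> (b \<cdot> a) = (c \<cdot> b) \<cdot> a"
    using category by (simp add: category_def)
  moreover have "a \<in> hom C (Src C a) (Tgt C a)" "b \<in> hom C (Tgt C a) (Tgt C b)"
    "c \<in> hom C (Tgt C b) (Tgt C c)"
    using assms by (auto simp: hom_iff)
  ultimately show ?thesis by metis
qed

text \<open>Composites are kept bracketed to the right, so a known product of \<open>b\<close> and
  \<open>t\<close> is hidden as soon as another factor follows; this makes it available again. The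
  two-clause rules for lifts and cells below repeat the pattern.\<close>

lemma cmp_cmp_eq:
  assumes "b \<cdot> t = a" "b \<in> Ar C" "t \<in> Ar C" "Src C b = Tgt C t" "c \<in> Ar C" "Tgt C c = Src C t"
  shows "b \<cdot> (t \<cdot> c) = a \<cdot> c"
  using assms by (metis cmp_assoc)

lemma cmp_cmp_cmp_eq:
  assumes "b \<cdot> s \<cdot> t = a" "b \<in> Ar C" "s \<in> Ar C" "t \<in> Ar C" "Src C b = Tgt C s" "Src C s = Tgt C t"
    "c \<in> Ar C" "Tgt C c = Src C t"
  shows "b \<cdot> s \<cdot> t \<cdot> c = a \<cdot> c"
proof -
  have "b \<cdot> s \<cdot> t \<cdot> c = (b \<cdot> s \<cdot> t) \<cdot> c" using assms(2-) by simp
  then show ?thesis by (simp only: assms(1))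
qed

lemma inverses_unique:
  assumes "inverses C a b" "inverses C a c" shows "b = c"
proof -
  have *: "a \<in> Ar C" "b \<in> Ar C" "c \<in> Ar C" "Src C b = Tgt C a" "Tgt C b = Src C a"
    "Src C c = Tgt C a" "Tgt C c = Src C a" "b \<cdot> a = Ide C (Src C a)" "a \<cdot> c = Ide C (Tgt C a)"
    using assms by (auto simp: inverses_def hom_iff)
  have "(b \<cdot> a) \<cdot> c = b \<cdot> (a \<cdot> c)"
    using * by (intro cmp_assoc) auto
  with * show ?thesis by simp
qed

lemma inv_ar_eq: "inverses C a b \<Longrightarrow> inv_ar C a = b"
  unfolding inv_ar_def using inverses_unique by blast

lemma inv_ar_props:
  assumes "is_iso C a"
  shows "inv_ar C a \<in> Ar C" "Src C (inv_ar C a) = Tgt C a" "Tgt C (inv_ar C a) = Src C a"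
    "inv_ar C a \<cdot> a = Ide C (Src C a)" "a \<cdot> inv_ar C a = Ide C (Tgt C a)"
proof -
  obtain b where b: "inverses C a b" using assms by (auto simp: is_iso_def)
  then show "inv_ar C a \<in> Ar C" "Src C (inv_ar C a) = Tgt C a" "Tgt C (inv_ar C a) = Src C a"
    "inv_ar C a \<cdot> a = Ide C (Src C a)" "a \<cdot> inv_ar C a = Ide C (Tgt C a)"
    using inv_ar_eq[OF b] by (auto simp: inverses_def hom_iff)
qed

lemma is_isoD: "is_iso C a \<Longrightarrow> a \<in> Ar C"
  by (auto simp: is_iso_def inverses_def)

lemma is_isoI:
  assumes "a \<in> Ar C" "b \<in> Ar C" "Src C b = Tgt C a" "Tgt C b = Src C a"
    "b \<cdot> a = Ide C (Src C a)" "a \<cdot> b = Ide C (Tgt C a)"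
  shows "is_iso C a"
  using assms by (auto simp: is_iso_def inverses_def hom_iff)

lemma iso_epi:
  assumes "is_iso C e" "b \<in> Ar C" "c \<in> Ar C" "Src C b = Tgt C e" "Src C c = Tgt C e" "b \<cdot> e = c \<cdot> e"
  shows "b = c"
proof -
  note i = inv_ar_props[OF assms(1)] is_isoD[OF assms(1)]
  have "(b \<cdot> e) \<cdot> inv_ar C e = (c \<cdot> e) \<cdot> inv_ar C e" using assms by simp
  with i assms(2-5) show ?thesis by simp
qed

lemma iso_mono:
  assumes "is_iso C e" "b \<in> Ar C" "c \<in> Ar C" "Tgt C b = Src C e" "Tgt C c = Src C e" "e \<cdot> b = e \<cdot> c"
  shows "b = c"
proof -
  note i = inv_ar_props[OF assms(1)] is_isoD[OF assms(1)]
  have "inv_ar C e \<cdot> (e \<cdot> b) = inv_ar C e \<cdot> (e \<cdot> c)" using assms by simp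
  with i assms(2-5) show ?thesis by (simp flip: cmp_assoc)
qed

lemma is_iso_cmp:
  assumes "is_iso C a" "is_iso C b" "Src C b = Tgt C a"
  shows "is_iso C (b \<cdot> a)"
proof -
  note i = inv_ar_props[OF assms(1)] is_isoD[OF assms(1)] inv_ar_props[OF assms(2)] is_isoD[OF assms(2)]
  show ?thesis
    using i assms(3)
    by (intro is_isoI[of _ "inv_ar C a \<cdot> inv_ar C b"])
      (auto simp: cmp_cmp_eq[OF i(4)] cmp_cmp_eq[OF i(5)] cmp_cmp_eq[OF i(10)] cmp_cmp_eq[OF i(11)])
qed

lemma is_iso_Ide [simp]: "x \<in> Ob C \<Longrightarrow> is_iso C (Ide C x)"
  by (intro is_isoI[of _ "Ide C x"]) auto

end

lemma functorD:
  assumes "is_functor C D F"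
  shows "x \<in> Ob C \<Longrightarrow> OM F x \<in> Ob D"
    "a \<in> Ar C \<Longrightarrow> AM F a \<in> Ar D"
    "a \<in> Ar C \<Longrightarrow> Src D (AM F a) = OM F (Src C a)"
    "a \<in> Ar C \<Longrightarrow> Tgt D (AM F a) = OM F (Tgt C a)"
    "x \<in> Ob C \<Longrightarrow> AM F (Ide C x) = Ide D (OM F x)"
    "a \<in> Ar C \<Longrightarrow> b \<in> Ar C \<Longrightarrow> Src C b = Tgt C a \<Longrightarrow> AM F (b \<cdot>\<^bsub>C\<^esub> a) = AM F b \<cdot>\<^bsub>D\<^esub> AM F a"
    "OM F \<in> extensional (Ob C)" "AM F \<in> extensional (Ar C)"
  using assms by (auto simp: is_functor_def PiE_iff)

lemma functorI:
  assumes "\<And>x. x \<in> Ob C \<Longrightarrow> OM F x \<in> Ob D"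
    "\<And>a. a \<in> Ar C \<Longrightarrow> AM F a \<in> hom D (OM F (Src C a)) (OM F (Tgt C a))"
    "\<And>x. x \<in> Ob C \<Longrightarrow> AM F (Ide C x) = Ide D (OM F x)"
    "\<And>a b. a \<in> Ar C \<Longrightarrow> b \<in> Ar C \<Longrightarrow> Src C b = Tgt C a \<Longrightarrow> AM F (b \<cdot>\<^bsub>C\<^esub> a) = AM F b \<cdot>\<^bsub>D\<^esub> AM F a"
    "OM F \<in> extensional (Ob C)" "AM F \<in> extensional (Ar C)"
  shows "is_functor C D F"
  using assms by (auto simp: is_functor_def PiE_iff hom_iff)

lemma functor_is_iso:
  assumes "is_functor C D F" "category C" "is_iso C a"
  shows "is_iso D (AM F a)"
proof -
  interpret C: cat C by (rule cat.intro) fact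
  note i = C.inv_ar_props[OF assms(3)] C.is_isoD[OF assms(3)]
  have "inverses D (AM F a) (AM F (inv_ar C a))"
    using i functorD[OF assms(1)] functorD(6)[OF assms(1), symmetric]
    by (auto simp: inverses_def hom_iff)
  then show ?thesis by (auto simp: is_iso_def)
qed

lemma comp_ftor_OM: "x \<in> Ob C \<Longrightarrow> OM (comp_ftor C G F) x = OM G (OM F x)"
  and comp_ftor_AM: "a \<in> Ar C \<Longrightarrow> AM (comp_ftor C G F) a = AM G (AM F a)"
  by (simp_all add: comp_ftor_def compose_def)

lemma is_functor_comp:
  assumes F: "is_functor C D F" and G: "is_functor D E G" and C: "category C"
  shows "is_functor C E (comp_ftor C G F)"
proof -
  interpret C: cat C by (rule cat.intro) fact
  show ?thesis
    by (rule functorI)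
      (auto simp: comp_ftor_OM comp_ftor_AM functorD[OF F] functorD[OF G] hom_iff,
       auto simp: comp_ftor_def)
qed

lemma is_functor_id: "category C \<Longrightarrow> is_functor C C (id_ftor C)"
proof -
  assume "category C"
  then interpret cat C by (rule cat.intro)
  show ?thesis by (rule functorI) (auto simp: id_ftor_def hom_iff)
qed

lemma comp_id_ftor: "is_functor C D F \<Longrightarrow> comp_ftor C F (id_ftor C) = F"
  using functorD(7,8)[of C D F]
  by (intro ftor.equality extensionalityI[of _ "Ob C"] extensionalityI[of _ "Ar C"])
    (auto simp: comp_ftor_def id_ftor_def compose_def)

lemma comp_ftor_assoc:
  assumes "is_functor C D F"
  shows "comp_ftor C H (comp_ftor C G F) = comp_ftor C (comp_ftor D H G) F"
  using functorD(1,2)[OF assms] by (auto simp: comp_ftor_def compose_def intro!: restrict_ext)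

lemma prod_cat_simps [simp]:
  "Ob (prod_cat C D) = Ob C \<times> Ob D" "Ar (prod_cat C D) = Ar C \<times> Ar D"
  "Src (prod_cat C D) (a, b) = (Src C a, Src D b)" "Tgt (prod_cat C D) (a, b) = (Tgt C a, Tgt D b)"
  "Ide (prod_cat C D) (x, y) = (Ide C x, Ide D y)"
  "(a', b') \<cdot>\<^bsub>prod_cat C D\<^esub> (a, b) = (a' \<cdot>\<^bsub>C\<^esub> a, b' \<cdot>\<^bsub>D\<^esub> b)"
  by (auto simp: prod_cat_def)

lemma hom_prod_cat: "hom (prod_cat C D) (x, y) (x', y') = hom C x x' \<times> hom D y y'"
  by (auto simp: hom_def)

lemma category_prod_cat:
  assumes "category C" "category D" shows "category (prod_cat C D)"
proof -
  interpret C: cat C by (rule cat.intro) fact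
  interpret D: cat D by (rule cat.intro) fact
  show ?thesis
    by (auto simp: category_def hom_iff)
qed

lemma unit_cat_simps [simp]: "Ob unit_cat = UNIV" "Ar unit_cat = UNIV"
  by (auto simp: unit_cat_def)

lemma category_unit_cat: "category unit_cat"
  by (auto simp: category_def hom_iff)

lemma groupoidD:
  assumes "groupoid C" shows "category C" "a \<in> Ar C \<Longrightarrow> is_iso C a"
  using assms by (auto simp: groupoid_def)

section \<open>A criterion for homotopy pullbacks\<close>

lemma is_natI:
  assumes "\<And>x. x \<in> Ob C \<Longrightarrow> t x \<in> hom D (OM F x) (OM G x)"
    "\<And>a. a \<in> Ar C \<Longrightarrow> t (Tgt C a) \<cdot>\<^bsub>D\<^esub> AM F a = AM G a \<cdot>\<^bsub>D\<^esub> t (Src C a)"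
    "\<And>x. x \<in> Ob C \<Longrightarrow> is_iso D (t x)"
  shows "is_nat_iso C D F G t"
  using assms by (auto simp: is_nat_iso_def is_nat_def)

text \<open>An arrow of the iso-comma groupoid is a pair of arrows compatible with the fillers, so
  \<open>ff\<close> is full faithfulness of the comparison functor and \<open>es\<close> its
  essential surjectivity. As \<open>A\<close> and \<open>B\<close> are groupoids, \<open>es\<close>
  need only supply some pair of arrows: the pair of inverses is again compatible.\<close>

lemma hpullbackI:
  assumes L: "category L" and A: "groupoid A" and B: "groupoid B" and C: "category C"
    and P: "is_functor L A P" and Q: "is_functor L B Q" and U: "is_functor A C U" and V: "is_functor B C V"
    and t: "is_nat_iso L C (comp_ftor L U P) (comp_ftor L V Q) t"
    and ff: "\<And>x y a b. \<lbrakk>x \<in> Ob L; y \<in> Ob L; a \<in> hom A (OM P x) (OM P y); b \<in> hom B (OM Q x) (OM Q y);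
        AM V b \<cdot>\<^bsub>C\<^esub> t x = t y \<cdot>\<^bsub>C\<^esub> AM U a\<rbrakk> \<Longrightarrow> \<exists>!d. d \<in> hom L x y \<and> AM P d = a \<and> AM Q d = b"
    and es: "\<And>z w c. \<lbrakk>z \<in> Ob A; w \<in> Ob B; c \<in> hom C (OM U z) (OM V w); is_iso C c\<rbrakk> \<Longrightarrow>
        \<exists>x\<in>Ob L. \<exists>a\<in>hom A (OM P x) z. \<exists>b\<in>hom B (OM Q x) w. AM V b \<cdot>\<^bsub>C\<^esub> t x = c \<cdot>\<^bsub>C\<^esub> AM U a"
  shows "hpullback L A B C P Q U V t"
proof -
  interpret L: cat L by (rule cat.intro) fact
  interpret A: cat A by (rule cat.intro) (rule groupoidD[OF A])
  interpret B: cat B by (rule cat.intro) (rule groupoidD[OF B])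
  interpret C: cat C by (rule cat.intro) fact
  define k where "k x = (OM P x, OM Q x, t x)" for x
  define I where "I = iso_comma A B C U V"
  define K where "K = \<lparr>OM = (\<lambda>x\<in>Ob L. k x), AM = (\<lambda>a\<in>Ar L. (k (Src L a), (AM P a, AM Q a), k (Tgt L a)))\<rparr>"
  note [simp] = functorD[OF P] functorD[OF Q] functorD[OF U] functorD[OF V]
  have t_hom: "t x \<in> Ar C" "Src C (t x) = OM U (OM P x)" "Tgt C (t x) = OM V (OM Q x)" "is_iso C (t x)"
    if "x \<in> Ob L" for x
    using t that by (auto simp: is_nat_iso_def is_nat_def hom_iff comp_ftor_OM)
  have t_nat: "t (Tgt L a) \<cdot>\<^bsub>C\<^esub> AM U (AM P a) = AM V (AM Q a) \<cdot>\<^bsub>C\<^esub> t (Src L a)" if "a \<in> Ar L" for a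
    using t that by (auto simp: is_nat_iso_def is_nat_def comp_ftor_AM)
  have IOb: "Ob I = {(x, y, c). x \<in> Ob A \<and> y \<in> Ob B \<and> c \<in> hom C (OM U x) (OM V y) \<and> is_iso C c}"
    by (simp add: I_def iso_comma_def)
  have IAr: "(w, (a, b), w') \<in> Ar I \<longleftrightarrow> w \<in> Ob I \<and> w' \<in> Ob I \<and> a \<in> hom A (fst w) (fst w') \<and>
      b \<in> hom B (fst (snd w)) (fst (snd w')) \<and>
      AM V b \<cdot>\<^bsub>C\<^esub> snd (snd w) = snd (snd w') \<cdot>\<^bsub>C\<^esub> AM U a" for w a b w'
    by (cases w; cases w') (auto simp: I_def iso_comma_def Let_def)
  have ISrc: "Src I = fst" and ITgt: "Tgt I (w, ab, w') = w'"
    and IIde: "Ide I w = (w, (Ide A (fst w), Ide B (fst (snd w))), w)"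
    and ICmp: "(w2, (a', b'), w3) \<cdot>\<^bsub>I\<^esub> (w, (a, b), w1) = (w, (a' \<cdot>\<^bsub>A\<^esub> a, b' \<cdot>\<^bsub>B\<^esub> b), w3)"
    for w ab w' w1 w2 w3 a b a' b'
    by (cases w, auto simp: I_def iso_comma_def Let_def)+
  have kOb: "k x \<in> Ob I" if "x \<in> Ob L" for x
    using that t_hom by (auto simp: IOb k_def hom_iff)
  have K: "is_functor L I K"
  proof (rule functorI)
    show "OM K x \<in> Ob I" if "x \<in> Ob L" for x
      using that kOb by (simp add: K_def)
    show "AM K a \<in> hom I (OM K (Src L a)) (OM K (Tgt L a))" if "a \<in> Ar L" for a
      using that kOb t_nat by (auto simp: K_def hom_iff ISrc ITgt IAr k_def)
    show "AM K (Ide L x) = Ide I (OM K x)" if "x \<in> Ob L" for x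
      using that by (auto simp: K_def IIde k_def)
    show "AM K (b \<cdot>\<^bsub>L\<^esub> a) = AM K b \<cdot>\<^bsub>I\<^esub> AM K a"
      if "a \<in> Ar L" "b \<in> Ar L" "Src L b = Tgt L a" for a b
      using that by (auto simp: K_def ICmp)
  qed (auto simp: K_def)
  have homK: "bij_betw (AM K) (hom L x y) (hom I (OM K x) (OM K y))" if xy: "x \<in> Ob L" "y \<in> Ob L" for x y
  proof (rule bij_betwI')
    fix d d' assume d: "d \<in> hom L x y" "d' \<in> hom L x y"
    show "(AM K d = AM K d') = (d = d')"
    proof
      assume "AM K d = AM K d'"
      then have e: "AM P d = AM P d'" "AM Q d = AM Q d'" using d by (auto simp: K_def hom_iff)
      \<comment> \<open>Naturality of \<open>t\<close> at \<open>d\<close> is the compatibility that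
        \<open>ff\<close> asks for; its uniqueness then identifies \<open>d\<close> with
        \<open>d'\<close>.\<close>
      have "AM V (AM Q d) \<cdot>\<^bsub>C\<^esub> t x = t y \<cdot>\<^bsub>C\<^esub> AM U (AM P d)"
        using t_nat[of d] d by (auto simp: hom_iff)
      then show "d = d'"
        using ff[OF xy, of "AM P d" "AM Q d"] d e by (auto simp: hom_iff)
    qed simp
  next
    fix d assume "d \<in> hom L x y"
    then show "AM K d \<in> hom I (OM K x) (OM K y)"
      using K xy by (auto simp: hom_iff dest: functorD)
  next
    fix w assume w: "w \<in> hom I (OM K x) (OM K y)"
    obtain w0 a b w1 where w': "w = (w0, (a, b), w1)" by (metis surj_pair)
    have "\<exists>!d. d \<in> hom L x y \<and> AM P d = a \<and> AM Q d = b"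
      using w xy by (intro ff) (auto simp: w' K_def IAr hom_iff k_def ISrc ITgt)
    then obtain d where "d \<in> hom L x y" "AM P d = a" "AM Q d = b" by blast
    then show "\<exists>d\<in>hom L x y. w = AM K d"
      using w xy by (intro bexI[of _ d]) (auto simp: w' K_def hom_iff ISrc ITgt)
  qed
  have "\<exists>x\<in>Ob L. \<exists>d\<in>hom I (OM K x) w. is_iso I d" if w: "w \<in> Ob I" for w
  proof -
    obtain z v c where zv: "w = (z, v, c)" by (metis surj_pair)
    then have c: "z \<in> Ob A" "v \<in> Ob B" "c \<in> Ar C" "Src C c = OM U z" "Tgt C c = OM V v" "is_iso C c"
      using w by (auto simp: IOb hom_iff)
    then obtain x a b where x: "x \<in> Ob L" and ab: "a \<in> hom A (OM P x) z" "b \<in> hom B (OM Q x) v"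
      and e: "AM V b \<cdot>\<^bsub>C\<^esub> t x = c \<cdot>\<^bsub>C\<^esub> AM U a"
      using es[of z v c] by (auto simp: hom_iff)
    define a' b' where "a' = inv_ar A a" and "b' = inv_ar B b"
    have a': "a \<in> Ar A" "Src A a = OM P x" "Tgt A a = z" "a' \<in> Ar A" "Src A a' = z" "Tgt A a' = OM P x"
      "a' \<cdot>\<^bsub>A\<^esub> a = Ide A (OM P x)" "a \<cdot>\<^bsub>A\<^esub> a' = Ide A z"
      using ab A.inv_ar_props[of a] groupoidD(2)[OF A, of a] by (auto simp: a'_def hom_iff)
    have b': "b \<in> Ar B" "Src B b = OM Q x" "Tgt B b = v" "b' \<in> Ar B" "Src B b' = v" "Tgt B b' = OM Q x"
      "b' \<cdot>\<^bsub>B\<^esub> b = Ide B (OM Q x)" "b \<cdot>\<^bsub>B\<^esub> b' = Ide B v"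
      using ab B.inv_ar_props[of b] groupoidD(2)[OF B, of b] by (auto simp: b'_def hom_iff)
    have UV: "AM U a \<cdot>\<^bsub>C\<^esub> AM U a' = Ide C (OM U z)" "AM V b' \<cdot>\<^bsub>C\<^esub> AM V b = Ide C (OM V (OM Q x))"
      using a' b' c(2) x functorD(6)[OF U, of a' a] functorD(6)[OF V, of b b'] by auto
    \<comment> \<open>Composing the square \<open>e\<close> with the inverses on both sides gives
      the square for \<open>a'\<close> and \<open>b'\<close>, which makes the pair of inverses an
      arrow of the iso-comma groupoid.\<close>
    have "AM V b' \<cdot>\<^bsub>C\<^esub> c = AM V b' \<cdot>\<^bsub>C\<^esub> (c \<cdot>\<^bsub>C\<^esub> (AM U a \<cdot>\<^bsub>C\<^esub> AM U a'))"
      using UV c a' b' by simp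
    also have "\<dots> = AM V b' \<cdot>\<^bsub>C\<^esub> ((c \<cdot>\<^bsub>C\<^esub> AM U a) \<cdot>\<^bsub>C\<^esub> AM U a')"
      using c a' b' by (subst C.cmp_assoc) auto
    also have "\<dots> = (AM V b' \<cdot>\<^bsub>C\<^esub> AM V b) \<cdot>\<^bsub>C\<^esub> (t x \<cdot>\<^bsub>C\<^esub> AM U a')"
      unfolding e[symmetric] using c a' b' t_hom[OF x] by simp
    also have "\<dots> = t x \<cdot>\<^bsub>C\<^esub> AM U a'"
      unfolding UV using x a' b' t_hom[OF x] by simp
    finally have e': "AM V b' \<cdot>\<^bsub>C\<^esub> c = t x \<cdot>\<^bsub>C\<^esub> AM U a'" .
    have inv: "inverses I (k x, (a, b), w) (w, (a', b'), k x)"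
      using e e' a' b' kOb[OF x] w x c
      by (auto simp: inverses_def IAr hom_iff ISrc ITgt IIde ICmp k_def zv)
    then have "(k x, (a, b), w) \<in> hom I (OM K x) w"
      using x by (auto simp: inverses_def hom_iff ISrc ITgt K_def)
    then show ?thesis using x inv unfolding is_iso_def by blast
  qed
  with K homK have "is_equivalence L I K"
    by (auto simp: is_equivalence_def)
  then show ?thesis
    using P Q U V t by (auto simp: hpullback_def Let_def K_def I_def k_def)
qed

section \<open>Simplicial groupoids with cartesian lifts\<close>

lemma Delta_simps:
  "Ob Delta = UNIV" "Src Delta (m, a, n) = m" "Tgt Delta (m, a, n) = n"
  "Ide Delta n = (n, \<lambda>i\<in>{0..n}. i, n)"
  "(m', b, l) \<cdot>\<^bsub>Delta\<^esub> (m, a, n) = (m, compose {0..m} b a, l)"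
  "(m, a, n) \<in> Ar Delta \<longleftrightarrow> a \<in> {0..m} \<rightarrow>\<^sub>E {0..n} \<and> mono_on {0..m} a"
  by (auto simp: Delta_def)

lemma category_Delta: "category Delta"
proof -
  have "hom Delta x y = {(x, a, y) | a. a \<in> {0..x} \<rightarrow>\<^sub>E {0..y} \<and> mono_on {0..x} a}" for x y
    by (auto simp: hom_iff Delta_simps)
  then show ?thesis
    by (auto simp: category_def compose_def PiE_iff monotone_on_def extensional_def Delta_simps
        intro!: ext split: if_splits)
qed

interpretation Delta: cat Delta
  by (rule cat.intro) (rule category_Delta)

declare Delta_simps(1) [simp] generic_map.simps [simp del] free_map.simps [simp del]

text \<open>The elements of the groupoids \<open>X\<^sub>n\<close> have underlying objects \<open>u x\<close> in a category \<open>E\<close>, their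
  isomorphisms have underlying arrows \<open>am \<alpha>\<close>, and \<open>ov f z x a\<close> says that \<open>a : u z \<rightarrow> u x\<close> lies over
  \<open>f\<close> in the right fibration over \<open>\<Delta>\<close> that \<open>X\<close> classifies. Since all such arrows are
  monic in \<open>E\<close>, the coherence equations of \<open>X\<close> can be checked after composition with a lift.\<close>

locale fibred =
  fixes X :: "('w, 'b) sgpd" and E :: "('o, 'a) cat" and u :: "'w \<Rightarrow> 'o" and am :: "'b \<Rightarrow> 'a"
    and ov :: "dmap \<Rightarrow> 'w \<Rightarrow> 'w \<Rightarrow> 'a \<Rightarrow> bool" and lift :: "dmap \<Rightarrow> 'w \<Rightarrow> 'a"
  assumes category_base: "category E"
    and category_Val: "category (Val X n)"
    and hom_ov: "\<alpha> \<in> hom (Val X n) z x \<Longrightarrow> ov (Ide Delta n) z x (am \<alpha>)"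
    and ov_hom: "ov (Ide Delta n) z x a \<Longrightarrow> \<exists>\<alpha>\<in>hom (Val X n) z x. am \<alpha> = a"
    and am_inj: "\<alpha> \<in> hom (Val X n) z x \<Longrightarrow> \<beta> \<in> hom (Val X n) z x \<Longrightarrow> am \<alpha> = am \<beta> \<Longrightarrow> \<alpha> = \<beta>"
    and am_cmp [simp]: "\<alpha> \<in> Ar (Val X n) \<Longrightarrow> \<beta> \<in> Ar (Val X n) \<Longrightarrow> Src (Val X n) \<beta> = Tgt (Val X n) \<alpha> \<Longrightarrow>
      am (\<beta> \<cdot>\<^bsub>Val X n\<^esub> \<alpha>) = am \<beta> \<cdot>\<^bsub>E\<^esub> am \<alpha>"
    and am_Ide [simp]: "x \<in> Ob (Val X n) \<Longrightarrow> am (Ide (Val X n) x) = Ide E (u x)"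
    and ovD: "ov f z x a \<Longrightarrow> f \<in> Ar Delta \<and> z \<in> Ob (Val X (Src Delta f)) \<and> x \<in> Ob (Val X (Tgt Delta f)) \<and>
      a \<in> hom E (u z) (u x)"
    and ov_mono: "ov f z x a \<Longrightarrow> t \<in> Ar E \<Longrightarrow> t' \<in> Ar E \<Longrightarrow> Tgt E t = u z \<Longrightarrow> Tgt E t' = u z \<Longrightarrow>
      a \<cdot>\<^bsub>E\<^esub> t = a \<cdot>\<^bsub>E\<^esub> t' \<Longrightarrow> t = t'"
    and ov_cmp: "ov f z y a \<Longrightarrow> ov g y x b \<Longrightarrow> Src Delta g = Tgt Delta f \<Longrightarrow> ov (g \<cdot>\<^bsub>Delta\<^esub> f) z x (b \<cdot>\<^bsub>E\<^esub> a)"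
    and ov_fill: "ov g y x b \<Longrightarrow> ov (g \<cdot>\<^bsub>Delta\<^esub> f) z x c \<Longrightarrow> f \<in> Ar Delta \<Longrightarrow> Tgt Delta f = Src Delta g \<Longrightarrow>
      \<exists>t. ov f z y t \<and> b \<cdot>\<^bsub>E\<^esub> t = c"
    and ov_generic: "generic_map f \<Longrightarrow> ov f z x a \<Longrightarrow> is_iso E a"
    and ov_lift: "f \<in> Ar Delta \<Longrightarrow> x \<in> Ob (Val X (Tgt Delta f)) \<Longrightarrow> ov f (OM (Act X f) x) x (lift f x)"
    and Act_lift: "f \<in> Ar Delta \<Longrightarrow> \<alpha> \<in> hom (Val X (Tgt Delta f)) x y \<Longrightarrow>
      AM (Act X f) \<alpha> \<in> hom (Val X (Src Delta f)) (OM (Act X f) x) (OM (Act X f) y) \<and>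
      lift f y \<cdot>\<^bsub>E\<^esub> am (AM (Act X f) \<alpha>) = am \<alpha> \<cdot>\<^bsub>E\<^esub> lift f x"
    and Act_ext: "f \<in> Ar Delta \<Longrightarrow> OM (Act X f) \<in> extensional (Ob (Val X (Tgt Delta f))) \<and>
      AM (Act X f) \<in> extensional (Ar (Val X (Tgt Delta f)))"
    and PU_lift: "x \<in> Ob (Val X n) \<Longrightarrow> PU X n x \<in> hom (Val X n) x (OM (Act X (Ide Delta n)) x) \<and>
      lift (Ide Delta n) x \<cdot>\<^bsub>E\<^esub> am (PU X n x) = Ide E (u x)"
    and PC_lift: "f \<in> Ar Delta \<Longrightarrow> g \<in> Ar Delta \<Longrightarrow> Src Delta g = Tgt Delta f \<Longrightarrow> x \<in> Ob (Val X (Tgt Delta g)) \<Longrightarrow>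
      PC X g f x \<in> hom (Val X (Src Delta f)) (OM (Act X f) (OM (Act X g) x)) (OM (Act X (g \<cdot>\<^bsub>Delta\<^esub> f)) x) \<and>
      lift (g \<cdot>\<^bsub>Delta\<^esub> f) x \<cdot>\<^bsub>E\<^esub> am (PC X g f x) = lift g x \<cdot>\<^bsub>E\<^esub> lift f (OM (Act X g) x)"
begin

sublocale E: cat E by (rule cat.intro) (rule category_base)
sublocale V: cat "Val X n" for n by (rule cat.intro) (rule category_Val)

lemma Act_Ob [simp]:
  "f \<in> Ar Delta \<Longrightarrow> x \<in> Ob (Val X (Tgt Delta f)) \<Longrightarrow> n = Src Delta f \<Longrightarrow> OM (Act X f) x \<in> Ob (Val X n)"
  using ovD[OF ov_lift] by simp

lemma lift_simps [simp]:
  assumes "f \<in> Ar Delta" "x \<in> Ob (Val X (Tgt Delta f))"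
  shows "lift f x \<in> Ar E" "Src E (lift f x) = u (OM (Act X f) x)" "Tgt E (lift f x) = u x"
  using ovD[OF ov_lift[OF assms]] by (auto simp: hom_iff)

lemma u_Ob: "x \<in> Ob (Val X n) \<Longrightarrow> u x \<in> Ob E"
  using ovD[OF hom_ov[of "Ide (Val X n) x" n x x]] E.Src_Ob[of "Ide E (u x)"] by (auto simp: hom_iff)

lemma am_Ar:
  assumes "\<alpha> \<in> Ar (Val X n)"
  shows "am \<alpha> \<in> Ar E" "Src E (am \<alpha>) = u (Src (Val X n) \<alpha>)" "Tgt E (am \<alpha>) = u (Tgt (Val X n) \<alpha>)"
  using ovD[OF hom_ov[of \<alpha> n "Src (Val X n) \<alpha>" "Tgt (Val X n) \<alpha>"]] assms by (auto simp: hom_iff)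

lemma am_ov: "\<alpha> \<in> Ar (Val X n) \<Longrightarrow> ov (Ide Delta n) (Src (Val X n) \<alpha>) (Tgt (Val X n) \<alpha>) (am \<alpha>)"
  by (rule hom_ov) (simp add: hom_iff)

lemma Act_Ar [simp]:
  assumes "f \<in> Ar Delta" "\<alpha> \<in> Ar (Val X (Tgt Delta f))" "n = Src Delta f"
  shows "AM (Act X f) \<alpha> \<in> Ar (Val X n)"
    "Src (Val X n) (AM (Act X f) \<alpha>) = OM (Act X f) (Src (Val X (Tgt Delta f)) \<alpha>)"
    "Tgt (Val X n) (AM (Act X f) \<alpha>) = OM (Act X f) (Tgt (Val X (Tgt Delta f)) \<alpha>)"
  using Act_lift[OF assms(1), of \<alpha>] assms by (auto simp: hom_iff)

lemma am_Act [simp]: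
  assumes "f \<in> Ar Delta" "\<alpha> \<in> Ar (Val X (Tgt Delta f))"
  shows "am (AM (Act X f) \<alpha>) \<in> Ar E"
    "Src E (am (AM (Act X f) \<alpha>)) = u (OM (Act X f) (Src (Val X (Tgt Delta f)) \<alpha>))"
    "Tgt E (am (AM (Act X f) \<alpha>)) = u (OM (Act X f) (Tgt (Val X (Tgt Delta f)) \<alpha>))"
  using assms am_Ar[OF Act_Ar(1)[OF assms refl]] by auto

text \<open>Together with the analogous rules for \<open>PU\<close>, \<open>PC\<close> and the cells
  of maps, this computes composites that begin with a chosen lift: lifts move to the right and the
  coherence cells disappear. What remains is an identity between composites of lifts in
  \<open>E\<close>.\<close>

lemma lift_Act [simp]:
  assumes "f \<in> Ar Delta" "\<alpha> \<in> Ar (Val X (Tgt Delta f))" "y = Tgt (Val X (Tgt Delta f)) \<alpha>"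
  shows "lift f y \<cdot>\<^bsub>E\<^esub> am (AM (Act X f) \<alpha>) = am \<alpha> \<cdot>\<^bsub>E\<^esub> lift f (Src (Val X (Tgt Delta f)) \<alpha>)"
    "t \<in> Ar E \<Longrightarrow> Tgt E t = u (OM (Act X f) (Src (Val X (Tgt Delta f)) \<alpha>)) \<Longrightarrow>
      lift f y \<cdot>\<^bsub>E\<^esub> am (AM (Act X f) \<alpha>) \<cdot>\<^bsub>E\<^esub> t = am \<alpha> \<cdot>\<^bsub>E\<^esub> lift f (Src (Val X (Tgt Delta f)) \<alpha>) \<cdot>\<^bsub>E\<^esub> t"
proof -
  show *: "lift f y \<cdot>\<^bsub>E\<^esub> am (AM (Act X f) \<alpha>) = am \<alpha> \<cdot>\<^bsub>E\<^esub> lift f (Src (Val X (Tgt Delta f)) \<alpha>)"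
    using Act_lift[OF assms(1), of \<alpha>] assms by (auto simp: hom_iff)
  assume "t \<in> Ar E" "Tgt E t = u (OM (Act X f) (Src (Val X (Tgt Delta f)) \<alpha>))"
  with assms am_Ar[OF assms(2)]
  show "lift f y \<cdot>\<^bsub>E\<^esub> am (AM (Act X f) \<alpha>) \<cdot>\<^bsub>E\<^esub> t = am \<alpha> \<cdot>\<^bsub>E\<^esub> lift f (Src (Val X (Tgt Delta f)) \<alpha>) \<cdot>\<^bsub>E\<^esub> t"
    by (subst E.cmp_cmp_eq[OF *]) auto
qed

lemma PU_Ar [simp]:
  assumes "x \<in> Ob (Val X n)"
  shows "PU X n x \<in> Ar (Val X n)" "Src (Val X n) (PU X n x) = x"
    "Tgt (Val X n) (PU X n x) = OM (Act X (Ide Delta n)) x"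
  using PU_lift[OF assms] by (auto simp: hom_iff)

lemma am_PU [simp]:
  assumes "x \<in> Ob (Val X n)"
  shows "am (PU X n x) \<in> Ar E" "Src E (am (PU X n x)) = u x"
    "Tgt E (am (PU X n x)) = u (OM (Act X (Ide Delta n)) x)"
  using assms am_Ar[OF PU_Ar(1)[OF assms]] by auto

lemma lift_PU [simp]:
  assumes "x \<in> Ob (Val X n)"
  shows "lift (Ide Delta n) x \<cdot>\<^bsub>E\<^esub> am (PU X n x) = Ide E (u x)"
    "t \<in> Ar E \<Longrightarrow> Tgt E t = u x \<Longrightarrow> lift (Ide Delta n) x \<cdot>\<^bsub>E\<^esub> am (PU X n x) \<cdot>\<^bsub>E\<^esub> t = t"
proof -
  show *: "lift (Ide Delta n) x \<cdot>\<^bsub>E\<^esub> am (PU X n x) = Ide E (u x)"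
    using PU_lift[OF assms] by simp
  assume "t \<in> Ar E" "Tgt E t = u x"
  then show "lift (Ide Delta n) x \<cdot>\<^bsub>E\<^esub> am (PU X n x) \<cdot>\<^bsub>E\<^esub> t = t"
    using assms by (subst E.cmp_cmp_eq[OF *]) auto
qed

lemma PC_Ar [simp]:
  assumes "f \<in> Ar Delta" "g \<in> Ar Delta" "Src Delta g = Tgt Delta f" "x \<in> Ob (Val X (Tgt Delta g))"
    "n = Src Delta f"
  shows "PC X g f x \<in> Ar (Val X n)" "Src (Val X n) (PC X g f x) = OM (Act X f) (OM (Act X g) x)"
    "Tgt (Val X n) (PC X g f x) = OM (Act X (g \<cdot>\<^bsub>Delta\<^esub> f)) x"
  using PC_lift[OF assms(1-4)] assms(5) by (auto simp: hom_iff)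

lemma am_PC [simp]:
  assumes "f \<in> Ar Delta" "g \<in> Ar Delta" "Src Delta g = Tgt Delta f" "x \<in> Ob (Val X (Tgt Delta g))"
  shows "am (PC X g f x) \<in> Ar E" "Src E (am (PC X g f x)) = u (OM (Act X f) (OM (Act X g) x))"
    "Tgt E (am (PC X g f x)) = u (OM (Act X (g \<cdot>\<^bsub>Delta\<^esub> f)) x)"
  using assms am_Ar[OF PC_Ar(1)[OF assms refl]] by auto

lemma lift_PC [simp]:
  assumes "f \<in> Ar Delta" "g \<in> Ar Delta" "Src Delta g = Tgt Delta f" "x \<in> Ob (Val X (Tgt Delta g))"
    "h = g \<cdot>\<^bsub>Delta\<^esub> f"
  shows "lift h x \<cdot>\<^bsub>E\<^esub> am (PC X g f x) = lift g x \<cdot>\<^bsub>E\<^esub> lift f (OM (Act X g) x)"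
    "t \<in> Ar E \<Longrightarrow> Tgt E t = u (OM (Act X f) (OM (Act X g) x)) \<Longrightarrow>
      lift h x \<cdot>\<^bsub>E\<^esub> am (PC X g f x) \<cdot>\<^bsub>E\<^esub> t = lift g x \<cdot>\<^bsub>E\<^esub> lift f (OM (Act X g) x) \<cdot>\<^bsub>E\<^esub> t"
proof -
  show *: "lift h x \<cdot>\<^bsub>E\<^esub> am (PC X g f x) = lift g x \<cdot>\<^bsub>E\<^esub> lift f (OM (Act X g) x)"
    using PC_lift[OF assms(1-4)] assms(5) by simp
  assume "t \<in> Ar E" "Tgt E t = u (OM (Act X f) (OM (Act X g) x))"
  then show "lift h x \<cdot>\<^bsub>E\<^esub> am (PC X g f x) \<cdot>\<^bsub>E\<^esub> t = lift g x \<cdot>\<^bsub>E\<^esub> lift f (OM (Act X g) x) \<cdot>\<^bsub>E\<^esub> t"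
    using assms by (subst E.cmp_cmp_eq[OF *]) auto
qed

text \<open>Lifts are monic by \<open>ov_mono\<close>, and an arrow of a groupoid of
  \<open>X\<close> is determined by its ends and its underlying arrow by
  \<open>am_inj\<close>.\<close>

lemma lift_cancel:
  assumes "f \<in> Ar Delta" "x \<in> Ob (Val X (Tgt Delta f))" "n = Src Delta f"
    "\<alpha> \<in> Ar (Val X n)" "\<beta> \<in> Ar (Val X n)" "Src (Val X n) \<alpha> = Src (Val X n) \<beta>"
    "Tgt (Val X n) \<alpha> = OM (Act X f) x" "Tgt (Val X n) \<beta> = OM (Act X f) x"
    "lift f x \<cdot>\<^bsub>E\<^esub> am \<alpha> = lift f x \<cdot>\<^bsub>E\<^esub> am \<beta>"
  shows "\<alpha> = \<beta>"
proof -
  have "am \<alpha> = am \<beta>"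
    by (rule ov_mono[OF ov_lift[OF assms(1,2)]]) (use am_Ar[OF assms(4)] am_Ar[OF assms(5)] assms in \<open>simp_all\<close>)
  with assms show ?thesis
    by (intro am_inj[of \<alpha> n "Src (Val X n) \<alpha>" "OM (Act X f) x" \<beta>]) (simp_all add: hom_iff)
qed

text \<open>Filling the identity of \<open>x\<close> through \<open>a\<close> gives a right inverse,
  and monicity of \<open>a\<close> makes it two-sided. Hence invertibility of the arrows of
  \<open>X\<close> is a consequence of filling.\<close>

lemma ov_Ide_iso:
  assumes a: "ov (Ide Delta n) z x a" shows "\<exists>b. ov (Ide Delta n) x z b \<and> a \<cdot>\<^bsub>E\<^esub> b = Ide E (u x) \<and> b \<cdot>\<^bsub>E\<^esub> a = Ide E (u z)"
proof -
  have n: "Ide Delta n \<cdot>\<^bsub>Delta\<^esub> Ide Delta n = Ide Delta n" by simp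
  have xz: "x \<in> Ob (Val X n)" "z \<in> Ob (Val X n)" "a \<in> Ar E" "Src E a = u z" "Tgt E a = u x"
    using ovD[OF a] by (auto simp: hom_iff)
  have "ov (Ide Delta n) x x (Ide E (u x))"
    using am_ov[of "Ide (Val X n) x" n] xz by simp
  then obtain b where b: "ov (Ide Delta n) x z b" "a \<cdot>\<^bsub>E\<^esub> b = Ide E (u x)"
    using ov_fill[of "Ide Delta n" z x a "Ide Delta n" x "Ide E (u x)"] a by (auto simp: n)
  have b': "b \<in> Ar E" "Src E b = u x" "Tgt E b = u z"
    using ovD[OF b(1)] by (auto simp: hom_iff)
  have "b \<cdot>\<^bsub>E\<^esub> a = Ide E (u z)"
    by (rule ov_mono[OF a]) (use xz b b' in \<open>auto simp: u_Ob E.cmp_cmp_eq[OF b(2)]\<close>)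
  with b show ?thesis by blast
qed

lemma groupoid_Val: "groupoid (Val X n)"
  unfolding groupoid_def
proof (intro conjI ballI)
  fix \<alpha> assume \<alpha>: "\<alpha> \<in> Ar (Val X n)"
  obtain b where b: "ov (Ide Delta n) (Tgt (Val X n) \<alpha>) (Src (Val X n) \<alpha>) b"
    "am \<alpha> \<cdot>\<^bsub>E\<^esub> b = Ide E (u (Tgt (Val X n) \<alpha>))" "b \<cdot>\<^bsub>E\<^esub> am \<alpha> = Ide E (u (Src (Val X n) \<alpha>))"
    using ov_Ide_iso[OF am_ov[OF \<alpha>]] by blast
  obtain \<beta> where \<beta>: "\<beta> \<in> hom (Val X n) (Tgt (Val X n) \<alpha>) (Src (Val X n) \<alpha>)" "am \<beta> = b"
    using ov_hom[OF b(1)] by blast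
  show "is_iso (Val X n) \<alpha>"
  proof (rule V.is_isoI)
    show "\<beta> \<cdot>\<^bsub>Val X n\<^esub> \<alpha> = Ide (Val X n) (Src (Val X n) \<alpha>)"
      using \<alpha> \<beta> b by (intro am_inj[of _ n]) (auto simp: hom_iff)
    show "\<alpha> \<cdot>\<^bsub>Val X n\<^esub> \<beta> = Ide (Val X n) (Tgt (Val X n) \<alpha>)"
      using \<alpha> \<beta> b by (intro am_inj[of _ n]) (auto simp: hom_iff)
  qed (use \<alpha> \<beta> in \<open>auto simp: hom_iff\<close>)
qed (rule category_Val)

lemma Val_iso [simp]: "\<alpha> \<in> Ar (Val X n) \<Longrightarrow> is_iso (Val X n) \<alpha>"
  using groupoid_Val by (rule groupoidD)

text \<open>The action on arrows is known only through its square with the lifts. Both sides of each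
  functor law complete the same square, so they agree.\<close>

lemma Act_functor:
  assumes f: "f \<in> Ar Delta"
  shows "is_functor (Val X (Tgt Delta f)) (Val X (Src Delta f)) (Act X f)"
proof (rule functorI)
  show "AM (Act X f) (Ide (Val X (Tgt Delta f)) x) = Ide (Val X (Src Delta f)) (OM (Act X f) x)"
    if "x \<in> Ob (Val X (Tgt Delta f))" for x
    using that f by (intro lift_cancel[OF f that refl]) auto
  show "AM (Act X f) (\<beta> \<cdot>\<^bsub>Val X (Tgt Delta f)\<^esub> \<alpha>) = AM (Act X f) \<beta> \<cdot>\<^bsub>Val X (Src Delta f)\<^esub> AM (Act X f) \<alpha>"
    if "\<alpha> \<in> Ar (Val X (Tgt Delta f))" "\<beta> \<in> Ar (Val X (Tgt Delta f))"
      "Src (Val X (Tgt Delta f)) \<beta> = Tgt (Val X (Tgt Delta f)) \<alpha>" for \<alpha> \<beta>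
    using that f am_Ar[OF that(1)] am_Ar[OF that(2)]
    by (intro lift_cancel[OF f _ refl, of "Tgt (Val X (Tgt Delta f)) \<beta>"]) auto
qed (use f Act_ext in \<open>auto simp: hom_iff\<close>)

lemma simplicial_groupoid: "simplicial_groupoid X"
  unfolding simplicial_groupoid_def
proof (intro conjI allI ballI)
  show "groupoid (Val X n)" for n by (rule groupoid_Val)
next
  fix i j f assume "f \<in> hom Delta i j"
  then show "is_functor (Val X j) (Val X i) (Act X f)"
    using Act_functor[of f] by (auto simp: hom_iff)
next
  show "is_nat_iso (Val X n) (Val X n) (id_ftor (Val X n)) (Act X (Ide Delta n)) (PU X n)" for n
  proof (rule is_natI)
    fix \<alpha> assume \<alpha>: "\<alpha> \<in> Ar (Val X n)"
    note [simp] = am_Ar[OF \<alpha>]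
    show "PU X n (Tgt (Val X n) \<alpha>) \<cdot>\<^bsub>Val X n\<^esub> AM (id_ftor (Val X n)) \<alpha> =
          AM (Act X (Ide Delta n)) \<alpha> \<cdot>\<^bsub>Val X n\<^esub> PU X n (Src (Val X n) \<alpha>)"
      using \<alpha> by (intro lift_cancel[of "Ide Delta n" "Tgt (Val X n) \<alpha>"]) (auto simp: id_ftor_def)
  qed (auto simp: id_ftor_def hom_iff)
next
  fix i j k f g assume "f \<in> hom Delta i j" "g \<in> hom Delta j k"
  then have fg: "f \<in> Ar Delta" "g \<in> Ar Delta" "Src Delta f = i" "Tgt Delta f = j" "Src Delta g = j" "Tgt Delta g = k"
    by (auto simp: hom_iff)
  show "is_nat_iso (Val X k) (Val X i) (comp_ftor (Val X k) (Act X f) (Act X g))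
          (Act X (g \<cdot>\<^bsub>Delta\<^esub> f)) (PC X g f)"
  proof (rule is_natI)
    fix \<alpha> assume \<alpha>: "\<alpha> \<in> Ar (Val X k)"
    note [simp] = am_Ar[OF \<alpha>]
    show "PC X g f (Tgt (Val X k) \<alpha>) \<cdot>\<^bsub>Val X i\<^esub> AM (comp_ftor (Val X k) (Act X f) (Act X g)) \<alpha> =
         AM (Act X (g \<cdot>\<^bsub>Delta\<^esub> f)) \<alpha> \<cdot>\<^bsub>Val X i\<^esub> PC X g f (Src (Val X k) \<alpha>)"
      using \<alpha> fg by (intro lift_cancel[of "g \<cdot>\<^bsub>Delta\<^esub> f" "Tgt (Val X k) \<alpha>"]) (auto simp: comp_ftor_AM)
  qed (use fg in \<open>auto simp: comp_ftor_OM hom_iff\<close>)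
next
  fix i j f x assume "f \<in> hom Delta i j" and x: "x \<in> Ob (Val X j)"
  then have f: "f \<in> Ar Delta" "Src Delta f = i" "Tgt Delta f = j" by (auto simp: hom_iff)
  show "PC X f (Ide Delta i) x \<cdot>\<^bsub>Val X i\<^esub> PU X i (OM (Act X f) x) = Ide (Val X i) (OM (Act X f) x)"
    using f x by (intro lift_cancel[of f x]) (auto simp: u_Ob)
  show "PC X (Ide Delta j) f x \<cdot>\<^bsub>Val X i\<^esub> AM (Act X f) (PU X j x) = Ide (Val X i) (OM (Act X f) x)"
    using f x by (intro lift_cancel[of f x]) (auto simp: u_Ob)
next
  fix i j k l f g h x
  assume "f \<in> hom Delta i j" "g \<in> hom Delta j k" "h \<in> hom Delta k l" and x: "x \<in> Ob (Val X l)"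
  then have fg: "f \<in> Ar Delta" "g \<in> Ar Delta" "h \<in> Ar Delta" "Src Delta f = i" "Tgt Delta f = j"
    "Src Delta g = j" "Tgt Delta g = k" "Src Delta h = k" "Tgt Delta h = l"
    by (auto simp: hom_iff)
  show "PC X h (g \<cdot>\<^bsub>Delta\<^esub> f) x \<cdot>\<^bsub>Val X i\<^esub> PC X g f (OM (Act X h) x)
        = PC X (h \<cdot>\<^bsub>Delta\<^esub> g) f x \<cdot>\<^bsub>Val X i\<^esub> AM (Act X f) (PC X h g x)"
    using fg x by (intro lift_cancel[of "h \<cdot>\<^bsub>Delta\<^esub> g \<cdot>\<^bsub>Delta\<^esub> f" x]) auto
qed

end

section \<open>Products and the terminal simplicial groupoid\<close>

lemma prod_sgpd_simps [simp]:
  "Val (prod_sgpd X Y) n = prod_cat (Val X n) (Val Y n)"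
  "PU (prod_sgpd X Y) n (x, y) = (PU X n x, PU Y n y)"
  "PC (prod_sgpd X Y) g f (x, y) = (PC X g f x, PC Y g f y)"
  "x \<in> Ob (Val X (Tgt Delta f)) \<Longrightarrow> y \<in> Ob (Val Y (Tgt Delta f)) \<Longrightarrow>
    OM (Act (prod_sgpd X Y) f) (x, y) = (OM (Act X f) x, OM (Act Y f) y)"
  "\<alpha> \<in> Ar (Val X (Tgt Delta f)) \<Longrightarrow> \<beta> \<in> Ar (Val Y (Tgt Delta f)) \<Longrightarrow>
    AM (Act (prod_sgpd X Y) f) (\<alpha>, \<beta>) = (AM (Act X f) \<alpha>, AM (Act Y f) \<beta>)"
  by (auto simp: prod_sgpd_def prod_ftor_def)

lemma unit_sgpd_simps [simp]:
  "Val unit_sgpd n = unit_cat"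
  by (auto simp: unit_sgpd_def)

lemma is_iso_prod:
  assumes "is_iso C a" "is_iso D b" shows "is_iso (prod_cat C D) (a, b)"
proof -
  obtain a' b' where "inverses C a a'" "inverses D b b'"
    using assms by (auto simp: is_iso_def)
  then have "inverses (prod_cat C D) (a, b) (a', b')"
    by (auto simp: inverses_def hom_iff)
  then show ?thesis by (auto simp: is_iso_def)
qed

text \<open>The source of a tensor product becomes fibred data of the same kind, so the tensor can
  be handled as a map between two such objects. Each postulate holds componentwise.\<close>

lemma fibred_prod:
  assumes X: "fibred X E u am ov lift" and Y: "fibred Y E' u' am' ov' lift'"
  shows "fibred (prod_sgpd X Y) (prod_cat E E') (map_prod u u') (map_prod am am')
    (\<lambda>f z x a. ov f (fst z) (fst x) (fst a) \<and> ov' f (snd z) (snd x) (snd a))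
    (\<lambda>f x. (lift f (fst x), lift' f (snd x)))"
proof -
  interpret X: fibred X E u am ov lift by fact
  interpret Y: fibred Y E' u' am' ov' lift' by fact
  show ?thesis
  proof (unfold_locales, goal_cases)
    case 1 show ?case by (rule category_prod_cat) (rule X.category_base Y.category_base)+
  next
    case (2 n) show ?case by (simp add: category_prod_cat X.category_Val Y.category_Val)
  next
    case (3 \<alpha> n z x) then show ?case
      by (cases z; cases x) (auto simp: hom_prod_cat X.hom_ov Y.hom_ov)
  next
    case (4 n z x a) then show ?case
      using X.ov_hom[of n "fst z" "fst x" "fst a"] Y.ov_hom[of n "snd z" "snd x" "snd a"]
      by (cases z; cases x; cases a) (auto simp: hom_prod_cat)
  next
    case (5 \<alpha> n z x \<beta>) then show ?case
      using X.am_inj[of "fst \<alpha>" n "fst z" "fst x" "fst \<beta>"] Y.am_inj[of "snd \<alpha>" n "snd z" "snd x" "snd \<beta>"]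
      by (cases z; cases x; cases \<alpha>; cases \<beta>) (auto simp: hom_prod_cat)
  next
    case (6 \<alpha> n \<beta>) then show ?case by (cases \<alpha>; cases \<beta>) auto
  next
    case (7 x n) then show ?case by (cases x) auto
  next
    case (8 f z x a) then show ?case
      using X.ovD[of f "fst z" "fst x" "fst a"] Y.ovD[of f "snd z" "snd x" "snd a"]
      by (cases z; cases x; cases a) (auto simp: hom_prod_cat)
  next
    case (9 f z x a t t') then show ?case
      using X.ov_mono[of f "fst z" "fst x" "fst a" "fst t" "fst t'"]
        Y.ov_mono[of f "snd z" "snd x" "snd a" "snd t" "snd t'"]
      by (cases z; cases x; cases a; cases t; cases t') auto
  next
    case (10 f z y a g x b) then show ?case
      by (cases z; cases y; cases x; cases a; cases b) (auto simp: X.ov_cmp Y.ov_cmp)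
  next
    case (11 g y x b f z c) then show ?case
      using X.ov_fill[of g "fst y" "fst x" "fst b" f "fst z" "fst c"]
        Y.ov_fill[of g "snd y" "snd x" "snd b" f "snd z" "snd c"]
      by (cases z; cases y; cases x; cases c; cases b) auto
  next
    case (12 f z x a) then show ?case
      using X.ov_generic[of f "fst z" "fst x" "fst a"] Y.ov_generic[of f "snd z" "snd x" "snd a"]
      by (cases a) (auto intro: is_iso_prod)
  next
    case (13 f x) then show ?case
      by (cases x) (auto simp: X.ov_lift Y.ov_lift)
  next
    case (14 f \<alpha> x y) then show ?case
      using X.Act_lift[of f "fst \<alpha>" "fst x" "fst y"] Y.Act_lift[of f "snd \<alpha>" "snd x" "snd y"]
      by (cases \<alpha>; cases x; cases y) (auto simp: hom_iff)
  next
    case (15 f) show ?case by (auto simp: prod_sgpd_def prod_ftor_def)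
  next
    case (16 x n) then show ?case
      using X.PU_lift[of "fst x" n] Y.PU_lift[of "snd x" n]
      by (cases x) (auto simp: hom_prod_cat)
  next
    case (17 f g x) then show ?case
      using X.PC_lift[of f g "fst x"] Y.PC_lift[of f g "snd x"]
      by (cases x) (auto simp: hom_prod_cat)
  qed
qed

text \<open>The source of the unit map of a monoidal structure: over every simplicial operator lies
  exactly one arrow.\<close>

lemma fibred_unit: "fibred unit_sgpd unit_cat id id (\<lambda>f z x a. f \<in> Ar Delta) (\<lambda>f x. ())"
  by unfold_locales
    (auto simp: category_unit_cat hom_iff is_iso_def inverses_def unit_sgpd_def id_ftor_def)

text \<open>A simplicial map lying over a functor \<open>\<Phi>\<close> between the underlying
  categories, with cells that compare the image of a chosen lift with the chosen lift of the image.
  In \<open>ov_Cpt\<close> the relation is reflected as well as preserved; reflection is what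
  produces arrows upstairs in the CULF squares.\<close>

locale fibred_map = X: fibred X E u am ov lift + Y: fibred Y E' u' am' ov' lift'
  for X :: "('w, 'b) sgpd" and E :: "('o, 'a) cat" and u am ov lift
    and Y :: "('w2, 'b2) sgpd" and E' :: "('o2, 'a2) cat" and u' am' ov' lift' +
  fixes F :: "('w, 'b, 'w2, 'b2) sgmap" and \<Phi> :: "('o, 'a, 'o2, 'a2) ftor"
  assumes functor_base: "is_functor E E' \<Phi>"
    and functor_Cpt: "is_functor (Val X n) (Val Y n) (Cpt F n)"
    and u_Cpt [simp]: "x \<in> Ob (Val X n) \<Longrightarrow> u' (OM (Cpt F n) x) = OM \<Phi> (u x)"
    and am_Cpt [simp]: "\<alpha> \<in> Ar (Val X n) \<Longrightarrow> am' (AM (Cpt F n) \<alpha>) = AM \<Phi> (am \<alpha>)"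
    and ov_Cpt: "f \<in> hom Delta i j \<Longrightarrow> z \<in> Ob (Val X i) \<Longrightarrow> x \<in> Ob (Val X j) \<Longrightarrow> a \<in> hom E (u z) (u x) \<Longrightarrow>
      ov' f (OM (Cpt F i) z) (OM (Cpt F j) x) (AM \<Phi> a) \<longleftrightarrow> ov f z x a"
    and Cel_ext: "Cel F \<in> extensional (Ar Delta)"
      "f \<in> Ar Delta \<Longrightarrow> Cel F f \<in> extensional (Ob (Val X (Tgt Delta f)))"
    and Cel_lift: "f \<in> hom Delta i j \<Longrightarrow> x \<in> Ob (Val X j) \<Longrightarrow>
      Cel F f x \<in> hom (Val Y i) (OM (Cpt F i) (OM (Act X f) x)) (OM (Act Y f) (OM (Cpt F j) x)) \<and>
      lift' f (OM (Cpt F j) x) \<cdot>\<^bsub>E'\<^esub> am' (Cel F f x) = AM \<Phi> (lift f x)"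
begin

lemmas base_simps [simp] = functorD(1-5)[OF functor_base]
lemmas Cpt_simps [simp] = functorD(1-5)[OF functor_Cpt]
lemmas base_cmp = functorD(6)[OF functor_base]

lemma Cel_Ar [simp]:
  assumes "f \<in> Ar Delta" "x \<in> Ob (Val X (Tgt Delta f))" "n = Src Delta f"
  shows "Cel F f x \<in> Ar (Val Y n)" "Src (Val Y n) (Cel F f x) = OM (Cpt F n) (OM (Act X f) x)"
    "Tgt (Val Y n) (Cel F f x) = OM (Act Y f) (OM (Cpt F (Tgt Delta f)) x)"
  using Cel_lift[of f n "Tgt Delta f" x] assms by (auto simp: hom_iff)

lemma am_Cel [simp]:
  assumes "f \<in> Ar Delta" "x \<in> Ob (Val X (Tgt Delta f))"
  shows "am' (Cel F f x) \<in> Ar E'" "Src E' (am' (Cel F f x)) = OM \<Phi> (u (OM (Act X f) x))"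
    "Tgt E' (am' (Cel F f x)) = u' (OM (Act Y f) (OM (Cpt F (Tgt Delta f)) x))"
  using assms Y.am_Ar[OF Cel_Ar(1)[OF assms refl]] by auto

lemma lift_Cel [simp]:
  assumes "f \<in> Ar Delta" "x \<in> Ob (Val X (Tgt Delta f))" "y = OM (Cpt F (Tgt Delta f)) x"
  shows "lift' f y \<cdot>\<^bsub>E'\<^esub> am' (Cel F f x) = AM \<Phi> (lift f x)"
    "t \<in> Ar E' \<Longrightarrow> Tgt E' t = OM \<Phi> (u (OM (Act X f) x)) \<Longrightarrow>
      lift' f y \<cdot>\<^bsub>E'\<^esub> am' (Cel F f x) \<cdot>\<^bsub>E'\<^esub> t = AM \<Phi> (lift f x) \<cdot>\<^bsub>E'\<^esub> t"
proof -
  show *: "lift' f y \<cdot>\<^bsub>E'\<^esub> am' (Cel F f x) = AM \<Phi> (lift f x)"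
    using Cel_lift[of f "Src Delta f" "Tgt Delta f" x] assms by (auto simp: hom_iff)
  assume "t \<in> Ar E'" "Tgt E' t = OM \<Phi> (u (OM (Act X f) x))"
  then show "lift' f y \<cdot>\<^bsub>E'\<^esub> am' (Cel F f x) \<cdot>\<^bsub>E'\<^esub> t = AM \<Phi> (lift f x) \<cdot>\<^bsub>E'\<^esub> t"
    using assms by (subst Y.E.cmp_cmp_eq[OF *]) auto
qed

lemma simplicial_map: "simplicial_map X Y F"
  unfolding simplicial_map_def
proof (intro conjI allI ballI)
  show "is_functor (Val X n) (Val Y n) (Cpt F n)" for n by (rule functor_Cpt)
  show "Cel F \<in> extensional (Ar Delta)" by (rule Cel_ext)
next
  fix i j f assume "f \<in> hom Delta i j"
  then have f: "f \<in> Ar Delta" "Src Delta f = i" "Tgt Delta f = j" by (auto simp: hom_iff)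
  show "Cel F f \<in> extensional (Ob (Val X j))" using Cel_ext(2)[of f] f by simp
  show "is_nat_iso (Val X j) (Val Y i) (comp_ftor (Val X j) (Cpt F i) (Act X f))
          (comp_ftor (Val X j) (Act Y f) (Cpt F j)) (Cel F f)"
  proof (rule is_natI)
    fix \<alpha> assume \<alpha>: "\<alpha> \<in> Ar (Val X j)"
    note [simp] = X.am_Ar[OF \<alpha>]
    show "Cel F f (Tgt (Val X j) \<alpha>) \<cdot>\<^bsub>Val Y i\<^esub> AM (comp_ftor (Val X j) (Cpt F i) (Act X f)) \<alpha> =
         AM (comp_ftor (Val X j) (Act Y f) (Cpt F j)) \<alpha> \<cdot>\<^bsub>Val Y i\<^esub> Cel F f (Src (Val X j) \<alpha>)"
      using f \<alpha> by (intro Y.lift_cancel[of f "OM (Cpt F j) (Tgt (Val X j) \<alpha>)"])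
        (auto simp: comp_ftor_AM base_cmp[symmetric])
  qed (use f in \<open>auto simp: comp_ftor_OM hom_iff\<close>)
next
  fix n x assume x: "x \<in> Ob (Val X n)"
  then show "Cel F (Ide Delta n) x \<cdot>\<^bsub>Val Y n\<^esub> AM (Cpt F n) (PU X n x) = PU Y n (OM (Cpt F n) x)"
    by (intro Y.lift_cancel[of "Ide Delta n" "OM (Cpt F n) x"]) (auto simp: base_cmp[symmetric] X.u_Ob)
next
  fix i j k f g x assume "f \<in> hom Delta i j" "g \<in> hom Delta j k" and x: "x \<in> Ob (Val X k)"
  then have fg: "f \<in> Ar Delta" "g \<in> Ar Delta" "Src Delta f = i" "Tgt Delta f = j" "Src Delta g = j" "Tgt Delta g = k"
    by (auto simp: hom_iff)
  show "Cel F (g \<cdot>\<^bsub>Delta\<^esub> f) x \<cdot>\<^bsub>Val Y i\<^esub> AM (Cpt F i) (PC X g f x)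
        = PC Y g f (OM (Cpt F k) x) \<cdot>\<^bsub>Val Y i\<^esub> AM (Act Y f) (Cel F g x)
            \<cdot>\<^bsub>Val Y i\<^esub> Cel F f (OM (Act X g) x)"
    using fg x
    by (intro Y.lift_cancel[of "g \<cdot>\<^bsub>Delta\<^esub> f" "OM (Cpt F k) x"]) (auto simp: base_cmp[symmetric])
qed

lemma nat_iso_Cel:
  "f \<in> hom Delta i j \<Longrightarrow> is_nat_iso (Val X j) (Val Y i) (comp_ftor (Val X j) (Cpt F i) (Act X f))
      (comp_ftor (Val X j) (Act Y f) (Cpt F j)) (Cel F f)"
  using simplicial_map unfolding simplicial_map_def by blast

text \<open>Lifts over a generic map are invertible, so an arrow in degree j is recovered from its
  image under the action of \<open>g\<close>, and the underlying functor carries it to the given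
  arrow of \<open>Y\<close>. Only essential surjectivity needs an extra hypothesis: a refinement
  along \<open>g\<close> of the image of \<open>z\<close> must come from a refinement of
  \<open>z\<close> with the same underlying object.\<close>

theorem culf:
  assumes lift_layering: "\<And>g i j z y a. g \<in> hom Delta i j \<Longrightarrow> generic_map g \<Longrightarrow> z \<in> Ob (Val X i) \<Longrightarrow>
      y \<in> Ob (Val Y j) \<Longrightarrow> ov' g (OM (Cpt F i) z) y a \<Longrightarrow>
      \<exists>x\<in>Ob (Val X j). u x = u z \<and> ov g z x (Ide E (u z)) \<and> ov' (Ide Delta j) (OM (Cpt F j) x) y a"
  shows "culf X Y F"
  unfolding culf_def
proof (intro conjI allI ballI impI simplicial_map)
  fix i j g assume g0: "g \<in> hom Delta i j" and gen: "generic_map g"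
  then have g: "g \<in> Ar Delta" "Src Delta g = i" "Tgt Delta g = j" by (auto simp: hom_iff)
  show "hpullback (Val X j) (Val X i) (Val Y j) (Val Y i) (Act X g) (Cpt F j) (Cpt F i) (Act Y g) (Cel F g)"
  proof (rule hpullbackI)
    fix x y \<alpha> \<beta>
    assume x: "x \<in> Ob (Val X j)" and y: "y \<in> Ob (Val X j)"
      and \<alpha>0: "\<alpha> \<in> hom (Val X i) (OM (Act X g) x) (OM (Act X g) y)"
      and \<beta>0: "\<beta> \<in> hom (Val Y j) (OM (Cpt F j) x) (OM (Cpt F j) y)"
      and eq: "AM (Act Y g) \<beta> \<cdot>\<^bsub>Val Y i\<^esub> Cel F g x = Cel F g y \<cdot>\<^bsub>Val Y i\<^esub> AM (Cpt F i) \<alpha>"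
    have \<alpha>: "\<alpha> \<in> Ar (Val X i)" "Src (Val X i) \<alpha> = OM (Act X g) x" "Tgt (Val X i) \<alpha> = OM (Act X g) y"
      and \<beta>: "\<beta> \<in> Ar (Val Y j)" "Src (Val Y j) \<beta> = OM (Cpt F j) x" "Tgt (Val Y j) \<beta> = OM (Cpt F j) y"
      using \<alpha>0 \<beta>0 by (auto simp: hom_iff)
    note [simp] = X.am_Ar[OF \<alpha>(1), unfolded \<alpha>] Y.am_Ar[OF \<beta>(1), unfolded \<beta>]
    have iso: "is_iso E (lift g x)"
      using x g X.ov_generic[OF gen X.ov_lift[of g x]] by simp
    \<comment> \<open>The only possible underlying arrow of the filler \<open>d\<close>: its square
      with the lifts of \<open>g\<close> must give \<open>\<alpha>\<close>.\<close>
    define a where "a = lift g y \<cdot>\<^bsub>E\<^esub> am \<alpha> \<cdot>\<^bsub>E\<^esub> inv_ar E (lift g x)"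
    note i = X.E.inv_ar_props[OF iso]
    have a: "a \<in> Ar E" "Src E a = u x" "Tgt E a = u y" "a \<cdot>\<^bsub>E\<^esub> lift g x = lift g y \<cdot>\<^bsub>E\<^esub> am \<alpha>"
      using i g x y \<alpha> by (auto simp: a_def)
    \<comment> \<open>This is \<open>eq\<close> followed by a lift in \<open>Y\<close>; the image of
      the lift at \<open>x\<close> stays invertible and is cancelled on the right.\<close>
    have "AM \<Phi> a = am' \<beta>"
    proof (rule Y.E.iso_epi)
      show "is_iso E' (AM \<Phi> (lift g x))"
        using functor_is_iso[OF functor_base X.category_base iso] .
      have "lift' g (OM (Cpt F j) y) \<cdot>\<^bsub>E'\<^esub> am' (AM (Act Y g) \<beta> \<cdot>\<^bsub>Val Y i\<^esub> Cel F g x)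
          = lift' g (OM (Cpt F j) y) \<cdot>\<^bsub>E'\<^esub> am' (Cel F g y \<cdot>\<^bsub>Val Y i\<^esub> AM (Cpt F i) \<alpha>)"
        unfolding eq ..
      then show "AM \<Phi> a \<cdot>\<^bsub>E'\<^esub> AM \<Phi> (lift g x) = am' \<beta> \<cdot>\<^bsub>E'\<^esub> AM \<Phi> (lift g x)"
        using a g x y \<alpha> \<beta> by (simp flip: base_cmp)
    qed (use a g x y \<alpha> \<beta> in auto)
    then have "ov' (Ide Delta j) (OM (Cpt F j) x) (OM (Cpt F j) y) (AM \<Phi> a)"
      using Y.hom_ov[OF \<beta>0] by simp
    then have "ov (Ide Delta j) x y a"
      using x y a by (subst ov_Cpt[of _ j j, symmetric]) (auto simp: hom_iff)
    then obtain d where d: "d \<in> hom (Val X j) x y" "am d = a"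
      using X.ov_hom by blast
    show "\<exists>!d. d \<in> hom (Val X j) x y \<and> AM (Act X g) d = \<alpha> \<and> AM (Cpt F j) d = \<beta>"
    proof (intro ex1I[of _ d] conjI)
      show "AM (Act X g) d = \<alpha>"
        using d a g x y \<alpha> by (intro X.lift_cancel[of g y]) (auto simp: hom_iff)
      show "AM (Cpt F j) d = \<beta>"
        using d \<beta> \<open>AM \<Phi> a = am' \<beta>\<close> by (intro Y.am_inj[OF _ \<beta>0]) (auto simp: hom_iff)
    next
      fix d' assume d': "d' \<in> hom (Val X j) x y \<and> AM (Act X g) d' = \<alpha> \<and> AM (Cpt F j) d' = \<beta>"
      note [simp] = X.am_Ar[of d' j]
      have "am d' = am d"
      proof (rule X.E.iso_epi[OF iso])
        have "lift g y \<cdot>\<^bsub>E\<^esub> am (AM (Act X g) d') = am d' \<cdot>\<^bsub>E\<^esub> lift g x"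
          using d' g x y by (auto simp: hom_iff)
        then show "am d' \<cdot>\<^bsub>E\<^esub> lift g x = am d \<cdot>\<^bsub>E\<^esub> lift g x"
          using d' d a by simp
      qed (use d' d a g x y in \<open>auto simp: hom_iff\<close>)
      then show "d' = d" using d d' X.am_inj by blast
    qed (use d in auto)
  next
    fix z w c assume z: "z \<in> Ob (Val X i)" and w: "w \<in> Ob (Val Y j)"
      and c0: "c \<in> hom (Val Y i) (OM (Cpt F i) z) (OM (Act Y g) w)"
    then have c: "c \<in> Ar (Val Y i)" "Src (Val Y i) c = OM (Cpt F i) z" "Tgt (Val Y i) c = OM (Act Y g) w"
      by (auto simp: hom_iff)
    note [simp] = Y.am_Ar[OF c(1), unfolded c]
    \<comment> \<open>Composing with the lift turns \<open>c\<close>, an isomorphism in degree i,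
      into an arrow over \<open>g\<close> ending at \<open>w\<close> itself; this is the form that
      \<open>lift_layering\<close> accepts.\<close>
    define a' where "a' = lift' g w \<cdot>\<^bsub>E'\<^esub> am' c"
    have "ov' (g \<cdot>\<^bsub>Delta\<^esub> Ide Delta i) (OM (Cpt F i) z) w a'"
      unfolding a'_def using g w by (intro Y.ov_cmp[OF Y.hom_ov[OF c0] Y.ov_lift]) auto
    then have "ov' g (OM (Cpt F i) z) w a'" using g by simp
    from lift_layering[OF g0 gen z w this] obtain x where x: "x \<in> Ob (Val X j)" and ux: "u x = u z"
      and o1: "ov g z x (Ide E (u z))" and o2: "ov' (Ide Delta j) (OM (Cpt F j) x) w a'" by blast
    \<comment> \<open>The identity \<open>o1\<close> and the chosen lift both end at
      \<open>x\<close> over \<open>g\<close>. Filling one through the other shows that the chosen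
      lift, read in degree i, is the isomorphism to \<open>z\<close> that is required.\<close>
    have "ov (g \<cdot>\<^bsub>Delta\<^esub> Ide Delta i) (OM (Act X g) x) x (lift g x)"
      using g x X.ov_lift[of g x] by simp
    then obtain t where t: "ov (Ide Delta i) (OM (Act X g) x) z t" "Ide E (u z) \<cdot>\<^bsub>E\<^esub> t = lift g x"
      using X.ov_fill[OF o1, of "Ide Delta i" "OM (Act X g) x" "lift g x"] g by auto
    then have "t = lift g x" using X.ovD[OF t(1)] by (auto simp: hom_iff)
    then obtain \<alpha> where \<alpha>: "\<alpha> \<in> hom (Val X i) (OM (Act X g) x) z" "am \<alpha> = lift g x"
      using X.ov_hom[OF t(1)] by blast
    obtain \<beta> where \<beta>: "\<beta> \<in> hom (Val Y j) (OM (Cpt F j) x) w" "am' \<beta> = a'"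
      using Y.ov_hom[OF o2] by blast
    have "AM (Act Y g) \<beta> \<cdot>\<^bsub>Val Y i\<^esub> Cel F g x = c \<cdot>\<^bsub>Val Y i\<^esub> AM (Cpt F i) \<alpha>"
      using g x w c \<alpha> \<beta> ux
      by (intro Y.lift_cancel[of g w]) (auto simp: hom_iff a'_def)
    then show "\<exists>x\<in>Ob (Val X j). \<exists>a\<in>hom (Val X i) (OM (Act X g) x) z. \<exists>b\<in>hom (Val Y j) (OM (Cpt F j) x) w.
         AM (Act Y g) b \<cdot>\<^bsub>Val Y i\<^esub> Cel F g x = c \<cdot>\<^bsub>Val Y i\<^esub> AM (Cpt F i) a"
      using x \<alpha> \<beta> by blast
  qed (use g0 g X.Act_functor[of g] Y.Act_functor[of g] in
      \<open>auto simp: X.groupoid_Val Y.groupoid_Val X.category_Val Y.category_Val functor_Cpt nat_iso_Cel\<close>)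
qed

end

section \<open>The decomposition condition for simplicial groupoids with lifts\<close>

context fibred
begin

text \<open>The filler of a square in a simplicial groupoid involves an inverse coherence cell,
  which never has to be computed: composing back with \<open>PC X g' f' x\<close> and then with the
  lift gives an equation between lifts alone.\<close>

lemma PC_inv_iso:
  assumes "f \<in> Ar Delta" "g \<in> Ar Delta" "Src Delta g = Tgt Delta f" "x \<in> Ob (Val X (Tgt Delta g))"
    and "f' \<in> Ar Delta" "g' \<in> Ar Delta" "Src Delta g' = Tgt Delta f'" "Tgt Delta g' = Tgt Delta g"
    and eq: "g \<cdot>\<^bsub>Delta\<^esub> f = g' \<cdot>\<^bsub>Delta\<^esub> f'" and n: "n = Src Delta f"
  defines "t \<equiv> inv_ar (Val X n) (PC X g' f' x) \<cdot>\<^bsub>Val X n\<^esub> PC X g f x"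
  shows "t \<in> hom (Val X n) (OM (Act X f) (OM (Act X g) x)) (OM (Act X f') (OM (Act X g') x))"
    "lift g' x \<cdot>\<^bsub>E\<^esub> lift f' (OM (Act X g') x) \<cdot>\<^bsub>E\<^esub> am t = lift g x \<cdot>\<^bsub>E\<^esub> lift f (OM (Act X g) x)"
proof -
  have n': "n = Src Delta f'" using assms by (metis Delta.Src_cmp)
  have iso: "is_iso (Val X n) (PC X g' f' x)" using assms n' by auto
  note i = V.inv_ar_props[OF iso]
  have e: "Src Delta f = Src Delta f'" using n n' by simp
  show t: "t \<in> hom (Val X n) (OM (Act X f) (OM (Act X g) x)) (OM (Act X f') (OM (Act X g') x))"
    using i assms n' e by (auto simp: t_def hom_iff)
  have "PC X g' f' x \<cdot>\<^bsub>Val X n\<^esub> t = PC X g f x"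
    unfolding t_def using i assms n' e by (subst V.cmp_cmp_eq[OF i(5)]) auto
  then have "lift (g' \<cdot>\<^bsub>Delta\<^esub> f') x \<cdot>\<^bsub>E\<^esub> am (PC X g' f' x \<cdot>\<^bsub>Val X n\<^esub> t) = lift (g \<cdot>\<^bsub>Delta\<^esub> f) x \<cdot>\<^bsub>E\<^esub> am (PC X g f x)"
    by (simp add: eq)
  then show "lift g' x \<cdot>\<^bsub>E\<^esub> lift f' (OM (Act X g') x) \<cdot>\<^bsub>E\<^esub> am t = lift g x \<cdot>\<^bsub>E\<^esub> lift f (OM (Act X g) x)"
    using t assms n' e am_Ar[of t n] by (auto simp: hom_iff)
qed

text \<open>\<open>glue_ov\<close> gives fullness and \<open>glue_ob\<close> essential surjectivity.
  Since \<open>g'\<close> is generic, its lifts are invertible: an arrow over the pushout is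
  determined by its restriction along \<open>g'\<close>, and the restriction along \<open>f'\<close>
  only has to be checked. Likewise a glued object has the underlying object of \<open>z\<close>, so
  gluing concerns the layering alone.\<close>

theorem decomposition_space:
  assumes glue_ov: "\<And>f g g' f' x y a. free_map f \<Longrightarrow> generic_map g \<Longrightarrow> pushout Delta f g g' f' \<Longrightarrow>
      x \<in> Ob (Val X (Tgt Delta g')) \<Longrightarrow> y \<in> Ob (Val X (Tgt Delta g')) \<Longrightarrow> a \<in> hom E (u x) (u y) \<Longrightarrow>
      ov g' (OM (Act X g') x) y (a \<cdot>\<^bsub>E\<^esub> lift g' x) \<Longrightarrow> ov f' (OM (Act X f') x) y (a \<cdot>\<^bsub>E\<^esub> lift f' x) \<Longrightarrow>
      ov (Ide Delta (Tgt Delta g')) x y a"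
    and glue_ob: "\<And>f g g' f' w y e z d. free_map f \<Longrightarrow> generic_map g \<Longrightarrow> pushout Delta f g g' f' \<Longrightarrow>
      ov g w y e \<Longrightarrow> ov f w z d \<Longrightarrow>
      \<exists>x h. u x = u z \<and> ov g' z x (Ide E (u z)) \<and> ov f' y x h \<and> h \<cdot>\<^bsub>E\<^esub> e = d"
    and pushout_generic: "\<And>f g g' f'. free_map f \<Longrightarrow> generic_map g \<Longrightarrow> pushout Delta f g g' f' \<Longrightarrow> generic_map g'"
  shows "decomposition_space X"
  unfolding decomposition_space_def
proof (intro conjI allI impI simplicial_groupoid)
  fix f g g' f' assume H: "free_map f \<and> generic_map g \<and> pushout Delta f g g' f'"
  define i where "i = Src Delta f"
  define j where "j = Tgt Delta f"
  define k where "k = Tgt Delta g"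
  define l where "l = Tgt Delta g'"
  have D: "f \<in> Ar Delta" "g \<in> Ar Delta" "f' \<in> Ar Delta" "g' \<in> Ar Delta"
    "Src Delta f = i" "Tgt Delta f = j" "Src Delta g = i" "Tgt Delta g = k" "Src Delta f' = k" "Tgt Delta f' = l"
    "Src Delta g' = j" "Tgt Delta g' = l" "g' \<cdot>\<^bsub>Delta\<^esub> f = f' \<cdot>\<^bsub>Delta\<^esub> g"
    using H by (auto simp: pushout_def i_def j_def k_def l_def hom_iff)
  have gen: "generic_map g" "generic_map g'" using H pushout_generic by blast+
  define t where "t x = inv_ar (Val X i) (PC X f' g x) \<cdot>\<^bsub>Val X i\<^esub> PC X g' f x" for x
  have t: "t x \<in> Ar (Val X i)" "Src (Val X i) (t x) = OM (Act X f) (OM (Act X g') x)"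
      "Tgt (Val X i) (t x) = OM (Act X g) (OM (Act X f') x)"
      "am (t x) \<in> Ar E" "Src E (am (t x)) = u (OM (Act X f) (OM (Act X g') x))"
      "Tgt E (am (t x)) = u (OM (Act X g) (OM (Act X f') x))"
      "lift f' x \<cdot>\<^bsub>E\<^esub> lift g (OM (Act X f') x) \<cdot>\<^bsub>E\<^esub> am (t x) = lift g' x \<cdot>\<^bsub>E\<^esub> lift f (OM (Act X g') x)"
    if "x \<in> Ob (Val X l)" for x
    using PC_inv_iso[of f g' x g f' i] am_Ar[of "t x" i] D that by (auto simp: hom_iff t_def)
  have t': "lift f' x \<cdot>\<^bsub>E\<^esub> lift g (OM (Act X f') x) \<cdot>\<^bsub>E\<^esub> am (t x) \<cdot>\<^bsub>E\<^esub> c = lift g' x \<cdot>\<^bsub>E\<^esub> lift f (OM (Act X g') x) \<cdot>\<^bsub>E\<^esub> c"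
    if "x \<in> Ob (Val X l)" "c \<in> Ar E" "Tgt E c = u (OM (Act X f) (OM (Act X g') x))" for x c
    using that t(1-6)[OF that(1)] D by (subst E.cmp_cmp_cmp_eq[OF t(7)[OF that(1)]]) auto
  have lift_f'_mono: "s = s'" if "x \<in> Ob (Val X l)" "s \<in> Ar E" "s' \<in> Ar E" "Tgt E s = u (OM (Act X f') x)"
    "Tgt E s' = u (OM (Act X f') x)" "lift f' x \<cdot>\<^bsub>E\<^esub> s = lift f' x \<cdot>\<^bsub>E\<^esub> s'" for x s s'
    by (rule ov_mono[OF ov_lift[of f' x]]) (use that D in \<open>auto\<close>)
  show "hpullback (Val X (Tgt Delta g')) (Val X (Tgt Delta f)) (Val X (Tgt Delta g)) (Val X (Src Delta f))
          (Act X g') (Act X f') (Act X f) (Act X g)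
          (\<lambda>x. inv_ar (Val X (Src Delta f)) (PC X f' g x) \<cdot>\<^bsub>Val X (Src Delta f)\<^esub> PC X g' f x)"
    unfolding D t_def[symmetric]
  proof (rule hpullbackI)
    show "is_nat_iso (Val X l) (Val X i) (comp_ftor (Val X l) (Act X f) (Act X g'))
        (comp_ftor (Val X l) (Act X g) (Act X f')) t"
    proof (rule is_natI)
      fix \<alpha> assume \<alpha>: "\<alpha> \<in> Ar (Val X l)"
      define x where "x = Src (Val X l) \<alpha>"
      define y where "y = Tgt (Val X l) \<alpha>"
      have xy: "x \<in> Ob (Val X l)" "y \<in> Ob (Val X l)" using \<alpha> by (auto simp: x_def y_def)
      note [simp] = am_Ar[OF \<alpha>] x_def[symmetric] y_def[symmetric]
      \<comment> \<open>The filler \<open>t\<close> is characterised only after two lifts. They are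
        cancelled one at a time, the lift over \<open>f'\<close> by \<open>lift_f'_mono\<close> and
        the one over \<open>g\<close> by \<open>lift_cancel\<close>.\<close>
      have *: "lift f' y \<cdot>\<^bsub>E\<^esub> lift g (OM (Act X f') y) \<cdot>\<^bsub>E\<^esub> am (t y \<cdot>\<^bsub>Val X i\<^esub> AM (Act X f) (AM (Act X g') \<alpha>))
        = lift f' y \<cdot>\<^bsub>E\<^esub> lift g (OM (Act X f') y) \<cdot>\<^bsub>E\<^esub> am (AM (Act X g) (AM (Act X f') \<alpha>) \<cdot>\<^bsub>Val X i\<^esub> t x)"
        using \<alpha> xy D t[OF xy(1)] t[OF xy(2)] t'[OF xy(2)] by simp
      have **: "lift g (OM (Act X f') y) \<cdot>\<^bsub>E\<^esub> am (t y \<cdot>\<^bsub>Val X i\<^esub> AM (Act X f) (AM (Act X g') \<alpha>))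
        = lift g (OM (Act X f') y) \<cdot>\<^bsub>E\<^esub> am (AM (Act X g) (AM (Act X f') \<alpha>) \<cdot>\<^bsub>Val X i\<^esub> t x)"
        by (rule lift_f'_mono[OF xy(2) _ _ _ _ *]) (use \<alpha> xy D t[OF xy(1)] t[OF xy(2)] in \<open>simp_all del: lift_Act\<close>)
      have "t y \<cdot>\<^bsub>Val X i\<^esub> AM (Act X f) (AM (Act X g') \<alpha>) = AM (Act X g) (AM (Act X f') \<alpha>) \<cdot>\<^bsub>Val X i\<^esub> t x"
        by (rule lift_cancel[where n = i, OF _ _ _ _ _ _ _ _ **])
          (use \<alpha> xy D t(1-6)[OF xy(1)] t(1-6)[OF xy(2)] in simp_all)
      then show "t (Tgt (Val X l) \<alpha>) \<cdot>\<^bsub>Val X i\<^esub> AM (comp_ftor (Val X l) (Act X f) (Act X g')) \<alpha> =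
         AM (comp_ftor (Val X l) (Act X g) (Act X f')) \<alpha> \<cdot>\<^bsub>Val X i\<^esub> t (Src (Val X l) \<alpha>)"
        using \<alpha> by (simp add: comp_ftor_AM)
    qed (use D t in \<open>auto simp: comp_ftor_OM hom_iff\<close>)
  next
    fix x y \<alpha> \<beta>
    assume x: "x \<in> Ob (Val X l)" and y: "y \<in> Ob (Val X l)"
      and \<alpha>0: "\<alpha> \<in> hom (Val X j) (OM (Act X g') x) (OM (Act X g') y)"
      and \<beta>0: "\<beta> \<in> hom (Val X k) (OM (Act X f') x) (OM (Act X f') y)"
      and eq: "AM (Act X g) \<beta> \<cdot>\<^bsub>Val X i\<^esub> t x = t y \<cdot>\<^bsub>Val X i\<^esub> AM (Act X f) \<alpha>"
    have \<alpha>: "\<alpha> \<in> Ar (Val X j)" "Src (Val X j) \<alpha> = OM (Act X g') x" "Tgt (Val X j) \<alpha> = OM (Act X g') y"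
      and \<beta>: "\<beta> \<in> Ar (Val X k)" "Src (Val X k) \<beta> = OM (Act X f') x" "Tgt (Val X k) \<beta> = OM (Act X f') y"
      using \<alpha>0 \<beta>0 by (auto simp: hom_iff)
    note [simp] = am_Ar[OF \<alpha>(1), unfolded \<alpha>] am_Ar[OF \<beta>(1), unfolded \<beta>]
    note t_simps = t[OF x] t[OF y] t'[OF y] t'[OF x]
    have iso: "is_iso E (lift g' x)"
      using x D ov_generic[OF gen(2) ov_lift[of g' x]] by simp
    \<comment> \<open>Forced by the square of \<open>\<alpha>\<close> with the lifts of the generic
      map \<open>g'\<close>.\<close>
    define a where "a = lift g' y \<cdot>\<^bsub>E\<^esub> am \<alpha> \<cdot>\<^bsub>E\<^esub> inv_ar E (lift g' x)"
    note i = E.inv_ar_props[OF iso]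
    have a: "a \<in> Ar E" "Src E a = u x" "Tgt E a = u y" "a \<cdot>\<^bsub>E\<^esub> lift g' x = lift g' y \<cdot>\<^bsub>E\<^esub> am \<alpha>"
      using i D x y \<alpha> by (auto simp: a_def)
    have a': "a \<cdot>\<^bsub>E\<^esub> lift g' x \<cdot>\<^bsub>E\<^esub> c = lift g' y \<cdot>\<^bsub>E\<^esub> am \<alpha> \<cdot>\<^bsub>E\<^esub> c" if "c \<in> Ar E" "Tgt E c = u (OM (Act X g') x)" for c
      using that a(1-3) D x y \<alpha> by (subst E.cmp_cmp_eq[OF a(4)]) auto
    have e: "is_iso E (lift g (OM (Act X f') x) \<cdot>\<^bsub>E\<^esub> am (t x))"
    proof (rule E.is_iso_cmp)
      show "is_iso E (am (t x))"
        using ov_Ide_iso[OF am_ov[OF t(1)[OF x]]] t(4-6)[OF x] t(2,3)[OF x]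
        by (metis E.is_isoI fibred.ovD fibred_axioms hom_iff)
      show "is_iso E (lift g (OM (Act X f') x))"
        using x D ov_generic[OF gen(1) ov_lift[of g "OM (Act X f') x"]] by simp
    qed (use D x t_simps in auto)
    \<comment> \<open>The arrow \<open>a\<close> was built from \<open>\<alpha>\<close> only. Its
      agreement with \<open>\<beta>\<close> holds on the common restriction by \<open>eq\<close>;
      the arrow from that restriction is invertible, as it consists of a generic lift and the
      isomorphism \<open>t x\<close>, and can be cancelled.\<close>
    have a_f': "a \<cdot>\<^bsub>E\<^esub> lift f' x = lift f' y \<cdot>\<^bsub>E\<^esub> am \<beta>"
    proof (rule E.iso_epi[OF e])
      have "lift f' y \<cdot>\<^bsub>E\<^esub> lift g (OM (Act X f') y) \<cdot>\<^bsub>E\<^esub> am (AM (Act X g) \<beta> \<cdot>\<^bsub>Val X i\<^esub> t x)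
        = lift f' y \<cdot>\<^bsub>E\<^esub> lift g (OM (Act X f') y) \<cdot>\<^bsub>E\<^esub> am (t y \<cdot>\<^bsub>Val X i\<^esub> AM (Act X f) \<alpha>)"
        unfolding eq ..
      then show "(a \<cdot>\<^bsub>E\<^esub> lift f' x) \<cdot>\<^bsub>E\<^esub> lift g (OM (Act X f') x) \<cdot>\<^bsub>E\<^esub> am (t x)
        = (lift f' y \<cdot>\<^bsub>E\<^esub> am \<beta>) \<cdot>\<^bsub>E\<^esub> lift g (OM (Act X f') x) \<cdot>\<^bsub>E\<^esub> am (t x)"
        using a a' D x y \<alpha> \<beta> t_simps by simp
    qed (use D x y a \<beta> t_simps in auto)
    have "ov (Ide Delta (Tgt Delta g')) x y a"
    proof (rule glue_ov)
      have "ov (g' \<cdot>\<^bsub>Delta\<^esub> Ide Delta j) (OM (Act X g') x) y (lift g' y \<cdot>\<^bsub>E\<^esub> am \<alpha>)"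
        using D y by (intro ov_cmp[OF hom_ov[OF \<alpha>0] ov_lift]) auto
      then show "ov g' (OM (Act X g') x) y (a \<cdot>\<^bsub>E\<^esub> lift g' x)" using D a by simp
      have "ov (f' \<cdot>\<^bsub>Delta\<^esub> Ide Delta k) (OM (Act X f') x) y (lift f' y \<cdot>\<^bsub>E\<^esub> am \<beta>)"
        using D y by (intro ov_cmp[OF hom_ov[OF \<beta>0] ov_lift]) auto
      then show "ov f' (OM (Act X f') x) y (a \<cdot>\<^bsub>E\<^esub> lift f' x)" using D a_f' by simp
    qed (use H D x y a in \<open>auto simp: hom_iff\<close>)
    then obtain d where d: "d \<in> hom (Val X l) x y" "am d = a"
      using ov_hom[of l x y a] D by auto
    show "\<exists>!d. d \<in> hom (Val X l) x y \<and> AM (Act X g') d = \<alpha> \<and> AM (Act X f') d = \<beta>"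
    proof (intro ex1I[of _ d] conjI)
      show "AM (Act X g') d = \<alpha>"
        using d a D x y \<alpha> by (intro lift_cancel[of g' y]) (auto simp: hom_iff)
      show "AM (Act X f') d = \<beta>"
        using d a a_f' D x y \<beta> by (intro lift_cancel[of f' y]) (auto simp: hom_iff)
    next
      fix d' assume d': "d' \<in> hom (Val X l) x y \<and> AM (Act X g') d' = \<alpha> \<and> AM (Act X f') d' = \<beta>"
      note [simp] = am_Ar[of d' l]
      have "am d' = am d"
      proof (rule E.iso_epi[OF iso])
        have "lift g' y \<cdot>\<^bsub>E\<^esub> am (AM (Act X g') d') = am d' \<cdot>\<^bsub>E\<^esub> lift g' x"
          using d' D x y by (auto simp: hom_iff)
        then show "am d' \<cdot>\<^bsub>E\<^esub> lift g' x = am d \<cdot>\<^bsub>E\<^esub> lift g' x"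
          using d' d a by simp
      qed (use d' d a D x y in \<open>auto simp: hom_iff\<close>)
      then show "d' = d" using d d' am_inj by blast
    qed (use d in auto)
  next
    fix z y c assume z: "z \<in> Ob (Val X j)" and y: "y \<in> Ob (Val X k)"
      and c0: "c \<in> hom (Val X i) (OM (Act X f) z) (OM (Act X g) y)"
    then have c: "c \<in> Ar (Val X i)" "Src (Val X i) c = OM (Act X f) z" "Tgt (Val X i) c = OM (Act X g) y"
      by (auto simp: hom_iff)
    note [simp] = am_Ar[OF c(1), unfolded c]
    \<comment> \<open>The restriction of \<open>z\<close> along \<open>f\<close> is taken as the
      common piece: it maps to \<open>y\<close> by \<open>e\<close> over \<open>g\<close> and to
      \<open>z\<close> by the chosen lift over \<open>f\<close>.\<close>
    define e where "e = lift g y \<cdot>\<^bsub>E\<^esub> am c"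
    have "ov (g \<cdot>\<^bsub>Delta\<^esub> Ide Delta i) (OM (Act X f) z) y e"
      unfolding e_def using D y by (intro ov_cmp[OF hom_ov[OF c0] ov_lift]) auto
    then have e1: "ov g (OM (Act X f) z) y e" using D by simp
    have e2: "ov f (OM (Act X f) z) z (lift f z)" using D z by (intro ov_lift) auto
    have "\<exists>x h. u x = u z \<and> ov g' z x (Ide E (u z)) \<and> ov f' y x h \<and> h \<cdot>\<^bsub>E\<^esub> e = lift f z"
      using H e1 e2 by (intro glue_ob) auto
    then obtain x h where ux: "u x = u z" and o1: "ov g' z x (Ide E (u z))" and o2: "ov f' y x h"
      and he: "h \<cdot>\<^bsub>E\<^esub> e = lift f z" by blast
    have x: "x \<in> Ob (Val X l)" using ovD[OF o1] D by simp
    have h: "h \<in> Ar E" "Src E h = u y" "Tgt E h = u x" using ovD[OF o2] by (auto simp: hom_iff)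
    have he': "h \<cdot>\<^bsub>E\<^esub> lift g y \<cdot>\<^bsub>E\<^esub> am c \<cdot>\<^bsub>E\<^esub> s = lift f z \<cdot>\<^bsub>E\<^esub> s"
      if "s \<in> Ar E" "Tgt E s = u (OM (Act X f) z)" for s
      using that h D y z c by (subst E.cmp_cmp_cmp_eq[OF he[unfolded e_def]]) auto
    note t_simps = t[OF x] t'[OF x]
    have "ov (g' \<cdot>\<^bsub>Delta\<^esub> Ide Delta j) (OM (Act X g') x) x (lift g' x)"
      using D x ov_lift[of g' x] by simp
    then obtain s where s: "ov (Ide Delta j) (OM (Act X g') x) z s" "Ide E (u z) \<cdot>\<^bsub>E\<^esub> s = lift g' x"
      using ov_fill[OF o1, of "Ide Delta j" "OM (Act X g') x" "lift g' x"] D by auto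
    then have "s = lift g' x" using ovD[OF s(1)] by (auto simp: hom_iff)
    then obtain \<alpha> where \<alpha>: "\<alpha> \<in> hom (Val X j) (OM (Act X g') x) z" "am \<alpha> = lift g' x"
      using ov_hom[OF s(1)] by blast
    have "ov (f' \<cdot>\<^bsub>Delta\<^esub> Ide Delta k) (OM (Act X f') x) x (lift f' x)"
      using D x ov_lift[of f' x] by simp
    then obtain r where r: "ov (Ide Delta k) (OM (Act X f') x) y r" "h \<cdot>\<^bsub>E\<^esub> r = lift f' x"
      using ov_fill[OF o2, of "Ide Delta k" "OM (Act X f') x" "lift f' x"] D by auto
    obtain \<beta> where \<beta>: "\<beta> \<in> hom (Val X k) (OM (Act X f') x) y" "am \<beta> = r"
      using ov_hom[OF r(1)] by blast
    have r': "r \<in> Ar E" "Src E r = u (OM (Act X f') x)" "Tgt E r = u y"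
      using ovD[OF r(1)] by (auto simp: hom_iff)
    have hr: "h \<cdot>\<^bsub>E\<^esub> r \<cdot>\<^bsub>E\<^esub> s = lift f' x \<cdot>\<^bsub>E\<^esub> s" if "s \<in> Ar E" "Tgt E s = u (OM (Act X f') x)" for s
      using that h r' by (subst E.cmp_cmp_eq[OF r(2)]) auto
    \<comment> \<open>Both composites reduce to the lift of \<open>f\<close> at \<open>z\<close>
      after the lift of \<open>g'\<close>: on the left by the definition of \<open>r\<close>, on the
      right because \<open>h\<close> after \<open>e\<close> is that lift of \<open>f\<close>. The
      arrows \<open>h\<close> and the lift of \<open>g\<close> are then cancelled.\<close>
    have *: "h \<cdot>\<^bsub>E\<^esub> lift g y \<cdot>\<^bsub>E\<^esub> am (AM (Act X g) \<beta> \<cdot>\<^bsub>Val X i\<^esub> t x)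
      = h \<cdot>\<^bsub>E\<^esub> lift g y \<cdot>\<^bsub>E\<^esub> am (c \<cdot>\<^bsub>Val X i\<^esub> AM (Act X f) \<alpha>)"
      using D x y z c \<alpha> \<beta> h hr he' t_simps r' by (auto simp: hom_iff ux)
    have **: "lift g y \<cdot>\<^bsub>E\<^esub> am (AM (Act X g) \<beta> \<cdot>\<^bsub>Val X i\<^esub> t x)
      = lift g y \<cdot>\<^bsub>E\<^esub> am (c \<cdot>\<^bsub>Val X i\<^esub> AM (Act X f) \<alpha>)"
      by (rule ov_mono[OF o2 _ _ _ _ *]) (use D x y z c \<alpha> \<beta> h t_simps r' in \<open>auto simp: hom_iff simp del: lift_Act\<close>)
    have "AM (Act X g) \<beta> \<cdot>\<^bsub>Val X i\<^esub> t x = c \<cdot>\<^bsub>Val X i\<^esub> AM (Act X f) \<alpha>"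
      by (rule lift_cancel[where n = i, OF _ _ _ _ _ _ _ _ **])
        (use D x y z c \<alpha> \<beta> h t(1-6)[OF x] r' in \<open>auto simp: hom_iff\<close>)
    then show "\<exists>x\<in>Ob (Val X l). \<exists>a\<in>hom (Val X j) (OM (Act X g') x) z. \<exists>b\<in>hom (Val X k) (OM (Act X f') x) y.
         AM (Act X g) b \<cdot>\<^bsub>Val X i\<^esub> t x = c \<cdot>\<^bsub>Val X i\<^esub> AM (Act X f) a"
      using x \<alpha> \<beta> by blast
  qed (use D Act_functor[of f] Act_functor[of g] Act_functor[of f'] Act_functor[of g'] in
      \<open>auto simp: groupoid_Val category_Val\<close>)
qed

end

section \<open>Generic-free pushouts in the simplex category\<close>

lemma increasing_le:
  fixes h :: "nat \<Rightarrow> nat"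
  assumes "\<And>i. i < l \<Longrightarrow> h i < h (Suc i)" "i \<le> l"
  shows "i \<le> h i"
  using assms(2)
proof (induction i)
  case (Suc i) then show ?case using assms(1)[of i] by simp
qed simp

text \<open>Monotone maps with inverses are strictly increasing, so neither map can lie below the
  identity anywhere, and being inverse to each other they cannot lie above it. This rigidity of
  \<open>Delta\<close> makes pushouts unique, and not merely unique up to isomorphism.\<close>

lemma monotone_inverse_identity:
  fixes h k :: "nat \<Rightarrow> nat"
  assumes h: "mono_on {0..l} h" "\<And>i. i \<le> l \<Longrightarrow> h i \<le> m" and k: "mono_on {0..m} k" "\<And>i. i \<le> m \<Longrightarrow> k i \<le> l"
    and kh: "\<And>i. i \<le> l \<Longrightarrow> k (h i) = i" and hk: "\<And>i. i \<le> m \<Longrightarrow> h (k i) = i"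
  shows "l = m" "i \<le> l \<Longrightarrow> h i = i"
proof -
  \<comment> \<open>A left inverse makes \<open>g\<close> injective, and an injective monotone map
    increases strictly.\<close>
  have inv: "g i < g (Suc i)" if "mono_on {0..p} g" "\<And>i. i \<le> p \<Longrightarrow> g' (g i) = i" "i < p" for g g' :: "nat \<Rightarrow> nat" and p i
    using monotone_onD[OF that(1), of i "Suc i"] arg_cong[of "g i" "g (Suc i)" g'] that(2)[of i] that(2)[of "Suc i"] that(3)
    by fastforce
  have "h i < h (Suc i)" if "i < l" for i using inv[OF h(1) kh that] .
  then have ih: "i \<le> h i" if "i \<le> l" for i using increasing_le[of l h i] that by blast
  have "k i < k (Suc i)" if "i < m" for i using inv[OF k(1) hk that] .
  then have ik: "i \<le> k i" if "i \<le> m" for i using increasing_le[of m k i] that by blast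
  show "l = m" using ih[of l] ik[of m] h(2)[of l] k(2)[of m] by simp
  show "h i = i" if "i \<le> l" using ih[of i] ik[of "h i"] h(2)[of i] kh[of i] that by simp
qed

lemma free_map_eq:
  assumes "free_map (m, f, n)" "i \<le> m" shows "f i = i + f 0"
  using assms(2)
proof (induction i)
  case (Suc i) then show ?case using assms(1) by (simp add: free_map.simps)
qed simp

lemma Delta_Ar_iff:
  "(m, a, n) \<in> Ar Delta \<longleftrightarrow> a \<in> extensional {0..m} \<and> (\<forall>i\<le>m. a i \<le> n) \<and> (\<forall>i j. i \<le> j \<longrightarrow> j \<le> m \<longrightarrow> a i \<le> a j)"
  by (auto simp: Delta_simps PiE_iff monotone_on_def)

text \<open>The free map picks out the stretch of [b] from \<open>s\<close> to \<open>s + a\<close>;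
  the pushout replaces this stretch by a copy of [c]. Thus \<open>g'\<close> is the identity below
  it, a translate of \<open>g\<close> on it and a shift by \<open>c - a\<close> above it, and
  \<open>f'\<close> includes [c] at \<open>s\<close>. The explicit cocone is compared with the given
  pushout by an isomorphism, which rigidity turns into an identity.\<close>

lemma pushout_generic_free:
  assumes f: "free_map (a, f, b)" and g: "generic_map (a, g, c)"
    and po: "pushout Delta (a, f, b) (a, g, c) g' f'"
  defines "s \<equiv> f 0"
  shows "g' = (b, \<lambda>i\<in>{0..b}. if i \<le> s then i else if i \<le> s + a then g (i - s) + s else i + c - a, b + c - a)"
    and "f' = (c, \<lambda>j\<in>{0..c}. j + s, b + c - a)"
    and "s + a \<le> b"
proof -
  have fA: "(a, f, b) \<in> Ar Delta" using f by (simp add: free_map.simps)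
  have gA: "(a, g, c) \<in> Ar Delta" and g0: "g 0 = 0" and ga: "g a = c" using g by (auto simp: generic_map.simps)
  have f_eq: "f i = i + s" if "i \<le> a" for i using free_map_eq[OF f that] by (simp add: s_def)
  have g_le: "g i \<le> c" if "i \<le> a" for i using gA that by (auto simp: Delta_Ar_iff)
  have g_mono: "g i \<le> g j" if "i \<le> j" "j \<le> a" for i j using gA that by (auto simp: Delta_Ar_iff)
  show sab: "s + a \<le> b" using f_eq[of a] fA by (auto simp: Delta_Ar_iff)
  obtain l where l: "g' \<in> hom Delta b l" "f' \<in> hom Delta c l" "g' \<cdot>\<^bsub>Delta\<^esub> (a, f, b) = f' \<cdot>\<^bsub>Delta\<^esub> (a, g, c)"
    and uni': "\<forall>w. \<forall>x\<in>hom Delta b w. \<forall>y\<in>hom Delta c w. x \<cdot>\<^bsub>Delta\<^esub> (a, f, b) = y \<cdot>\<^bsub>Delta\<^esub> (a, g, c) \<longrightarrow>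
      (\<exists>!h. h \<in> hom Delta l w \<and> h \<cdot>\<^bsub>Delta\<^esub> g' = x \<and> h \<cdot>\<^bsub>Delta\<^esub> f' = y)"
    using po unfolding pushout_def Delta_simps(3) by blast
  obtain u where u: "g' = (b, u, l)" using l(1) by (cases g') (auto simp: hom_iff Delta_simps(2,3))
  obtain v where v: "f' = (c, v, l)" using l(2) by (cases f') (auto simp: hom_iff Delta_simps(2,3))
  have A: "(b, u, l) \<in> Ar Delta" "(c, v, l) \<in> Ar Delta"
    "(b, u, l) \<cdot>\<^bsub>Delta\<^esub> (a, f, b) = (c, v, l) \<cdot>\<^bsub>Delta\<^esub> (a, g, c)"
    using l by (simp_all add: hom_iff u v)
  have uni: "\<exists>!h. h \<in> hom Delta l w \<and> h \<cdot>\<^bsub>Delta\<^esub> (b, u, l) = x \<and> h \<cdot>\<^bsub>Delta\<^esub> (c, v, l) = y"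
    if "x \<in> hom Delta b w" "y \<in> hom Delta c w" "x \<cdot>\<^bsub>Delta\<^esub> (a, f, b) = y \<cdot>\<^bsub>Delta\<^esub> (a, g, c)" for w x y
    using uni' that unfolding u v by blast
  have uv: "u (i + s) = v (g i)" if "i \<le> a" for i
    using A(3) that f_eq[OF that] by (auto simp: Delta_simps compose_def fun_eq_iff split: if_splits)
  have u_le: "u i \<le> l" if "i \<le> b" for i using A(1) that by (auto simp: Delta_Ar_iff)
  have v_le: "v i \<le> l" if "i \<le> c" for i using A(2) that by (auto simp: Delta_Ar_iff)
  have u_mono: "u i \<le> u j" if "i \<le> j" "j \<le> b" for i j using A(1) that by (auto simp: Delta_Ar_iff)
  have v_mono: "v i \<le> v j" if "i \<le> j" "j \<le> c" for i j using A(2) that by (auto simp: Delta_Ar_iff)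
  have gs_le: "g (i - s) \<le> c" if "i \<le> s + a" for i using g_le[of "i - s"] that by simp
  have gs_mono: "g (i - s) \<le> g (j - s)" if "i \<le> j" "j \<le> s + a" for i j
    using g_mono[of "i - s" "j - s"] that by simp
  define G where "G = (\<lambda>i\<in>{0..b}. if i \<le> s then i else if i \<le> s + a then g (i - s) + s else i + c - a)"
  define F where "F = (\<lambda>j\<in>{0..c}. j + s)"
  define L where "L = b + c - a"
  have G: "(b, G, L) \<in> Ar Delta"
    unfolding Delta_Ar_iff
  proof (intro conjI allI impI)
    show "G i \<le> L" if "i \<le> b" for i
      using that sab gs_le[of i] by (auto simp: G_def L_def)
    show "G i \<le> G j" if "i \<le> j" "j \<le> b" for i j
      using that sab gs_le[of i] gs_mono[of i j] by (auto simp: G_def)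
  qed (auto simp: G_def)
  have F: "(c, F, L) \<in> Ar Delta"
    using sab by (auto simp: Delta_Ar_iff F_def L_def)
  have "G (i + s) = F (g i)" if "i \<le> a" for i
    using that sab g_le[of i] g0 by (cases "i = 0") (auto simp: G_def F_def)
  then have GF: "(b, G, L) \<cdot>\<^bsub>Delta\<^esub> (a, f, b) = (c, F, L) \<cdot>\<^bsub>Delta\<^esub> (a, g, c)"
    using f_eq by (auto simp: Delta_simps compose_def)
  obtain hh where hh: "hh \<in> hom Delta l L" "hh \<cdot>\<^bsub>Delta\<^esub> (b, u, l) = (b, G, L)" "hh \<cdot>\<^bsub>Delta\<^esub> (c, v, l) = (c, F, L)"
    using uni[of "(b, G, L)" L "(c, F, L)"] G F GF by (auto simp: hom_iff Delta_simps(2,3))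
  obtain h where h: "hh = (l, h, L)" using hh(1) by (cases hh) (auto simp: hom_iff Delta_simps(2,3))
  have h_Ar: "(l, h, L) \<in> Ar Delta" using hh h by (simp add: hom_iff)
  have hu: "h (u i) = G i" if "i \<le> b" for i
    using hh(2) that by (auto simp: h Delta_simps compose_def fun_eq_iff split: if_splits)
  have hv: "h (v i) = F i" if "i \<le> c" for i
    using hh(3) that by (auto simp: h Delta_simps compose_def fun_eq_iff split: if_splits)
  \<comment> \<open>The inverse of \<open>h\<close>: on the inserted copy of [c] it is given by
    \<open>v\<close>, outside it by \<open>u\<close> at the old position. The two prescriptions
    agree at the ends of the stretch by \<open>us\<close>, which is also why \<open>k\<close> is
    monotone.\<close>
  define k where "k = (\<lambda>i\<in>{0..L}. if i \<le> s then u i else if i \<le> s + c then v (i - s) else u (i + a - c))"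
  have us: "u s = v 0" "u (s + a) = v c" using uv[of 0] uv[of a] g0 ga by (auto simp: add.commute)
  have k_Ar: "(L, k, l) \<in> Ar Delta"
    unfolding Delta_Ar_iff
  proof (intro conjI allI impI)
    show "k i \<le> l" if "i \<le> L" for i
      using that sab by (auto simp: k_def L_def intro!: u_le v_le)
    fix i j assume ij: "i \<le> j" "j \<le> L"
    have 1: "u i \<le> v (j - s)" if "i \<le> s" "s < j" "j \<le> s + c"
    proof -
      have "j - s \<le> c" "i \<le> s" "s \<le> b" using that sab by linarith+
      then show ?thesis using u_mono[of i s] v_mono[of 0 "j - s"] us by simp
    qed
    have 2: "v (i - s) \<le> u (j + a - c)" if "s < i" "i \<le> s + c" "s + c < j"
    proof -
      have "i - s \<le> c" "s + a \<le> j + a - c" "j + a - c \<le> b" using that sab ij by (simp_all add: L_def)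
      then show ?thesis using u_mono[of "s + a" "j + a - c"] v_mono[of "i - s" c] us by simp
    qed
    have 3: "u i \<le> u (j + a - c)" if "i \<le> s" "s + c < j"
    proof -
      have "i \<le> j + a - c" "j + a - c \<le> b" using that sab ij by (simp_all add: L_def)
      then show ?thesis by (rule u_mono)
    qed
    show "k i \<le> k j"
      using ij sab 1 2 3 by (auto simp: k_def L_def intro!: u_mono v_mono)
  qed (auto simp: k_def)
  have kG: "k (G i) = u i" if i: "i \<le> b" for i
  proof -
    have "G i \<le> L" using G i by (simp add: Delta_Ar_iff)
    \<comment> \<open>If \<open>g (i - s)\<close> is 0, the point \<open>G i\<close> equals
      \<open>s\<close> and meets the first branch of \<open>k\<close>, not the middle one; the
      values still agree since \<open>u s = v 0\<close>.\<close>
    consider "i \<le> s" | "s < i" "i \<le> s + a" "g (i - s) = 0" | "s < i" "i \<le> s + a" "0 < g (i - s)" | "s + a < i"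
      by fastforce
    then show ?thesis
    proof cases
      case 2
      then show ?thesis using i uv[of "i - s"] us \<open>G i \<le> L\<close> by (auto simp: k_def G_def)
    next
      case 3
      then show ?thesis using i uv[of "i - s"] gs_le[of i] \<open>G i \<le> L\<close> by (auto simp: k_def G_def)
    qed (use i sab \<open>G i \<le> L\<close> in \<open>auto simp: k_def G_def\<close>)
  qed
  have kF: "k (F i) = v i" if "i \<le> c" for i
    using that us sab by (cases "i = 0") (auto simp: k_def F_def L_def)
  have hk: "h (k i) = i" if i: "i \<le> L" for i
  proof -
    consider "i \<le> s" | "s < i" "i \<le> s + c" | "s + c < i" by fastforce
    then show ?thesis
      by cases (use i sab hu[of i] hv[of "i - s"] hu[of "i + a - c"] in \<open>auto simp: k_def G_def F_def L_def\<close>)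
  qed
  \<comment> \<open>The composite and the identity are endomorphisms of the pushout with the same
    restrictions to both legs; uniqueness in the universal property identifies them.\<close>
  have "(L, k, l) \<cdot>\<^bsub>Delta\<^esub> (l, h, L) = Ide Delta l"
  proof -
    have m1: "(L, k, l) \<cdot>\<^bsub>Delta\<^esub> (l, h, L) \<in> hom Delta l l"
      using k_Ar h_Ar by (auto simp: hom_iff Delta_simps(2,3))
    have m2: "((L, k, l) \<cdot>\<^bsub>Delta\<^esub> (l, h, L)) \<cdot>\<^bsub>Delta\<^esub> (b, u, l) = (b, u, l)"
      "((L, k, l) \<cdot>\<^bsub>Delta\<^esub> (l, h, L)) \<cdot>\<^bsub>Delta\<^esub> (c, v, l) = (c, v, l)"
      using A(1,2) u_le v_le kG kF hu hv
      by (auto simp: Delta_simps compose_def PiE_iff extensional_def fun_eq_iff)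
    have i: "Ide Delta l \<in> hom Delta l l" "Ide Delta l \<cdot>\<^bsub>Delta\<^esub> (b, u, l) = (b, u, l)"
      "Ide Delta l \<cdot>\<^bsub>Delta\<^esub> (c, v, l) = (c, v, l)"
      using A(1,2) by (auto simp: hom_iff Delta_simps(2,3))
    have "(b, u, l) \<in> hom Delta b l" "(c, v, l) \<in> hom Delta c l" using l(1,2) u v by simp_all
    then have ex: "\<exists>!h. h \<in> hom Delta l l \<and> h \<cdot>\<^bsub>Delta\<^esub> (b, u, l) = (b, u, l) \<and> h \<cdot>\<^bsub>Delta\<^esub> (c, v, l) = (c, v, l)"
      using uni A(3) by blast
    show ?thesis
      by (rule trans[OF the1_equality[OF ex, symmetric] the1_equality[OF ex]]) (intro conjI m1 m2 i)+
  qed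
  then have kh: "k (h i) = i" if "i \<le> l" for i
    using that by (auto simp: Delta_simps compose_def fun_eq_iff split: if_splits)
  have hm: "mono_on {0..l} h" "\<And>i. i \<le> l \<Longrightarrow> h i \<le> L" "mono_on {0..L} k" "\<And>i. i \<le> L \<Longrightarrow> k i \<le> l"
    using h_Ar k_Ar by (auto simp: Delta_Ar_iff monotone_on_def)
  note mi = monotone_inverse_identity[OF hm kh hk]
  have lL: "l = L" by (rule mi(1))
  have h_id: "h i = i" if "i \<le> l" for i by (rule mi(2)) (use that in simp_all)
  have "u = G"
    using hu h_id u_le A(1) G by (intro extensionalityI[of _ "{0..b}"]) (auto simp: Delta_Ar_iff)
  then show "g' = (b, \<lambda>i\<in>{0..b}. if i \<le> s then i else if i \<le> s + a then g (i - s) + s else i + c - a, b + c - a)"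
    using lL u by (simp add: G_def L_def)
  have "v = F"
    using hv h_id v_le A(2) F by (intro extensionalityI[of _ "{0..c}"]) (auto simp: Delta_Ar_iff)
  then show "f' = (c, \<lambda>j\<in>{0..c}. j + s, b + c - a)"
    using lL v by (simp add: F_def L_def)
qed

lemma pushout_generic:
  assumes f: "free_map f" and g: "generic_map g" and po: "pushout Delta f g g' f'"
  shows "generic_map g'"
proof -
  obtain a ff b gg c where fg: "f = (a, ff, b)" "g = (a, gg, c)"
    using po by (cases f; cases g) (auto simp: pushout_def Delta_simps)
  note P = pushout_generic_free[OF f[unfolded fg] g[unfolded fg] po[unfolded fg]]
  have "g' \<in> Ar Delta" using po by (auto simp: pushout_def hom_iff)
  moreover have "gg a = c" "gg 0 = 0" using g fg by (auto simp: generic_map.simps)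
  ultimately show ?thesis using P by (auto simp: generic_map.simps)
qed

section \<open>Finite posets and convex maps\<close>

lemma Pos_simps [simp]:
  "P \<in> Ob Pos \<longleftrightarrow> finite P \<and> Partial_order P" "Src Pos (K, f, P) = K" "Tgt Pos (K, f, P) = P"
  "Ide Pos P = (P, \<lambda>a\<in>Field P. a, P)"
  "(L, g, Q) \<cdot>\<^bsub>Pos\<^esub> (K, f, P) = (K, compose (Field K) g f, Q)"
  by (auto simp: Pos_def)

lemma Pos_Ar: "(K, f, P) \<in> Ar Pos \<longleftrightarrow> K \<in> Ob Pos \<and> P \<in> Ob Pos \<and> convex_map K f P"
  by (auto simp: Pos_def)

lemma fn_simp [simp]: "fn (K, f, P) = f"
  by (simp add: fn_def)

lemma Partial_order_simps:
  assumes "Partial_order P"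
  shows "a \<in> Field P \<Longrightarrow> (a, a) \<in> P" "(a, b) \<in> P \<Longrightarrow> (b, c) \<in> P \<Longrightarrow> (a, c) \<in> P"
    "(a, b) \<in> P \<Longrightarrow> (b, a) \<in> P \<Longrightarrow> a = b"
  using assms by (auto simp: order_on_defs refl_on_def dest: transD antisymD)

lemma convex_mapD:
  assumes "convex_map K f P"
  shows "a \<in> Field K \<Longrightarrow> f a \<in> Field P" "(a, b) \<in> K \<Longrightarrow> (f a, f b) \<in> P" "f \<in> extensional (Field K)"
    "a \<in> Field K \<Longrightarrow> b \<in> Field K \<Longrightarrow> (f a, x) \<in> P \<Longrightarrow> (x, f b) \<in> P \<Longrightarrow> \<exists>!k. (a, k) \<in> K \<and> (k, b) \<in> K \<and> f k = x"
  using assms unfolding convex_map_def by (auto simp: PiE_iff)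

text \<open>The points over \<open>f a\<close> in the interval from \<open>a\<close> to \<open>b\<close> witness \<open>a \<le> b\<close>; hence convex maps reflect
  the order and are injective.\<close>

lemma convex_map_reflects:
  assumes f: "convex_map K f P" and K: "Partial_order K" and P: "Partial_order P"
    and ab: "a \<in> Field K" "b \<in> Field K" "(f a, f b) \<in> P"
  shows "(a, b) \<in> K"
proof -
  have "(f a, f a) \<in> P" using f ab(1) P by (metis convex_mapD(1) Partial_order_simps(1))
  then show ?thesis using convex_mapD(4)[OF f ab(1,2), of "f a"] ab(3) Partial_order_simps(2)[OF K] by metis
qed

lemma convex_map_inj:
  assumes f: "convex_map K f P" and K: "Partial_order K" and P: "Partial_order P"
  shows "inj_on f (Field K)"
proof (rule inj_onI)
  fix a b assume ab: "a \<in> Field K" "b \<in> Field K" "f a = f b"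
  have "(f a, f b) \<in> P" "(f b, f a) \<in> P" using f ab P by (metis convex_mapD(1) Partial_order_simps(1))+
  then show "a = b" using convex_map_reflects[OF f K P] ab Partial_order_simps(3)[OF K] by metis
qed

text \<open>The factor \<open>h\<close> is \<open>u\<close> followed by the inverse of
  \<open>v\<close> on its image. It is monotone because \<open>v\<close> reflects the order, and
  convex because a point between \<open>h a\<close> and \<open>h b\<close> is carried by
  \<open>v\<close> between \<open>u a\<close> and \<open>u b\<close>, where convexity of
  \<open>u\<close> supplies the required point.\<close>

lemma convex_map_factor:
  assumes u: "convex_map K u P" and v: "convex_map L v P" and K: "Partial_order K" and L: "Partial_order L"
    and P: "Partial_order P" and img: "u ` Field K \<subseteq> v ` Field L"
  defines "h \<equiv> \<lambda>a\<in>Field K. inv_into (Field L) v (u a)"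
  shows "convex_map K h L" "\<And>a. a \<in> Field K \<Longrightarrow> v (h a) = u a"
proof -
  have hF: "h a \<in> Field L" and vh: "v (h a) = u a" if "a \<in> Field K" for a
    using that img by (auto simp: h_def intro!: inv_into_into f_inv_into_f)
  show "v (h a) = u a" if "a \<in> Field K" for a using vh[OF that] .
  show "convex_map K h L"
    unfolding convex_map_def
  proof (intro conjI ballI allI impI)
    show "h \<in> Field K \<rightarrow>\<^sub>E Field L" using hF by (auto simp: h_def PiE_iff)
    show "case e of (a, b) \<Rightarrow> (h a, h b) \<in> L" if e: "e \<in> K" for e
    proof (cases e)
      case (Pair a b)
      then have ab: "(a, b) \<in> K" "a \<in> Field K" "b \<in> Field K" using e by (auto simp: Field_def)
      then have "(v (h a), v (h b)) \<in> P" using convex_mapD(2)[OF u] vh by simp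
      then show ?thesis using convex_map_reflects[OF v L P] hF ab Pair by simp
    qed
    fix a b x assume ab: "a \<in> Field K" "b \<in> Field K" and x: "(h a, x) \<in> L \<and> (x, h b) \<in> L"
    have xF: "x \<in> Field L" using x by (auto simp: Field_def)
    have "(u a, v x) \<in> P" "(v x, u b) \<in> P" using x ab convex_mapD(2)[OF v] vh by metis+
    then have ex: "\<exists>!k. (a, k) \<in> K \<and> (k, b) \<in> K \<and> u k = v x" using convex_mapD(4)[OF u ab] by simp
    have eq: "u k = v x \<longleftrightarrow> h k = x" if "k \<in> Field K" for k
      using vh[OF that] hF[OF that] xF convex_map_inj[OF v L P] by (metis inj_onD)
    have "(a, k) \<in> K \<and> (k, b) \<in> K \<and> u k = v x \<longleftrightarrow> (a, k) \<in> K \<and> (k, b) \<in> K \<and> h k = x" for k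
      using eq[of k] by (auto simp: Field_def)
    then show "\<exists>!k. (a, k) \<in> K \<and> (k, b) \<in> K \<and> h k = x" using ex by simp
  qed
qed

lemma Pos_ArD:
  assumes "u \<in> Ar Pos"
  shows "u = (Src Pos u, fn u, Tgt Pos u)" "convex_map (Src Pos u) (fn u) (Tgt Pos u)"
    "Partial_order (Src Pos u)" "Partial_order (Tgt Pos u)" "inj_on (fn u) (Field (Src Pos u))"
    "finite (Src Pos u)" "finite (Tgt Pos u)"
  using assms convex_map_inj by (cases u, auto simp: Pos_Ar)+

lemma Pos_Ar_eqI:
  assumes "u \<in> Ar Pos" "v \<in> Ar Pos" "Src Pos u = Src Pos v" "Tgt Pos u = Tgt Pos v"
    "\<And>a. a \<in> Field (Src Pos u) \<Longrightarrow> fn u a = fn v a"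
  shows "u = v"
proof -
  have "fn u = fn v"
    using assms convex_mapD(3)[OF Pos_ArD(2)[OF assms(1)]] convex_mapD(3)[OF Pos_ArD(2)[OF assms(2)]]
    by (intro extensionalityI[of _ "Field (Src Pos u)"]) auto
  then show ?thesis using Pos_ArD(1)[OF assms(1)] Pos_ArD(1)[OF assms(2)] assms(3,4) by metis
qed

lemma fn_cmp: "a \<in> Field (Src Pos u) \<Longrightarrow> fn (v \<cdot>\<^bsub>Pos\<^esub> u) a = fn v (fn u a)"
  by (cases u; cases v) (simp add: compose_def)

lemma fn_Ide: "a \<in> Field P \<Longrightarrow> fn (Ide Pos P) a = a"
  by simp

lemma convex_map_comp:
  assumes f: "convex_map K f L" and g: "convex_map L g P" and K: "Partial_order K" and L: "Partial_order L"
    and P: "Partial_order P"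
  shows "convex_map K (compose (Field K) g f) P"
  unfolding convex_map_def
proof (intro conjI ballI allI impI)
  show "compose (Field K) g f \<in> Field K \<rightarrow>\<^sub>E Field P"
    using convex_mapD[OF f] convex_mapD[OF g] by (auto simp: PiE_iff compose_def)
  show "case e of (a, b) \<Rightarrow> (compose (Field K) g f a, compose (Field K) g f b) \<in> P" if "e \<in> K" for e
    using that convex_mapD(2)[OF f] convex_mapD(2)[OF g] by (cases e) (auto simp: compose_def Field_def)
  fix a b x assume ab: "a \<in> Field K" "b \<in> Field K"
    and x: "(compose (Field K) g f a, x) \<in> P \<and> (x, compose (Field K) g f b) \<in> P"
  obtain y where y: "(f a, y) \<in> L" "(y, f b) \<in> L" "g y = x"
    using convex_mapD(4)[OF g convex_mapD(1)[OF f ab(1)] convex_mapD(1)[OF f ab(2)], of x] x ab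
    by (auto simp: compose_def)
  have "compose (Field K) g f k = x \<longleftrightarrow> f k = y" if "k \<in> Field K" for k
    using that y convex_mapD(1)[OF f that] convex_map_inj[OF g L P]
    by (auto simp: compose_def inj_on_def Field_def)
  then have "(a, k) \<in> K \<and> (k, b) \<in> K \<and> compose (Field K) g f k = x \<longleftrightarrow> (a, k) \<in> K \<and> (k, b) \<in> K \<and> f k = y" for k
    by (auto simp: Field_def)
  then show "\<exists>!k. (a, k) \<in> K \<and> (k, b) \<in> K \<and> compose (Field K) g f k = x"
    using convex_mapD(4)[OF f ab y(1,2)] by simp
qed

lemma Pos_factor:
  assumes u: "u \<in> Ar Pos" and v: "v \<in> Ar Pos" and tgt: "Tgt Pos u = Tgt Pos v"
    and img: "fn u ` Field (Src Pos u) \<subseteq> fn v ` Field (Src Pos v)"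
  shows "\<exists>h\<in>hom Pos (Src Pos u) (Src Pos v). v \<cdot>\<^bsub>Pos\<^esub> h = u"
proof -
  define h where "h = (\<lambda>a\<in>Field (Src Pos u). inv_into (Field (Src Pos v)) (fn v) (fn u a))"
  note U = Pos_ArD[OF u] and V = Pos_ArD[OF v]
  have h: "convex_map (Src Pos u) h (Src Pos v)" "\<And>a. a \<in> Field (Src Pos u) \<Longrightarrow> fn v (h a) = fn u a"
    using convex_map_factor[OF U(2) V(2)[folded tgt] U(3) V(3) U(4) img] by (auto simp: h_def)
  define w where "w = (Src Pos u, h, Src Pos v)"
  have w: "w \<in> hom Pos (Src Pos u) (Src Pos v)"
    using h(1) U V by (simp add: w_def hom_iff Pos_Ar)
  have e: "v \<cdot>\<^bsub>Pos\<^esub> w = (Src Pos u, compose (Field (Src Pos u)) (fn v) h, Tgt Pos v)"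
    by (subst V(1)) (simp add: w_def)
  have "v \<cdot>\<^bsub>Pos\<^esub> w = u"
  proof (rule Pos_Ar_eqI)
    show "v \<cdot>\<^bsub>Pos\<^esub> w \<in> Ar Pos"
      unfolding e using convex_map_comp[OF h(1) V(2) U(3) V(3,4)] U V by (simp add: Pos_Ar)
  qed (use u h(2) tgt in \<open>auto simp: e compose_def\<close>)
  with w show ?thesis by blast
qed

lemma Pos_mono:
  assumes v: "v \<in> Ar Pos" and "s \<in> Ar Pos" "t \<in> Ar Pos" "Tgt Pos s = Src Pos v" "Tgt Pos t = Src Pos v"
    and eq: "v \<cdot>\<^bsub>Pos\<^esub> s = v \<cdot>\<^bsub>Pos\<^esub> t"
  shows "s = t"
proof -
  have st: "Src Pos s = Src Pos t"
    using arg_cong[OF eq, of "Src Pos"] by (cases s; cases t; cases v) auto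
  show ?thesis
  proof (rule Pos_Ar_eqI[OF assms(2,3) st])
    fix a assume a: "a \<in> Field (Src Pos s)"
    have "fn v (fn s a) = fn v (fn t a)"
      using arg_cong[OF eq, of "\<lambda>w. fn w a"] fn_cmp[of a s v] fn_cmp[of a t v] a st by simp
    moreover have "fn s a \<in> Field (Src Pos v)" "fn t a \<in> Field (Src Pos v)"
      using convex_mapD(1)[OF Pos_ArD(2)[OF assms(2)]] convex_mapD(1)[OF Pos_ArD(2)[OF assms(3)]] a st assms(4,5)
      by auto
    ultimately show "fn s a = fn t a" using Pos_ArD(5)[OF v] by (auto dest: inj_onD)
  qed (use assms in auto)
qed

lemma Field_Restr: "Partial_order P \<Longrightarrow> K \<subseteq> Field P \<Longrightarrow> Field (Restr P K) = K"
  by (rule Refl_Field_Restr2) (auto simp: order_on_defs)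

lemma Restr_Ob:
  assumes "P \<in> Ob Pos" shows "Restr P K \<in> Ob Pos"
  using assms Partial_order_Restr[of P K] by (simp add: finite_subset[of "Restr P K" P])

lemma incl_Ar:
  assumes P: "P \<in> Ob Pos" and K: "K \<subseteq> Field P"
    and convex: "\<And>a b x. a \<in> K \<Longrightarrow> b \<in> K \<Longrightarrow> (a, x) \<in> P \<Longrightarrow> (x, b) \<in> P \<Longrightarrow> x \<in> K"
  shows "incl P K \<in> hom Pos (Restr P K) P"
proof -
  have F: "Field (Restr P K) = K" using P K by (intro Field_Restr) auto
  have "convex_map (Restr P K) (\<lambda>a\<in>K. a) P"
    unfolding convex_map_def F
  proof (intro conjI ballI allI impI)
    fix a b x assume a: "a \<in> K" and b: "b \<in> K"
      and x: "((\<lambda>a\<in>K. a) a, x) \<in> P \<and> (x, (\<lambda>a\<in>K. a) b) \<in> P"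
    then have "x \<in> K" using convex[OF a b] by simp
    then show "\<exists>!k. (a, k) \<in> Restr P K \<and> (k, b) \<in> Restr P K \<and> (\<lambda>a\<in>K. a) k = x"
      using a b x by (intro ex1I[of _ x]) auto
  qed (use K in auto)
  then show ?thesis using P Restr_Ob[OF P, of K] by (simp add: incl_def hom_iff Pos_Ar)
qed

lemma Ide_Pos_Ar: "P \<in> Ob Pos \<Longrightarrow> Ide Pos P \<in> Ar Pos"
  by (auto simp: Pos_Ar convex_map_def intro: Partial_order_simps) (metis FieldI1 FieldI2)+

section \<open>Arrows of a directed restriction species\<close>

locale species =
  fixes R :: "('v, 'o, 'a) drs"
  assumes species: "directed_restriction_species R"
begin

abbreviation pos :: "'o \<Rightarrow> 'v poset" where "pos \<equiv> OM (Prj R)"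
abbreviation pt :: "'a \<Rightarrow> 'v point \<Rightarrow> 'v point" where "pt a \<equiv> fn (AM (Prj R) a)"

lemma fibration: "right_fibration (Tot R) Pos (Prj R)"
  using species by (simp add: directed_restriction_species_def)

sublocale E: cat "Tot R"
  by (rule cat.intro) (use fibration in \<open>simp add: right_fibration_def\<close>)

lemma Prj_functor: "is_functor (Tot R) Pos (Prj R)"
  using fibration by (simp add: right_fibration_def)

lemmas Prj_simps = functorD[OF Prj_functor]

lemma pos_Ob: "X \<in> Ob (Tot R) \<Longrightarrow> pos X \<in> Ob Pos"
  by (rule Prj_simps(1))

lemma Partial_order_pos: "X \<in> Ob (Tot R) \<Longrightarrow> Partial_order (pos X)"
  using pos_Ob by auto

lemma pt_convex: "a \<in> Ar (Tot R) \<Longrightarrow> convex_map (pos (Src (Tot R) a)) (pt a) (pos (Tgt (Tot R) a))"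
  using Pos_ArD(2)[of "AM (Prj R) a"] Prj_simps(2-4)[of a] by simp

lemma pt_Field: "a \<in> Ar (Tot R) \<Longrightarrow> v \<in> Field (pos (Src (Tot R) a)) \<Longrightarrow> pt a v \<in> Field (pos (Tgt (Tot R) a))"
  using pt_convex convex_mapD(1) by blast

lemma pt_inj: "a \<in> Ar (Tot R) \<Longrightarrow> inj_on (pt a) (Field (pos (Src (Tot R) a)))"
  using Pos_ArD(5)[of "AM (Prj R) a"] Prj_simps(2-4)[of a] by simp

lemma pt_cmp:
  assumes "a \<in> Ar (Tot R)" "b \<in> Ar (Tot R)" "Src (Tot R) b = Tgt (Tot R) a" "v \<in> Field (pos (Src (Tot R) a))"
  shows "pt (b \<cdot>\<^bsub>Tot R\<^esub> a) v = pt b (pt a v)"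
  using assms Prj_simps(3,6) by (simp add: fn_cmp)

lemma pt_Ide: "X \<in> Ob (Tot R) \<Longrightarrow> v \<in> Field (pos X) \<Longrightarrow> pt (Ide (Tot R) X) v = v"
  by (simp add: Prj_simps(5))

lemma vertical_iso:
  assumes a: "a \<in> Ar (Tot R)" and p: "AM (Prj R) a = Ide Pos Q" and Q: "Q \<in> Ob Pos"
  shows "is_iso (Tot R) a"
proof -
  have "groupoid (fibre (Tot R) Pos (Prj R) Q)" using fibration Q by (simp add: right_fibration_def)
  moreover have "a \<in> Ar (fibre (Tot R) Pos (Prj R) Q)" using a p by (simp add: fibre_def)
  ultimately have "is_iso (fibre (Tot R) Pos (Prj R) Q) a" by (rule groupoidD(2))
  then show ?thesis by (auto simp: is_iso_def inverses_def fibre_def hom_iff)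
qed

text \<open>Comparing an arrow with the cartesian lift of its image shows that it is itself cartesian.\<close>

lemma cartesian_factorisation:
  assumes b: "b \<in> Ar (Tot R)"
  obtains a h where "cartesian (Tot R) Pos (Prj R) a" "a \<in> Ar (Tot R)" "is_iso (Tot R) h"
    "Src (Tot R) h = Src (Tot R) b" "Tgt (Tot R) h = Src (Tot R) a" "Tgt (Tot R) a = Tgt (Tot R) b"
    "AM (Prj R) a = AM (Prj R) b" "AM (Prj R) h = Ide Pos (pos (Src (Tot R) b))" "a \<cdot>\<^bsub>Tot R\<^esub> h = b"
proof -
  obtain a where a: "cartesian (Tot R) Pos (Prj R) a" "Tgt (Tot R) a = Tgt (Tot R) b" "AM (Prj R) a = AM (Prj R) b"
    using fibration b Prj_simps(2-4)[OF b] unfolding right_fibration_def by (metis E.Tgt_Ob)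
  have aA: "a \<in> Ar (Tot R)" using a by (simp add: cartesian_def)
  have src: "pos (Src (Tot R) a) = pos (Src (Tot R) b)"
    using a(3) Prj_simps(3)[OF aA] Prj_simps(3)[OF b] by simp
  define Q where "Q = pos (Src (Tot R) b)"
  have Q: "Q \<in> Ob Pos" using b pos_Ob by (simp add: Q_def del: Pos_simps)
  have I: "Ide Pos Q \<in> hom Pos Q Q"
    using Ide_Pos_Ar[OF Q] by (simp add: hom_iff)
  have "AM (Prj R) b = AM (Prj R) a \<cdot>\<^bsub>Pos\<^esub> Ide Pos Q"
  proof -
    note B = Pos_ArD[OF Prj_simps(2)[OF b]]
    have "compose (Field Q) (pt b) (\<lambda>a\<in>Field Q. a) = pt b"
      using convex_mapD(3)[OF pt_convex[OF b]]
      by (auto simp: Q_def compose_def extensional_def)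
    then show ?thesis
      unfolding a(3) using Prj_simps(3)[OF b] by (subst (1 2) B(1)) (simp add: Q_def)
  qed
  then have "\<exists>!h. h \<in> hom (Tot R) (Src (Tot R) b) (Src (Tot R) a) \<and> AM (Prj R) h = Ide Pos Q \<and> a \<cdot>\<^bsub>Tot R\<^esub> h = b"
    using a(1,2) b I src unfolding cartesian_def Q_def by simp
  then obtain h where h: "h \<in> hom (Tot R) (Src (Tot R) b) (Src (Tot R) a)" "AM (Prj R) h = Ide Pos Q" "a \<cdot>\<^bsub>Tot R\<^esub> h = b"
    by blast
  show thesis
    by (rule that[OF a(1) aA vertical_iso[OF _ h(2) Q]]) (use h a in \<open>auto simp: hom_iff Q_def\<close>)
qed

text \<open>For poset maps nested images suffice, by \<open>Pos_factor\<close>. The factorisation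
  lifts through the cartesian arrow \<open>a\<close> and is moved to \<open>b\<close> by the
  vertical isomorphism \<open>h\<close>.\<close>

lemma arrow_factor:
  assumes b: "b \<in> Ar (Tot R)" and c: "c \<in> Ar (Tot R)" and tgt: "Tgt (Tot R) c = Tgt (Tot R) b"
    and img: "pt c ` Field (pos (Src (Tot R) c)) \<subseteq> pt b ` Field (pos (Src (Tot R) b))"
  shows "\<exists>t\<in>hom (Tot R) (Src (Tot R) c) (Src (Tot R) b). b \<cdot>\<^bsub>Tot R\<^esub> t = c"
proof -
  obtain a h where a: "cartesian (Tot R) Pos (Prj R) a" "a \<in> Ar (Tot R)" "is_iso (Tot R) h"
    "Src (Tot R) h = Src (Tot R) b" "Tgt (Tot R) h = Src (Tot R) a" "Tgt (Tot R) a = Tgt (Tot R) b"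
    "AM (Prj R) a = AM (Prj R) b" "a \<cdot>\<^bsub>Tot R\<^esub> h = b"
    by (rule cartesian_factorisation[OF b])
  note i = E.inv_ar_props[OF a(3)] E.is_isoD[OF a(3)]
  have sa: "pos (Src (Tot R) a) = pos (Src (Tot R) b)"
    using a(7) Prj_simps(3)[OF a(2)] Prj_simps(3)[OF b] by simp
  obtain g where g: "g \<in> hom Pos (pos (Src (Tot R) c)) (pos (Src (Tot R) b))"
    "AM (Prj R) b \<cdot>\<^bsub>Pos\<^esub> g = AM (Prj R) c"
    using Pos_factor[of "AM (Prj R) c" "AM (Prj R) b"] Prj_simps(2-4)[OF b] Prj_simps(2-4)[OF c] tgt img by auto
  then have "\<exists>!k. k \<in> hom (Tot R) (Src (Tot R) c) (Src (Tot R) a) \<and> AM (Prj R) k = g \<and> a \<cdot>\<^bsub>Tot R\<^esub> k = c"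
    using a c tgt sa unfolding cartesian_def by simp
  then obtain k where k: "k \<in> Ar (Tot R)" "Src (Tot R) k = Src (Tot R) c" "Tgt (Tot R) k = Src (Tot R) a"
    "a \<cdot>\<^bsub>Tot R\<^esub> k = c" by (auto simp: hom_iff)
  have "b \<cdot>\<^bsub>Tot R\<^esub> (inv_ar (Tot R) h \<cdot>\<^bsub>Tot R\<^esub> k) = c"
    unfolding a(8)[symmetric] using i a(2,4,5) k by (simp add: E.cmp_cmp_eq[OF i(5)])
  then show ?thesis using i a k by (intro bexI[of _ "inv_ar (Tot R) h \<cdot>\<^bsub>Tot R\<^esub> k"]) (auto simp: hom_iff)
qed

text \<open>Arrows equalised by \<open>b\<close> lie over the same poset map, since convex maps are
  injective. After the isomorphism \<open>h\<close> both solve the same lifting problem for a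
  cartesian arrow.\<close>

lemma arrow_mono:
  assumes b: "b \<in> Ar (Tot R)" and s: "s \<in> Ar (Tot R)" and t: "t \<in> Ar (Tot R)"
    and tgt: "Tgt (Tot R) s = Src (Tot R) b" "Tgt (Tot R) t = Src (Tot R) b"
    and eq: "b \<cdot>\<^bsub>Tot R\<^esub> s = b \<cdot>\<^bsub>Tot R\<^esub> t"
  shows "s = t"
proof -
  obtain a h where a: "cartesian (Tot R) Pos (Prj R) a" "a \<in> Ar (Tot R)" "is_iso (Tot R) h"
    "Src (Tot R) h = Src (Tot R) b" "Tgt (Tot R) h = Src (Tot R) a" "Tgt (Tot R) a = Tgt (Tot R) b"
    "AM (Prj R) a = AM (Prj R) b" "a \<cdot>\<^bsub>Tot R\<^esub> h = b"
    by (rule cartesian_factorisation[OF b])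
  note hA = E.is_isoD[OF a(3)]
  have src: "Src (Tot R) s = Src (Tot R) t"
    using arg_cong[OF eq, of "Src (Tot R)"] b s t tgt by simp
  have e: "a \<cdot>\<^bsub>Tot R\<^esub> (h \<cdot>\<^bsub>Tot R\<^esub> s) = b \<cdot>\<^bsub>Tot R\<^esub> s" "a \<cdot>\<^bsub>Tot R\<^esub> (h \<cdot>\<^bsub>Tot R\<^esub> t) = b \<cdot>\<^bsub>Tot R\<^esub> s"
    using E.cmp_cmp_eq[OF a(8) a(2) hA] a s t tgt eq by auto
  have "AM (Prj R) b \<cdot>\<^bsub>Pos\<^esub> AM (Prj R) s = AM (Prj R) b \<cdot>\<^bsub>Pos\<^esub> AM (Prj R) t"
    using arg_cong[OF eq, of "AM (Prj R)"] b s t tgt by (simp add: Prj_simps(6))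
  then have p: "AM (Prj R) s = AM (Prj R) t"
    by (rule Pos_mono[rotated 5]) (use b s t tgt in \<open>auto simp: Prj_simps\<close>)
  define g where "g = AM (Prj R) (h \<cdot>\<^bsub>Tot R\<^esub> s)"
  have g': "g = AM (Prj R) (h \<cdot>\<^bsub>Tot R\<^esub> t)"
    using p hA a s t tgt by (simp add: g_def Prj_simps(6))
  have ex: "\<exists>!k. k \<in> hom (Tot R) (Src (Tot R) (b \<cdot>\<^bsub>Tot R\<^esub> s)) (Src (Tot R) a) \<and> AM (Prj R) k = g \<and> a \<cdot>\<^bsub>Tot R\<^esub> k = b \<cdot>\<^bsub>Tot R\<^esub> s"
  proof -
    have "g \<in> hom Pos (pos (Src (Tot R) (b \<cdot>\<^bsub>Tot R\<^esub> s))) (pos (Src (Tot R) a))"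
      unfolding g_def using a hA s b tgt by (auto simp: hom_iff Prj_simps(2-4))
    moreover have "AM (Prj R) (b \<cdot>\<^bsub>Tot R\<^esub> s) = AM (Prj R) a \<cdot>\<^bsub>Pos\<^esub> g"
      unfolding e(1)[symmetric] g_def using a hA s b tgt by (intro Prj_simps(6)) auto
    moreover have "b \<cdot>\<^bsub>Tot R\<^esub> s \<in> Ar (Tot R)" "Tgt (Tot R) (b \<cdot>\<^bsub>Tot R\<^esub> s) = Tgt (Tot R) a"
      using a s b tgt by auto
    ultimately show ?thesis using a(1) unfolding cartesian_def by blast
  qed
  have "h \<cdot>\<^bsub>Tot R\<^esub> s = h \<cdot>\<^bsub>Tot R\<^esub> t"
    by (rule trans[OF the1_equality[OF ex, symmetric] the1_equality[OF ex]])
      (use a b hA s t tgt src e g' in \<open>auto simp: hom_iff g_def\<close>)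
  then show ?thesis
    by (rule E.iso_mono[OF a(3), rotated 4]) (use a s t tgt in auto)
qed

text \<open>Surjectivity lets the identity of the target factor through \<open>a\<close>; the right
  inverse so obtained is two-sided because \<open>a\<close> is monic.\<close>

lemma arrow_iso:
  assumes a: "a \<in> Ar (Tot R)" and surj: "Field (pos (Tgt (Tot R) a)) \<subseteq> pt a ` Field (pos (Src (Tot R) a))"
  shows "is_iso (Tot R) a"
proof -
  have "pt (Ide (Tot R) (Tgt (Tot R) a)) ` Field (pos (Tgt (Tot R) a)) = Field (pos (Tgt (Tot R) a))"
    using a pt_Ide by auto
  then obtain t where t: "t \<in> hom (Tot R) (Tgt (Tot R) a) (Src (Tot R) a)" "a \<cdot>\<^bsub>Tot R\<^esub> t = Ide (Tot R) (Tgt (Tot R) a)"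
    using arrow_factor[of a "Ide (Tot R) (Tgt (Tot R) a)"] a surj by auto
  have "t \<cdot>\<^bsub>Tot R\<^esub> a = Ide (Tot R) (Src (Tot R) a)"
    by (rule arrow_mono[OF a]) (use a t E.cmp_cmp_eq[OF t(2)] in \<open>auto simp: hom_iff\<close>)
  with a t show ?thesis by (intro E.is_isoI[of _ t]) (auto simp: hom_iff)
qed

lemma iso_surj:
  assumes "is_iso (Tot R) a"
  shows "pt a ` Field (pos (Src (Tot R) a)) = Field (pos (Tgt (Tot R) a))"
proof -
  note i = E.inv_ar_props[OF assms] E.is_isoD[OF assms]
  have "pt a (pt (inv_ar (Tot R) a) v) = v" if "v \<in> Field (pos (Tgt (Tot R) a))" for v
    using that i pt_cmp[of "inv_ar (Tot R) a" a v] pt_Ide[of "Tgt (Tot R) a" v] by simp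
  moreover have "pt (inv_ar (Tot R) a) v \<in> Field (pos (Src (Tot R) a))" if "v \<in> Field (pos (Tgt (Tot R) a))" for v
    using that i pt_Field[of "inv_ar (Tot R) a" v] by simp
  ultimately show ?thesis using pt_Field[OF i(6)] by force
qed

lemma fill_eq:
  assumes "b \<in> Ar (Tot R)" "t \<in> hom (Tot R) (Src (Tot R) a) (Src (Tot R) b)" "b \<cdot>\<^bsub>Tot R\<^esub> t = a"
  shows "fill (Tot R) b a = t"
  unfolding fill_def
proof (rule the_equality)
  fix s assume s: "s \<in> hom (Tot R) (Src (Tot R) a) (Src (Tot R) b) \<and> b \<cdot>\<^bsub>Tot R\<^esub> s = a"
  show "s = t"
    by (rule arrow_mono[OF assms(1)]) (use s assms in \<open>auto simp: hom_iff\<close>)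
qed (use assms in auto)

end

section \<open>Layered structures\<close>

abbreviation lay :: "('v, 'o) lobj \<Rightarrow> 'v point \<Rightarrow> nat" where "lay x \<equiv> fst (snd x)"
abbreviation str :: "('v, 'o) lobj \<Rightarrow> 'o" where "str x \<equiv> snd (snd x)"
abbreviation dm :: "dmap \<Rightarrow> nat \<Rightarrow> nat" where "dm f \<equiv> fst (snd f)"

lemma dm_mono: "f \<in> Ar Delta \<Longrightarrow> i \<le> j \<Longrightarrow> j \<le> Src Delta f \<Longrightarrow> dm f i \<le> dm f j"
  and dm_le: "f \<in> Ar Delta \<Longrightarrow> i \<le> Src Delta f \<Longrightarrow> dm f i \<le> Tgt Delta f"
  by (cases f, auto simp: Delta_Ar_iff Delta_simps(2,3))+

lemma dm_cmp: "i \<le> Src Delta f \<Longrightarrow> dm (g \<cdot>\<^bsub>Delta\<^esub> f) i = dm g (dm f i)"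
  by (cases f; cases g) (simp add: Delta_simps compose_def)

lemma dm_Ide: "i \<le> n \<Longrightarrow> dm (Ide Delta n) i = i"
  by (simp add: Delta_simps)

lemma generic_dm:
  assumes "generic_map f"
  shows "f \<in> Ar Delta" "dm f 0 = 0" "dm f (Src Delta f) = Tgt Delta f"
  using assms by (cases f, auto simp: generic_map.simps Delta_simps(2,3))+

text \<open>The half-open intervals from \<open>f (i - 1)\<close> to \<open>f i\<close> cover
  everything between the first and the last value of \<open>f\<close>; the least \<open>i\<close>
  whose value reaches \<open>k\<close> gives the interval.\<close>

lemma layer_exists:
  assumes f: "f \<in> Ar Delta" and k: "dm f 0 < k" "k \<le> dm f (Src Delta f)"
  shows "\<exists>i\<in>{1..Src Delta f}. dm f (i - 1) < k \<and> k \<le> dm f i"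
proof -
  define i where "i = (LEAST i. k \<le> dm f i)"
  have i: "k \<le> dm f i" "i \<le> Src Delta f" unfolding i_def using k(2) by (rule LeastI, rule Least_le)
  have "i \<noteq> 0" using i(1) k(1) by (metis leD)
  moreover have "\<not> k \<le> dm f (i - 1)" if "i \<noteq> 0" using not_less_Least[of "i - 1" "\<lambda>i. k \<le> dm f i"] that by (simp add: i_def)
  ultimately show ?thesis using i by (intro bexI[of _ i]) auto
qed

text \<open>A later interval starts at or above the end of an earlier one. This yields both
  uniqueness of the layer in \<open>under_generic\<close> and monotonicity of the layering pushed
  along it.\<close>

lemma layer_mono:
  assumes f: "f \<in> Ar Delta" and ij: "1 \<le> i" "i \<le> Src Delta f" "j \<le> Src Delta f"
    and k: "dm f (i - 1) < k" "k \<le> k'" "k' \<le> dm f j"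
  shows "i \<le> j"
proof (rule ccontr)
  assume "\<not> i \<le> j"
  then have "dm f j \<le> dm f (i - 1)" using ij by (intro dm_mono[OF f]) auto
  with k show False by simp
qed

text \<open>The arrows over \<open>f\<close> are described without factoring \<open>f\<close>: the image consists of the layers in the
  range of \<open>f\<close>, and layer \<open>i\<close> of \<open>z\<close> goes to the layers \<open>j\<close> of \<open>x\<close> with \<open>f (i - 1) < j \<le> f i\<close>.\<close>

definition lov :: "('v, 'o, 'a) drs \<Rightarrow> dmap \<Rightarrow> ('v, 'o) lobj \<Rightarrow> ('v, 'o) lobj \<Rightarrow> 'a \<Rightarrow> bool" where
  "lov R f z x a \<longleftrightarrow> f \<in> Ar Delta \<and> z \<in> Lobj R (Src Delta f) \<and> x \<in> Lobj R (Tgt Delta f) \<and>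
     a \<in> hom (Tot R) (str z) (str x) \<and>
     (\<forall>v\<in>Field (fst x). v \<in> fn (AM (Prj R) a) ` Field (fst z) \<longleftrightarrow>
        dm f 0 < lay x v \<and> lay x v \<le> dm f (Src Delta f)) \<and>
     (\<forall>w\<in>Field (fst z). dm f (lay z w - 1) < lay x (fn (AM (Prj R) a) w) \<and>
        lay x (fn (AM (Prj R) a) w) \<le> dm f (lay z w))"

lemma Lcat_simps [simp]:
  "Ob (Lcat R n) = Lobj R n" "Src (Lcat R n) (x, a, y) = x" "Tgt (Lcat R n) (x, a, y) = y"
  "(y', b, z) \<cdot>\<^bsub>Lcat R n\<^esub> (x, a, y) = (x, b \<cdot>\<^bsub>Tot R\<^esub> a, z)"
  "Ide (Lcat R n) x = (x, Ide (Tot R) (str x), x)"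
  by (auto simp: Lcat_def split: prod.split)

lemma Lcat_Ar: "(x, a, y) \<in> Ar (Lcat R n) \<longleftrightarrow> x \<in> Lobj R n \<and> y \<in> Lobj R n \<and> a \<in> hom (Tot R) (str x) (str y) \<and>
    is_iso (Tot R) a \<and> (\<forall>u\<in>Field (fst x). lay y (fn (AM (Prj R) a) u) = lay x u)"
  by (cases x; cases y) (auto simp: Lcat_def)

lemma Lcat_hom: "\<alpha> \<in> hom (Lcat R n) x y \<longleftrightarrow> (\<exists>a. \<alpha> = (x, a, y) \<and> (x, a, y) \<in> Ar (Lcat R n))"
  by (cases \<alpha>) (auto simp: hom_iff)

lemma lov_image:
  assumes "lov R f z x a" "v \<in> Field (fst x)"
  shows "v \<in> fn (AM (Prj R) a) ` Field (fst z) \<longleftrightarrow> dm f 0 < lay x v \<and> lay x v \<le> dm f (Src Delta f)"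
  using assms unfolding lov_def by blast

lemma lov_layer:
  assumes "lov R f z x a" "w \<in> Field (fst z)"
  shows "dm f (lay z w - 1) < lay x (fn (AM (Prj R) a) w)" "lay x (fn (AM (Prj R) a) w) \<le> dm f (lay z w)"
  using assms unfolding lov_def by blast+

lemma lovD:
  assumes "lov R f z x a"
  shows "f \<in> Ar Delta" "z \<in> Lobj R (Src Delta f)" "x \<in> Lobj R (Tgt Delta f)"
    "a \<in> Ar (Tot R)" "Src (Tot R) a = str z" "Tgt (Tot R) a = str x"
  using assms by (auto simp: lov_def hom_iff)

lemma lovI:
  assumes "f \<in> Ar Delta" "z \<in> Lobj R (Src Delta f)" "x \<in> Lobj R (Tgt Delta f)"
    "a \<in> hom (Tot R) (str z) (str x)"
    "\<And>v. v \<in> Field (fst x) \<Longrightarrow> v \<in> fn (AM (Prj R) a) ` Field (fst z) \<longleftrightarrow>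
        dm f 0 < lay x v \<and> lay x v \<le> dm f (Src Delta f)"
    "\<And>w. w \<in> Field (fst z) \<Longrightarrow> dm f (lay z w - 1) < lay x (fn (AM (Prj R) a) w) \<and>
        lay x (fn (AM (Prj R) a) w) \<le> dm f (lay z w)"
  shows "lov R f z x a"
  using assms unfolding lov_def by blast

lemma free_part_generic_part:
  assumes "f \<in> Ar Delta"
  shows "generic_map (generic_part f)" "free_map (free_part f)" "free_part f \<cdot>\<^bsub>Delta\<^esub> generic_part f = f"
    "Src Delta (generic_part f) = Src Delta f" "Tgt Delta (generic_part f) = Src Delta (free_part f)"
    "Tgt Delta (free_part f) = Tgt Delta f" "dm (free_part f) 0 = dm f 0"
proof -
  obtain m a n where f: "f = (m, a, n)" by (cases f)
  have a: "a \<in> extensional {0..m}" "\<And>i. i \<le> m \<Longrightarrow> a i \<le> n" "\<And>i j. i \<le> j \<Longrightarrow> j \<le> m \<Longrightarrow> a i \<le> a j"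
    using assms by (auto simp: f Delta_Ar_iff)
  have a0: "a 0 \<le> a i" if "i \<le> m" for i using a(3)[of 0 i] that by simp
  show "generic_map (generic_part f)"
    using a by (auto simp: f generic_map.simps Delta_Ar_iff intro!: diff_le_mono)
  show "free_map (free_part f)"
    using a(2)[of m] a0[of m] by (auto simp: f free_map.simps Delta_Ar_iff)
  show "free_part f \<cdot>\<^bsub>Delta\<^esub> generic_part f = f"
    using a a0 by (auto simp: f Delta_simps compose_def extensional_def fun_eq_iff intro!: diff_le_mono)
qed (cases f, auto simp: Delta_simps(2,3))+

lemma under_generic:
  assumes g: "generic_map g" and j: "1 \<le> j" "j \<le> Tgt Delta g"
  shows "under_generic g j \<in> {1..Src Delta g}" "dm g (under_generic g j - 1) < j" "j \<le> dm g (under_generic g j)"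
proof -
  obtain n h m where eq: "g = (n, h, m)" by (cases g)
  note G = generic_dm[OF g]
  obtain i where i: "i \<in> {1..n}" "h (i - 1) < j" "j \<le> h i"
    using layer_exists[OF G(1), of j] j G by (auto simp: eq Delta_simps(2,3))
  have "i' = i" if "i' \<in> {1..n}" "h (i' - 1) < j" "j \<le> h i'" for i'
    using layer_mono[OF G(1), of i i' j j] layer_mono[OF G(1), of i' i j j] i that
    by (auto simp: eq Delta_simps(2,3))
  then have "(THE i. i \<in> {1..n} \<and> h (i - 1) < j \<and> j \<le> h i) = i"
    using i by (intro the_equality) blast+
  then have "under_generic g j = i"
    using j by (simp add: eq Delta_simps(3))
  then show "under_generic g j \<in> {1..Src Delta g}" "dm g (under_generic g j - 1) < j" "j \<le> dm g (under_generic g j)"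
    using i by (auto simp: eq Delta_simps(2,3))
qed

context species
begin

lemma Lobj_iff: "(P, l, X) \<in> Lobj R n \<longleftrightarrow> X \<in> Ob (Tot R) \<and> P = pos X \<and> l \<in> Field P \<rightarrow>\<^sub>E {1..n} \<and>
    (\<forall>a b. (a, b) \<in> P \<longrightarrow> l a \<le> l b)"
  using pos_Ob[of X] by (auto simp: Lobj_def fibre_def)

lemma LobjD:
  assumes "x \<in> Lobj R n"
  shows "str x \<in> Ob (Tot R)" "fst x = pos (str x)" "lay x \<in> extensional (Field (fst x))"
    "v \<in> Field (pos (str x)) \<Longrightarrow> 1 \<le> lay x v" "v \<in> Field (pos (str x)) \<Longrightarrow> lay x v \<le> n"
    "v \<in> Field (pos (str x)) \<Longrightarrow> 0 < lay x v"
    "(v, w) \<in> pos (str x) \<Longrightarrow> lay x v \<le> lay x w"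
  using assms by (cases x, fastforce simp: Lobj_iff PiE_iff)+

lemma LobjI:
  assumes "X \<in> Ob (Tot R)" "P = pos X" "l \<in> extensional (Field P)"
    "\<And>v. v \<in> Field P \<Longrightarrow> 1 \<le> l v \<and> l v \<le> n" "\<And>a b. (a, b) \<in> P \<Longrightarrow> l a \<le> l b"
  shows "(P, l, X) \<in> Lobj R n"
  using assms by (auto simp: Lobj_iff PiE_iff)

text \<open>Over the identity the interval of layer j is the single layer j, so layers are
  preserved, and the image condition becomes surjectivity, which makes the arrow invertible. Layers
  start at 1, so subtracting 1 does not truncate.\<close>

lemma lov_Ide: "lov R (Ide Delta n) z x a \<longleftrightarrow> (z, a, x) \<in> Ar (Lcat R n)"
proof
  assume a: "lov R (Ide Delta n) z x a"
  note A = lovD[OF a]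
  note z = LobjD[OF A(2)] and x = LobjD[OF A(3)]
  have "is_iso (Tot R) a"
  proof (rule arrow_iso)
    show "Field (pos (Tgt (Tot R) a)) \<subseteq> pt a ` Field (pos (Src (Tot R) a))"
      using lov_image[OF a] A x z by (auto simp: dm_Ide)
  qed (use A in auto)
  moreover have "lay x (pt a u) = lay z u" if "u \<in> Field (fst z)" for u
  proof -
    have "u \<in> Field (pos (str z))" using that z(2) by simp
    then have "1 \<le> lay z u" "lay z u \<le> n" using z(4,5)[of u] by simp_all
    then show ?thesis using lov_layer[OF a that] by (simp add: dm_Ide)
  qed
  ultimately show "(z, a, x) \<in> Ar (Lcat R n)" using A by (auto simp: Lcat_Ar hom_iff)
next
  assume "(z, a, x) \<in> Ar (Lcat R n)"
  then have A: "z \<in> Lobj R n" "x \<in> Lobj R n" "a \<in> hom (Tot R) (str z) (str x)" "is_iso (Tot R) a"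
    "\<And>u. u \<in> Field (fst z) \<Longrightarrow> lay x (pt a u) = lay z u" by (auto simp: Lcat_Ar)
  note z = LobjD[OF A(1)] and x = LobjD[OF A(2)]
  show "lov R (Ide Delta n) z x a"
  proof (rule lovI)
    show "v \<in> pt a ` Field (fst z) \<longleftrightarrow>
         dm (Ide Delta n) 0 < lay x v \<and> lay x v \<le> dm (Ide Delta n) (Src Delta (Ide Delta n))"
      if "v \<in> Field (fst x)" for v
      using iso_surj[OF A(4)] A(3) x that z by (simp add: dm_Ide hom_iff)
    show "dm (Ide Delta n) (lay z w - 1) < lay x (pt a w) \<and> lay x (pt a w) \<le> dm (Ide Delta n) (lay z w)"
      if "w \<in> Field (fst z)" for w
    proof -
      have "w \<in> Field (pos (str z))" using that z(2) by simp
      then show ?thesis using A(5)[OF that] z(4,5)[of w] by (simp add: dm_Ide)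
    qed
  qed (use A in auto)
qed

text \<open>The interval of \<open>i\<close> for the composite is the union of the intervals of
  \<open>g\<close> over the layers between \<open>f (i - 1)\<close> and \<open>f i\<close>. A strict
  bound below a layer of \<open>y\<close> becomes a weak bound below that layer minus 1, where
  monotonicity of \<open>g\<close> applies.\<close>

lemma lov_cmp:
  assumes a: "lov R f z y a" and b: "lov R g y x b" and fg: "Src Delta g = Tgt Delta f"
  shows "lov R (g \<cdot>\<^bsub>Delta\<^esub> f) z x (b \<cdot>\<^bsub>Tot R\<^esub> a)"
proof -
  note A = lovD[OF a] and B = lovD[OF b]
  note z = LobjD[OF A(2)] and y = LobjD[OF A(3)] and x = LobjD[OF B(3)]
  have ba: "pt (b \<cdot>\<^bsub>Tot R\<^esub> a) w = pt b (pt a w)" if "w \<in> Field (pos (str z))" for w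
    using A B that by (simp add: pt_cmp)
  have paF: "pt a w \<in> Field (pos (str y))" if "w \<in> Field (pos (str z))" for w
    using pt_Field[OF A(4)] that A by simp
  have pbF: "pt b w \<in> Field (pos (str x))" if "w \<in> Field (pos (str y))" for w
    using pt_Field[OF B(4)] that B by simp
  show ?thesis
  proof (rule lovI)
    fix v assume v0: "v \<in> Field (fst x)"
    then have v: "v \<in> Field (pos (str x))" using x by simp
    have f0: "dm g 0 \<le> dm g (dm f 0)" using dm_mono[OF B(1), of 0 "dm f 0"] dm_le[OF A(1), of 0] fg by simp
    have fm: "dm g (dm f (Src Delta f)) \<le> dm g (Src Delta g)"
      using dm_mono[OF B(1), of "dm f (Src Delta f)" "Src Delta g"] dm_le[OF A(1), of "Src Delta f"] fg by simp
    have "v \<in> pt (b \<cdot>\<^bsub>Tot R\<^esub> a) ` Field (pos (str z)) \<longleftrightarrow> dm g (dm f 0) < lay x v \<and> lay x v \<le> dm g (dm f (Src Delta f))"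
    proof
      assume "v \<in> pt (b \<cdot>\<^bsub>Tot R\<^esub> a) ` Field (pos (str z))"
      then obtain w where w: "w \<in> Field (pos (str z))" "v = pt b (pt a w)" using ba by auto
      have u: "dm f 0 < lay y (pt a w)" "lay y (pt a w) \<le> dm f (Src Delta f)"
        using lov_image[OF a, of "pt a w"] paF[OF w(1)] w y z by auto
      have 1: "dm g (dm f 0) \<le> dm g (lay y (pt a w) - 1)"
        using u y(5)[OF paF[OF w(1)]] fg by (intro dm_mono[OF B(1)]) auto
      have 2: "dm g (lay y (pt a w)) \<le> dm g (dm f (Src Delta f))"
        using u dm_le[OF A(1), of "Src Delta f"] fg by (intro dm_mono[OF B(1)]) auto
      show "dm g (dm f 0) < lay x v \<and> lay x v \<le> dm g (dm f (Src Delta f))"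
        using 1 2 lov_layer[OF b, of "pt a w"] paF[OF w(1)] y w(2) by simp
    next
      assume *: "dm g (dm f 0) < lay x v \<and> lay x v \<le> dm g (dm f (Src Delta f))"
      then obtain u where u: "u \<in> Field (pos (str y))" "v = pt b u"
        using lov_image[OF b v0] f0 fm y by auto
      have ly: "dm g (lay y u - 1) < lay x v" "lay x v \<le> dm g (lay y u)"
        using lov_layer[OF b, of u] u y by auto
      have "dm f 0 < lay y u"
      proof (rule ccontr)
        assume "\<not> ?thesis"
        then have "dm g (lay y u) \<le> dm g (dm f 0)"
          using dm_le[OF A(1), of 0] fg by (intro dm_mono[OF B(1)]) auto
        with ly * show False by simp
      qed
      moreover have "lay y u \<le> dm f (Src Delta f)"
      proof (rule ccontr)
        assume "\<not> ?thesis"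
        then have "dm g (dm f (Src Delta f)) \<le> dm g (lay y u - 1)"
          using y(5)[OF u(1)] fg by (intro dm_mono[OF B(1)]) auto
        with ly * show False by simp
      qed
      ultimately obtain w where "w \<in> Field (pos (str z))" "u = pt a w"
        using lov_image[OF a, of u] u y z by auto
      then show "v \<in> pt (b \<cdot>\<^bsub>Tot R\<^esub> a) ` Field (pos (str z))" using u ba by auto
    qed
    then show "v \<in> pt (b \<cdot>\<^bsub>Tot R\<^esub> a) ` Field (fst z) \<longleftrightarrow>
         dm (g \<cdot>\<^bsub>Delta\<^esub> f) 0 < lay x v \<and> lay x v \<le> dm (g \<cdot>\<^bsub>Delta\<^esub> f) (Src Delta (g \<cdot>\<^bsub>Delta\<^esub> f))"
      using A B fg z by (simp add: dm_cmp)
  next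
    fix w assume w0: "w \<in> Field (fst z)"
    then have w: "w \<in> Field (pos (str z))" using z by simp
    note lw = z(4,5)[OF w]
    have f: "dm f (lay z w - 1) < lay y (pt a w)" "lay y (pt a w) \<le> dm f (lay z w)"
      using lov_layer[OF a w0] by auto
    have g: "dm g (lay y (pt a w) - 1) < lay x (pt b (pt a w))" "lay x (pt b (pt a w)) \<le> dm g (lay y (pt a w))"
      using lov_layer[OF b, of "pt a w"] paF[OF w] y by auto
    have 1: "dm g (dm f (lay z w - 1)) \<le> dm g (lay y (pt a w) - 1)"
      using f y(5)[OF paF[OF w]] fg by (intro dm_mono[OF B(1)]) auto
    have 2: "dm g (lay y (pt a w)) \<le> dm g (dm f (lay z w))"
      using f dm_le[OF A(1), of "lay z w"] lw fg by (intro dm_mono[OF B(1)]) auto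
    have 3: "dm (g \<cdot>\<^bsub>Delta\<^esub> f) (lay z w - 1) = dm g (dm f (lay z w - 1))" "dm (g \<cdot>\<^bsub>Delta\<^esub> f) (lay z w) = dm g (dm f (lay z w))"
      using lw by (auto intro!: dm_cmp)
    show "dm (g \<cdot>\<^bsub>Delta\<^esub> f) (lay z w - 1) < lay x (pt (b \<cdot>\<^bsub>Tot R\<^esub> a) w) \<and>
         lay x (pt (b \<cdot>\<^bsub>Tot R\<^esub> a) w) \<le> dm (g \<cdot>\<^bsub>Delta\<^esub> f) (lay z w)"
      unfolding 3 ba[OF w] using g 1 2 by simp
  qed (use A B fg in \<open>auto simp: hom_iff\<close>)
qed

text \<open>The range of the composite lies in the range of \<open>g\<close>, so the images are
  nested and a filler exists. Its layers are correct because the intervals of \<open>g\<close> do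
  not overlap: a layer of \<open>y\<close> on the wrong side of a value of \<open>f\<close> would
  put the corresponding layer of \<open>x\<close> on the wrong side of the value of the
  composite.\<close>

lemma lov_fill:
  assumes b: "lov R g y x b" and c: "lov R (g \<cdot>\<^bsub>Delta\<^esub> f) z x c" and f: "f \<in> Ar Delta" and fg: "Tgt Delta f = Src Delta g"
  shows "lov R f z y (fill (Tot R) b c)" "b \<cdot>\<^bsub>Tot R\<^esub> fill (Tot R) b c = c"
proof -
  note C = lovD[OF c] and B = lovD[OF b]
  have sf: "Src Delta (g \<cdot>\<^bsub>Delta\<^esub> f) = Src Delta f" using B f fg by simp
  note z = LobjD[OF C(2)] and y = LobjD[OF B(2)] and x = LobjD[OF C(3)]
  have f0: "dm g 0 \<le> dm g (dm f 0)" using dm_mono[OF B(1), of 0 "dm f 0"] dm_le[OF f, of 0] fg by simp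
  have fm: "dm g (dm f (Src Delta f)) \<le> dm g (Src Delta g)"
    using dm_mono[OF B(1), of "dm f (Src Delta f)" "Src Delta g"] dm_le[OF f, of "Src Delta f"] fg by simp
  have "pt c ` Field (pos (str z)) \<subseteq> pt b ` Field (pos (str y))"
  proof
    fix v assume v: "v \<in> pt c ` Field (pos (str z))"
    then have vF: "v \<in> Field (fst x)" using pt_Field[OF C(4)] C x by auto
    then have "dm g (dm f 0) < lay x v \<and> lay x v \<le> dm g (dm f (Src Delta f))"
      using lov_image[OF c vF] v z sf by (simp add: dm_cmp)
    then show "v \<in> pt b ` Field (pos (str y))"
      using lov_image[OF b vF] f0 fm y by simp
  qed
  then obtain t where t: "t \<in> Ar (Tot R)" "Src (Tot R) t = str z" "Tgt (Tot R) t = str y" "b \<cdot>\<^bsub>Tot R\<^esub> t = c"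
    using arrow_factor[of b c] B C by (auto simp: hom_iff)
  have fill: "fill (Tot R) b c = t"
    using fill_eq[of b t c] t B C by (simp add: hom_iff)
  show "b \<cdot>\<^bsub>Tot R\<^esub> fill (Tot R) b c = c" using t fill by simp
  have bt: "pt c w = pt b (pt t w)" if "w \<in> Field (pos (str z))" for w
    unfolding t(4)[symmetric] using t B that by (intro pt_cmp) auto
  have ptF: "pt t w \<in> Field (pos (str y))" if "w \<in> Field (pos (str z))" for w
    using pt_Field[OF t(1)] that t by simp
  have "lov R f z y t"
  proof (rule lovI)
    fix u assume u0: "u \<in> Field (fst y)"
    then have u: "u \<in> Field (pos (str y))" using y by simp
    define v where "v = pt b u"
    have v: "v \<in> Field (fst x)" using pt_Field[OF B(4)] u B x by (simp add: v_def)
    have ly: "dm g (lay y u - 1) < lay x v" "lay x v \<le> dm g (lay y u)"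
      using lov_layer[OF b u0] by (auto simp: v_def)
    \<comment> \<open>Membership in the image of \<open>t\<close> can be tested in \<open>x\<close>,
      because \<open>b\<close> is injective on points.\<close>
    have "u \<in> pt t ` Field (pos (str z)) \<longleftrightarrow> v \<in> pt c ` Field (pos (str z))"
    proof
      assume "u \<in> pt t ` Field (pos (str z))"
      then obtain w where w: "w \<in> Field (pos (str z))" "u = pt t w" by blast
      then show "v \<in> pt c ` Field (pos (str z))" by (intro image_eqI[of _ _ w]) (simp_all add: v_def bt)
    next
      assume "v \<in> pt c ` Field (pos (str z))"
      then obtain w where w: "w \<in> Field (pos (str z))" "v = pt c w" by blast
      then have eq: "pt b u = pt b (pt t w)" using bt by (simp add: v_def)
      have "inj_on (pt b) (Field (pos (str y)))" using pt_inj[OF B(4)] B by simp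
      then have "u = pt t w" using eq u ptF[OF w(1)] by (rule inj_onD)
      then show "u \<in> pt t ` Field (pos (str z))" using w by blast
    qed
    also have "\<dots> \<longleftrightarrow> dm g (dm f 0) < lay x v \<and> lay x v \<le> dm g (dm f (Src Delta f))"
      using lov_image[OF c v] z sf by (simp add: dm_cmp)
    also have "\<dots> \<longleftrightarrow> dm f 0 < lay y u \<and> lay y u \<le> dm f (Src Delta f)"
    proof safe
      assume *: "dm g (dm f 0) < lay x v" "lay x v \<le> dm g (dm f (Src Delta f))"
      show "dm f 0 < lay y u"
      proof (rule ccontr)
        assume "\<not> ?thesis"
        then have "dm g (lay y u) \<le> dm g (dm f 0)"
          using dm_le[OF f, of 0] fg by (intro dm_mono[OF B(1)]) auto
        with ly * show False by simp
      qed
      show "lay y u \<le> dm f (Src Delta f)"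
      proof (rule ccontr)
        assume "\<not> ?thesis"
        then have "dm g (dm f (Src Delta f)) \<le> dm g (lay y u - 1)"
          using y(5)[OF u] fg by (intro dm_mono[OF B(1)]) auto
        with ly * show False by simp
      qed
    next
      assume *: "dm f 0 < lay y u" "lay y u \<le> dm f (Src Delta f)"
      have "dm g (dm f 0) \<le> dm g (lay y u - 1)"
        using * y(5)[OF u] fg by (intro dm_mono[OF B(1)]) auto
      then show "dm g (dm f 0) < lay x v" using ly by simp
      have "dm g (lay y u) \<le> dm g (dm f (Src Delta f))"
        using * dm_le[OF f, of "Src Delta f"] fg by (intro dm_mono[OF B(1)]) auto
      then show "lay x v \<le> dm g (dm f (Src Delta f))" using ly by simp
    qed
    finally show "u \<in> pt t ` Field (fst z) \<longleftrightarrow> dm f 0 < lay y u \<and> lay y u \<le> dm f (Src Delta f)"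
      using z by simp
  next
    fix w assume w0: "w \<in> Field (fst z)"
    then have w: "w \<in> Field (pos (str z))" using z by simp
    note lw = z(4,5)[OF w, unfolded sf]
    have g: "dm g (lay y (pt t w) - 1) < lay x (pt c w)" "lay x (pt c w) \<le> dm g (lay y (pt t w))"
      using lov_layer[OF b, of "pt t w"] ptF[OF w] y bt[OF w] by auto
    have gf: "dm g (dm f (lay z w - 1)) < lay x (pt c w)" "lay x (pt c w) \<le> dm g (dm f (lay z w))"
      using lov_layer[OF c w0] lw by (auto simp: dm_cmp)
    show "dm f (lay z w - 1) < lay y (pt t w) \<and> lay y (pt t w) \<le> dm f (lay z w)"
    proof (intro conjI; rule ccontr)
      assume "\<not> dm f (lay z w - 1) < lay y (pt t w)"
      then have "dm g (lay y (pt t w)) \<le> dm g (dm f (lay z w - 1))"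
        using dm_le[OF f, of "lay z w - 1"] lw fg by (intro dm_mono[OF B(1)]) auto
      with g gf show False by simp
    next
      assume "\<not> lay y (pt t w) \<le> dm f (lay z w)"
      then have "dm g (dm f (lay z w)) \<le> dm g (lay y (pt t w) - 1)"
        using y(5)[OF ptF[OF w]] fg by (intro dm_mono[OF B(1)]) auto
      with g gf show False by simp
    qed
  qed (use C(2) B(2) sf fg f t in \<open>auto simp: hom_iff\<close>)
  with fill show "lov R f z y (fill (Tot R) b c)" by simp
qed

section \<open>Chosen lifts and the action of simplicial operators\<close>

lemma rlift_props:
  assumes X: "X \<in> Ob (Tot R)" and K: "K \<subseteq> Field (pos X)"
    and convex: "\<And>a b x. a \<in> K \<Longrightarrow> b \<in> K \<Longrightarrow> (a, x) \<in> pos X \<Longrightarrow> (x, b) \<in> pos X \<Longrightarrow> x \<in> K"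
  shows "rlift R X K \<in> hom (Tot R) (restr R X K) X" "AM (Prj R) (rlift R X K) = incl (pos X) K"
    "pos (restr R X K) = Restr (pos X) K"
proof -
  have P: "pos X \<in> Ob Pos" using X by (rule pos_Ob)
  have incl: "incl (pos X) K \<in> hom Pos (Restr (pos X) K) (pos X)"
    using incl_Ar[OF P K] convex by blast
  have *: "rlift R X K \<in> Ar (Tot R) \<and> Tgt (Tot R) (rlift R X K) = X \<and> AM (Prj R) (rlift R X K) = incl (pos X) K"
  proof (cases "K = Field (pos X)")
    case True
    \<comment> \<open>Here the normalised cleavage chooses an identity arrow, so the inclusion of
      the whole poset has to be literally the identity of \<open>Pos\<close>.\<close>
    have "Restr (pos X) (Field (pos X)) = pos X" by (auto simp: Field_def)
    then show ?thesis using True X by (auto simp: rlift_def Prj_simps(5) incl_def)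
  next
    case False
    have "\<exists>a. cartesian (Tot R) Pos (Prj R) a \<and> Tgt (Tot R) a = X \<and> AM (Prj R) a = incl (pos X) K"
      using fibration X incl unfolding right_fibration_def hom_iff by blast
    from someI_ex[OF this] show ?thesis using False by (auto simp: rlift_def cartesian_def)
  qed
  then show "rlift R X K \<in> hom (Tot R) (restr R X K) X" "AM (Prj R) (rlift R X K) = incl (pos X) K"
    by (auto simp: hom_iff restr_def)
  show "pos (restr R X K) = Restr (pos X) K"
    using Prj_simps(3)[of "rlift R X K"] * incl by (auto simp: restr_def hom_iff)
qed

lemma free_ob_lov:
  assumes f: "free_map f" and x: "x \<in> Lobj R (Tgt Delta f)"
  shows "lov R f (free_ob R f x) x (free_lift R f x)"
proof -
  obtain n h m where fe: "f = (n, h, m)" by (cases f)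
  obtain P l X where xe: "x = (P, l, X)" by (cases x)
  have h: "h i = i + h 0" if "i \<le> n" for i using free_map_eq[of n h m i] f that by (simp add: fe)
  have fA: "f \<in> Ar Delta" using f by (simp add: fe free_map.simps)
  note X = LobjD[OF x, unfolded xe, simplified]
  define K where "K = window f P l"
  \<comment> \<open>The window consists of the layers above \<open>h 0\<close> and up to
    \<open>h n\<close>. In this form convexity is immediate, since a point between two of its points
    has a layer in between, and subtracting \<open>h 0\<close> leaves a layer of at least 1.\<close>
  have K: "K = {v \<in> Field (pos X). h 0 < l v \<and> l v \<le> h n}"
  proof -
    have "(\<exists>i\<in>{1..n}. under_free f i = l v) \<longleftrightarrow> h 0 < l v \<and> l v \<le> h n" for v
    proof
      assume "h 0 < l v \<and> l v \<le> h n"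
      then show "\<exists>i\<in>{1..n}. under_free f i = l v"
        using h[of n] by (intro bexI[of _ "l v - h 0"]) (auto simp: fe)
    qed (use h[of n] in \<open>auto simp: fe\<close>)
    then show ?thesis using X(2) by (simp add: K_def window_def fe Delta_simps(2))
  qed
  have KF: "K \<subseteq> Field (pos X)" by (auto simp: K)
  have conv: "v \<in> K" if "a \<in> K" "b \<in> K" "(a, v) \<in> pos X" "(v, b) \<in> pos X" for a b v
    using that X(7)[of a v] X(7)[of v b] by (auto simp: K Field_def)
  have L: "rlift R X K \<in> hom (Tot R) (restr R X K) X" "AM (Prj R) (rlift R X K) = incl (pos X) K"
    "pos (restr R X K) = Restr (pos X) K"
    by (rule rlift_props[OF X(1) KF]; use conv in blast)+
  have FK: "Field (Restr (pos X) K) = K"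
    using Partial_order_pos[OF X(1)] KF by (rule Field_Restr)
  have ptK: "pt (rlift R X K) v = v" if "v \<in> K" for v
    using that by (simp add: L(2) incl_def)
  have z: "free_ob R f x = (Restr (pos X) K, \<lambda>a\<in>K. l a - h 0, restr R X K)"
    using X(2) by (simp add: fe xe Let_def K_def)
  have zL: "free_ob R f x \<in> Lobj R n"
    unfolding z
  proof (rule LobjI)
    show "restr R X K \<in> Ob (Tot R)" using L(1) E.Src_Ob[of "rlift R X K"] by (simp add: hom_iff)
    show "1 \<le> (\<lambda>a\<in>K. l a - h 0) v \<and> (\<lambda>a\<in>K. l a - h 0) v \<le> n" if "v \<in> Field (Restr (pos X) K)" for v
      using that h[of n] unfolding FK by (auto simp: K)
  qed (use L X(7) FK in \<open>auto intro: diff_le_mono\<close>)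
  have lift: "free_lift R f x = rlift R X K" by (simp add: xe K_def)
  show ?thesis
  proof (rule lovI)
    show "v \<in> pt (free_lift R f x) ` Field (fst (free_ob R f x)) \<longleftrightarrow> dm f 0 < lay x v \<and> lay x v \<le> dm f (Src Delta f)"
      if "v \<in> Field (fst x)" for v
      using that ptK X(2) unfolding z lift by (simp add: FK) (auto simp: K xe fe Delta_simps(2,3))
    show "dm f (lay (free_ob R f x) w - 1) < lay x (pt (free_lift R f x) w) \<and>
         lay x (pt (free_lift R f x) w) \<le> dm f (lay (free_ob R f x) w)" if "w \<in> Field (fst (free_ob R f x))" for w
    proof -
      have w: "w \<in> K" using that unfolding z by (simp add: FK)
      then have "h 0 < l w" "l w \<le> h n" by (auto simp: K)
      then show ?thesis
        unfolding z lift using w ptK[OF w] h[of n] h[of "l w - h 0"] h[of "l w - h 0 - 1"]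
        by (simp add: fe xe)
    qed
    show "free_lift R f x \<in> hom (Tot R) (str (free_ob R f x)) (str x)"
      unfolding z lift using L(1) by (simp add: xe)
    show "free_ob R f x \<in> Lobj R (Src Delta f)" using zL by (simp add: fe Delta_simps(2))
  qed (rule fA x)+
qed

text \<open>A generic map reaches from 0 to the top, so no point is lost and an identity arrow
  serves as lift; only the layering is coarsened.\<close>

lemma generic_ob_lov:
  assumes g: "generic_map g" and x: "x \<in> Lobj R (Tgt Delta g)"
  shows "lov R g (generic_ob g x) x (Ide (Tot R) (str x))"
proof -
  obtain P l X where xe: "x = (P, l, X)" by (cases x)
  note X = LobjD[OF x, unfolded xe, simplified] and G = generic_dm[OF g]
  have u: "under_generic g (l v) \<in> {1..Src Delta g}" "dm g (under_generic g (l v) - 1) < l v" "l v \<le> dm g (under_generic g (l v))"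
    if "v \<in> Field (pos X)" for v
    using under_generic[OF g, of "l v"] X(4,5)[OF that] by auto
  have z: "generic_ob g x = (pos X, compose (Field (pos X)) (under_generic g) l, X)"
    using X(2) by (simp add: xe)
  have zL: "generic_ob g x \<in> Lobj R (Src Delta g)"
    unfolding z
  proof (rule LobjI)
    show "1 \<le> compose (Field (pos X)) (under_generic g) l v \<and> compose (Field (pos X)) (under_generic g) l v \<le> Src Delta g"
      if "v \<in> Field (pos X)" for v
      using that u(1)[OF that] by (simp add: compose_def)
    fix a b assume ab: "(a, b) \<in> pos X"
    then have F: "a \<in> Field (pos X)" "b \<in> Field (pos X)" by (auto simp: Field_def)
    show "compose (Field (pos X)) (under_generic g) l a \<le> compose (Field (pos X)) (under_generic g) l b"
      using layer_mono[OF G(1), of "under_generic g (l a)" "under_generic g (l b)" "l a" "l b"]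
        u[OF F(1)] u[OF F(2)] X(7)[OF ab] F by (simp add: compose_def)
  qed (use X in auto)
  show ?thesis
  proof (rule lovI)
    show "v \<in> pt (Ide (Tot R) (str x)) ` Field (fst (generic_ob g x)) \<longleftrightarrow> dm g 0 < lay x v \<and> lay x v \<le> dm g (Src Delta g)"
      if "v \<in> Field (fst x)" for v
      using that X pt_Ide[of X] G by (simp add: z xe)
    show "dm g (lay (generic_ob g x) w - 1) < lay x (pt (Ide (Tot R) (str x)) w) \<and>
         lay x (pt (Ide (Tot R) (str x)) w) \<le> dm g (lay (generic_ob g x) w)" if "w \<in> Field (fst (generic_ob g x))" for w
      using that X pt_Ide[of X w] u[of w] by (simp add: z xe compose_def)
  qed (use G x zL X in \<open>auto simp: z xe hom_iff\<close>)
qed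

lemma category_Lcat: "category (Lcat R n)"
proof -
  have I: "(x, Ide (Tot R) (str x), x) \<in> Ar (Lcat R n)" if "x \<in> Lobj R n" for x
    using that LobjD[OF that] pt_Ide by (auto simp: Lcat_Ar hom_iff)
  have C: "(x, b \<cdot>\<^bsub>Tot R\<^esub> a, z) \<in> Ar (Lcat R n)" if "(x, a, y) \<in> Ar (Lcat R n)" "(y, b, z) \<in> Ar (Lcat R n)" for x a y b z
  proof -
    have x: "x \<in> Lobj R n" and y: "y \<in> Lobj R n" using that by (auto simp: Lcat_Ar)
    have "pt (b \<cdot>\<^bsub>Tot R\<^esub> a) u = pt b (pt a u)" "pt a u \<in> Field (fst y)" if "u \<in> Field (fst x)" for u
      using \<open>(x, a, y) \<in> Ar (Lcat R n)\<close> \<open>(y, b, z) \<in> Ar (Lcat R n)\<close> that LobjD(2)[OF x] LobjD(2)[OF y]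
        pt_cmp[of a b u] pt_Field[of a u]
      by (auto simp: Lcat_Ar hom_iff)
    then show ?thesis
      using that E.is_iso_cmp[of a b] by (auto simp: Lcat_Ar hom_iff)
  qed
  show ?thesis
    unfolding category_def
  proof (intro conjI allI ballI)
    fix w x y z a b c assume "a \<in> hom (Lcat R n) w x" "b \<in> hom (Lcat R n) x y" "c \<in> hom (Lcat R n) y z"
    then show "c \<cdot>\<^bsub>Lcat R n\<^esub> (b \<cdot>\<^bsub>Lcat R n\<^esub> a) = (c \<cdot>\<^bsub>Lcat R n\<^esub> b) \<cdot>\<^bsub>Lcat R n\<^esub> a"
      by (auto simp: Lcat_hom) (auto simp: Lcat_Ar hom_iff)
  next
    fix a assume "a \<in> Ar (Lcat R n)"
    then show "Src (Lcat R n) a \<in> Ob (Lcat R n)" "Tgt (Lcat R n) a \<in> Ob (Lcat R n)"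
      by (cases a, auto simp: Lcat_Ar)+
  next
    fix x assume "x \<in> Ob (Lcat R n)"
    then show "Ide (Lcat R n) x \<in> hom (Lcat R n) x x" using I by (simp add: Lcat_hom)
  next
    fix x y z a b assume "a \<in> hom (Lcat R n) x y" "b \<in> hom (Lcat R n) y z"
    then obtain a' b' where "a = (x, a', y)" "b = (y, b', z)" "(x, a', y) \<in> Ar (Lcat R n)" "(y, b', z) \<in> Ar (Lcat R n)"
      by (auto simp: Lcat_hom)
    then show "b \<cdot>\<^bsub>Lcat R n\<^esub> a \<in> hom (Lcat R n) x z" using C[of x a' y b' z] by (simp add: Lcat_hom)
  next
    fix x y a assume "a \<in> hom (Lcat R n) x y"
    then show "a \<cdot>\<^bsub>Lcat R n\<^esub> Ide (Lcat R n) x = a" "Ide (Lcat R n) y \<cdot>\<^bsub>Lcat R n\<^esub> a = a"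
      by (auto simp: Lcat_hom) (auto simp: Lcat_Ar hom_iff)
  qed
qed

lemma free_ob_Lobj: "free_map f \<Longrightarrow> x \<in> Lobj R (Tgt Delta f) \<Longrightarrow> free_ob R f x \<in> Lobj R (Src Delta f)"
  using lovD(2)[OF free_ob_lov] .

lemma Lact_OM:
  assumes "f \<in> Ar Delta" "x \<in> Lobj R (Tgt Delta f)"
  shows "OM (Lact R f) x = generic_ob (generic_part f) (free_ob R (free_part f) x)"
  using assms free_part_generic_part[OF assms(1)] free_ob_Lobj[of "free_part f" x]
  by (simp add: Lact_def comp_ftor_def generic_act_def free_act_def compose_def)

text \<open>The lift of the generic part is an identity, so the lift of \<open>f\<close> is that of
  its free part alone; this is why \<open>Llift\<close> mentions only the latter.\<close>

lemma Lact_lov: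
  assumes f: "f \<in> Ar Delta" and x: "x \<in> Lobj R (Tgt Delta f)"
  shows "lov R f (OM (Lact R f) x) x (Llift R f x)"
proof -
  note P = free_part_generic_part[OF f]
  have 1: "lov R (free_part f) (free_ob R (free_part f) x) x (Llift R f x)"
    unfolding Llift_def using x P by (intro free_ob_lov) auto
  have 2: "lov R (generic_part f) (OM (Lact R f) x) (free_ob R (free_part f) x) (Ide (Tot R) (str (free_ob R (free_part f) x)))"
    unfolding Lact_OM[OF f x] using lovD(2)[OF 1] P by (intro generic_ob_lov) auto
  show ?thesis using lov_cmp[OF 2 1] P lovD[OF 1] by simp
qed

lemma lov_postcompose:
  assumes "(x, a, y) \<in> Ar (Lcat R n)" "lov R f z x b" "n = Tgt Delta f"
  shows "lov R f z y (a \<cdot>\<^bsub>Tot R\<^esub> b)"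
proof -
  have "lov R (Ide Delta n) x y a" using assms(1) by (simp only: lov_Ide)
  from lov_cmp[OF assms(2) this] show ?thesis using assms(3) lovD(1)[OF assms(2)] by simp
qed

text \<open>Filling along the identity operator: a filler between two arrows over the same
  \<open>f\<close> is an isomorphism of layered structures. The coherence cells and the cells of
  simplicial maps are all obtained in this way.\<close>

lemma fill_Ar:
  assumes b: "lov R f y x b" and c: "lov R f z x c" and n: "n = Src Delta f"
  shows "(z, fill (Tot R) b c, y) \<in> Ar (Lcat R n)" "b \<cdot>\<^bsub>Tot R\<^esub> fill (Tot R) b c = c"
  using lov_fill[OF b, of "Ide Delta n" z c] c n lovD(1)[OF b] by (auto simp: lov_Ide)

lemma Lact_AM:
  assumes f: "f \<in> Ar Delta" and a: "(x, a, y) \<in> Ar (Lcat R (Tgt Delta f))"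
  shows "AM (Lact R f) (x, a, y) = (OM (Lact R f) x, fill (Tot R) (Llift R f y) (a \<cdot>\<^bsub>Tot R\<^esub> Llift R f x), OM (Lact R f) y)"
proof -
  note P = free_part_generic_part[OF f]
  have xy: "x \<in> Lobj R (Tgt Delta f)" "y \<in> Lobj R (Tgt Delta f)" using a by (auto simp: Lcat_Ar)
  have "(free_ob R (free_part f) x, fill (Tot R) (free_lift R (free_part f) y) (a \<cdot>\<^bsub>Tot R\<^esub> free_lift R (free_part f) x),
      free_ob R (free_part f) y) \<in> Ar (Lcat R (Src Delta (free_part f)))"
    using P xy a
    by (intro fill_Ar(1)[of "free_part f" _ y] free_ob_lov lov_postcompose[OF _ free_ob_lov]) auto
  then show ?thesis
    using a P Lact_OM[OF f] xy
    by (simp add: Lact_def comp_ftor_def generic_act_def free_act_def compose_def Llift_def)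
qed

text \<open>The cases follow the assumptions of \<open>fibred\<close> in order. Case 9 is monicity
  of all arrows of \<open>R\<close>, case 11 filling, case 12 surjectivity over generic maps; cases
  14, 16 and 17 are fillers through chosen lifts.\<close>

lemma fibred_Lsgpd: "fibred (Lsgpd R) (Tot R) (\<lambda>x. str x) (\<lambda>\<alpha>. fst (snd \<alpha>)) (lov R) (Llift R)"
proof (unfold_locales, goal_cases)
  case 1 show ?case by (rule E.category)
next
  case (2 n) show ?case by (simp add: Lsgpd_def category_Lcat)
next
  case (3 \<alpha> n z x) then show ?case by (auto simp: Lsgpd_def Lcat_hom lov_Ide)
next
  case (4 n z x a) then show ?case
    by (intro bexI[of _ "(z, a, x)"]) (auto simp: Lsgpd_def Lcat_hom lov_Ide)
next
  case (5 \<alpha> n z x \<beta>) then show ?case by (auto simp: Lsgpd_def Lcat_hom)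
next
  case (6 \<alpha> n \<beta>) then show ?case by (cases \<alpha>; cases \<beta>) (simp add: Lsgpd_def)
next
  case (7 x n) then show ?case by (simp add: Lsgpd_def)
next
  case (8 f z x a) then show ?case using lovD[OF 8] by (auto simp: Lsgpd_def hom_iff)
next
  case (9 f z x a t t') show ?case
    by (rule arrow_mono[of a]) (use lovD[OF 9(1)] 9 in auto)
next
  case (10 f z y a g x b) then show ?case by (rule lov_cmp)
next
  case (11 g y x b f z c) then show ?case using lov_fill[OF 11] by blast
next
  case (12 f z x a)
  note A = lovD[OF 12(2)] and G = generic_dm[OF 12(1)]
  show ?case
  proof (rule arrow_iso[OF A(4)], unfold A)
    show "Field (pos (str x)) \<subseteq> pt a ` Field (pos (str z))"
      using lov_image[OF 12(2)] LobjD[OF A(2)] LobjD[OF A(3)] G by auto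
  qed
next
  case (13 f x) then show ?case by (simp add: Lsgpd_def Lact_lov)
next
  case (14 f \<alpha> x y)
  then obtain a where a: "\<alpha> = (x, a, y)" "(x, a, y) \<in> Ar (Lcat R (Tgt Delta f))"
    by (auto simp: Lsgpd_def Lcat_hom)
  then have xy: "x \<in> Lobj R (Tgt Delta f)" "y \<in> Lobj R (Tgt Delta f)" by (auto simp: Lcat_Ar)
  note F = fill_Ar[OF Lact_lov[OF 14(1) xy(2)] lov_postcompose[OF a(2) Lact_lov[OF 14(1) xy(1)] refl] refl]
  show ?case using F Lact_AM[OF 14(1) a(2)] by (auto simp: Lsgpd_def Lcat_hom a(1))
next
  case (15 f) show ?case by (auto simp: Lsgpd_def Lact_def comp_ftor_def)
next
  case (16 x n)
  then have x: "x \<in> Lobj R n" by (simp add: Lsgpd_def)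
  have "(x, Ide (Tot R) (str x), x) \<in> Ar (Lcat R n)"
    using x LobjD[OF x] pt_Ide by (auto simp: Lcat_Ar hom_iff)
  then have "lov R (Ide Delta n) x x (Ide (Tot R) (str x))" by (simp add: lov_Ide)
  from fill_Ar[OF Lact_lov this, of n] show ?case using x by (auto simp: Lsgpd_def Lcat_hom)
next
  case (17 f g x)
  then have x: "x \<in> Lobj R (Tgt Delta g)" by (simp add: Lsgpd_def)
  have y: "OM (Lact R g) x \<in> Lobj R (Tgt Delta f)"
    using lovD(2)[OF Lact_lov[OF 17(2) x]] 17 by simp
  note L = lov_cmp[OF Lact_lov[OF 17(1) y] Lact_lov[OF 17(2) x] 17(3)]
  have "lov R (g \<cdot>\<^bsub>Delta\<^esub> f) (OM (Lact R (g \<cdot>\<^bsub>Delta\<^esub> f)) x) x (Llift R (g \<cdot>\<^bsub>Delta\<^esub> f) x)"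
    using 17 x by (intro Lact_lov) auto
  from fill_Ar[OF this L refl] show ?case using 17 by (auto simp: Lsgpd_def Lcat_hom)
qed

end

section \<open>The decomposition space of layered structures\<close>

text \<open>The descriptions of \<open>g'\<close> below, on and above the stretch are each stated
  with their end points included. A layer \<open>i\<close> involves the values at both
  \<open>i - 1\<close> and \<open>i\<close>, and this overlap lets each layer be treated within one
  description.\<close>

lemma pushout_maps:
  assumes f: "free_map f" and g: "generic_map g" and po: "pushout Delta f g g' f'"
  defines "s \<equiv> dm f 0" and "a \<equiv> Src Delta f" and "b \<equiv> Tgt Delta f" and "c \<equiv> Tgt Delta g"
  shows "Src Delta g = a" "Src Delta g' = b" "Src Delta f' = c" "Tgt Delta g' = b + c - a" "Tgt Delta f' = b + c - a"
    "s + a \<le> b" "f \<in> Ar Delta" "g \<in> Ar Delta" "f' \<in> Ar Delta" "g' \<in> Ar Delta"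
    "\<And>i. i \<le> a \<Longrightarrow> dm f i = i + s" "\<And>j. j \<le> c \<Longrightarrow> dm f' j = j + s"
    "\<And>i. i \<le> s \<Longrightarrow> dm g' i = i" "\<And>i. i \<le> a \<Longrightarrow> dm g' (i + s) = dm g i + s"
    "\<And>i. s + a \<le> i \<Longrightarrow> i \<le> b \<Longrightarrow> dm g' i = i + c - a"
proof -
  obtain ff gg where fg: "f = (a, ff, b)" "g = (a, gg, c)"
    using po by (cases f; cases g) (auto simp: pushout_def Delta_simps(2,3) a_def b_def c_def)
  have s: "s = ff 0" by (simp add: s_def fg)
  note P = pushout_generic_free[OF f[unfolded fg] g[unfolded fg] po[unfolded fg], folded s]
  have gg: "gg 0 = 0" "gg a = c" using g by (auto simp: fg generic_map.simps)
  show "f \<in> Ar Delta" "g \<in> Ar Delta" using po by (auto simp: pushout_def)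
  show "f' \<in> Ar Delta" "g' \<in> Ar Delta" using po by (auto simp: pushout_def hom_iff)
  show "s + a \<le> b" by (rule P(3))
  show "Src Delta g = a" "Src Delta g' = b" "Src Delta f' = c" "Tgt Delta g' = b + c - a" "Tgt Delta f' = b + c - a"
    using P(1,2) by (simp_all add: fg Delta_simps(2,3))
  show "dm f i = i + s" if "i \<le> a" for i
    using free_map_eq[of a ff b i] f that by (simp add: fg s)
  show "dm f' j = j + s" if "j \<le> c" for j using that P(2) by simp
  show "dm g' i = i" if "i \<le> s" for i using that P(1,3) by simp
  show "dm g' (i + s) = dm g i + s" if "i \<le> a" for i
    using that P(1,3) gg by (cases "i = 0") (auto simp: fg)
  show "dm g' i = i + c - a" if "s + a \<le> i" "i \<le> b" for i
  proof (cases "i = s + a")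
    case True
    \<comment> \<open>If the stretch is a single point, \<open>s + a\<close> is \<open>s\<close> and
      falls under the first branch of the formula; then c is 0 as well, and the values
      agree.\<close>
    show ?thesis
    proof (cases "a = 0")
      case True then show ?thesis using \<open>i = s + a\<close> that P(1) gg by simp
    next
      case False then show ?thesis using \<open>i = s + a\<close> that P(1) gg by simp
    qed
  next
    case False then show ?thesis using that P(1) by simp
  qed
qed

text \<open>Off the inserted stretch \<open>g'\<close> moves in unit steps, so the interval of
  \<open>i\<close> holds a single layer. On the stretch the interval lies in the range of
  \<open>f'\<close>, which \<open>out\<close> excludes.\<close>

lemma pushout_same_layer:
  assumes f: "free_map f" and g: "generic_map g" and po: "pushout Delta f g g' f'"
    and i: "1 \<le> i" "i \<le> Src Delta g'"
    and k: "dm g' (i - 1) < k" "k \<le> dm g' i" and k': "dm g' (i - 1) < k'" "k' \<le> dm g' i"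
    and out: "\<not> (dm f' 0 < k \<and> k \<le> dm f' (Src Delta f'))"
  shows "k = k'"
proof -
  define s where "s = dm f 0"
  define a where "a = Src Delta f"
  define b where "b = Tgt Delta f"
  define c where "c = Tgt Delta g"
  note P = pushout_maps[OF f g po, folded s_def a_def b_def c_def]
  have out: "k \<le> s \<or> s + c < k" using out P(3) P(12)[of 0] P(12)[of c] by auto
  have ib: "i \<le> b" using i P(2) by simp
  consider "i \<le> s" | "s < i" "i \<le> s + a" | "s + a < i" by linarith
  then show ?thesis
  proof cases
    case 1
    then show ?thesis using P(13)[of i] P(13)[of "i - 1"] k k' i by simp
  next
    case 2
    have e: "i - 1 = (i - 1 - s) + s" "i = (i - s) + s" "i - 1 - s \<le> a" "i - s \<le> a" using 2 by auto
    have "dm g' (i - 1) = dm g (i - 1 - s) + s" using P(14)[OF e(3)] e(1) by simp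
    moreover have "dm g' i = dm g (i - s) + s" using P(14)[OF e(4)] e(2) by simp
    moreover have "dm g (i - s) \<le> c" using dm_le[OF P(8), of "i - s"] P(1) e(4) by (simp add: c_def)
    ultimately have False using k out by linarith
    then show ?thesis ..
  next
    case 3
    have "dm g' (i - 1) = i - 1 + c - a" "dm g' i = i + c - a"
      using P(15)[of "i - 1"] P(15)[of i] 3 ib by auto
    then show ?thesis using k k' 3 by linarith
  qed
qed

context species
begin

lemma lov_generic_surj:
  assumes g: "generic_map g" and a: "lov R g z x a"
  shows "pt a ` Field (pos (str z)) = Field (pos (str x))"
proof -
  note A = lovD[OF a] and G = generic_dm[OF g]
  note z = LobjD[OF A(2)] and x = LobjD[OF A(3)]
  have "v \<in> pt a ` Field (pos (str z))" if "v \<in> Field (pos (str x))" for v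
    using lov_image[OF a, of v] that x z G by simp
  then show ?thesis using pt_Field[OF A(4)] A by auto
qed

text \<open>Layers in the range of \<open>f'\<close> are compared through \<open>w\<close>: as
  \<open>f'\<close> is a translation, each of its intervals is a single layer. All other layers are
  determined by \<open>g'\<close> through \<open>pushout_same_layer\<close>. Invertibility of
  \<open>a\<close> comes from surjectivity over the generic map \<open>g'\<close>.\<close>

lemma glue_lov:
  assumes f: "free_map f" and g: "generic_map g" and po: "pushout Delta f g g' f'"
    and a: "a \<in> hom (Tot R) (str x) (str y)"
    and b: "lov R g' z x b" and c: "lov R f' w x c"
    and ab: "lov R g' z y (a \<cdot>\<^bsub>Tot R\<^esub> b)" and ac: "lov R f' w y (a \<cdot>\<^bsub>Tot R\<^esub> c)"
  shows "lov R (Ide Delta (Tgt Delta g')) x y a"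
proof -
  note P = pushout_maps[OF f g po]
  have g': "generic_map g'" using pushout_generic[OF f g po] .
  note B = lovD[OF b] and C = lovD[OF c] and AB = lovD[OF ab]
  note z = LobjD[OF B(2)] and x = LobjD[OF B(3)] and y = LobjD[OF AB(3)] and w = LobjD[OF C(2)]
  have aA: "a \<in> Ar (Tot R)" "Src (Tot R) a = str x" "Tgt (Tot R) a = str y" using a by (auto simp: hom_iff)
  have pab: "pt (a \<cdot>\<^bsub>Tot R\<^esub> b) v = pt a (pt b v)" if "v \<in> Field (pos (str z))" for v
    using that aA B by (intro pt_cmp) auto
  have pac: "pt (a \<cdot>\<^bsub>Tot R\<^esub> c) v = pt a (pt c v)" if "v \<in> Field (pos (str w))" for v
    using that aA C by (intro pt_cmp) auto
  have "(x, a, y) \<in> Ar (Lcat R (Tgt Delta g'))"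
    unfolding Lcat_Ar
  proof (intro conjI ballI)
    have "v \<in> pt a ` Field (pos (str x))" if v: "v \<in> Field (pos (str y))" for v
    proof -
      obtain u where u: "u \<in> Field (pos (str z))" "v = pt (a \<cdot>\<^bsub>Tot R\<^esub> b) u"
        using v unfolding lov_generic_surj[OF g' ab, symmetric] by blast
      then have "pt b u \<in> Field (pos (str x))" using pt_Field[OF B(4)] B by simp
      then show ?thesis using u pab by simp
    qed
    then show "is_iso (Tot R) a" using aA by (intro arrow_iso) auto
    fix u assume "u \<in> Field (fst x)"
    then have uF: "u \<in> Field (pos (str x))" using x by simp
    then obtain v where v: "v \<in> Field (pos (str z))" "u = pt b v"
      unfolding lov_generic_surj[OF g' b, symmetric] by blast
    have lb: "dm g' (lay z v - 1) < lay x u" "lay x u \<le> dm g' (lay z v)"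
      using lov_layer[OF b, of v] v z by auto
    have lab: "dm g' (lay z v - 1) < lay y (pt a u)" "lay y (pt a u) \<le> dm g' (lay z v)"
      using lov_layer[OF ab, of v] v z pab by auto
    show "lay y (pt a u) = lay x u"
    proof (cases "dm f' 0 < lay x u \<and> lay x u \<le> dm f' (Src Delta f')")
      case True
      then obtain q where q: "q \<in> Field (pos (str w))" "u = pt c q"
        using lov_image[OF c, of u] uF x w by auto
      have "dm f' (lay w q - 1) < lay x u" "lay x u \<le> dm f' (lay w q)"
        using lov_layer[OF c, of q] q w by auto
      moreover have "dm f' (lay w q - 1) < lay y (pt a u)" "lay y (pt a u) \<le> dm f' (lay w q)"
        using lov_layer[OF ac, of q] q w pac by auto
      ultimately show ?thesis
        using P(12)[of "lay w q"] P(12)[of "lay w q - 1"] w(4,5)[OF q(1)] P(3) by linarith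
    next
      case False
      have "lay x u = lay y (pt a u)"
        using z(4,5)[OF v(1)] by (intro pushout_same_layer[OF f g po _ _ lb lab False]) auto
      then show ?thesis by simp
    qed
  qed (use B AB a in auto)
  then show ?thesis by (simp add: lov_Ide)
qed

text \<open>The layering of \<open>z\<close> already fixes everything outside the layers selected by
  \<open>f\<close>; on these, \<open>y\<close> provides the refinement. Only the layering of
  \<open>z\<close> changes, so an identity arrow lies over \<open>g'\<close>.\<close>

lemma glue_Lobj:
  assumes f: "free_map f" and g: "generic_map g" and po: "pushout Delta f g g' f'"
    and e: "lov R g w y e" and d: "lov R f w z d"
  shows "\<exists>x h. str x = str z \<and> lov R g' z x (Ide (Tot R) (str z)) \<and> lov R f' y x h \<and> h \<cdot>\<^bsub>Tot R\<^esub> e = d"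
proof -
  define s where "s = dm f 0"
  define a where "a = Src Delta f"
  define b where "b = Tgt Delta f"
  define c where "c = Tgt Delta g"
  note P = pushout_maps[OF f g po, folded s_def a_def b_def c_def]
  note E = lovD[OF e] and D = lovD[OF d] and G = generic_dm[OF g]
  note w = LobjD[OF E(2)] and y = LobjD[OF E(3)] and z = LobjD[OF D(3)]
  have e_surj: "pt e ` Field (pos (str w)) = Field (pos (str y))" by (rule lov_generic_surj[OF g e])
  have e_iso: "is_iso (Tot R) e" by (rule arrow_iso[OF E(4)]) (simp add: E e_surj)
  note i = E.inv_ar_props[OF e_iso]
  \<comment> \<open>Since \<open>e\<close> lies over a generic map it is invertible, and the
    equation required of \<open>h\<close> leaves no other choice.\<close>
  define h where "h = d \<cdot>\<^bsub>Tot R\<^esub> inv_ar (Tot R) e"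
  have h: "h \<in> Ar (Tot R)" "Src (Tot R) h = str y" "Tgt (Tot R) h = str z" "h \<cdot>\<^bsub>Tot R\<^esub> e = d"
    using i E D by (auto simp: h_def)
  have ph: "pt h (pt e u) = pt d u" if "u \<in> Field (pos (str w))" for u
    using that h E pt_cmp[of e h u] by simp
  have peF: "pt e u \<in> Field (pos (str y))" if "u \<in> Field (pos (str w))" for u
    using pt_Field[OF E(4)] that E by simp
  have pdF: "pt d u \<in> Field (pos (str z))" if "u \<in> Field (pos (str w))" for u
    using pt_Field[OF D(4)] that D by simp
  have d_inj: "inj_on (pt d) (Field (pos (str w)))" using pt_inj[OF D(4)] D by simp
  \<comment> \<open>Points selected by \<open>f\<close> get their layer from \<open>y\<close>,
    translated by \<open>s\<close>; lower layers are kept; higher ones move by the change of length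
    \<open>c - a\<close> of the replaced stretch.\<close>
  define m where "m = (\<lambda>p\<in>Field (pos (str z)).
    if s < lay z p \<and> lay z p \<le> s + a then s + lay y (pt e (inv_into (Field (pos (str w))) (pt d) p))
    else if lay z p \<le> s then lay z p else lay z p + c - a)"
  have d_image: "p \<in> pt d ` Field (pos (str w)) \<longleftrightarrow> s < lay z p \<and> lay z p \<le> s + a"
    if "p \<in> Field (pos (str z))" for p
    using lov_image[OF d, of p] that w z P(11)[of 0] P(11)[of a] by (auto simp: a_def)
  have lz: "lay z (pt d u) = lay w u + s" "1 \<le> lay w u" "lay w u \<le> a" if "u \<in> Field (pos (str w))" for u
    using lov_layer[OF d, of u] that w(2) w(4,5)[OF that] P(1) P(11)[of "lay w u"] P(11)[of "lay w u - 1"] by auto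
  have md: "m (pt d u) = s + lay y (pt e u)" if "u \<in> Field (pos (str w))" for u
    using that pdF[OF that] lz[OF that] d_inj by (simp add: m_def)
  have m_low: "m p = lay z p" if "p \<in> Field (pos (str z))" "lay z p \<le> s" for p
    using that by (simp add: m_def)
  have m_high: "m p = lay z p + c - a" if "p \<in> Field (pos (str z))" "s + a < lay z p" for p
    using that by (simp add: m_def)
  have ly: "1 \<le> lay y (pt e u)" "lay y (pt e u) \<le> c" if "u \<in> Field (pos (str w))" for u
    using y(4,5)[OF peF[OF that]] by (auto simp: c_def)
  have cases: "(\<exists>u\<in>Field (pos (str w)). p = pt d u) \<or> lay z p \<le> s \<or> s + a < lay z p"
    if "p \<in> Field (pos (str z))" for p
    using d_image[OF that] by (auto simp: not_le)
  have z_range: "1 \<le> lay z p" "lay z p \<le> b" if "p \<in> Field (pos (str z))" for p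
    using z(4,5)[OF that] by (auto simp: b_def)
  define x where "x = (pos (str z), m, str z)"
  have m_range: "1 \<le> m p \<and> m p \<le> b + c - a" if p: "p \<in> Field (pos (str z))" for p
    using cases[OF p] z_range[OF p] P(6) ly md m_low[OF p] m_high[OF p] by fastforce
  have m_mono: "m p \<le> m q" if pq: "(p, q) \<in> pos (str z)" for p q
  proof -
    have F: "p \<in> Field (pos (str z))" "q \<in> Field (pos (str z))" using pq by (auto simp: Field_def)
    have l: "lay z p \<le> lay z q" using z(7)[OF pq] .
    \<comment> \<open>For two points of the stretch, \<open>d\<close> reflects the relation and
      \<open>e\<close> carries it to \<open>y\<close>. Otherwise the blocks decide: low points have
      new layer at most \<open>s\<close>, stretch points lie above \<open>s\<close> up to
      \<open>s + c\<close>, high points lie beyond.\<close>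
    show ?thesis
    proof (cases "(\<exists>u\<in>Field (pos (str w)). p = pt d u) \<and> (\<exists>u\<in>Field (pos (str w)). q = pt d u)")
      case True
      then obtain u v where uv: "u \<in> Field (pos (str w))" "v \<in> Field (pos (str w))" "p = pt d u" "q = pt d v" by blast
      have "(u, v) \<in> pos (str w)"
        using convex_map_reflects[OF pt_convex[OF D(4)], unfolded D, of u v] uv pq
          Partial_order_pos[OF w(1)] Partial_order_pos[OF z(1)] by simp
      then have "(pt e u, pt e v) \<in> pos (str y)"
        using convex_mapD(2)[OF pt_convex[OF E(4)]] E by simp
      then show ?thesis using y(7) md uv by simp
    next
      case False
      have p: "m p \<le> s + c" if "lay z p \<le> s + a"
        using cases[OF F(1)] that md ly m_low[OF F(1)] by fastforce
      have q: "s < m q" if "s < lay z q"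
        using cases[OF F(2)] that md ly m_high[OF F(2)] by fastforce
      consider "lay z p \<le> s" | "s + a < lay z p" | u where "u \<in> Field (pos (str w))" "p = pt d u"
        using cases[OF F(1)] by blast
      then show ?thesis
      proof cases
        case 1
        then show ?thesis
          using m_low[OF F(1)] m_low[OF F(2)] q l by (cases "lay z q \<le> s") auto
      next
        case 2
        then show ?thesis using m_high[OF F(1)] m_high[OF F(2)] l by simp
      next
        case 3
        then have "s + a < lay z q" using False cases[OF F(2)] l lz[of u] by auto
        then show ?thesis using m_high[OF F(2)] p l md[OF 3(1)] ly[OF 3(1)] 3(2) by simp
      qed
    qed
  qed
  have xL: "x \<in> Lobj R (b + c - a)"
    unfolding x_def using m_range m_mono z(1) by (intro LobjI) (auto simp: m_def)
  have g'g: "generic_map g'" using pushout_generic[OF f g po] .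
  note G' = generic_dm[OF g'g]
  have "lov R g' z x (Ide (Tot R) (str z))"
  proof (rule lovI)
    show "v \<in> pt (Ide (Tot R) (str z)) ` Field (fst z) \<longleftrightarrow> dm g' 0 < lay x v \<and> lay x v \<le> dm g' (Src Delta g')"
      if "v \<in> Field (fst x)" for v
      using that m_range[of v] z pt_Ide[OF z(1)] G' P(4) by (auto simp: x_def)
    fix p assume "p \<in> Field (fst z)"
    then have p: "p \<in> Field (pos (str z))" using z by simp
    have "dm g' (lay z p - 1) < m p \<and> m p \<le> dm g' (lay z p)"
      using cases[OF p]
    proof (elim disjE bexE)
      fix u assume u: "u \<in> Field (pos (str w))" "p = pt d u"
      have "lay z p = lay w u + s" "lay z p - 1 = (lay w u - 1) + s" using lz[OF u(1)] u(2) by auto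
      then have "dm g' (lay z p) = dm g (lay w u) + s" "dm g' (lay z p - 1) = dm g (lay w u - 1) + s"
        using P(14)[of "lay w u"] P(14)[of "lay w u - 1"] lz[OF u(1)] by auto
      then show ?thesis using lov_layer[OF e, of u] u w md by simp
    next
      assume "lay z p \<le> s"
      then show ?thesis using m_low[OF p] P(13)[of "lay z p"] P(13)[of "lay z p - 1"] z_range[OF p] by simp
    next
      assume "s + a < lay z p"
      then show ?thesis using m_high[OF p] P(15)[of "lay z p"] P(15)[of "lay z p - 1"] z_range[OF p] by simp
    qed
    then show "dm g' (lay z p - 1) < lay x (pt (Ide (Tot R) (str z)) p) \<and>
         lay x (pt (Ide (Tot R) (str z)) p) \<le> dm g' (lay z p)"
      using pt_Ide[OF z(1) p] by (simp add: x_def)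
  qed (use P D(3) xL z in \<open>auto simp: x_def hom_iff b_def\<close>)
  moreover have "lov R f' y x h"
  proof (rule lovI)
    fix v assume "v \<in> Field (fst x)"
    then have v: "v \<in> Field (pos (str z))" by (simp add: x_def)
    have "pt h ` Field (pos (str y)) = pt d ` Field (pos (str w))"
      unfolding e_surj[symmetric] image_image using ph by (intro image_cong) auto
    moreover have "s < m v \<and> m v \<le> s + c \<longleftrightarrow> v \<in> pt d ` Field (pos (str w))"
    proof
      assume "s < m v \<and> m v \<le> s + c"
      then show "v \<in> pt d ` Field (pos (str w))"
        using cases[OF v] m_low[OF v] m_high[OF v] by fastforce
    qed (use md ly in fastforce)
    ultimately show "v \<in> pt h ` Field (fst y) \<longleftrightarrow> dm f' 0 < lay x v \<and> lay x v \<le> dm f' (Src Delta f')"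
      using y P(3) P(12)[of 0] P(12)[of c] by (simp add: x_def add.commute)
  next
    fix v assume "v \<in> Field (fst y)"
    then have v: "v \<in> Field (pos (str y))" using y by simp
    then obtain u where u: "u \<in> Field (pos (str w))" "v = pt e u" using e_surj by blast
    show "dm f' (lay y v - 1) < lay x (pt h v) \<and> lay x (pt h v) \<le> dm f' (lay y v)"
      using ph[OF u(1)] md[OF u(1)] ly[OF u(1)] P(12)[of "lay y v"] P(12)[of "lay y v - 1"] by (simp add: x_def u(2))
  qed (use P E(3) xL h in \<open>auto simp: x_def hom_iff c_def\<close>)
  ultimately show ?thesis using h(4) by (intro exI[of _ x] exI[of _ h]) (simp add: x_def)
qed

lemma decomposition_space_Lsgpd: "decomposition_space (Lsgpd R)"
proof -
  interpret L: fibred "Lsgpd R" "Tot R" "\<lambda>x. str x" "\<lambda>\<alpha>. fst (snd \<alpha>)" "lov R" "Llift R"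
    by (rule fibred_Lsgpd)
  show ?thesis
  proof (rule L.decomposition_space)
    fix f g g' f' x y a
    assume H: "free_map f" "generic_map g" "pushout Delta f g g' f'"
      and x: "x \<in> Ob (Val (Lsgpd R) (Tgt Delta g'))" and a: "a \<in> hom (Tot R) (str x) (str y)"
      and "lov R g' (OM (Act (Lsgpd R) g') x) y (a \<cdot>\<^bsub>Tot R\<^esub> Llift R g' x)"
      and "lov R f' (OM (Act (Lsgpd R) f') x) y (a \<cdot>\<^bsub>Tot R\<^esub> Llift R f' x)"
    then show "lov R (Ide Delta (Tgt Delta g')) x y a"
      using pushout_maps(4,5,9,10)[OF H]
      by (intro glue_lov[OF H a L.ov_lift L.ov_lift]) auto
  qed (use glue_Lobj pushout_generic in blast)+
qed

end

section \<open>Morphisms of directed restriction species\<close>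

lemma Lsgpd_simps [simp]: "Val (Lsgpd Q) = Lcat Q" "Act (Lsgpd Q) = Lact Q"
  by (simp_all add: Lsgpd_def)

locale species_map = R': species R' + R: species R
  for R' :: "('v, 'o, 'a) drs" and R :: "('v, 'p, 'b) drs" +
  fixes \<phi> :: "('o, 'a, 'p, 'b) ftor"
  assumes morphism: "drs_morphism R' R \<phi>"
begin

lemma map_functor: "is_functor (Tot R') (Tot R) \<phi>"
  using morphism by (simp add: drs_morphism_def)

lemmas map_simps = functorD[OF map_functor]

lemma pos_map: "X \<in> Ob (Tot R') \<Longrightarrow> R.pos (OM \<phi> X) = R'.pos X"
  using morphism comp_ftor_OM[of X "Tot R'" "Prj R" \<phi>] by (simp add: drs_morphism_def)

lemma Prj_map: "a \<in> Ar (Tot R') \<Longrightarrow> AM (Prj R) (AM \<phi> a) = AM (Prj R') a"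
  using morphism comp_ftor_AM[of a "Tot R'" "Prj R" \<phi>] by (simp add: drs_morphism_def)

lemma map_ob_simps [simp]: "fst (map_ob \<phi> x) = fst x" "lay (map_ob \<phi> x) = lay x" "str (map_ob \<phi> x) = OM \<phi> (str x)"
  by (cases x; simp)+

lemma map_ob_Lobj: "x \<in> Lobj R' n \<Longrightarrow> map_ob \<phi> x \<in> Lobj R n"
  by (cases x) (auto simp: R.Lobj_iff R'.Lobj_iff pos_map map_simps)

text \<open>A morphism of species commutes with the projections, so it changes neither posets nor
  underlying convex maps, and \<open>lov\<close> constrains only these and the layerings.\<close>

lemma lov_map:
  assumes f: "f \<in> hom Delta i j" and z: "z \<in> Lobj R' i" and x: "x \<in> Lobj R' j" and a: "a \<in> hom (Tot R') (str z) (str x)"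
  shows "lov R f (map_ob \<phi> z) (map_ob \<phi> x) (AM \<phi> a) \<longleftrightarrow> lov R' f z x a"
  using f z x a map_ob_Lobj[OF z] map_ob_Lobj[OF x] map_simps(2-4)[of a] Prj_map[of a]
  by (simp add: lov_def hom_iff)

lemma Lcat_map: "(x, a, y) \<in> Ar (Lcat R' n) \<Longrightarrow> (map_ob \<phi> x, AM \<phi> a, map_ob \<phi> y) \<in> Ar (Lcat R n)"
  using lov_map[of "Ide Delta n" n n x y a] by (simp add: R.lov_Ide R'.lov_Ide hom_iff) (simp add: Lcat_Ar hom_iff)

lemma Cel_Lmap:
  assumes f: "f \<in> hom Delta i j" and x: "x \<in> Lobj R' j"
  shows "(map_ob \<phi> (OM (Lact R' f) x), fill (Tot R) (Llift R f (map_ob \<phi> x)) (AM \<phi> (Llift R' f x)),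
      OM (Lact R f) (map_ob \<phi> x)) \<in> Ar (Lcat R i)"
    "Llift R f (map_ob \<phi> x) \<cdot>\<^bsub>Tot R\<^esub> fill (Tot R) (Llift R f (map_ob \<phi> x)) (AM \<phi> (Llift R' f x)) = AM \<phi> (Llift R' f x)"
proof -
  have fA: "f \<in> Ar Delta" "Src Delta f = i" "Tgt Delta f = j" using f by (auto simp: hom_iff)
  have L: "lov R' f (OM (Lact R' f) x) x (Llift R' f x)"
    using x fA by (intro R'.Lact_lov) auto
  then have 1: "lov R f (map_ob \<phi> (OM (Lact R' f) x)) (map_ob \<phi> x) (AM \<phi> (Llift R' f x))"
    using lov_map[of f i j "OM (Lact R' f) x" x "Llift R' f x"] f x fA lovD[OF L] by (simp add: hom_iff)
  have 2: "lov R f (OM (Lact R f) (map_ob \<phi> x)) (map_ob \<phi> x) (Llift R f (map_ob \<phi> x))"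
    using x fA map_ob_Lobj[OF x] by (intro R.Lact_lov) auto
  show "(map_ob \<phi> (OM (Lact R' f) x), fill (Tot R) (Llift R f (map_ob \<phi> x)) (AM \<phi> (Llift R' f x)),
      OM (Lact R f) (map_ob \<phi> x)) \<in> Ar (Lcat R i)"
    "Llift R f (map_ob \<phi> x) \<cdot>\<^bsub>Tot R\<^esub> fill (Tot R) (Llift R f (map_ob \<phi> x)) (AM \<phi> (Llift R' f x)) = AM \<phi> (Llift R' f x)"
    using R.fill_Ar[OF 2 1, of i] fA by auto
qed

lemma Lmap_Cpt:
  "x \<in> Lobj R' n \<Longrightarrow> OM (Cpt (Lmap R' \<phi> R) n) x = map_ob \<phi> x"
  "(x, a, y) \<in> Ar (Lcat R' n) \<Longrightarrow> AM (Cpt (Lmap R' \<phi> R) n) (x, a, y) = (map_ob \<phi> x, AM \<phi> a, map_ob \<phi> y)"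
  by (auto simp: Lmap_def)

lemma Lmap_Cel:
  "f \<in> hom Delta i j \<Longrightarrow> x \<in> Lobj R' j \<Longrightarrow> Cel (Lmap R' \<phi> R) f x =
    (map_ob \<phi> (OM (Lact R' f) x), fill (Tot R) (Llift R f (map_ob \<phi> x)) (AM \<phi> (Llift R' f x)),
      OM (Lact R f) (map_ob \<phi> x))"
  by (simp add: Lmap_def hom_iff)

lemma Cpt_functor: "is_functor (Lcat R' n) (Lcat R n) (Cpt (Lmap R' \<phi> R) n)"
proof (rule functorI)
  interpret L: cat "Lcat R' n" by (rule cat.intro) (rule R'.category_Lcat)
  show "OM (Cpt (Lmap R' \<phi> R) n) x \<in> Ob (Lcat R n)" if "x \<in> Ob (Lcat R' n)" for x
    using that by (simp add: Lmap_Cpt map_ob_Lobj)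
  show "AM (Cpt (Lmap R' \<phi> R) n) \<alpha> \<in> hom (Lcat R n) (OM (Cpt (Lmap R' \<phi> R) n) (Src (Lcat R' n) \<alpha>))
     (OM (Cpt (Lmap R' \<phi> R) n) (Tgt (Lcat R' n) \<alpha>))" if "\<alpha> \<in> Ar (Lcat R' n)" for \<alpha>
    using that Lcat_map by (cases \<alpha>) (auto simp: Lmap_Cpt Lcat_Ar[of _ _ _ R'] Lcat_hom)
  show "AM (Cpt (Lmap R' \<phi> R) n) (Ide (Lcat R' n) x) = Ide (Lcat R n) (OM (Cpt (Lmap R' \<phi> R) n) x)"
    if "x \<in> Ob (Lcat R' n)" for x
    using that L.Ide_Ar[of x] R'.LobjD(1)[of x n] by (simp add: Lmap_Cpt map_simps)
  show "AM (Cpt (Lmap R' \<phi> R) n) (\<beta> \<cdot>\<^bsub>Lcat R' n\<^esub> \<alpha>) = AM (Cpt (Lmap R' \<phi> R) n) \<beta> \<cdot>\<^bsub>Lcat R n\<^esub> AM (Cpt (Lmap R' \<phi> R) n) \<alpha>"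
    if ab: "\<alpha> \<in> Ar (Lcat R' n)" "\<beta> \<in> Ar (Lcat R' n)" "Src (Lcat R' n) \<beta> = Tgt (Lcat R' n) \<alpha>" for \<alpha> \<beta>
  proof -
    obtain x a y b z where e: "\<alpha> = (x, a, y)" "\<beta> = (y, b, z)" using ab(3) by (cases \<alpha>; cases \<beta>) auto
    have "(x, b \<cdot>\<^bsub>Tot R'\<^esub> a, z) \<in> Ar (Lcat R' n)" using L.cmp_Ar[OF ab] by (simp add: e)
    then show ?thesis using ab by (simp add: e Lmap_Cpt) (simp add: Lcat_Ar hom_iff map_simps)
  qed
qed (auto simp: Lmap_def)

lemma fibred_map_Lmap:
  "fibred_map (Lsgpd R') (Tot R') (\<lambda>x. str x) (\<lambda>\<alpha>. fst (snd \<alpha>)) (lov R') (Llift R')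
    (Lsgpd R) (Tot R) (\<lambda>x. str x) (\<lambda>\<alpha>. fst (snd \<alpha>)) (lov R) (Llift R) (Lmap R' \<phi> R) \<phi>"
proof (intro fibred_map.intro R'.fibred_Lsgpd R.fibred_Lsgpd, unfold_locales, goal_cases)
  case 1 show ?case by (rule map_functor)
next
  case (2 n) show ?case by (simp add: Cpt_functor)
next
  case (3 x n) then show ?case by (simp add: Lmap_Cpt)
next
  case (4 \<alpha> n) then show ?case by (cases \<alpha>) (simp add: Lmap_Cpt)
next
  case (5 f i j z x a) then show ?case by (simp add: Lmap_Cpt lov_map)
next
  case 6 show ?case by (simp add: Lmap_def)
next
  case (7 f) then show ?case by (simp add: Lmap_def)
next
  case (8 f i j x)
  then have x: "x \<in> Lobj R' j" by simp
  note C = Cel_Lmap[OF 8(1) x]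
  have "OM (Lact R' f) x \<in> Lobj R' i"
    using lovD(2)[OF R'.Lact_lov[of f x]] 8 by (simp add: hom_iff)
  then show ?case using C x by (simp add: Lmap_Cel[OF 8(1) x] Lmap_Cpt Lcat_hom)
qed

end

section \<open>CULF squares of morphisms of species\<close>

context species
begin

text \<open>Over a generic map \<open>a\<close> is bijective on points, so the finer layering of
  \<open>y\<close> can be pulled back to the structure of \<open>z\<close>. The same arrow then
  splits into an identity over \<open>g\<close> and an isomorphism of layered structures.\<close>

lemma generic_pushforward:
  assumes g: "generic_map g" and a: "lov R g z y a"
  defines "x \<equiv> (fst z, \<lambda>v\<in>Field (fst z). lay y (pt a v), str z)"
  shows "x \<in> Lobj R (Tgt Delta g)" "lov R g z x (Ide (Tot R) (str z))" "lov R (Ide Delta (Tgt Delta g)) x y a"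
proof -
  note A = lovD[OF a] and G = generic_dm[OF g]
  note z = LobjD[OF A(2)] and y = LobjD[OF A(3)]
  have aF: "pt a v \<in> Field (pos (str y))" if "v \<in> Field (pos (str z))" for v
    using pt_Field[OF A(4)] that A by simp
  have l: "1 \<le> lay y (pt a v)" "lay y (pt a v) \<le> Tgt Delta g" if "v \<in> Field (pos (str z))" for v
    using y(4,5)[OF aF[OF that]] by auto
  show x: "x \<in> Lobj R (Tgt Delta g)"
    unfolding x_def
  proof (rule LobjI)
    fix v w assume "(v, w) \<in> fst z"
    then have vw: "(v, w) \<in> pos (str z)" using z by simp
    then have "(pt a v, pt a w) \<in> pos (str y)"
      using convex_mapD(2)[OF pt_convex[OF A(4)]] A by simp
    moreover have "v \<in> Field (fst z)" "w \<in> Field (fst z)" using vw z(2) by (auto simp: Field_def)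
    ultimately show "(\<lambda>v\<in>Field (fst z). lay y (pt a v)) v \<le> (\<lambda>v\<in>Field (fst z). lay y (pt a v)) w"
      using y(7) by simp
  qed (use z l in auto)
  show "lov R g z x (Ide (Tot R) (str z))"
  proof (rule lovI)
    show "v \<in> pt (Ide (Tot R) (str z)) ` Field (fst z) \<longleftrightarrow> dm g 0 < lay x v \<and> lay x v \<le> dm g (Src Delta g)"
      if "v \<in> Field (fst x)" for v
      using that l[of v] z pt_Ide[OF z(1)] G by (auto simp: x_def)
    show "dm g (lay z w - 1) < lay x (pt (Ide (Tot R) (str z)) w) \<and> lay x (pt (Ide (Tot R) (str z)) w) \<le> dm g (lay z w)"
      if "w \<in> Field (fst z)" for w
      using lov_layer[OF a that] that z pt_Ide[OF z(1), of w] by (simp add: x_def)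
  qed (use A x z in \<open>auto simp: x_def hom_iff\<close>)
  have "is_iso (Tot R) a"
    by (rule arrow_iso[OF A(4)]) (simp add: A lov_generic_surj[OF g a])
  then show "lov R (Ide Delta (Tgt Delta g)) x y a"
    unfolding lov_Ide Lcat_Ar using A x by (auto simp: x_def hom_iff)
qed

end

context species_map
begin

lemma map_ob_Lobj_iff: "str x \<in> Ob (Tot R') \<Longrightarrow> map_ob \<phi> x \<in> Lobj R n \<longleftrightarrow> x \<in> Lobj R' n"
  by (cases x) (auto simp: R.Lobj_iff R'.Lobj_iff pos_map map_simps)

text \<open>The pulled-back layering lives on the poset, which is the same for a structure and its
  image under the morphism; hence it is a layering of the original structure too.\<close>

lemma culf_Lmap: "culf (Lsgpd R') (Lsgpd R) (Lmap R' \<phi> R)"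
proof -
  interpret M: fibred_map "Lsgpd R'" "Tot R'" "\<lambda>x. str x" "\<lambda>\<alpha>. fst (snd \<alpha>)" "lov R'" "Llift R'"
    "Lsgpd R" "Tot R" "\<lambda>x. str x" "\<lambda>\<alpha>. fst (snd \<alpha>)" "lov R" "Llift R" "Lmap R' \<phi> R" \<phi>
    by (rule fibred_map_Lmap)
  show ?thesis
  proof (rule M.culf)
    fix g i j z y a
    assume g: "g \<in> hom Delta i j" "generic_map g" and z0: "z \<in> Ob (Val (Lsgpd R') i)"
      and a0: "lov R g (OM (Cpt (Lmap R' \<phi> R) i) z) y a"
    have z: "z \<in> Lobj R' i" using z0 by simp
    have a: "lov R g (map_ob \<phi> z) y a" using a0 z by (simp add: Lmap_Cpt)
    note Z = R'.LobjD[OF z]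
    have gj: "Tgt Delta g = j" using g by (simp add: hom_iff)
    define x where "x = (fst z, \<lambda>v\<in>Field (fst z). lay y (R.pt a v), str z)"
    have mx: "map_ob \<phi> x = (fst (map_ob \<phi> z), \<lambda>v\<in>Field (fst (map_ob \<phi> z)). lay y (R.pt a v), str (map_ob \<phi> z))"
      by (simp add: x_def)
    note F = R.generic_pushforward[OF g(2) a, folded mx, unfolded gj]
    have x: "x \<in> Lobj R' j"
      using F(1) Z(1) map_ob_Lobj_iff[of x j] by (simp add: x_def)
    moreover have "lov R' g z x (Ide (Tot R') (str z))"
      using F(2) lov_map[OF g(1) z x, of "Ide (Tot R') (str z)"] Z(1)
      by (simp add: map_simps hom_iff x_def)
    ultimately show "\<exists>x\<in>Ob (Val (Lsgpd R') j). str x = str z \<and> lov R' g z x (Ide (Tot R') (str z)) \<and>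
        lov R (Ide Delta j) (OM (Cpt (Lmap R' \<phi> R) j) x) y a"
      using F(3) by (intro bexI[of _ x]) (auto simp: Lmap_Cpt, simp add: x_def)
  qed
qed

end

section \<open>Functoriality of layered structures\<close>

lemma (in species) Lmap_id: "Lmap R (id_ftor (Tot R)) R = id_sgmap (Lsgpd R)"
proof -
  let ?I = "id_ftor (Tot R)"
  have I: "OM ?I X = X" if "X \<in> Ob (Tot R)" for X using that by (simp add: id_ftor_def)
  have IA: "AM ?I a = a" if "a \<in> Ar (Tot R)" for a using that by (simp add: id_ftor_def)
  have m: "map_ob ?I x = x" if "x \<in> Lobj R n" for x n
    using LobjD(1)[OF that] I by (cases x) simp
  have "Cpt (Lmap R ?I R) n = id_ftor (Lcat R n)" for n
  proof (rule ftor.equality)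
    show "OM (Cpt (Lmap R ?I R) n) = OM (id_ftor (Lcat R n))"
      by (auto simp: Lmap_def id_ftor_def[of "Lcat R n"] m simp del: map_ob.simps intro!: restrict_ext)
    have "(map_ob ?I x, AM ?I a, map_ob ?I y) = (x, a, y)" if "(x, a, y) \<in> Ar (Lcat R n)" for x a y
      using that m[of x n] m[of y n] IA[of a] by (simp add: Lcat_Ar hom_iff del: map_ob.simps)
    then show "AM (Cpt (Lmap R ?I R) n) = AM (id_ftor (Lcat R n))"
      by (auto simp: Lmap_def id_ftor_def[of "Lcat R n"] simp del: map_ob.simps intro!: restrict_ext)
  qed simp
  moreover have "Cel (Lmap R ?I R) = Cel (id_sgmap (Lsgpd R))"
  proof -
    \<comment> \<open>An identity fills a lift through itself, and fillers are unique.\<close>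
    have "fill (Tot R) (Llift R f (map_ob ?I x)) (AM ?I (Llift R f x)) = Ide (Tot R) (str (OM (Lact R f) x))"
      "map_ob ?I (OM (Lact R f) x) = OM (Lact R f) x" "map_ob ?I x = x"
      if "f \<in> Ar Delta" "x \<in> Lobj R (Tgt Delta f)" for f x
    proof -
      note L = lovD[OF Lact_lov[OF that]]
      show "map_ob ?I (OM (Lact R f) x) = OM (Lact R f) x" "map_ob ?I x = x" using m L(2) that(2) by auto
      then show "fill (Tot R) (Llift R f (map_ob ?I x)) (AM ?I (Llift R f x)) = Ide (Tot R) (str (OM (Lact R f) x))"
        using L LobjD(1)[OF L(2)] by (intro fill_eq) (auto simp: IA hom_iff)
    qed
    then show ?thesis
      by (auto simp: Lmap_def id_sgmap_def simp del: map_ob.simps intro!: restrict_ext)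
  qed
  ultimately show ?thesis by (simp add: id_sgmap_def Lmap_def fun_eq_iff)
qed

text \<open>On objects and arrows the two sides agree by unfolding. Their cells are both fillers
  through the same lift in \<open>T\<close>: one compares the composite image directly, the other
  passes through the lift chosen in \<open>S\<close>.\<close>

lemma Lmap_comp:
  assumes "species_map R S \<phi>" "species_map S T \<psi>"
  shows "Lmap R (comp_ftor (Tot R) \<psi> \<phi>) T = comp_sgmap (Lsgpd R) (Lsgpd T) (Lmap S \<psi> T) (Lmap R \<phi> S)"
proof -
  interpret F: species_map R S \<phi> by fact
  interpret G: species_map S T \<psi> by fact
  let ?c = "comp_ftor (Tot R) \<psi> \<phi>"
  have m: "map_ob ?c x = map_ob \<psi> (map_ob \<phi> x)" if "x \<in> Lobj R n" for x n
    using F.R'.LobjD(1)[OF that] by (cases x) (simp add: comp_ftor_OM)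
  have "Cpt (Lmap R ?c T) n = comp_ftor (Lcat R n) (Cpt (Lmap S \<psi> T) n) (Cpt (Lmap R \<phi> S) n)" for n
  proof -
    have "OM (Cpt (Lmap R ?c T) n) = OM (comp_ftor (Lcat R n) (Cpt (Lmap S \<psi> T) n) (Cpt (Lmap R \<phi> S) n))"
      by (auto simp: comp_ftor_def[of "Lcat R n"] compose_def Lmap_def m F.map_ob_Lobj
          simp del: map_ob.simps intro!: restrict_ext)
    moreover have "AM (Cpt (Lmap R ?c T) n) = AM (comp_ftor (Lcat R n) (Cpt (Lmap S \<psi> T) n) (Cpt (Lmap R \<phi> S) n))"
    proof -
      have "AM (Cpt (Lmap R ?c T) n) \<alpha> = AM (comp_ftor (Lcat R n) (Cpt (Lmap S \<psi> T) n) (Cpt (Lmap R \<phi> S) n)) \<alpha>"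
        if \<alpha>: "\<alpha> \<in> Ar (Lcat R n)" for \<alpha>
      proof -
        obtain x a y where e: "\<alpha> = (x, a, y)" by (cases \<alpha>)
        have "x \<in> Lobj R n" "y \<in> Lobj R n" "a \<in> Ar (Tot R)" using \<alpha> by (auto simp: e Lcat_Ar hom_iff)
        then show ?thesis
          using \<alpha> F.Lcat_map[of x a y n] unfolding e
          by (simp add: comp_ftor_AM F.Lmap_Cpt G.Lmap_Cpt m del: map_ob.simps)
            (simp add: Lmap_def comp_ftor_AM m del: map_ob.simps)
      qed
      then show ?thesis
        by (intro extensionalityI[of _ "Ar (Lcat R n)"]) (auto simp: Lmap_def comp_ftor_def)
    qed
    ultimately show ?thesis by (simp add: comp_ftor_def)
  qed
  moreover have "Cel (Lmap R ?c T) = Cel (comp_sgmap (Lsgpd R) (Lsgpd T) (Lmap S \<psi> T) (Lmap R \<phi> S))"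
  proof -
    have "Cel (Lmap R ?c T) f x = Cel (comp_sgmap (Lsgpd R) (Lsgpd T) (Lmap S \<psi> T) (Lmap R \<phi> S)) f x"
      if f: "f \<in> Ar Delta" and x: "x \<in> Lobj R (Tgt Delta f)" for f x
    proof -
      define i where "i = Src Delta f"
      define j where "j = Tgt Delta f"
      have fh: "f \<in> hom Delta i j" using f by (simp add: hom_iff i_def j_def)
      have xj: "x \<in> Lobj R j" using x by (simp add: j_def)
      define x1 where "x1 = map_ob \<phi> x"
      have x1: "x1 \<in> Lobj S j" using F.map_ob_Lobj[OF xj] by (simp add: x1_def)
      have x2: "map_ob \<psi> x1 \<in> Lobj T j" using G.map_ob_Lobj[OF x1] .
      define L0 where "L0 = Llift R f x"
      define L1 where "L1 = Llift S f x1"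
      define L2 where "L2 = Llift T f (map_ob \<psi> x1)"
      define t1 where "t1 = fill (Tot S) L1 (AM \<phi> L0)"
      define t2 where "t2 = fill (Tot T) L2 (AM \<psi> L1)"
      have y: "OM (Lact R f) x \<in> Lobj R i"
        using lovD(2)[OF F.R'.Lact_lov[OF f x]] by (simp add: i_def)
      note C1 = F.Cel_Lmap[OF fh xj, folded x1_def L0_def, folded L1_def, folded t1_def]
      note C2 = G.Cel_Lmap[OF fh x1, folded L1_def L2_def, folded t2_def]
      have L0A: "L0 \<in> Ar (Tot R)" using lovD(4)[OF F.R'.Lact_lov[OF f x]] by (simp add: L0_def)
      have L1: "L1 \<in> Ar (Tot S)" "Src (Tot S) L1 = str (OM (Lact S f) x1)" "Tgt (Tot S) L1 = str x1"
        using lovD[OF F.R.Lact_lov[OF f, of x1]] x1 by (auto simp: L1_def j_def)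
      have L2: "L2 \<in> Ar (Tot T)" "Src (Tot T) L2 = str (OM (Lact T f) (map_ob \<psi> x1))" "Tgt (Tot T) L2 = str (map_ob \<psi> x1)"
        using lovD[OF G.R.Lact_lov[OF f, of "map_ob \<psi> x1"]] x2 by (auto simp: L2_def j_def)
      have t1: "t1 \<in> Ar (Tot S)" "Src (Tot S) t1 = OM \<phi> (str (OM (Lact R f) x))" "Tgt (Tot S) t1 = str (OM (Lact S f) x1)"
        using C1(1) by (auto simp: Lcat_Ar hom_iff)
      have t2: "t2 \<in> Ar (Tot T)" "Src (Tot T) t2 = OM \<psi> (str (OM (Lact S f) x1))"
        "Tgt (Tot T) t2 = str (OM (Lact T f) (map_ob \<psi> x1))"
        using C2(1) by (auto simp: Lcat_Ar hom_iff)
      \<comment> \<open>Here \<open>t1\<close> compares the image of the lift in \<open>R\<close>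
        with the lift in \<open>S\<close>, and \<open>t2\<close> the image of the latter with the
        lift in \<open>T\<close>. The composite of \<open>t2\<close> with the image of
        \<open>t1\<close> solves the direct comparison, hence is the filler.\<close>
      have "L2 \<cdot>\<^bsub>Tot T\<^esub> (t2 \<cdot>\<^bsub>Tot T\<^esub> AM \<psi> t1) = AM \<psi> (L1 \<cdot>\<^bsub>Tot S\<^esub> t1)"
        using G.R.E.cmp_cmp_eq[OF C2(2), of "AM \<psi> t1"] L1 L2 t1 t2 by (simp add: G.map_simps)
      then have fill: "fill (Tot T) L2 (AM \<psi> (AM \<phi> L0)) = t2 \<cdot>\<^bsub>Tot T\<^esub> AM \<psi> t1"
        using L1 L2 t1 t2 C1(2) L0A F.map_simps(3)[OF L0A] lovD(5)[OF F.R'.Lact_lov[OF f x]]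
        by (intro G.R.fill_eq) (auto simp: hom_iff G.map_simps F.map_simps L0_def)
      have "Cel (Lmap R ?c T) f x = (map_ob \<psi> (map_ob \<phi> (OM (Lact R f) x)), t2 \<cdot>\<^bsub>Tot T\<^esub> AM \<psi> t1, OM (Lact T f) (map_ob \<psi> x1))"
        using f x L0A fill by (simp add: Lmap_def m[OF xj] m[OF y] comp_ftor_AM x1_def[symmetric] L0_def[symmetric] L2_def[symmetric])
      moreover have "Cel (comp_sgmap (Lsgpd R) (Lsgpd T) (Lmap S \<psi> T) (Lmap R \<phi> S)) f x =
         Cel (Lmap S \<psi> T) f x1 \<cdot>\<^bsub>Lcat T i\<^esub> AM (Cpt (Lmap S \<psi> T) i) (Cel (Lmap R \<phi> S) f x)"
        using f x by (simp add: comp_sgmap_def i_def j_def[symmetric] x1_def F.Lmap_Cpt xj)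
      moreover have "\<dots> = (map_ob \<psi> (map_ob \<phi> (OM (Lact R f) x)), t2 \<cdot>\<^bsub>Tot T\<^esub> AM \<psi> t1, OM (Lact T f) (map_ob \<psi> x1))"
        using C1(1) by (simp add: F.Lmap_Cel[OF fh xj, folded x1_def L0_def, folded L1_def, folded t1_def]
          G.Lmap_Cel[OF fh x1, folded L1_def L2_def, folded t2_def] G.Lmap_Cpt)
      ultimately show ?thesis by simp
    qed
    then have "Cel (Lmap R ?c T) f = Cel (comp_sgmap (Lsgpd R) (Lsgpd T) (Lmap S \<psi> T) (Lmap R \<phi> S)) f" if "f \<in> Ar Delta" for f
      using that by (intro extensionalityI[of _ "Lobj R (Tgt Delta f)"]) (auto simp: Lmap_def comp_sgmap_def)
    then show ?thesis
      by (intro extensionalityI[of _ "Ar Delta"]) (auto simp: Lmap_def comp_sgmap_def)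
  qed
  ultimately show ?thesis by (simp add: comp_sgmap_def Lmap_def fun_eq_iff)
qed

lemma speciesI: "directed_restriction_species R \<Longrightarrow> species R"
  by (rule species.intro)

lemma species_mapI:
  "directed_restriction_species R' \<Longrightarrow> directed_restriction_species R \<Longrightarrow> drs_morphism R' R \<phi> \<Longrightarrow> species_map R' R \<phi>"
  by (simp add: species_map_def species_def species_map_axioms_def)

lemma DRS_simps [simp]:
  "R \<in> Ob DRS \<longleftrightarrow> directed_restriction_species R"
  "(R', \<phi>, R) \<in> Ar DRS \<longleftrightarrow> directed_restriction_species R' \<and> directed_restriction_species R \<and> drs_morphism R' R \<phi>"
  "Src DRS (R', \<phi>, R) = R'" "Tgt DRS (R', \<phi>, R) = R" "Ide DRS R = (R, id_ftor (Tot R), R)"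
  "(S', \<psi>, S) \<cdot>\<^bsub>DRS\<^esub> (R', \<phi>, R) = (R', comp_ftor (Tot R') \<psi> \<phi>, S)"
  by (auto simp: DRS_def)

lemma Dcmp_simps [simp]:
  "X \<in> Ob Dcmp \<longleftrightarrow> decomposition_space X"
  "(X, F, Y) \<in> Ar Dcmp \<longleftrightarrow> decomposition_space X \<and> decomposition_space Y \<and> culf X Y F"
  "Src Dcmp (X, F, Y) = X" "Tgt Dcmp (X, F, Y) = Y" "Ide Dcmp X = (X, id_sgmap X, X)"
  "(Y', G, Z) \<cdot>\<^bsub>Dcmp\<^esub> (X, F, Y) = (X, comp_sgmap X Z G F, Z)"
  by (auto simp: Dcmp_def)

lemma drs_morphism_id: "directed_restriction_species R \<Longrightarrow> drs_morphism R R (id_ftor (Tot R))"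
  using species.Prj_functor[OF speciesI] comp_id_ftor is_functor_id[of "Tot R"]
  by (auto simp: drs_morphism_def directed_restriction_species_def right_fibration_def)

lemma drs_morphism_comp:
  assumes "directed_restriction_species R" "drs_morphism R S \<phi>" "drs_morphism S T \<psi>"
  shows "drs_morphism R T (comp_ftor (Tot R) \<psi> \<phi>)"
proof -
  interpret species R by (rule speciesI) fact
  show ?thesis
    using assms is_functor_comp[of "Tot R" "Tot S" \<phi> "Tot T" \<psi>] E.category
      comp_ftor_assoc[of "Tot R" "Tot S" \<phi> "Prj T" \<psi>]
    by (auto simp: drs_morphism_def)
qed

theorem Lay_functor: "is_functor DRS Dcmp Lay"
proof (rule functorI)
  show "OM Lay R \<in> Ob Dcmp" if "R \<in> Ob DRS" for R
    using that species.decomposition_space_Lsgpd[OF speciesI] by (simp add: Lay_def)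
  show "AM Lay a \<in> hom Dcmp (OM Lay (Src DRS a)) (OM Lay (Tgt DRS a))" if "a \<in> Ar DRS" for a
  proof -
    obtain R' \<phi> R where a: "a = (R', \<phi>, R)" by (cases a)
    show ?thesis
      using that by (auto simp: a Lay_def hom_iff intro!: species.decomposition_space_Lsgpd speciesI
          species_map.culf_Lmap species_mapI)
  qed
  show "AM Lay (Ide DRS R) = Ide Dcmp (OM Lay R)" if "R \<in> Ob DRS" for R
    using that species.Lmap_id[OF speciesI] by (simp add: Lay_def drs_morphism_id)
  show "AM Lay (b \<cdot>\<^bsub>DRS\<^esub> a) = AM Lay b \<cdot>\<^bsub>Dcmp\<^esub> AM Lay a"
    if ab: "a \<in> Ar DRS" "b \<in> Ar DRS" "Src DRS b = Tgt DRS a" for a b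
  proof -
    obtain R \<phi> S \<psi> T where e: "a = (R, \<phi>, S)" "b = (S, \<psi>, T)" using ab(3) by (cases a; cases b) auto
    show ?thesis
      using ab Lmap_comp[OF species_mapI species_mapI, of R S \<phi> T \<psi>] drs_morphism_comp[of R S \<phi> T \<psi>]
      by (simp add: e Lay_def)
  qed
qed (auto simp: Lay_def)

section \<open>Monoidal simplicial groupoids with cartesian lifts\<close>

locale moncat = cat E for E :: "('o, 'a) cat" +
  fixes M :: "('o, 'a) monoidal"
  assumes monoidal: "monoidal_category E M"
begin

lemma Tns_functor: "is_functor (prod_cat E E) E (Tns M)"
  using monoidal by (simp add: monoidal_category_def)

lemma tns_simps [simp]:
  "x \<in> Ob E \<Longrightarrow> y \<in> Ob E \<Longrightarrow> x \<otimes>\<^bsub>M\<^esub> y \<in> Ob E"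
  "a \<in> Ar E \<Longrightarrow> b \<in> Ar E \<Longrightarrow> a \<odot>\<^bsub>M\<^esub> b \<in> Ar E"
  "a \<in> Ar E \<Longrightarrow> b \<in> Ar E \<Longrightarrow> Src E (a \<odot>\<^bsub>M\<^esub> b) = Src E a \<otimes>\<^bsub>M\<^esub> Src E b"
  "a \<in> Ar E \<Longrightarrow> b \<in> Ar E \<Longrightarrow> Tgt E (a \<odot>\<^bsub>M\<^esub> b) = Tgt E a \<otimes>\<^bsub>M\<^esub> Tgt E b"
  "x \<in> Ob E \<Longrightarrow> y \<in> Ob E \<Longrightarrow> Ide E x \<odot>\<^bsub>M\<^esub> Ide E y = Ide E (x \<otimes>\<^bsub>M\<^esub> y)"
  using functorD(1)[OF Tns_functor, of "(x, y)"] functorD(2-4)[OF Tns_functor, of "(a, b)"]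
    functorD(5)[OF Tns_functor, of "(x, y)"] by auto

lemma tns_cmp [simp]:
  assumes "a \<in> Ar E" "b \<in> Ar E" "Src E b = Tgt E a" "a' \<in> Ar E" "b' \<in> Ar E" "Src E b' = Tgt E a'"
  shows "(b \<odot>\<^bsub>M\<^esub> b') \<cdot>\<^bsub>E\<^esub> (a \<odot>\<^bsub>M\<^esub> a') = (b \<cdot>\<^bsub>E\<^esub> a) \<odot>\<^bsub>M\<^esub> (b' \<cdot>\<^bsub>E\<^esub> a')"
    "c \<in> Ar E \<Longrightarrow> Tgt E c = Src E a \<otimes>\<^bsub>M\<^esub> Src E a' \<Longrightarrow>
      (b \<odot>\<^bsub>M\<^esub> b') \<cdot>\<^bsub>E\<^esub> (a \<odot>\<^bsub>M\<^esub> a') \<cdot>\<^bsub>E\<^esub> c = ((b \<cdot>\<^bsub>E\<^esub> a) \<odot>\<^bsub>M\<^esub> (b' \<cdot>\<^bsub>E\<^esub> a')) \<cdot>\<^bsub>E\<^esub> c"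
proof -
  show *: "(b \<odot>\<^bsub>M\<^esub> b') \<cdot>\<^bsub>E\<^esub> (a \<odot>\<^bsub>M\<^esub> a') = (b \<cdot>\<^bsub>E\<^esub> a) \<odot>\<^bsub>M\<^esub> (b' \<cdot>\<^bsub>E\<^esub> a')"
    using functorD(6)[OF Tns_functor, of "(a, a')" "(b, b')"] assms by simp
  show "(b \<odot>\<^bsub>M\<^esub> b') \<cdot>\<^bsub>E\<^esub> (a \<odot>\<^bsub>M\<^esub> a') \<cdot>\<^bsub>E\<^esub> c = ((b \<cdot>\<^bsub>E\<^esub> a) \<odot>\<^bsub>M\<^esub> (b' \<cdot>\<^bsub>E\<^esub> a')) \<cdot>\<^bsub>E\<^esub> c"
    if "c \<in> Ar E" "Tgt E c = Src E a \<otimes>\<^bsub>M\<^esub> Src E a'"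
    using that assms by (subst cmp_cmp_eq[OF *]) auto
qed

lemma Unt_Ob [simp]: "Unt M \<in> Ob E"
  using monoidal by (simp add: monoidal_category_def)

lemma constraint_simps [simp]:
  "x \<in> Ob E \<Longrightarrow> y \<in> Ob E \<Longrightarrow> z \<in> Ob E \<Longrightarrow> Asc M x y z \<in> Ar E"
  "x \<in> Ob E \<Longrightarrow> y \<in> Ob E \<Longrightarrow> z \<in> Ob E \<Longrightarrow> Src E (Asc M x y z) = (x \<otimes>\<^bsub>M\<^esub> y) \<otimes>\<^bsub>M\<^esub> z"
  "x \<in> Ob E \<Longrightarrow> y \<in> Ob E \<Longrightarrow> z \<in> Ob E \<Longrightarrow> Tgt E (Asc M x y z) = x \<otimes>\<^bsub>M\<^esub> (y \<otimes>\<^bsub>M\<^esub> z)"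
  "x \<in> Ob E \<Longrightarrow> Lun M x \<in> Ar E" "x \<in> Ob E \<Longrightarrow> Src E (Lun M x) = Unt M \<otimes>\<^bsub>M\<^esub> x" "x \<in> Ob E \<Longrightarrow> Tgt E (Lun M x) = x"
  "x \<in> Ob E \<Longrightarrow> Run M x \<in> Ar E" "x \<in> Ob E \<Longrightarrow> Src E (Run M x) = x \<otimes>\<^bsub>M\<^esub> Unt M" "x \<in> Ob E \<Longrightarrow> Tgt E (Run M x) = x"
  using monoidal by (auto simp: monoidal_category_def hom_iff)

lemma constraint_iso:
  "x \<in> Ob E \<Longrightarrow> y \<in> Ob E \<Longrightarrow> z \<in> Ob E \<Longrightarrow> is_iso E (Asc M x y z)"
  "x \<in> Ob E \<Longrightarrow> is_iso E (Lun M x)" "x \<in> Ob E \<Longrightarrow> is_iso E (Run M x)"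
  using monoidal by (auto simp: monoidal_category_def)

lemma naturality:
  "a \<in> Ar E \<Longrightarrow> b \<in> Ar E \<Longrightarrow> c \<in> Ar E \<Longrightarrow> Asc M (Tgt E a) (Tgt E b) (Tgt E c) \<cdot>\<^bsub>E\<^esub> ((a \<odot>\<^bsub>M\<^esub> b) \<odot>\<^bsub>M\<^esub> c)
        = (a \<odot>\<^bsub>M\<^esub> (b \<odot>\<^bsub>M\<^esub> c)) \<cdot>\<^bsub>E\<^esub> Asc M (Src E a) (Src E b) (Src E c)"
  "a \<in> Ar E \<Longrightarrow> Lun M (Tgt E a) \<cdot>\<^bsub>E\<^esub> (Ide E (Unt M) \<odot>\<^bsub>M\<^esub> a) = a \<cdot>\<^bsub>E\<^esub> Lun M (Src E a)"
  "a \<in> Ar E \<Longrightarrow> Run M (Tgt E a) \<cdot>\<^bsub>E\<^esub> (a \<odot>\<^bsub>M\<^esub> Ide E (Unt M)) = a \<cdot>\<^bsub>E\<^esub> Run M (Src E a)"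
  using monoidal unfolding monoidal_category_def by blast+

lemma coherence:
  "w \<in> Ob E \<Longrightarrow> x \<in> Ob E \<Longrightarrow> y \<in> Ob E \<Longrightarrow> z \<in> Ob E \<Longrightarrow>
    Asc M w x (y \<otimes>\<^bsub>M\<^esub> z) \<cdot>\<^bsub>E\<^esub> Asc M (w \<otimes>\<^bsub>M\<^esub> x) y z
        = (Ide E w \<odot>\<^bsub>M\<^esub> Asc M x y z) \<cdot>\<^bsub>E\<^esub> Asc M w (x \<otimes>\<^bsub>M\<^esub> y) z \<cdot>\<^bsub>E\<^esub> (Asc M w x y \<odot>\<^bsub>M\<^esub> Ide E z)"
  "x \<in> Ob E \<Longrightarrow> y \<in> Ob E \<Longrightarrow> (Ide E x \<odot>\<^bsub>M\<^esub> Lun M y) \<cdot>\<^bsub>E\<^esub> Asc M x (Unt M) y = Run M x \<odot>\<^bsub>M\<^esub> Ide E y"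
  using monoidal unfolding monoidal_category_def by blast+

end

text \<open>The monoidal unit as a functor from the terminal category; it plays for the unit map the
  role that the functor \<open>Tns M\<close> plays for the tensor.\<close>

definition unit_ftor :: "('o, 'a) cat \<Rightarrow> ('o, 'a) monoidal \<Rightarrow> (unit, unit, 'o, 'a) ftor" where
  "unit_ftor E M = \<lparr>OM = (\<lambda>_. Unt M), AM = (\<lambda>_. Ide E (Unt M))\<rparr>"

lemma unit_ftor_simps [simp]: "OM (unit_ftor E M) x = Unt M" "AM (unit_ftor E M) a = Ide E (Unt M)"
  by (simp_all add: unit_ftor_def)

text \<open>A monoidal structure on \<open>X\<close> that lies over one on \<open>E\<close>: tensor
  and unit are maps over those of \<open>E\<close>, and associator and unitors have the constraints
  of \<open>E\<close> as underlying arrows. The axioms in each degree and their compatibility with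
  the simplicial structure are inherited from \<open>E\<close>.\<close>

locale fibred_monoidal =
  X: fibred "Base MX" E u am ov lift +
  E: moncat E M +
  T: fibred_map "prod_sgpd (Base MX) (Base MX)" "prod_cat E E" "map_prod u u" "map_prod am am"
    "\<lambda>f z x a. ov f (fst z) (fst x) (fst a) \<and> ov f (snd z) (snd x) (snd a)" "\<lambda>f x. (lift f (fst x), lift f (snd x))"
    "Base MX" E u am ov lift "PTns MX" "Tns M" +
  I: fibred_map unit_sgpd unit_cat id id "\<lambda>f z x a. f \<in> Ar Delta" "\<lambda>f x. ()"
    "Base MX" E u am ov lift "PUnt MX" "unit_ftor E M"
  for MX :: "('w, 'b) msgpd" and E :: "('o, 'a) cat" and u am ov lift M +
  assumes PAsc: "x \<in> Ob (Val (Base MX) n) \<Longrightarrow> y \<in> Ob (Val (Base MX) n) \<Longrightarrow> z \<in> Ob (Val (Base MX) n) \<Longrightarrow>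
      PAsc MX n x y z \<in> hom (Val (Base MX) n)
        ((x \<otimes>\<^bsub>mon_at MX n\<^esub> y) \<otimes>\<^bsub>mon_at MX n\<^esub> z) (x \<otimes>\<^bsub>mon_at MX n\<^esub> (y \<otimes>\<^bsub>mon_at MX n\<^esub> z)) \<and>
      am (PAsc MX n x y z) = Asc M (u x) (u y) (u z)"
    and PLun: "x \<in> Ob (Val (Base MX) n) \<Longrightarrow>
      PLun MX n x \<in> hom (Val (Base MX) n) (Unt (mon_at MX n) \<otimes>\<^bsub>mon_at MX n\<^esub> x) x \<and> am (PLun MX n x) = Lun M (u x)"
    and PRun: "x \<in> Ob (Val (Base MX) n) \<Longrightarrow>
      PRun MX n x \<in> hom (Val (Base MX) n) (x \<otimes>\<^bsub>mon_at MX n\<^esub> Unt (mon_at MX n)) x \<and> am (PRun MX n x) = Run M (u x)"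
begin

abbreviation V where "V \<equiv> Val (Base MX)"
abbreviation N where "N \<equiv> mon_at MX"

lemma mon_at_simps [simp]: "Tns (N n) = Cpt (PTns MX) n" "Unt (N n) = OM (Cpt (PUnt MX) n) ()"
  "Asc (N n) = PAsc MX n" "Lun (N n) = PLun MX n" "Run (N n) = PRun MX n"
  by (simp_all add: mon_at_def)

lemma PAsc_simps [simp]:
  assumes "x \<in> Ob (V n)" "y \<in> Ob (V n)" "z \<in> Ob (V n)"
  shows "PAsc MX n x y z \<in> Ar (V n)" "Src (V n) (PAsc MX n x y z) = (x \<otimes>\<^bsub>N n\<^esub> y) \<otimes>\<^bsub>N n\<^esub> z"
    "Tgt (V n) (PAsc MX n x y z) = x \<otimes>\<^bsub>N n\<^esub> (y \<otimes>\<^bsub>N n\<^esub> z)" "am (PAsc MX n x y z) = Asc M (u x) (u y) (u z)"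
  using PAsc[OF assms] by (auto simp: hom_iff)

lemma PLun_simps [simp]:
  assumes "x \<in> Ob (V n)"
  shows "PLun MX n x \<in> Ar (V n)" "Src (V n) (PLun MX n x) = Unt (N n) \<otimes>\<^bsub>N n\<^esub> x"
    "Tgt (V n) (PLun MX n x) = x" "am (PLun MX n x) = Lun M (u x)"
  using PLun[OF assms] by (auto simp: hom_iff)

lemma PRun_simps [simp]:
  assumes "x \<in> Ob (V n)"
  shows "PRun MX n x \<in> Ar (V n)" "Src (V n) (PRun MX n x) = x \<otimes>\<^bsub>N n\<^esub> Unt (N n)"
    "Tgt (V n) (PRun MX n x) = x" "am (PRun MX n x) = Run M (u x)"
  using PRun[OF assms] by (auto simp: hom_iff)

lemma tns_at [simp]:
  "x \<in> Ob (V n) \<Longrightarrow> y \<in> Ob (V n) \<Longrightarrow> OM (Cpt (PTns MX) n) (x, y) \<in> Ob (V n)"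
  "x \<in> Ob (V n) \<Longrightarrow> y \<in> Ob (V n) \<Longrightarrow> u (OM (Cpt (PTns MX) n) (x, y)) = u x \<otimes>\<^bsub>M\<^esub> u y"
  "\<alpha> \<in> Ar (V n) \<Longrightarrow> \<beta> \<in> Ar (V n) \<Longrightarrow> AM (Cpt (PTns MX) n) (\<alpha>, \<beta>) \<in> Ar (V n)"
  "\<alpha> \<in> Ar (V n) \<Longrightarrow> \<beta> \<in> Ar (V n) \<Longrightarrow> Src (V n) (AM (Cpt (PTns MX) n) (\<alpha>, \<beta>)) = OM (Cpt (PTns MX) n) (Src (V n) \<alpha>, Src (V n) \<beta>)"
  "\<alpha> \<in> Ar (V n) \<Longrightarrow> \<beta> \<in> Ar (V n) \<Longrightarrow> Tgt (V n) (AM (Cpt (PTns MX) n) (\<alpha>, \<beta>)) = OM (Cpt (PTns MX) n) (Tgt (V n) \<alpha>, Tgt (V n) \<beta>)"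
  "\<alpha> \<in> Ar (V n) \<Longrightarrow> \<beta> \<in> Ar (V n) \<Longrightarrow> am (AM (Cpt (PTns MX) n) (\<alpha>, \<beta>)) = am \<alpha> \<odot>\<^bsub>M\<^esub> am \<beta>"
  using T.Cpt_simps(1)[of "(x, y)" n] T.u_Cpt[of "(x, y)" n] T.Cpt_simps(2-4)[of "(\<alpha>, \<beta>)" n] T.am_Cpt[of "(\<alpha>, \<beta>)" n]
  by auto

lemma unit_at [simp]:
  "OM (Cpt (PUnt MX) n) () \<in> Ob (V n)" "u (OM (Cpt (PUnt MX) n) ()) = Unt M"
  using I.Cpt_simps(1)[of "()" n] I.u_Cpt[of "()" n] by auto

lemma am_u_Ob [simp]: "x \<in> Ob (V n) \<Longrightarrow> u x \<in> Ob E"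
  by (rule X.u_Ob)

lemma u_Act_Ob [simp]: "f \<in> Ar Delta \<Longrightarrow> x \<in> Ob (V (Tgt Delta f)) \<Longrightarrow> u (OM (Act (Base MX) f) x) \<in> Ob E"
  using X.u_Ob[OF X.Act_Ob[OF _ _ refl]] .

lemma V_eqI:
  assumes "\<alpha> \<in> Ar (V n)" "\<beta> \<in> Ar (V n)" "Src (V n) \<alpha> = Src (V n) \<beta>" "Tgt (V n) \<alpha> = Tgt (V n) \<beta>" "am \<alpha> = am \<beta>"
  shows "\<alpha> = \<beta>"
  using assms by (intro X.am_inj[of \<alpha> n "Src (V n) \<beta>" "Tgt (V n) \<beta>" \<beta>]) (auto simp: hom_iff)

text \<open>Each equation holds between underlying arrows in \<open>E\<close>, and arrows with the
  same ends and the same underlying arrow are equal.\<close>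

lemma monoidal_at: "monoidal_category (V n) (N n)"
  unfolding monoidal_category_def
proof (intro conjI ballI)
  show "category (V n)" by (rule X.category_Val)
  show "is_functor (prod_cat (V n) (V n)) (V n) (Tns (N n))"
    using T.functor_Cpt[of n] by simp
next
  fix a b c assume abc: "a \<in> Ar (V n)" "b \<in> Ar (V n)" "c \<in> Ar (V n)"
  note [simp] = X.am_Ar[OF abc(1)] X.am_Ar[OF abc(2)] X.am_Ar[OF abc(3)]
  have "am (Asc (N n) (Tgt (V n) a) (Tgt (V n) b) (Tgt (V n) c) \<cdot>\<^bsub>V n\<^esub> ((a \<odot>\<^bsub>N n\<^esub> b) \<odot>\<^bsub>N n\<^esub> c))
        = am ((a \<odot>\<^bsub>N n\<^esub> (b \<odot>\<^bsub>N n\<^esub> c)) \<cdot>\<^bsub>V n\<^esub> Asc (N n) (Src (V n) a) (Src (V n) b) (Src (V n) c))"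
    using abc E.naturality(1)[of "am a" "am b" "am c"] by simp
  then show "Asc (N n) (Tgt (V n) a) (Tgt (V n) b) (Tgt (V n) c) \<cdot>\<^bsub>V n\<^esub> ((a \<odot>\<^bsub>N n\<^esub> b) \<odot>\<^bsub>N n\<^esub> c)
        = (a \<odot>\<^bsub>N n\<^esub> (b \<odot>\<^bsub>N n\<^esub> c)) \<cdot>\<^bsub>V n\<^esub> Asc (N n) (Src (V n) a) (Src (V n) b) (Src (V n) c)"
    by (rule V_eqI[where n = n, rotated 4]) (use abc in auto)
next
  fix a assume a: "a \<in> Ar (V n)"
  note [simp] = X.am_Ar[OF a]
  have "am (Lun (N n) (Tgt (V n) a) \<cdot>\<^bsub>V n\<^esub> (Ide (V n) (Unt (N n)) \<odot>\<^bsub>N n\<^esub> a)) = am (a \<cdot>\<^bsub>V n\<^esub> Lun (N n) (Src (V n) a))"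
    using a E.naturality(2)[of "am a"] by simp
  then show "Lun (N n) (Tgt (V n) a) \<cdot>\<^bsub>V n\<^esub> (Ide (V n) (Unt (N n)) \<odot>\<^bsub>N n\<^esub> a) = a \<cdot>\<^bsub>V n\<^esub> Lun (N n) (Src (V n) a)"
    by (rule V_eqI[where n = n, rotated 4]) (use a in auto)
  have "am (Run (N n) (Tgt (V n) a) \<cdot>\<^bsub>V n\<^esub> (a \<odot>\<^bsub>N n\<^esub> Ide (V n) (Unt (N n)))) = am (a \<cdot>\<^bsub>V n\<^esub> Run (N n) (Src (V n) a))"
    using a E.naturality(3)[of "am a"] by simp
  then show "Run (N n) (Tgt (V n) a) \<cdot>\<^bsub>V n\<^esub> (a \<odot>\<^bsub>N n\<^esub> Ide (V n) (Unt (N n))) = a \<cdot>\<^bsub>V n\<^esub> Run (N n) (Src (V n) a)"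
    by (rule V_eqI[where n = n, rotated 4]) (use a in auto)
next
  fix w x y z assume w: "w \<in> Ob (V n)" "x \<in> Ob (V n)" "y \<in> Ob (V n)" "z \<in> Ob (V n)"
  have "am (Asc (N n) w x (y \<otimes>\<^bsub>N n\<^esub> z) \<cdot>\<^bsub>V n\<^esub> Asc (N n) (w \<otimes>\<^bsub>N n\<^esub> x) y z)
        = am ((Ide (V n) w \<odot>\<^bsub>N n\<^esub> Asc (N n) x y z) \<cdot>\<^bsub>V n\<^esub> Asc (N n) w (x \<otimes>\<^bsub>N n\<^esub> y) z \<cdot>\<^bsub>V n\<^esub> (Asc (N n) w x y \<odot>\<^bsub>N n\<^esub> Ide (V n) z))"
    using w E.coherence(1)[of "u w" "u x" "u y" "u z"] by simp
  then show "Asc (N n) w x (y \<otimes>\<^bsub>N n\<^esub> z) \<cdot>\<^bsub>V n\<^esub> Asc (N n) (w \<otimes>\<^bsub>N n\<^esub> x) y z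
        = (Ide (V n) w \<odot>\<^bsub>N n\<^esub> Asc (N n) x y z) \<cdot>\<^bsub>V n\<^esub> Asc (N n) w (x \<otimes>\<^bsub>N n\<^esub> y) z \<cdot>\<^bsub>V n\<^esub> (Asc (N n) w x y \<odot>\<^bsub>N n\<^esub> Ide (V n) z)"
    by (rule V_eqI[where n = n, rotated 4]) (use w in auto)
next
  fix x y assume x: "x \<in> Ob (V n)" "y \<in> Ob (V n)"
  have "am ((Ide (V n) x \<odot>\<^bsub>N n\<^esub> Lun (N n) y) \<cdot>\<^bsub>V n\<^esub> Asc (N n) x (Unt (N n)) y) = am (Run (N n) x \<odot>\<^bsub>N n\<^esub> Ide (V n) y)"
    using x E.coherence(2)[of "u x" "u y"] by simp
  then show "(Ide (V n) x \<odot>\<^bsub>N n\<^esub> Lun (N n) y) \<cdot>\<^bsub>V n\<^esub> Asc (N n) x (Unt (N n)) y = Run (N n) x \<odot>\<^bsub>N n\<^esub> Ide (V n) y"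
    by (rule V_eqI[where n = n, rotated 4]) (use x in auto)
qed (auto simp: hom_iff)

lemma Cel_tns [simp]:
  assumes "f \<in> Ar Delta" "x \<in> Ob (V (Tgt Delta f))" "y \<in> Ob (V (Tgt Delta f))"
  shows "n = Src Delta f \<Longrightarrow> Cel (PTns MX) f (x, y) \<in> Ar (V n)"
    "n = Src Delta f \<Longrightarrow> Src (V n) (Cel (PTns MX) f (x, y)) = OM (Cpt (PTns MX) n) (OM (Act (Base MX) f) x, OM (Act (Base MX) f) y)"
    "n = Src Delta f \<Longrightarrow> Tgt (V n) (Cel (PTns MX) f (x, y)) = OM (Act (Base MX) f) (OM (Cpt (PTns MX) (Tgt Delta f)) (x, y))"
    "am (Cel (PTns MX) f (x, y)) \<in> Ar E"
    "Src E (am (Cel (PTns MX) f (x, y))) = u (OM (Act (Base MX) f) x) \<otimes>\<^bsub>M\<^esub> u (OM (Act (Base MX) f) y)"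
    "Tgt E (am (Cel (PTns MX) f (x, y))) = u (OM (Act (Base MX) f) (OM (Cpt (PTns MX) (Tgt Delta f)) (x, y)))"
  using T.Cel_Ar[of f "(x, y)" n] T.am_Cel[of f "(x, y)"] assms by simp_all

lemma lift_Cel_tns [simp]:
  assumes "f \<in> Ar Delta" "x \<in> Ob (V (Tgt Delta f))" "y \<in> Ob (V (Tgt Delta f))" "n = Tgt Delta f"
  shows "lift f (OM (Cpt (PTns MX) n) (x, y)) \<cdot>\<^bsub>E\<^esub> am (Cel (PTns MX) f (x, y)) = lift f x \<odot>\<^bsub>M\<^esub> lift f y"
    "t \<in> Ar E \<Longrightarrow> Tgt E t = u (OM (Act (Base MX) f) x) \<otimes>\<^bsub>M\<^esub> u (OM (Act (Base MX) f) y) \<Longrightarrow>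
      lift f (OM (Cpt (PTns MX) n) (x, y)) \<cdot>\<^bsub>E\<^esub> am (Cel (PTns MX) f (x, y)) \<cdot>\<^bsub>E\<^esub> t = (lift f x \<odot>\<^bsub>M\<^esub> lift f y) \<cdot>\<^bsub>E\<^esub> t"
  using T.lift_Cel(1)[of f "(x, y)" "OM (Cpt (PTns MX) n) (x, y)"]
    T.lift_Cel(2)[of f "(x, y)" "OM (Cpt (PTns MX) n) (x, y)" t] assms by simp_all

lemma Cel_unt [simp]:
  assumes "f \<in> Ar Delta"
  shows "n = Src Delta f \<Longrightarrow> Cel (PUnt MX) f () \<in> Ar (V n)"
    "n = Src Delta f \<Longrightarrow> Src (V n) (Cel (PUnt MX) f ()) = OM (Cpt (PUnt MX) n) ()"
    "n = Src Delta f \<Longrightarrow> Tgt (V n) (Cel (PUnt MX) f ()) = OM (Act (Base MX) f) (OM (Cpt (PUnt MX) (Tgt Delta f)) ())"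
    "am (Cel (PUnt MX) f ()) \<in> Ar E" "Src E (am (Cel (PUnt MX) f ())) = Unt M"
    "Tgt E (am (Cel (PUnt MX) f ())) = u (OM (Act (Base MX) f) (OM (Cpt (PUnt MX) (Tgt Delta f)) ()))"
  using I.Cel_Ar[of f "()" n] I.am_Cel[of f "()"] assms by simp_all

lemma lift_Cel_unt [simp]:
  assumes "f \<in> Ar Delta" "n = Tgt Delta f"
  shows "lift f (OM (Cpt (PUnt MX) n) ()) \<cdot>\<^bsub>E\<^esub> am (Cel (PUnt MX) f ()) = Ide E (Unt M)"
    "t \<in> Ar E \<Longrightarrow> Tgt E t = Unt M \<Longrightarrow> lift f (OM (Cpt (PUnt MX) n) ()) \<cdot>\<^bsub>E\<^esub> am (Cel (PUnt MX) f ()) \<cdot>\<^bsub>E\<^esub> t = t"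
  using I.lift_Cel(1)[of f "()" "OM (Cpt (PUnt MX) n) ()"]
    I.lift_Cel(2)[of f "()" "OM (Cpt (PUnt MX) n) ()" t] assms by simp_all

text \<open>After composition with a lift, the tensor cells become tensors of lifts. The coherence
  conditions then are the naturality of the constraints of \<open>E\<close>, taken at the lifts of
  the objects involved.\<close>

lemma strong_monoidal_Act:
  assumes fh: "f \<in> hom Delta i j"
  shows "strong_monoidal (V j) (N j) (V i) (N i) (act_mon MX f)"
proof -
  have f: "f \<in> Ar Delta" "Src Delta f = i" "Tgt Delta f = j" using fh by (auto simp: hom_iff)
  have act [simp]: "Und (act_mon MX f) = Act (Base MX) f" "Mul (act_mon MX f) = Cel (PTns MX) f"
    "Uni (act_mon MX f) = Cel (PUnt MX) f ()" by (simp_all add: act_mon_def)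
  let ?A = "Act (Base MX) f"
  show ?thesis
    unfolding strong_monoidal_def
  proof (intro conjI ballI)
    show "is_functor (V j) (V i) (Und (act_mon MX f))" using X.Act_functor[of f] f by simp
    show "Mul (act_mon MX f) \<in> extensional (Ob (V j) \<times> Ob (V j))" using T.Cel_ext(2)[of f] f by simp
    have "Act (prod_sgpd (Base MX) (Base MX)) f = prod_ftor (V j) (V j) ?A ?A"
      using f by (simp add: prod_sgpd_def)
    then show "is_nat_iso (prod_cat (V j) (V j)) (V i)
       (comp_ftor (prod_cat (V j) (V j)) (Tns (N i)) (prod_ftor (V j) (V j) (Und (act_mon MX f)) (Und (act_mon MX f))))
       (comp_ftor (prod_cat (V j) (V j)) (Und (act_mon MX f)) (Tns (N j))) (Mul (act_mon MX f))"
      using T.nat_iso_Cel[OF fh] by simp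
    show "Uni (act_mon MX f) \<in> hom (V i) (Unt (N i)) (OM (Und (act_mon MX f)) (Unt (N j)))"
      "is_iso (V i) (Uni (act_mon MX f))" using f by (auto simp: hom_iff)
  next
    fix x y z assume x: "x \<in> Ob (V j)" and y: "y \<in> Ob (V j)" and z: "z \<in> Ob (V j)"
    have "lift f (OM (Cpt (PTns MX) j) (x, OM (Cpt (PTns MX) j) (y, z))) \<cdot>\<^bsub>E\<^esub>
        am (AM ?A (PAsc MX j x y z) \<cdot>\<^bsub>V i\<^esub> Cel (PTns MX) f (x \<otimes>\<^bsub>N j\<^esub> y, z) \<cdot>\<^bsub>V i\<^esub> (Cel (PTns MX) f (x, y) \<odot>\<^bsub>N i\<^esub> Ide (V i) (OM ?A z)))
      = lift f (OM (Cpt (PTns MX) j) (x, OM (Cpt (PTns MX) j) (y, z))) \<cdot>\<^bsub>E\<^esub>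
        am (Cel (PTns MX) f (x, y \<otimes>\<^bsub>N j\<^esub> z) \<cdot>\<^bsub>V i\<^esub> (Ide (V i) (OM ?A x) \<odot>\<^bsub>N i\<^esub> Cel (PTns MX) f (y, z))
            \<cdot>\<^bsub>V i\<^esub> PAsc MX i (OM ?A x) (OM ?A y) (OM ?A z))"
      using x y z f E.naturality(1)[of "lift f x" "lift f y" "lift f z"] by simp
    from X.lift_cancel[where n = i, OF _ _ _ _ _ _ _ _ this]
    show "AM (Und (act_mon MX f)) (Asc (N j) x y z) \<cdot>\<^bsub>V i\<^esub> Mul (act_mon MX f) (x \<otimes>\<^bsub>N j\<^esub> y, z)
          \<cdot>\<^bsub>V i\<^esub> (Mul (act_mon MX f) (x, y) \<odot>\<^bsub>N i\<^esub> Ide (V i) (OM (Und (act_mon MX f)) z))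
        = Mul (act_mon MX f) (x, y \<otimes>\<^bsub>N j\<^esub> z) \<cdot>\<^bsub>V i\<^esub> (Ide (V i) (OM (Und (act_mon MX f)) x) \<odot>\<^bsub>N i\<^esub> Mul (act_mon MX f) (y, z))
            \<cdot>\<^bsub>V i\<^esub> Asc (N i) (OM (Und (act_mon MX f)) x) (OM (Und (act_mon MX f)) y) (OM (Und (act_mon MX f)) z)"
      using x y z f by simp
  next
    fix x assume x: "x \<in> Ob (V j)"
    have "lift f x \<cdot>\<^bsub>E\<^esub> am (AM ?A (PLun MX j x) \<cdot>\<^bsub>V i\<^esub> Cel (PTns MX) f (Unt (N j), x)
          \<cdot>\<^bsub>V i\<^esub> (Cel (PUnt MX) f () \<odot>\<^bsub>N i\<^esub> Ide (V i) (OM ?A x))) = lift f x \<cdot>\<^bsub>E\<^esub> am (PLun MX i (OM ?A x))"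
      using x f E.naturality(2)[of "lift f x"] by simp
    from X.lift_cancel[where n = i, OF _ _ _ _ _ _ _ _ this]
    show "AM (Und (act_mon MX f)) (Lun (N j) x) \<cdot>\<^bsub>V i\<^esub> Mul (act_mon MX f) (Unt (N j), x)
          \<cdot>\<^bsub>V i\<^esub> (Uni (act_mon MX f) \<odot>\<^bsub>N i\<^esub> Ide (V i) (OM (Und (act_mon MX f)) x)) = Lun (N i) (OM (Und (act_mon MX f)) x)"
      using x f by simp
    have "lift f x \<cdot>\<^bsub>E\<^esub> am (AM ?A (PRun MX j x) \<cdot>\<^bsub>V i\<^esub> Cel (PTns MX) f (x, Unt (N j))
          \<cdot>\<^bsub>V i\<^esub> (Ide (V i) (OM ?A x) \<odot>\<^bsub>N i\<^esub> Cel (PUnt MX) f ())) = lift f x \<cdot>\<^bsub>E\<^esub> am (PRun MX i (OM ?A x))"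
      using x f E.naturality(3)[of "lift f x"] by simp
    from X.lift_cancel[where n = i, OF _ _ _ _ _ _ _ _ this]
    show "AM (Und (act_mon MX f)) (Run (N j) x) \<cdot>\<^bsub>V i\<^esub> Mul (act_mon MX f) (x, Unt (N j))
          \<cdot>\<^bsub>V i\<^esub> (Ide (V i) (OM (Und (act_mon MX f)) x) \<odot>\<^bsub>N i\<^esub> Uni (act_mon MX f)) = Run (N i) (OM (Und (act_mon MX f)) x)"
      using x f by simp
  qed
qed

theorem monoidal_sgpd: "monoidal_sgpd MX"
  unfolding monoidal_sgpd_def
  using X.simplicial_groupoid T.simplicial_map I.simplicial_map monoidal_at strong_monoidal_Act by blast

end

lemma strong_monoidalD:
  assumes "strong_monoidal C M D N F"
  shows "is_functor C D (Und F)" "Mul F \<in> extensional (Ob C \<times> Ob C)"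
    "x \<in> Ob C \<Longrightarrow> y \<in> Ob C \<Longrightarrow> Mul F (x, y) \<in> hom D (OM (Und F) x \<otimes>\<^bsub>N\<^esub> OM (Und F) y) (OM (Und F) (x \<otimes>\<^bsub>M\<^esub> y))"
    "x \<in> Ob C \<Longrightarrow> y \<in> Ob C \<Longrightarrow> is_iso D (Mul F (x, y))"
    "a \<in> Ar C \<Longrightarrow> b \<in> Ar C \<Longrightarrow> Mul F (Tgt C a, Tgt C b) \<cdot>\<^bsub>D\<^esub> (AM (Und F) a \<odot>\<^bsub>N\<^esub> AM (Und F) b) =
      AM (Und F) (a \<odot>\<^bsub>M\<^esub> b) \<cdot>\<^bsub>D\<^esub> Mul F (Src C a, Src C b)"
    "Uni F \<in> hom D (Unt N) (OM (Und F) (Unt M))" "is_iso D (Uni F)"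
    "x \<in> Ob C \<Longrightarrow> y \<in> Ob C \<Longrightarrow> z \<in> Ob C \<Longrightarrow>
      AM (Und F) (Asc M x y z) \<cdot>\<^bsub>D\<^esub> Mul F (x \<otimes>\<^bsub>M\<^esub> y, z) \<cdot>\<^bsub>D\<^esub> (Mul F (x, y) \<odot>\<^bsub>N\<^esub> Ide D (OM (Und F) z))
        = Mul F (x, y \<otimes>\<^bsub>M\<^esub> z) \<cdot>\<^bsub>D\<^esub> (Ide D (OM (Und F) x) \<odot>\<^bsub>N\<^esub> Mul F (y, z))
            \<cdot>\<^bsub>D\<^esub> Asc N (OM (Und F) x) (OM (Und F) y) (OM (Und F) z)"
    "x \<in> Ob C \<Longrightarrow> AM (Und F) (Lun M x) \<cdot>\<^bsub>D\<^esub> Mul F (Unt M, x) \<cdot>\<^bsub>D\<^esub> (Uni F \<odot>\<^bsub>N\<^esub> Ide D (OM (Und F) x))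
        = Lun N (OM (Und F) x)"
    "x \<in> Ob C \<Longrightarrow> AM (Und F) (Run M x) \<cdot>\<^bsub>D\<^esub> Mul F (x, Unt M) \<cdot>\<^bsub>D\<^esub> (Ide D (OM (Und F) x) \<odot>\<^bsub>N\<^esub> Uni F)
        = Run N (OM (Und F) x)"
proof -
  have n: "is_nat_iso (prod_cat C C) D (comp_ftor (prod_cat C C) (Tns N) (prod_ftor C C (Und F) (Und F)))
       (comp_ftor (prod_cat C C) (Und F) (Tns M)) (Mul F)"
    using assms unfolding strong_monoidal_def by blast
  show "Mul F (x, y) \<in> hom D (OM (Und F) x \<otimes>\<^bsub>N\<^esub> OM (Und F) y) (OM (Und F) (x \<otimes>\<^bsub>M\<^esub> y))" "is_iso D (Mul F (x, y))"
    if "x \<in> Ob C" "y \<in> Ob C"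
    using n that unfolding is_nat_iso_def is_nat_def by (auto simp: comp_ftor_OM prod_ftor_def)
  show "Mul F (Tgt C a, Tgt C b) \<cdot>\<^bsub>D\<^esub> (AM (Und F) a \<odot>\<^bsub>N\<^esub> AM (Und F) b) =
      AM (Und F) (a \<odot>\<^bsub>M\<^esub> b) \<cdot>\<^bsub>D\<^esub> Mul F (Src C a, Src C b)" if "a \<in> Ar C" "b \<in> Ar C"
    using n that unfolding is_nat_iso_def is_nat_def by (auto simp: comp_ftor_AM prod_ftor_def)
qed (use assms in \<open>unfold strong_monoidal_def, blast+\<close>)

lemma strong_monoidalI:
  assumes "is_functor C D (Und F)" "Mul F \<in> extensional (Ob C \<times> Ob C)"
    "\<And>x y. x \<in> Ob C \<Longrightarrow> y \<in> Ob C \<Longrightarrow> Mul F (x, y) \<in> hom D (OM (Und F) x \<otimes>\<^bsub>N\<^esub> OM (Und F) y) (OM (Und F) (x \<otimes>\<^bsub>M\<^esub> y))"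
    "\<And>x y. x \<in> Ob C \<Longrightarrow> y \<in> Ob C \<Longrightarrow> is_iso D (Mul F (x, y))"
    "\<And>a b. a \<in> Ar C \<Longrightarrow> b \<in> Ar C \<Longrightarrow> Mul F (Tgt C a, Tgt C b) \<cdot>\<^bsub>D\<^esub> (AM (Und F) a \<odot>\<^bsub>N\<^esub> AM (Und F) b) =
      AM (Und F) (a \<odot>\<^bsub>M\<^esub> b) \<cdot>\<^bsub>D\<^esub> Mul F (Src C a, Src C b)"
    "Uni F \<in> hom D (Unt N) (OM (Und F) (Unt M))" "is_iso D (Uni F)"
    "\<And>x y z. x \<in> Ob C \<Longrightarrow> y \<in> Ob C \<Longrightarrow> z \<in> Ob C \<Longrightarrow>
      AM (Und F) (Asc M x y z) \<cdot>\<^bsub>D\<^esub> Mul F (x \<otimes>\<^bsub>M\<^esub> y, z) \<cdot>\<^bsub>D\<^esub> (Mul F (x, y) \<odot>\<^bsub>N\<^esub> Ide D (OM (Und F) z))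
        = Mul F (x, y \<otimes>\<^bsub>M\<^esub> z) \<cdot>\<^bsub>D\<^esub> (Ide D (OM (Und F) x) \<odot>\<^bsub>N\<^esub> Mul F (y, z))
            \<cdot>\<^bsub>D\<^esub> Asc N (OM (Und F) x) (OM (Und F) y) (OM (Und F) z)"
    "\<And>x. x \<in> Ob C \<Longrightarrow> AM (Und F) (Lun M x) \<cdot>\<^bsub>D\<^esub> Mul F (Unt M, x) \<cdot>\<^bsub>D\<^esub> (Uni F \<odot>\<^bsub>N\<^esub> Ide D (OM (Und F) x))
        = Lun N (OM (Und F) x)"
    "\<And>x. x \<in> Ob C \<Longrightarrow> AM (Und F) (Run M x) \<cdot>\<^bsub>D\<^esub> Mul F (x, Unt M) \<cdot>\<^bsub>D\<^esub> (Ide D (OM (Und F) x) \<odot>\<^bsub>N\<^esub> Uni F)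
        = Run N (OM (Und F) x)"
  shows "strong_monoidal C M D N F"
proof -
  have "is_nat_iso (prod_cat C C) D (comp_ftor (prod_cat C C) (Tns N) (prod_ftor C C (Und F) (Und F)))
       (comp_ftor (prod_cat C C) (Und F) (Tns M)) (Mul F)"
    using assms(3-5) by (intro is_natI) (auto simp: comp_ftor_OM comp_ftor_AM prod_ftor_def)
  then show ?thesis unfolding strong_monoidal_def using assms by blast
qed

section \<open>Monoidal maps over a strong monoidal functor\<close>

locale fibred_monoidal_map =
  X: fibred_monoidal MX E u am ov lift M + Y: fibred_monoidal MY E' u' am' ov' lift' M' +
  S: fibred_map "Base MX" E u am ov lift "Base MY" E' u' am' ov' lift' "Smap F" "Und G"
  for MX :: "('w, 'b) msgpd" and E :: "('o, 'a) cat" and u am ov lift M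
    and MY :: "('w2, 'b2) msgpd" and E' :: "('o2, 'a2) cat" and u' am' ov' lift' M'
    and F :: "('w, 'b, 'w2, 'b2) msgmap" and G :: "('o, 'a, 'o2, 'a2) mftor" +
  assumes strong: "strong_monoidal E M E' M' G"
    and PMul: "x \<in> Ob (Val (Base MX) n) \<Longrightarrow> y \<in> Ob (Val (Base MX) n) \<Longrightarrow>
      PMul F n (x, y) \<in> hom (Val (Base MY) n)
        (OM (Cpt (PTns MY) n) (OM (Cpt (Smap F) n) x, OM (Cpt (Smap F) n) y)) (OM (Cpt (Smap F) n) (OM (Cpt (PTns MX) n) (x, y))) \<and>
      am' (PMul F n (x, y)) = Mul G (u x, u y)"
    and PMul_ext: "PMul F n \<in> extensional (Ob (Val (Base MX) n) \<times> Ob (Val (Base MX) n))"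
    and PUni: "PUni F n \<in> hom (Val (Base MY) n) (OM (Cpt (PUnt MY) n) ()) (OM (Cpt (Smap F) n) (OM (Cpt (PUnt MX) n) ())) \<and>
      am' (PUni F n) = Uni G"
begin

lemma PMul_simps [simp]:
  assumes "x \<in> Ob (X.V n)" "y \<in> Ob (X.V n)"
  shows "PMul F n (x, y) \<in> Ar (Y.V n)"
    "Src (Y.V n) (PMul F n (x, y)) = OM (Cpt (PTns MY) n) (OM (Cpt (Smap F) n) x, OM (Cpt (Smap F) n) y)"
    "Tgt (Y.V n) (PMul F n (x, y)) = OM (Cpt (Smap F) n) (OM (Cpt (PTns MX) n) (x, y))"
    "am' (PMul F n (x, y)) = Mul G (u x, u y)"
  using PMul[OF assms] by (auto simp: hom_iff)

lemma PUni_simps [simp]: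
  "PUni F n \<in> Ar (Y.V n)" "Src (Y.V n) (PUni F n) = OM (Cpt (PUnt MY) n) ()"
  "Tgt (Y.V n) (PUni F n) = OM (Cpt (Smap F) n) (OM (Cpt (PUnt MX) n) ())" "am' (PUni F n) = Uni G"
  using PUni[of n] by (auto simp: hom_iff)

lemma Mul_simps [simp]:
  assumes "x \<in> Ob E" "y \<in> Ob E"
  shows "Mul G (x, y) \<in> Ar E'" "Src E' (Mul G (x, y)) = OM (Und G) x \<otimes>\<^bsub>M'\<^esub> OM (Und G) y"
    "Tgt E' (Mul G (x, y)) = OM (Und G) (x \<otimes>\<^bsub>M\<^esub> y)"
  using strong_monoidalD(3)[OF strong assms] by (auto simp: hom_iff)

lemma Uni_simps [simp]: "Uni G \<in> Ar E'" "Src E' (Uni G) = Unt M'" "Tgt E' (Uni G) = OM (Und G) (Unt M)"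
  using strong_monoidalD(6)[OF strong] by (auto simp: hom_iff)

lemma strong_at: "strong_monoidal (X.V n) (X.N n) (Y.V n) (Y.N n) (map_at F n)"
proof -
  have m [simp]: "Und (map_at F n) = Cpt (Smap F) n" "Mul (map_at F n) = PMul F n" "Uni (map_at F n) = PUni F n"
    by (simp_all add: map_at_def)
  show ?thesis
  proof (rule strong_monoidalI)
    show "is_functor (X.V n) (Y.V n) (Und (map_at F n))" by (simp add: S.functor_Cpt)
    show "Mul (map_at F n) \<in> extensional (Ob (X.V n) \<times> Ob (X.V n))" by (simp add: PMul_ext)
  next
    fix a b assume a: "a \<in> Ar (X.V n)" "b \<in> Ar (X.V n)"
    note [simp] = X.X.am_Ar[OF a(1)] X.X.am_Ar[OF a(2)]
    have "am' (PMul F n (Tgt (X.V n) a, Tgt (X.V n) b) \<cdot>\<^bsub>Y.V n\<^esub> (AM (Cpt (Smap F) n) a \<odot>\<^bsub>Y.N n\<^esub> AM (Cpt (Smap F) n) b))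
      = am' (AM (Cpt (Smap F) n) (a \<odot>\<^bsub>X.N n\<^esub> b) \<cdot>\<^bsub>Y.V n\<^esub> PMul F n (Src (X.V n) a, Src (X.V n) b))"
      using a strong_monoidalD(5)[OF strong, of "am a" "am b"] by simp
    from Y.V_eqI[where n = n, OF _ _ _ _ this]
    show "Mul (map_at F n) (Tgt (X.V n) a, Tgt (X.V n) b) \<cdot>\<^bsub>Y.V n\<^esub>
         (AM (Und (map_at F n)) a \<odot>\<^bsub>Y.N n\<^esub> AM (Und (map_at F n)) b) =
         AM (Und (map_at F n)) (a \<odot>\<^bsub>X.N n\<^esub> b) \<cdot>\<^bsub>Y.V n\<^esub> Mul (map_at F n) (Src (X.V n) a, Src (X.V n) b)"
      using a by simp
  next
    fix x y z assume x: "x \<in> Ob (X.V n)" "y \<in> Ob (X.V n)" "z \<in> Ob (X.V n)"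
    have "am' (AM (Cpt (Smap F) n) (PAsc MX n x y z) \<cdot>\<^bsub>Y.V n\<^esub> PMul F n (x \<otimes>\<^bsub>X.N n\<^esub> y, z) \<cdot>\<^bsub>Y.V n\<^esub>
        (PMul F n (x, y) \<odot>\<^bsub>Y.N n\<^esub> Ide (Y.V n) (OM (Cpt (Smap F) n) z)))
      = am' (PMul F n (x, y \<otimes>\<^bsub>X.N n\<^esub> z) \<cdot>\<^bsub>Y.V n\<^esub> (Ide (Y.V n) (OM (Cpt (Smap F) n) x) \<odot>\<^bsub>Y.N n\<^esub> PMul F n (y, z)) \<cdot>\<^bsub>Y.V n\<^esub>
        PAsc MY n (OM (Cpt (Smap F) n) x) (OM (Cpt (Smap F) n) y) (OM (Cpt (Smap F) n) z))"
      using x strong_monoidalD(8)[OF strong, of "u x" "u y" "u z"] by simp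
    from Y.V_eqI[where n = n, OF _ _ _ _ this]
    show "AM (Und (map_at F n)) (Asc (X.N n) x y z) \<cdot>\<^bsub>Y.V n\<^esub> Mul (map_at F n) (x \<otimes>\<^bsub>X.N n\<^esub> y, z) \<cdot>\<^bsub>Y.V n\<^esub>
         (Mul (map_at F n) (x, y) \<odot>\<^bsub>Y.N n\<^esub> Ide (Y.V n) (OM (Und (map_at F n)) z)) =
         Mul (map_at F n) (x, y \<otimes>\<^bsub>X.N n\<^esub> z) \<cdot>\<^bsub>Y.V n\<^esub> (Ide (Y.V n) (OM (Und (map_at F n)) x) \<odot>\<^bsub>Y.N n\<^esub> Mul (map_at F n) (y, z)) \<cdot>\<^bsub>Y.V n\<^esub>
         Asc (Y.N n) (OM (Und (map_at F n)) x) (OM (Und (map_at F n)) y) (OM (Und (map_at F n)) z)"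
      using x by simp
  next
    fix x assume x: "x \<in> Ob (X.V n)"
    have "am' (AM (Cpt (Smap F) n) (PLun MX n x) \<cdot>\<^bsub>Y.V n\<^esub> PMul F n (Unt (X.N n), x) \<cdot>\<^bsub>Y.V n\<^esub>
        (PUni F n \<odot>\<^bsub>Y.N n\<^esub> Ide (Y.V n) (OM (Cpt (Smap F) n) x))) = am' (PLun MY n (OM (Cpt (Smap F) n) x))"
      using x strong_monoidalD(9)[OF strong, of "u x"] by simp
    from Y.V_eqI[where n = n, OF _ _ _ _ this]
    show "AM (Und (map_at F n)) (Lun (X.N n) x) \<cdot>\<^bsub>Y.V n\<^esub> Mul (map_at F n) (Unt (X.N n), x) \<cdot>\<^bsub>Y.V n\<^esub>
         (Uni (map_at F n) \<odot>\<^bsub>Y.N n\<^esub> Ide (Y.V n) (OM (Und (map_at F n)) x)) = Lun (Y.N n) (OM (Und (map_at F n)) x)"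
      using x by simp
    have "am' (AM (Cpt (Smap F) n) (PRun MX n x) \<cdot>\<^bsub>Y.V n\<^esub> PMul F n (x, Unt (X.N n)) \<cdot>\<^bsub>Y.V n\<^esub>
        (Ide (Y.V n) (OM (Cpt (Smap F) n) x) \<odot>\<^bsub>Y.N n\<^esub> PUni F n)) = am' (PRun MY n (OM (Cpt (Smap F) n) x))"
      using x strong_monoidalD(10)[OF strong, of "u x"] by simp
    from Y.V_eqI[where n = n, OF _ _ _ _ this]
    show "AM (Und (map_at F n)) (Run (X.N n) x) \<cdot>\<^bsub>Y.V n\<^esub> Mul (map_at F n) (x, Unt (X.N n)) \<cdot>\<^bsub>Y.V n\<^esub>
         (Ide (Y.V n) (OM (Und (map_at F n)) x) \<odot>\<^bsub>Y.N n\<^esub> Uni (map_at F n)) = Run (Y.N n) (OM (Und (map_at F n)) x)"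
      using x by simp
  qed (auto simp: hom_iff)
qed

text \<open>In each degree the equations are those of \<open>G\<close>. Compatibility of the
  constraints with the simplicial structure becomes, after composition with a lift, naturality of
  \<open>Mul G\<close> at the lifts of \<open>x\<close> and \<open>y\<close>.\<close>

theorem monoidal_sgmap: "monoidal_sgmap MX MY F"
  unfolding monoidal_sgmap_def
proof (intro conjI allI ballI)
  show "simplicial_map (Base MX) (Base MY) (Smap F)" by (rule S.simplicial_map)
  show "strong_monoidal (X.V n) (X.N n) (Y.V n) (Y.N n) (map_at F n)" for n by (rule strong_at)
next
  fix i j f x y assume fh: "f \<in> hom Delta i j" and x: "x \<in> Ob (X.V j)" and y: "y \<in> Ob (X.V j)"
  have f: "f \<in> Ar Delta" "Src Delta f = i" "Tgt Delta f = j" using fh by (auto simp: hom_iff)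
  have "lift' f (OM (Cpt (Smap F) j) (x \<otimes>\<^bsub>X.N j\<^esub> y)) \<cdot>\<^bsub>E'\<^esub> am' (Cel (Smap F) f (x \<otimes>\<^bsub>X.N j\<^esub> y) \<cdot>\<^bsub>Y.V i\<^esub>
      AM (Cpt (Smap F) i) (Cel (PTns MX) f (x, y)) \<cdot>\<^bsub>Y.V i\<^esub> PMul F i (OM (Act (Base MX) f) x, OM (Act (Base MX) f) y))
    = lift' f (OM (Cpt (Smap F) j) (x \<otimes>\<^bsub>X.N j\<^esub> y)) \<cdot>\<^bsub>E'\<^esub> am' (AM (Act (Base MY) f) (PMul F j (x, y)) \<cdot>\<^bsub>Y.V i\<^esub>
      Cel (PTns MY) f (OM (Cpt (Smap F) j) x, OM (Cpt (Smap F) j) y) \<cdot>\<^bsub>Y.V i\<^esub> (Cel (Smap F) f x \<odot>\<^bsub>Y.N i\<^esub> Cel (Smap F) f y))"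
  proof -
    \<comment> \<open>The image under \<open>G\<close> of the equation that characterises the tensor
      cell of the source; it removes the only cell that appears under \<open>G\<close>.\<close>
    have "AM (Und G) (lift f (OM (Cpt (PTns MX) j) (x, y))) \<cdot>\<^bsub>E'\<^esub> AM (Und G) (am (Cel (PTns MX) f (x, y))) = AM (Und G) (lift f x \<odot>\<^bsub>M\<^esub> lift f y)"
      using x y f by (simp flip: S.base_cmp)
    note * = Y.X.E.cmp_cmp_eq[OF this]
    show ?thesis
      using x y f strong_monoidalD(5)[OF strong, of "lift f x" "lift f y"] by (simp add: *)
  qed
  from Y.X.lift_cancel[where n = i, OF _ _ _ _ _ _ _ _ this]
  show "Cel (Smap F) f (x \<otimes>\<^bsub>X.N j\<^esub> y) \<cdot>\<^bsub>Y.V i\<^esub> AM (Cpt (Smap F) i) (Cel (PTns MX) f (x, y))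
          \<cdot>\<^bsub>Y.V i\<^esub> PMul F i (OM (Act (Base MX) f) x, OM (Act (Base MX) f) y)
        = AM (Act (Base MY) f) (PMul F j (x, y)) \<cdot>\<^bsub>Y.V i\<^esub> Cel (PTns MY) f (OM (Cpt (Smap F) j) x, OM (Cpt (Smap F) j) y)
          \<cdot>\<^bsub>Y.V i\<^esub> (Cel (Smap F) f x \<odot>\<^bsub>Y.N i\<^esub> Cel (Smap F) f y)"
    using x y f by simp
next
  fix i j f assume fh: "f \<in> hom Delta i j"
  have f: "f \<in> Ar Delta" "Src Delta f = i" "Tgt Delta f = j" using fh by (auto simp: hom_iff)
  have "lift' f (OM (Cpt (Smap F) j) (Unt (X.N j))) \<cdot>\<^bsub>E'\<^esub> am' (Cel (Smap F) f (Unt (X.N j)) \<cdot>\<^bsub>Y.V i\<^esub>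
      AM (Cpt (Smap F) i) (Cel (PUnt MX) f ()) \<cdot>\<^bsub>Y.V i\<^esub> PUni F i)
    = lift' f (OM (Cpt (Smap F) j) (Unt (X.N j))) \<cdot>\<^bsub>E'\<^esub> am' (AM (Act (Base MY) f) (PUni F j) \<cdot>\<^bsub>Y.V i\<^esub> Cel (PUnt MY) f ())"
  proof -
    have "AM (Und G) (lift f (OM (Cpt (PUnt MX) j) ())) \<cdot>\<^bsub>E'\<^esub> AM (Und G) (am (Cel (PUnt MX) f ())) = AM (Und G) (Ide E (Unt M))"
      using f by (simp flip: S.base_cmp del: S.base_simps(5))
    note * = Y.X.E.cmp_cmp_eq[OF this]
    show ?thesis using f by (simp add: *)
  qed
  from Y.X.lift_cancel[where n = i, OF _ _ _ _ _ _ _ _ this]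
  show "Cel (Smap F) f (Unt (X.N j)) \<cdot>\<^bsub>Y.V i\<^esub> AM (Cpt (Smap F) i) (Cel (PUnt MX) f ()) \<cdot>\<^bsub>Y.V i\<^esub> PUni F i
        = AM (Act (Base MY) f) (PUni F j) \<cdot>\<^bsub>Y.V i\<^esub> Cel (PUnt MY) f ()"
    using f by simp
qed

end

section \<open>Composition of strong monoidal functors\<close>

lemma strong_monoidal_id:
  assumes "monoidal_category C M" shows "strong_monoidal C M C M (id_mftor C M)"
proof -
  interpret moncat C M
    using assms by (intro moncat.intro cat.intro moncat_axioms.intro) (auto simp: monoidal_category_def)
  have I [simp]: "Und (id_mftor C M) = id_ftor C" "Uni (id_mftor C M) = Ide C (Unt M)"
    "x \<in> Ob C \<Longrightarrow> y \<in> Ob C \<Longrightarrow> Mul (id_mftor C M) (x, y) = Ide C (x \<otimes>\<^bsub>M\<^esub> y)"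
    "x \<in> Ob C \<Longrightarrow> OM (id_ftor C) x = x" "a \<in> Ar C \<Longrightarrow> AM (id_ftor C) a = a" for x y a
    by (simp_all add: id_mftor_def id_ftor_def)
  show ?thesis
    by (rule strong_monoidalI) (auto simp: is_functor_id category hom_iff, simp add: id_mftor_def)
qed

text \<open>Each coherence diagram of the composite is the image under \<open>G\<close> of the
  diagram of \<open>F\<close>, pasted to the diagram of \<open>G\<close>; naturality of
  \<open>Mul G\<close> at the constraints of \<open>F\<close> joins the two.\<close>

lemma strong_monoidal_comp:
  assumes C: "monoidal_category C M" and D: "monoidal_category D N" and E: "monoidal_category E P"
    and F: "strong_monoidal C M D N F" and G: "strong_monoidal D N E P G"
  shows "strong_monoidal C M E P (comp_mftor C E G F)"
proof -
  interpret C: moncat C M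
    using C by (intro moncat.intro cat.intro moncat_axioms.intro) (auto simp: monoidal_category_def)
  interpret D: moncat D N
    using D by (intro moncat.intro cat.intro moncat_axioms.intro) (auto simp: monoidal_category_def)
  interpret E: moncat E P
    using E by (intro moncat.intro cat.intro moncat_axioms.intro) (auto simp: monoidal_category_def)
  note fF = strong_monoidalD(1)[OF F] and fG = strong_monoidalD(1)[OF G]
  note [simp] = functorD(1-5)[OF fF] functorD(1-5)[OF fG]
  have H [simp]: "Und (comp_mftor C E G F) = comp_ftor C (Und G) (Und F)"
    "Uni (comp_mftor C E G F) = AM (Und G) (Uni F) \<cdot>\<^bsub>E\<^esub> Uni G"
    "x \<in> Ob C \<Longrightarrow> y \<in> Ob C \<Longrightarrow> Mul (comp_mftor C E G F) (x, y) =
      AM (Und G) (Mul F (x, y)) \<cdot>\<^bsub>E\<^esub> Mul G (OM (Und F) x, OM (Und F) y)" for x y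
    by (simp_all add: comp_mftor_def)
  note [simp] = comp_ftor_OM comp_ftor_AM
  have mF [simp]: "Mul F (x, y) \<in> Ar D" "Src D (Mul F (x, y)) = OM (Und F) x \<otimes>\<^bsub>N\<^esub> OM (Und F) y"
    "Tgt D (Mul F (x, y)) = OM (Und F) (x \<otimes>\<^bsub>M\<^esub> y)" if "x \<in> Ob C" "y \<in> Ob C" for x y
    using strong_monoidalD(3)[OF F that] by (auto simp: hom_iff)
  have mG [simp]: "Mul G (x, y) \<in> Ar E" "Src E (Mul G (x, y)) = OM (Und G) x \<otimes>\<^bsub>P\<^esub> OM (Und G) y"
    "Tgt E (Mul G (x, y)) = OM (Und G) (x \<otimes>\<^bsub>N\<^esub> y)" if "x \<in> Ob D" "y \<in> Ob D" for x y
    using strong_monoidalD(3)[OF G that] by (auto simp: hom_iff)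
  have uF [simp]: "Uni F \<in> Ar D" "Src D (Uni F) = Unt N" "Tgt D (Uni F) = OM (Und F) (Unt M)"
    using strong_monoidalD(6)[OF F] by (auto simp: hom_iff)
  have uG [simp]: "Uni G \<in> Ar E" "Src E (Uni G) = Unt P" "Tgt E (Uni G) = OM (Und G) (Unt N)"
    using strong_monoidalD(6)[OF G] by (auto simp: hom_iff)
  \<comment> \<open>Interchange is used from right to left here: the constraint of a composite has
    to be separated under the tensor before the naturality of \<open>Mul G\<close> can be applied to
    one of its factors.\<close>
  have split1: "(b \<cdot>\<^bsub>E\<^esub> a) \<odot>\<^bsub>P\<^esub> Ide E z = (b \<odot>\<^bsub>P\<^esub> Ide E z) \<cdot>\<^bsub>E\<^esub> (a \<odot>\<^bsub>P\<^esub> Ide E z)"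
    and split2: "Ide E z \<odot>\<^bsub>P\<^esub> (b \<cdot>\<^bsub>E\<^esub> a) = (Ide E z \<odot>\<^bsub>P\<^esub> b) \<cdot>\<^bsub>E\<^esub> (Ide E z \<odot>\<^bsub>P\<^esub> a)"
    if "a \<in> Ar E" "b \<in> Ar E" "Src E b = Tgt E a" "z \<in> Ob E" for a b z
    using that by simp_all
  note Gcmp = functorD(6)[OF fG, symmetric]
  show ?thesis
  proof (rule strong_monoidalI)
    show "is_functor C E (Und (comp_mftor C E G F))"
      using is_functor_comp[OF fF fG C.category] by simp
    show "Mul (comp_mftor C E G F) \<in> extensional (Ob C \<times> Ob C)" by (simp add: comp_mftor_def)
    show "is_iso E (Mul (comp_mftor C E G F) (x, y))" if "x \<in> Ob C" "y \<in> Ob C" for x y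
      using that strong_monoidalD(4)[OF F that] strong_monoidalD(4)[OF G, of "OM (Und F) x" "OM (Und F) y"]
        functor_is_iso[OF fG D.category, of "Mul F (x, y)"]
      by (auto intro!: E.is_iso_cmp)
    show "is_iso E (Uni (comp_mftor C E G F))"
      using strong_monoidalD(7)[OF F] strong_monoidalD(7)[OF G] functor_is_iso[OF fG D.category, of "Uni F"]
      by (auto intro!: E.is_iso_cmp)
  next
    fix a b assume a: "a \<in> Ar C" "b \<in> Ar C"
    have n: "Mul G (OM (Und F) (Tgt C a), OM (Und F) (Tgt C b)) \<cdot>\<^bsub>E\<^esub> (AM (Und G) (AM (Und F) a) \<odot>\<^bsub>P\<^esub> AM (Und G) (AM (Und F) b))
      = AM (Und G) (AM (Und F) a \<odot>\<^bsub>N\<^esub> AM (Und F) b) \<cdot>\<^bsub>E\<^esub> Mul G (OM (Und F) (Src C a), OM (Und F) (Src C b))"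
      using strong_monoidalD(5)[OF G, of "AM (Und F) a" "AM (Und F) b"] a by simp
    have c: "AM (Und G) (Mul F (Tgt C a, Tgt C b)) \<cdot>\<^bsub>E\<^esub> AM (Und G) (AM (Und F) a \<odot>\<^bsub>N\<^esub> AM (Und F) b)
      = AM (Und G) (AM (Und F) (a \<odot>\<^bsub>M\<^esub> b)) \<cdot>\<^bsub>E\<^esub> AM (Und G) (Mul F (Src C a, Src C b))"
      using a strong_monoidalD(5)[OF F a] by (simp add: Gcmp)
    show "Mul (comp_mftor C E G F) (Tgt C a, Tgt C b) \<cdot>\<^bsub>E\<^esub> (AM (Und (comp_mftor C E G F)) a \<odot>\<^bsub>P\<^esub> AM (Und (comp_mftor C E G F)) b) =
      AM (Und (comp_mftor C E G F)) (a \<odot>\<^bsub>M\<^esub> b) \<cdot>\<^bsub>E\<^esub> Mul (comp_mftor C E G F) (Src C a, Src C b)"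
      using a by (simp add: n E.cmp_cmp_eq[OF c])
  next
    fix x y z assume x: "x \<in> Ob C" "y \<in> Ob C" "z \<in> Ob C"
    let ?x = "OM (Und F) x" and ?y = "OM (Und F) y" and ?z = "OM (Und F) z"
    \<comment> \<open>The joining squares \<open>n1\<close> and \<open>n2\<close> move the
      constraints of \<open>F\<close> past those of \<open>G\<close>; \<open>c1\<close> is the image
      of the associativity diagram of \<open>F\<close> and \<open>c2\<close> is the diagram of
      \<open>G\<close>.\<close>
    have n1: "Mul G (OM (Und F) (x \<otimes>\<^bsub>M\<^esub> y), ?z) \<cdot>\<^bsub>E\<^esub> (AM (Und G) (Mul F (x, y)) \<odot>\<^bsub>P\<^esub> Ide E (OM (Und G) ?z))
      = AM (Und G) (Mul F (x, y) \<odot>\<^bsub>N\<^esub> Ide D ?z) \<cdot>\<^bsub>E\<^esub> Mul G (?x \<otimes>\<^bsub>N\<^esub> ?y, ?z)"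
      using strong_monoidalD(5)[OF G, of "Mul F (x, y)" "Ide D ?z"] x by simp
    have n2: "Mul G (?x, OM (Und F) (y \<otimes>\<^bsub>M\<^esub> z)) \<cdot>\<^bsub>E\<^esub> (Ide E (OM (Und G) ?x) \<odot>\<^bsub>P\<^esub> AM (Und G) (Mul F (y, z)))
      = AM (Und G) (Ide D ?x \<odot>\<^bsub>N\<^esub> Mul F (y, z)) \<cdot>\<^bsub>E\<^esub> Mul G (?x, ?y \<otimes>\<^bsub>N\<^esub> ?z)"
      using strong_monoidalD(5)[OF G, of "Ide D ?x" "Mul F (y, z)"] x by simp
    have c1: "AM (Und G) (AM (Und F) (Asc M x y z)) \<cdot>\<^bsub>E\<^esub> AM (Und G) (Mul F (x \<otimes>\<^bsub>M\<^esub> y, z)) \<cdot>\<^bsub>E\<^esub> AM (Und G) (Mul F (x, y) \<odot>\<^bsub>N\<^esub> Ide D ?z)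
      = AM (Und G) (Mul F (x, y \<otimes>\<^bsub>M\<^esub> z)) \<cdot>\<^bsub>E\<^esub> AM (Und G) (Ide D ?x \<odot>\<^bsub>N\<^esub> Mul F (y, z)) \<cdot>\<^bsub>E\<^esub> AM (Und G) (Asc N ?x ?y ?z)"
      using x strong_monoidalD(8)[OF F x] by (simp add: Gcmp)
    have c2: "AM (Und G) (Asc N ?x ?y ?z) \<cdot>\<^bsub>E\<^esub> Mul G (?x \<otimes>\<^bsub>N\<^esub> ?y, ?z) \<cdot>\<^bsub>E\<^esub> (Mul G (?x, ?y) \<odot>\<^bsub>P\<^esub> Ide E (OM (Und G) ?z))
      = Mul G (?x, ?y \<otimes>\<^bsub>N\<^esub> ?z) \<cdot>\<^bsub>E\<^esub> (Ide E (OM (Und G) ?x) \<odot>\<^bsub>P\<^esub> Mul G (?y, ?z)) \<cdot>\<^bsub>E\<^esub> Asc P (OM (Und G) ?x) (OM (Und G) ?y) (OM (Und G) ?z)"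
      using strong_monoidalD(8)[OF G, of ?x ?y ?z] x by simp
    show "AM (Und (comp_mftor C E G F)) (Asc M x y z) \<cdot>\<^bsub>E\<^esub> Mul (comp_mftor C E G F) (x \<otimes>\<^bsub>M\<^esub> y, z) \<cdot>\<^bsub>E\<^esub>
         (Mul (comp_mftor C E G F) (x, y) \<odot>\<^bsub>P\<^esub> Ide E (OM (Und (comp_mftor C E G F)) z)) =
         Mul (comp_mftor C E G F) (x, y \<otimes>\<^bsub>M\<^esub> z) \<cdot>\<^bsub>E\<^esub>
         (Ide E (OM (Und (comp_mftor C E G F)) x) \<odot>\<^bsub>P\<^esub> Mul (comp_mftor C E G F) (y, z)) \<cdot>\<^bsub>E\<^esub>
         Asc P (OM (Und (comp_mftor C E G F)) x) (OM (Und (comp_mftor C E G F)) y) (OM (Und (comp_mftor C E G F)) z)"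
      using x by (simp add: split1 split2 E.cmp_cmp_eq[OF n1] E.cmp_cmp_eq[OF n2] E.cmp_cmp_cmp_eq[OF c1] c2 del: E.tns_cmp)
  next
    fix x assume x: "x \<in> Ob C"
    let ?x = "OM (Und F) x"
    have n1: "Mul G (OM (Und F) (Unt M), ?x) \<cdot>\<^bsub>E\<^esub> (AM (Und G) (Uni F) \<odot>\<^bsub>P\<^esub> Ide E (OM (Und G) ?x))
      = AM (Und G) (Uni F \<odot>\<^bsub>N\<^esub> Ide D ?x) \<cdot>\<^bsub>E\<^esub> Mul G (Unt N, ?x)"
      using strong_monoidalD(5)[OF G, of "Uni F" "Ide D ?x"] x by simp
    have c1: "AM (Und G) (AM (Und F) (Lun M x)) \<cdot>\<^bsub>E\<^esub> AM (Und G) (Mul F (Unt M, x)) \<cdot>\<^bsub>E\<^esub> AM (Und G) (Uni F \<odot>\<^bsub>N\<^esub> Ide D ?x)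
      = AM (Und G) (Lun N ?x)"
      using x strong_monoidalD(9)[OF F x] by (simp add: Gcmp)
    show "AM (Und (comp_mftor C E G F)) (Lun M x) \<cdot>\<^bsub>E\<^esub> Mul (comp_mftor C E G F) (Unt M, x) \<cdot>\<^bsub>E\<^esub>
         (Uni (comp_mftor C E G F) \<odot>\<^bsub>P\<^esub> Ide E (OM (Und (comp_mftor C E G F)) x)) = Lun P (OM (Und (comp_mftor C E G F)) x)"
      using x strong_monoidalD(9)[OF G, of ?x]
      by (simp add: split1 E.cmp_cmp_eq[OF n1] E.cmp_cmp_cmp_eq[OF c1] del: E.tns_cmp)
    have n2: "Mul G (?x, OM (Und F) (Unt M)) \<cdot>\<^bsub>E\<^esub> (Ide E (OM (Und G) ?x) \<odot>\<^bsub>P\<^esub> AM (Und G) (Uni F))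
      = AM (Und G) (Ide D ?x \<odot>\<^bsub>N\<^esub> Uni F) \<cdot>\<^bsub>E\<^esub> Mul G (?x, Unt N)"
      using strong_monoidalD(5)[OF G, of "Ide D ?x" "Uni F"] x by simp
    have c2: "AM (Und G) (AM (Und F) (Run M x)) \<cdot>\<^bsub>E\<^esub> AM (Und G) (Mul F (x, Unt M)) \<cdot>\<^bsub>E\<^esub> AM (Und G) (Ide D ?x \<odot>\<^bsub>N\<^esub> Uni F)
      = AM (Und G) (Run N ?x)"
      using x strong_monoidalD(10)[OF F x] by (simp add: Gcmp)
    show "AM (Und (comp_mftor C E G F)) (Run M x) \<cdot>\<^bsub>E\<^esub> Mul (comp_mftor C E G F) (x, Unt M) \<cdot>\<^bsub>E\<^esub>
         (Ide E (OM (Und (comp_mftor C E G F)) x) \<odot>\<^bsub>P\<^esub> Uni (comp_mftor C E G F)) = Run P (OM (Und (comp_mftor C E G F)) x)"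
      using x strong_monoidalD(10)[OF G, of ?x]
      by (simp add: split2 E.cmp_cmp_eq[OF n2] E.cmp_cmp_cmp_eq[OF c2] del: E.tns_cmp)
  qed (auto simp: hom_iff)
qed

section \<open>Disjoint unions of layered structures\<close>

lemma dsum_iff [simp]:
  "(Lft a, Lft b) \<in> dsum P Q \<longleftrightarrow> (a, b) \<in> P" "(Rgt a, Rgt b) \<in> dsum P Q \<longleftrightarrow> (a, b) \<in> Q"
  "(Lft a, Rgt b) \<notin> dsum P Q" "(Rgt a, Lft b) \<notin> dsum P Q"
  by (auto simp: dsum_def)

lemma Field_dsum: "Field (dsum P Q) = Lft ` Field P \<union> Rgt ` Field Q"
  by (force simp: dsum_def Field_def)

lemma Field_dsum_simps [simp]: "Lft a \<in> Field (dsum P Q) \<longleftrightarrow> a \<in> Field P" "Rgt b \<in> Field (dsum P Q) \<longleftrightarrow> b \<in> Field Q"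
  by (auto simp: Field_dsum)

lemma dunion_simps [simp]:
  "P \<in> Ob Pos \<Longrightarrow> Q \<in> Ob Pos \<Longrightarrow> P \<otimes>\<^bsub>dunion\<^esub> Q = dsum P Q"
  "Unt dunion = {}"
  by (simp_all add: dunion_def)

lemma dunion_ar:
  assumes "v \<in> Ar Pos" "w \<in> Ar Pos"
  shows "Src Pos (v \<odot>\<^bsub>dunion\<^esub> w) = dsum (Src Pos v) (Src Pos w)"
    "a \<in> Field (Src Pos v) \<Longrightarrow> fn (v \<odot>\<^bsub>dunion\<^esub> w) (Lft a) = Lft (fn v a)"
    "b \<in> Field (Src Pos w) \<Longrightarrow> fn (v \<odot>\<^bsub>dunion\<^esub> w) (Rgt b) = Rgt (fn w b)"
  using assms by (cases v; cases w; simp add: dunion_def)+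

lemma Src_Pos_cmp: "Src Pos (v \<cdot>\<^bsub>Pos\<^esub> u) = Src Pos u"
  by (cases u; cases v) simp

lemma Pos_iso_bij:
  assumes "is_iso Pos u" shows "bij_betw (fn u) (Field (Src Pos u)) (Field (Tgt Pos u))"
proof -
  obtain v where v: "u \<in> Ar Pos" "v \<in> Ar Pos" "Src Pos v = Tgt Pos u" "Tgt Pos v = Src Pos u"
    "u \<cdot>\<^bsub>Pos\<^esub> v = Ide Pos (Tgt Pos u)"
    using assms by (auto simp: is_iso_def inverses_def hom_iff simp del: Pos_simps)
  have "fn u (fn v y) = y" "fn v y \<in> Field (Src Pos u)" if "y \<in> Field (Tgt Pos u)" for y
    using arg_cong[OF v(5), of "\<lambda>w. fn w y"] fn_cmp[of y v u] fn_Ide[of y "Tgt Pos u"] that v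
      convex_mapD(1)[OF Pos_ArD(2)[OF v(2)], of y] by auto
  then have "Field (Tgt Pos u) \<subseteq> fn u ` Field (Src Pos u)" by (metis imageI subsetI)
  then show ?thesis
    using Pos_ArD(5)[OF v(1)] convex_mapD(1)[OF Pos_ArD(2)[OF v(1)]] by (auto simp: bij_betw_def)
qed

section \<open>Points of a disjoint union of structures\<close>

locale monoidal_species =
  fixes R :: "('v, 'o, 'a) mdrs"
  assumes monoidal_drs: "monoidal_drs R"
begin

abbreviation C where "C \<equiv> Tot (Drs R)"
abbreviation tens (infixr "\<squnion>" 70) where "X \<squnion> Y \<equiv> X \<otimes>\<^bsub>Dsj R\<^esub> Y"
abbreviation tensa (infixr "\<boxplus>" 80) where "a \<boxplus> b \<equiv> a \<odot>\<^bsub>Dsj R\<^esub> b"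

sublocale species "Drs R"
  by (rule species.intro) (use monoidal_drs in \<open>simp add: monoidal_drs_def\<close>)

sublocale M: moncat C "Dsj R"
  by unfold_locales (use monoidal_drs in \<open>simp add: monoidal_drs_def\<close>)

text \<open>The poset under a disjoint union of structures is only isomorphic to
  \<open>dsum\<close>, through \<open>PrjMul\<close>. \<open>inl\<close> and \<open>inr\<close> are
  the resulting coproduct injections, and all later arguments about points are phrased with
  them.\<close>

definition inl where "inl X Y p = fn (PrjMul R (X, Y)) (Lft p)"
definition inr where "inr X Y p = fn (PrjMul R (X, Y)) (Rgt p)"

lemma strong: "strong_monoidal C (Dsj R) Pos dunion \<lparr>Und = Prj (Drs R), Mul = PrjMul R, Uni = PrjUni R\<rparr>"
  using monoidal_drs by (simp add: monoidal_drs_def)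

lemmas strongD = strong_monoidalD[OF strong, simplified mftor.simps]

lemma PrjMul_hom:
  assumes "X \<in> Ob C" "Y \<in> Ob C"
  shows "PrjMul R (X, Y) \<in> Ar Pos" "Src Pos (PrjMul R (X, Y)) = dsum (pos X) (pos Y)"
    "Tgt Pos (PrjMul R (X, Y)) = pos (X \<squnion> Y)" "is_iso Pos (PrjMul R (X, Y))"
  using strongD(3,4)[OF assms] dunion_simps(1)[OF pos_Ob[OF assms(1)] pos_Ob[OF assms(2)]]
  by (auto simp: hom_iff simp del: Pos_simps)

lemma PrjMul_bij:
  assumes "X \<in> Ob C" "Y \<in> Ob C"
  shows "bij_betw (fn (PrjMul R (X, Y))) (Field (dsum (pos X) (pos Y))) (Field (pos (X \<squnion> Y)))"
  using Pos_iso_bij[OF PrjMul_hom(4)[OF assms]] PrjMul_hom[OF assms] by simp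

lemma Field_tens:
  assumes "X \<in> Ob C" "Y \<in> Ob C"
  shows "Field (pos (X \<squnion> Y)) = inl X Y ` Field (pos X) \<union> inr X Y ` Field (pos Y)"
  using PrjMul_bij[OF assms] by (simp add: bij_betw_def Field_dsum image_Un image_image inl_def inr_def)

lemma inl_inr_inject:
  assumes "X \<in> Ob C" "Y \<in> Ob C"
  shows "p \<in> Field (pos X) \<Longrightarrow> p' \<in> Field (pos X) \<Longrightarrow> inl X Y p = inl X Y p' \<longleftrightarrow> p = p'"
    "q \<in> Field (pos Y) \<Longrightarrow> q' \<in> Field (pos Y) \<Longrightarrow> inr X Y q = inr X Y q' \<longleftrightarrow> q = q'"
    "p \<in> Field (pos X) \<Longrightarrow> q \<in> Field (pos Y) \<Longrightarrow> inl X Y p \<noteq> inr X Y q"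
  by (simp_all add: inl_def inr_def inj_on_eq_iff[OF bij_betw_imp_inj_on[OF PrjMul_bij[OF assms]]])

lemma inl_inr_le:
  assumes X: "X \<in> Ob C" and Y: "Y \<in> Ob C"
  shows "p \<in> Field (pos X) \<Longrightarrow> p' \<in> Field (pos X) \<Longrightarrow> (inl X Y p, inl X Y p') \<in> pos (X \<squnion> Y) \<longleftrightarrow> (p, p') \<in> pos X"
    "q \<in> Field (pos Y) \<Longrightarrow> q' \<in> Field (pos Y) \<Longrightarrow> (inr X Y q, inr X Y q') \<in> pos (X \<squnion> Y) \<longleftrightarrow> (q, q') \<in> pos Y"
    "p \<in> Field (pos X) \<Longrightarrow> q \<in> Field (pos Y) \<Longrightarrow> (inl X Y p, inr X Y q) \<notin> pos (X \<squnion> Y)"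
    "p \<in> Field (pos X) \<Longrightarrow> q \<in> Field (pos Y) \<Longrightarrow> (inr X Y q, inl X Y p) \<notin> pos (X \<squnion> Y)"
proof -
  note A = Pos_ArD[OF PrjMul_hom(1)[OF X Y], unfolded PrjMul_hom(2,3)[OF X Y]]
  have *: "(fn (PrjMul R (X, Y)) a, fn (PrjMul R (X, Y)) b) \<in> pos (X \<squnion> Y) \<longleftrightarrow> (a, b) \<in> dsum (pos X) (pos Y)"
    if "a \<in> Field (dsum (pos X) (pos Y))" "b \<in> Field (dsum (pos X) (pos Y))" for a b
    using convex_mapD(2)[OF A(2)] convex_map_reflects[OF A(2-4)] that by blast
  show "p \<in> Field (pos X) \<Longrightarrow> p' \<in> Field (pos X) \<Longrightarrow> (inl X Y p, inl X Y p') \<in> pos (X \<squnion> Y) \<longleftrightarrow> (p, p') \<in> pos X"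
    "q \<in> Field (pos Y) \<Longrightarrow> q' \<in> Field (pos Y) \<Longrightarrow> (inr X Y q, inr X Y q') \<in> pos (X \<squnion> Y) \<longleftrightarrow> (q, q') \<in> pos Y"
    "p \<in> Field (pos X) \<Longrightarrow> q \<in> Field (pos Y) \<Longrightarrow> (inl X Y p, inr X Y q) \<notin> pos (X \<squnion> Y)"
    "p \<in> Field (pos X) \<Longrightarrow> q \<in> Field (pos Y) \<Longrightarrow> (inr X Y q, inl X Y p) \<notin> pos (X \<squnion> Y)"
    by (simp_all add: inl_def inr_def *)
qed

text \<open>Naturality of the monoidal constraint of the projection, evaluated at a point of each
  summand.\<close>

lemma pt_tens:
  assumes a: "a \<in> Ar C" and b: "b \<in> Ar C"
  shows "p \<in> Field (pos (Src C a)) \<Longrightarrow> pt (a \<boxplus> b) (inl (Src C a) (Src C b) p) = inl (Tgt C a) (Tgt C b) (pt a p)"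
    "q \<in> Field (pos (Src C b)) \<Longrightarrow> pt (a \<boxplus> b) (inr (Src C a) (Src C b) q) = inr (Tgt C a) (Tgt C b) (pt b q)"
proof -
  note e = strongD(5)[OF a b]
  note d = dunion_ar[OF Prj_simps(2)[OF a] Prj_simps(2)[OF b], unfolded Prj_simps(3)[OF a] Prj_simps(3)[OF b]]
  have s: "Src Pos (PrjMul R (Src C a, Src C b)) = dsum (pos (Src C a)) (pos (Src C b))"
    using a b by (simp add: PrjMul_hom)
  show "p \<in> Field (pos (Src C a)) \<Longrightarrow> pt (a \<boxplus> b) (inl (Src C a) (Src C b) p) = inl (Tgt C a) (Tgt C b) (pt a p)"
    using arg_cong[OF e, of "\<lambda>w. fn w (Lft p)"] by (simp add: fn_cmp d s inl_def)
  show "q \<in> Field (pos (Src C b)) \<Longrightarrow> pt (a \<boxplus> b) (inr (Src C a) (Src C b) q) = inr (Tgt C a) (Tgt C b) (pt b q)"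
    using arg_cong[OF e, of "\<lambda>w. fn w (Rgt q)"] by (simp add: fn_cmp d s inr_def)
qed

text \<open>The associativity diagram of the projection, evaluated at a point of each of the three
  summands, where \<open>assoc_pt\<close> is explicit.\<close>

lemma pt_Asc:
  assumes X: "X \<in> Ob C" and Y: "Y \<in> Ob C" and Z: "Z \<in> Ob C"
  shows "p \<in> Field (pos X) \<Longrightarrow> pt (Asc (Dsj R) X Y Z) (inl (X \<squnion> Y) Z (inl X Y p)) = inl X (Y \<squnion> Z) p"
    "q \<in> Field (pos Y) \<Longrightarrow> pt (Asc (Dsj R) X Y Z) (inl (X \<squnion> Y) Z (inr X Y q)) = inr X (Y \<squnion> Z) (inl Y Z q)"
    "r \<in> Field (pos Z) \<Longrightarrow> pt (Asc (Dsj R) X Y Z) (inr (X \<squnion> Y) Z r) = inr X (Y \<squnion> Z) (inr Y Z r)"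
proof -
  note P = pos_Ob[OF X] pos_Ob[OF Y] pos_Ob[OF Z]
  note I = Ide_Pos_Ar[OF P(1)] Ide_Pos_Ar[OF P(2)] Ide_Pos_Ar[OF P(3)]
  note d1 = dunion_ar[OF PrjMul_hom(1)[OF X Y] I(3), unfolded PrjMul_hom(2)[OF X Y]]
  note d2 = dunion_ar[OF I(1) PrjMul_hom(1)[OF Y Z], unfolded PrjMul_hom(2)[OF Y Z]]
  note e = strongD(8)[OF X Y Z]
  have A: "Src Pos (Asc dunion (pos X) (pos Y) (pos Z)) = dsum (dsum (pos X) (pos Y)) (pos Z)"
    "fn (Asc dunion (pos X) (pos Y) (pos Z)) = restrict assoc_pt (Field (dsum (dsum (pos X) (pos Y)) (pos Z)))"
    by (simp_all add: dunion_def)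
  have s: "Src Pos (PrjMul R (X \<squnion> Y, Z)) = dsum (pos (X \<squnion> Y)) (pos Z)"
    using X Y Z by (simp add: PrjMul_hom)
  note s' = PrjMul_hom(2)[OF X Y] PrjMul_hom(2)[OF Y Z]
  show "p \<in> Field (pos X) \<Longrightarrow> pt (Asc (Dsj R) X Y Z) (inl (X \<squnion> Y) Z (inl X Y p)) = inl X (Y \<squnion> Z) p"
    using arg_cong[OF e, of "\<lambda>w. fn w (Lft (Lft p))"] d1 d2 A
    by (simp add: fn_cmp Src_Pos_cmp inl_def inr_def)
  show "q \<in> Field (pos Y) \<Longrightarrow> pt (Asc (Dsj R) X Y Z) (inl (X \<squnion> Y) Z (inr X Y q)) = inr X (Y \<squnion> Z) (inl Y Z q)"
    using arg_cong[OF e, of "\<lambda>w. fn w (Lft (Rgt q))"] d1 d2 A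
    by (simp add: fn_cmp Src_Pos_cmp inl_def inr_def)
  show "r \<in> Field (pos Z) \<Longrightarrow> pt (Asc (Dsj R) X Y Z) (inr (X \<squnion> Y) Z r) = inr X (Y \<squnion> Z) (inr Y Z r)"
    using arg_cong[OF e, of "\<lambda>w. fn w (Rgt r)"] d1 d2 A
    by (simp add: fn_cmp Src_Pos_cmp inl_def inr_def)
qed

lemma PrjUni_hom: "PrjUni R \<in> Ar Pos" "Src Pos (PrjUni R) = {}" "Tgt Pos (PrjUni R) = pos (Unt (Dsj R))"
  using strongD(6) by (auto simp: hom_iff)

lemma pos_unit: "pos (Unt (Dsj R)) = {}"
proof -
  have "Field (pos (Unt (Dsj R))) = {}"
    using Pos_iso_bij[OF strongD(7)] PrjUni_hom by (simp add: bij_betw_def)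
  then show ?thesis by (auto simp: Field_def)
qed

lemma pt_Lun: "X \<in> Ob C \<Longrightarrow> p \<in> Field (pos X) \<Longrightarrow> pt (Lun (Dsj R) X) (inr (Unt (Dsj R)) X p) = p"
  and pt_Run: "X \<in> Ob C \<Longrightarrow> p \<in> Field (pos X) \<Longrightarrow> pt (Run (Dsj R) X) (inl X (Unt (Dsj R)) p) = p"
proof -
  assume X: "X \<in> Ob C" and p: "p \<in> Field (pos X)"
  note I = Ide_Pos_Ar[OF pos_Ob[OF X]]
  have L: "fn (Lun dunion (pos X)) (Rgt p) = p" "fn (Run dunion (pos X)) (Lft p) = p"
    using p by (simp_all add: dunion_def)
  show "pt (Lun (Dsj R) X) (inr (Unt (Dsj R)) X p) = p"
    using arg_cong[OF strongD(9)[OF X], of "\<lambda>w. fn w (Rgt p)"] dunion_ar[OF PrjUni_hom(1) I] PrjUni_hom p L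
    by (simp add: fn_cmp Src_Pos_cmp inr_def)
  show "pt (Run (Dsj R) X) (inl X (Unt (Dsj R)) p) = p"
    using arg_cong[OF strongD(10)[OF X], of "\<lambda>w. fn w (Lft p)"] dunion_ar[OF I PrjUni_hom(1)] PrjUni_hom p L
    by (simp add: fn_cmp Src_Pos_cmp inl_def)
qed

text \<open>The inverse in \<open>Ltens_ob\<close> cancels against the injections because
  \<open>PrjMul\<close> is bijective on points. From here on the layering of a disjoint union is
  known by its values on the two summands.\<close>

lemma Ltens_ob_simps:
  assumes x: "x \<in> Lobj (Drs R) n" and y: "y \<in> Lobj (Drs R) n"
  shows "str (Ltens_ob R (x, y)) = str x \<squnion> str y" "fst (Ltens_ob R (x, y)) = pos (str x \<squnion> str y)"
    "p \<in> Field (pos (str x)) \<Longrightarrow> lay (Ltens_ob R (x, y)) (inl (str x) (str y) p) = lay x p"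
    "q \<in> Field (pos (str y)) \<Longrightarrow> lay (Ltens_ob R (x, y)) (inr (str x) (str y) q) = lay y q"
    "lay (Ltens_ob R (x, y)) \<in> extensional (Field (pos (str x \<squnion> str y)))"
proof -
  obtain P l X where xe: "x = (P, l, X)" by (cases x)
  obtain Q m Y where ye: "y = (Q, m, Y)" by (cases y)
  note X = LobjD[OF x, unfolded xe, simplified] and Y = LobjD[OF y, unfolded ye, simplified]
  have i: "inj_on (fn (PrjMul R (X, Y))) (Field (dsum P Q))"
    using PrjMul_bij[of X Y] X(1,2) Y(1,2) by (simp add: bij_betw_def)
  show "str (Ltens_ob R (x, y)) = str x \<squnion> str y" "fst (Ltens_ob R (x, y)) = pos (str x \<squnion> str y)"
    "lay (Ltens_ob R (x, y)) \<in> extensional (Field (pos (str x \<squnion> str y)))"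
    by (simp_all add: xe ye Let_def)
  show "lay (Ltens_ob R (x, y)) (inl (str x) (str y) p) = lay x p" if p: "p \<in> Field (pos (str x))"
  proof -
    have "inl X Y p \<in> Field (pos (X \<squnion> Y))" using p Field_tens[OF X(1) Y(1)] by (simp add: xe)
    moreover have "inv_into (Field (dsum P Q)) (fn (PrjMul R (X, Y))) (inl X Y p) = Lft p"
      unfolding inl_def using i p X by (intro inv_into_f_f) (auto simp: xe)
    ultimately show ?thesis by (simp add: xe ye Let_def)
  qed
  show "lay (Ltens_ob R (x, y)) (inr (str x) (str y) q) = lay y q" if q: "q \<in> Field (pos (str y))"
  proof -
    have "inr X Y q \<in> Field (pos (X \<squnion> Y))" using q Field_tens[OF X(1) Y(1)] by (simp add: ye)
    moreover have "inv_into (Field (dsum P Q)) (fn (PrjMul R (X, Y))) (inr X Y q) = Rgt q"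
      unfolding inr_def using i q Y by (intro inv_into_f_f) (auto simp: ye)
    ultimately show ?thesis by (simp add: xe ye Let_def)
  qed
qed

lemma Ltens_ob_Lobj:
  assumes x: "x \<in> Lobj (Drs R) n" and y: "y \<in> Lobj (Drs R) n"
  shows "Ltens_ob R (x, y) \<in> Lobj (Drs R) n"
proof -
  note X = LobjD[OF x] and Y = LobjD[OF y] and T = Ltens_ob_simps[OF x y]
  obtain W k Z where e: "Ltens_ob R (x, y) = (W, k, Z)" by (cases "Ltens_ob R (x, y)")
  note T = T[unfolded e, simplified]
  note F = Field_tens[OF X(1) Y(1)]
  have "(W, k, Z) \<in> Lobj (Drs R) n"
  proof (rule LobjI)
    show "1 \<le> k v \<and> k v \<le> n" if "v \<in> Field W" for v
      using that unfolding T(2) F using T(3,4) X(4,5) Y(4,5) by auto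
    fix a b assume "(a, b) \<in> W"
    then have ab: "(a, b) \<in> pos (str x \<squnion> str y)" "a \<in> Field (pos (str x \<squnion> str y))" "b \<in> Field (pos (str x \<squnion> str y))"
      using T(2) by (auto simp: Field_def)
    then show "k a \<le> k b"
      unfolding F using T(3,4) X(7) Y(7) inl_inr_le[OF X(1) Y(1)] by auto
  qed (use T X(1) Y(1) in auto)
  then show ?thesis by (simp add: e)
qed

text \<open>Every point of the union comes from exactly one summand and the arrow acts summandwise,
  so the image condition and the layer condition both split. The direction from the union to the
  summands is the reflection that the CULF property of the tensor uses.\<close>

lemma lov_tens:
  assumes f: "f \<in> hom Delta i j" and z: "z \<in> Lobj (Drs R) i" "z' \<in> Lobj (Drs R) i"
    and x: "x \<in> Lobj (Drs R) j" "x' \<in> Lobj (Drs R) j"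
    and a: "a \<in> hom C (str z) (str x)" and b: "b \<in> hom C (str z') (str x')"
  shows "lov (Drs R) f (Ltens_ob R (z, z')) (Ltens_ob R (x, x')) (a \<boxplus> b) \<longleftrightarrow>
    lov (Drs R) f z x a \<and> lov (Drs R) f z' x' b"
proof -
  note Z = LobjD(1,2)[OF z(1)] LobjD(1,2)[OF z(2)] and X = LobjD(1,2)[OF x(1)] LobjD(1,2)[OF x(2)]
  note TZ = Ltens_ob_simps[OF z] and TX = Ltens_ob_simps[OF x]
  have ab: "a \<in> Ar C" "Src C a = str z" "Tgt C a = str x" "b \<in> Ar C" "Src C b = str z'" "Tgt C b = str x'"
    using a b by (auto simp: hom_iff)
  note P = pt_tens[OF ab(1,4), unfolded ab]
  have paF: "pt a w \<in> Field (pos (str x))" if "w \<in> Field (pos (str z))" for w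
    using pt_Field[OF ab(1)] that ab by simp
  have pbF: "pt b w \<in> Field (pos (str x'))" if "w \<in> Field (pos (str z'))" for w
    using pt_Field[OF ab(4)] that ab by simp
  note FZ = Field_tens[OF Z(1,3)] and FX = Field_tens[OF X(1,3)]
  have img: "pt (a \<boxplus> b) ` Field (pos (str z \<squnion> str z')) =
      inl (str x) (str x') ` pt a ` Field (pos (str z)) \<union> inr (str x) (str x') ` pt b ` Field (pos (str z'))"
    unfolding FZ image_Un image_image using P by (intro arg_cong2[of _ _ _ _ "(\<union>)"] image_cong) auto
  have il: "inl (str x) (str x') v \<in> pt (a \<boxplus> b) ` Field (pos (str z \<squnion> str z')) \<longleftrightarrow> v \<in> pt a ` Field (pos (str z))"
    if "v \<in> Field (pos (str x))" for v
    unfolding img using that paF pbF inl_inr_inject[OF X(1,3)] by auto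
  have ir: "inr (str x) (str x') v \<in> pt (a \<boxplus> b) ` Field (pos (str z \<squnion> str z')) \<longleftrightarrow> v \<in> pt b ` Field (pos (str z'))"
    if "v \<in> Field (pos (str x'))" for v
    unfolding img using that paF pbF inl_inr_inject[OF X(1,3)] inl_inr_inject(3)[OF X(1,3), symmetric] by auto
  have ball: "(\<forall>w\<in>Field (pos (str y \<squnion> str y')). Q w) \<longleftrightarrow>
      (\<forall>w\<in>Field (pos (str y)). Q (inl (str y) (str y') w)) \<and> (\<forall>w\<in>Field (pos (str y')). Q (inr (str y) (str y') w))"
    if "str y \<in> Ob C" "str y' \<in> Ob C" for Q and y y' :: "('v, 'o) lobj"
    unfolding Field_tens[OF that] by auto
  show ?thesis
    unfolding lov_def TZ(1,2) TX(1,2) ball[OF Z(1,3)] ball[OF X(1,3)] Z(2,4) X(2,4)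
    using f z x a b Ltens_ob_Lobj[OF z] Ltens_ob_Lobj[OF x] ab
    by (auto simp: hom_iff il ir P TZ(3,4) TX(3,4) paF pbF)
qed

end

section \<open>The monoidal decomposition space of layered structures\<close>

context monoidal_species
begin

abbreviation L where "L \<equiv> Lcat (Drs R)"
abbreviation Lay_ob where "Lay_ob \<equiv> Lobj (Drs R)"

lemma Ltens_simps [simp]:
  "x \<in> Lay_ob n \<Longrightarrow> y \<in> Lay_ob n \<Longrightarrow> OM (Cpt (Ltens R) n) (x, y) = Ltens_ob R (x, y)"
  "(x, a, x') \<in> Ar (L n) \<Longrightarrow> (y, b, y') \<in> Ar (L n) \<Longrightarrow>
    AM (Cpt (Ltens R) n) ((x, a, x'), (y, b, y')) = (Ltens_ob R (x, y), a \<boxplus> b, Ltens_ob R (x', y'))"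
  "f \<in> hom Delta i j \<Longrightarrow> x \<in> Lay_ob j \<Longrightarrow> y \<in> Lay_ob j \<Longrightarrow> Cel (Ltens R) f (x, y) =
    (Ltens_ob R (OM (Lact (Drs R) f) x, OM (Lact (Drs R) f) y),
     fill C (Llift (Drs R) f (Ltens_ob R (x, y))) (Llift (Drs R) f x \<boxplus> Llift (Drs R) f y),
     OM (Lact (Drs R) f) (Ltens_ob R (x, y)))"
  by (simp_all add: Ltens_def hom_iff)

lemma Ltens_ar:
  assumes "(x, a, x') \<in> Ar (L n)" "(y, b, y') \<in> Ar (L n)"
  shows "(Ltens_ob R (x, y), a \<boxplus> b, Ltens_ob R (x', y')) \<in> Ar (L n)"
proof -
  have A: "x \<in> Lay_ob n" "x' \<in> Lay_ob n" "y \<in> Lay_ob n" "y' \<in> Lay_ob n" "a \<in> hom C (str x) (str x')" "b \<in> hom C (str y) (str y')"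
    using assms by (auto simp: Lcat_Ar)
  have "Ide Delta n \<in> hom Delta n n" by (simp add: hom_iff)
  from lov_tens[OF this A(1,3,2,4,5,6)] show ?thesis
    using assms by (simp add: lov_Ide)
qed

lemma Ltens_functor: "is_functor (prod_cat (L n) (L n)) (L n) (Cpt (Ltens R) n)"
proof -
  interpret L: cat "L n" by (rule cat.intro) (rule category_Lcat)
  show ?thesis
  proof (rule functorI)
    show "OM (Cpt (Ltens R) n) x \<in> Ob (L n)" if "x \<in> Ob (prod_cat (L n) (L n))" for x
      using that Ltens_ob_Lobj by (cases x) auto
    show "AM (Cpt (Ltens R) n) \<alpha> \<in> hom (L n) (OM (Cpt (Ltens R) n) (Src (prod_cat (L n) (L n)) \<alpha>))
        (OM (Cpt (Ltens R) n) (Tgt (prod_cat (L n) (L n)) \<alpha>))" if "\<alpha> \<in> Ar (prod_cat (L n) (L n))" for \<alpha>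
    proof -
      obtain x a x' y b y' where e: "\<alpha> = ((x, a, x'), (y, b, y'))" by (metis surj_pair)
      have A: "(x, a, x') \<in> Ar (L n)" "(y, b, y') \<in> Ar (L n)" using that by (auto simp: e)
      then have "x \<in> Lay_ob n" "x' \<in> Lay_ob n" "y \<in> Lay_ob n" "y' \<in> Lay_ob n" by (auto simp: Lcat_Ar)
      then show ?thesis using A Ltens_ar[OF A] by (simp add: e hom_iff)
    qed
    show "AM (Cpt (Ltens R) n) (Ide (prod_cat (L n) (L n)) x) = Ide (L n) (OM (Cpt (Ltens R) n) x)"
      if "x \<in> Ob (prod_cat (L n) (L n))" for x
    proof -
      obtain y z where e: "x = (y, z)" by (cases x)
      have yz: "y \<in> Lay_ob n" "z \<in> Lay_ob n" using that by (auto simp: e)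
      then have "(y, Ide C (str y), y) \<in> Ar (L n)" "(z, Ide C (str z), z) \<in> Ar (L n)"
        using L.Ide_Ar[of y] L.Ide_Ar[of z] by simp_all
      then show ?thesis using yz LobjD(1)[OF yz(1)] LobjD(1)[OF yz(2)] by (simp add: e Ltens_ob_simps(1))
    qed
    show "AM (Cpt (Ltens R) n) (\<beta> \<cdot>\<^bsub>prod_cat (L n) (L n)\<^esub> \<alpha>) = AM (Cpt (Ltens R) n) \<beta> \<cdot>\<^bsub>L n\<^esub> AM (Cpt (Ltens R) n) \<alpha>"
      if ab: "\<alpha> \<in> Ar (prod_cat (L n) (L n))" "\<beta> \<in> Ar (prod_cat (L n) (L n))"
        "Src (prod_cat (L n) (L n)) \<beta> = Tgt (prod_cat (L n) (L n)) \<alpha>" for \<alpha> \<beta>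
    proof -
      obtain x a x' y b y' where e: "\<alpha> = ((x, a, x'), (y, b, y'))" by (metis surj_pair)
      obtain c x'' d y'' where e': "\<beta> = ((x', c, x''), (y', d, y''))" using ab(3) unfolding e by (cases \<beta>) auto
      have A: "(x, a, x') \<in> Ar (L n)" "(y, b, y') \<in> Ar (L n)" "(x', c, x'') \<in> Ar (L n)" "(y', d, y'') \<in> Ar (L n)"
        using ab by (auto simp: e e')
      have "(x, c \<cdot>\<^bsub>C\<^esub> a, x'') \<in> Ar (L n)" "(y, d \<cdot>\<^bsub>C\<^esub> b, y'') \<in> Ar (L n)"
        using L.cmp_Ar[OF A(1,3)] L.cmp_Ar[OF A(2,4)] by simp_all
      then show ?thesis using A by (simp add: e e') (simp add: Lcat_Ar hom_iff)
    qed
  qed (auto simp: Ltens_def)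
qed

lemma fibred_map_Ltens:
  "fibred_map (prod_sgpd (Lsgpd (Drs R)) (Lsgpd (Drs R))) (prod_cat C C) (map_prod (\<lambda>x. str x) (\<lambda>x. str x))
    (map_prod (\<lambda>\<alpha>. fst (snd \<alpha>)) (\<lambda>\<alpha>. fst (snd \<alpha>)))
    (\<lambda>f z x a. lov (Drs R) f (fst z) (fst x) (fst a) \<and> lov (Drs R) f (snd z) (snd x) (snd a))
    (\<lambda>f x. (Llift (Drs R) f (fst x), Llift (Drs R) f (snd x)))
    (Lsgpd (Drs R)) C (\<lambda>x. str x) (\<lambda>\<alpha>. fst (snd \<alpha>)) (lov (Drs R)) (Llift (Drs R)) (Ltens R) (Tns (Dsj R))"
proof (intro fibred_map.intro fibred_prod fibred_Lsgpd, unfold_locales, goal_cases)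
  case 1 show ?case by (rule M.Tns_functor)
next
  case (2 n) show ?case by (simp add: Ltens_functor)
next
  case (3 x n)
  then have x: "fst x \<in> Lay_ob n" "snd x \<in> Lay_ob n" by auto
  then show ?case using Ltens_ob_simps(1)[OF x] Ltens_simps(1)[OF x] by (simp add: map_prod_def case_prod_beta)
next
  case (4 \<alpha> n)
  obtain x a x' y b y' where "\<alpha> = ((x, a, x'), (y, b, y'))" by (metis surj_pair)
  with 4 show ?case by simp
next
  case (5 f i j z x a)
  obtain z1 z2 x1 x2 a1 a2 where "z = (z1, z2)" "x = (x1, x2)" "a = (a1, a2)" by (metis surj_pair)
  with 5 show ?case by (simp add: lov_tens hom_prod_cat)
next
  case 6 show ?case by (simp add: Ltens_def)
next
  case (7 f) then show ?case by (simp add: Ltens_def)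
next
  case (8 f i j xy)
  obtain x y where e: "xy = (x, y)" by (cases xy)
  have x: "x \<in> Lay_ob j" "y \<in> Lay_ob j" using 8 by (auto simp: e)
  have f: "f \<in> Ar Delta" "Src Delta f = i" "Tgt Delta f = j" using 8 by (auto simp: hom_iff)
  have l: "lov (Drs R) f (OM (Lact (Drs R) f) x) x (Llift (Drs R) f x)" "lov (Drs R) f (OM (Lact (Drs R) f) y) y (Llift (Drs R) f y)"
    using Lact_lov[OF f(1)] x f by auto
  note l1 = lovD[OF l(1)] and l2 = lovD[OF l(2)]
  have t: "lov (Drs R) f (Ltens_ob R (OM (Lact (Drs R) f) x, OM (Lact (Drs R) f) y)) (Ltens_ob R (x, y))
      (Llift (Drs R) f x \<boxplus> Llift (Drs R) f y)"
    using l l1 l2 f x 8 by (subst lov_tens[of f i j]) (auto simp: hom_iff)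
  have "lov (Drs R) f (OM (Lact (Drs R) f) (Ltens_ob R (x, y))) (Ltens_ob R (x, y)) (Llift (Drs R) f (Ltens_ob R (x, y)))"
    using Ltens_ob_Lobj[OF x] f by (intro Lact_lov) auto
  from fill_Ar[OF this t, of i] show ?case
    using x l1 l2 f 8 Ltens_ob_Lobj[OF x] by (simp add: e Lcat_hom)
qed

text \<open>A refinement of the layering of a disjoint union is the same as a pair of refinements:
  restrict it along the two injections and reassemble.\<close>

lemma culf_Ltens: "culf (prod_sgpd (Lsgpd (Drs R)) (Lsgpd (Drs R))) (Lsgpd (Drs R)) (Ltens R)"
proof -
  interpret T: fibred_map "prod_sgpd (Lsgpd (Drs R)) (Lsgpd (Drs R))" "prod_cat C C" "map_prod (\<lambda>x. str x) (\<lambda>x. str x)"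
    "map_prod (\<lambda>\<alpha>. fst (snd \<alpha>)) (\<lambda>\<alpha>. fst (snd \<alpha>))"
    "\<lambda>f z x a. lov (Drs R) f (fst z) (fst x) (fst a) \<and> lov (Drs R) f (snd z) (snd x) (snd a)"
    "\<lambda>f x. (Llift (Drs R) f (fst x), Llift (Drs R) f (snd x))"
    "Lsgpd (Drs R)" C "\<lambda>x. str x" "\<lambda>\<alpha>. fst (snd \<alpha>)" "lov (Drs R)" "Llift (Drs R)" "Ltens R" "Tns (Dsj R)"
    by (rule fibred_map_Ltens)
  show ?thesis
  proof (rule T.culf)
    fix g i j z y a
    assume g: "g \<in> hom Delta i j" "generic_map g" and z: "z \<in> Ob (Val (prod_sgpd (Lsgpd (Drs R)) (Lsgpd (Drs R))) i)"
      and a0: "lov (Drs R) g (OM (Cpt (Ltens R) i) z) y a"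
    obtain z1 z2 where e: "z = (z1, z2)" by (cases z)
    have z12: "z1 \<in> Lay_ob i" "z2 \<in> Lay_ob i" using z by (auto simp: e)
    have a: "lov (Drs R) g (Ltens_ob R (z1, z2)) y a" using a0 z12 by (simp add: e)
    have gj: "Tgt Delta g = j" using g by (simp add: hom_iff)
    note Z1 = LobjD[OF z12(1)] and Z2 = LobjD[OF z12(2)] and TZ = Ltens_ob_simps[OF z12]
    note F = generic_pushforward[OF g(2) a, unfolded TZ(1,2) gj]
    define w where "w = (pos (str z1 \<squnion> str z2), \<lambda>v\<in>Field (pos (str z1 \<squnion> str z2)). lay y (pt a v), str z1 \<squnion> str z2)"
    note W = LobjD[OF F(1), simplified]
    define il where "il = inl (str z1) (str z2)"
    define ir where "ir = inr (str z1) (str z2)"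
    have FF: "Field (pos (str z1 \<squnion> str z2)) = il ` Field (pos (str z1)) \<union> ir ` Field (pos (str z2))"
      unfolding il_def ir_def by (rule Field_tens[OF Z1(1) Z2(1)])
    \<comment> \<open>Restrictions to the summands of the layering \<open>w\<close>, which is that
      of \<open>y\<close> pulled back along \<open>a\<close>.\<close>
    define x1 where "x1 = (pos (str z1), \<lambda>p\<in>Field (pos (str z1)). lay y (pt a (il p)), str z1)"
    define x2 where "x2 = (pos (str z2), \<lambda>p\<in>Field (pos (str z2)). lay y (pt a (ir p)), str z2)"
    have ilF: "il p \<in> Field (pos (str z1 \<squnion> str z2))" if "p \<in> Field (pos (str z1))" for p using that FF by auto
    have irF: "ir p \<in> Field (pos (str z1 \<squnion> str z2))" if "p \<in> Field (pos (str z2))" for p using that FF by auto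
    have x1: "x1 \<in> Lay_ob j"
      unfolding x1_def
    proof (rule LobjI)
      fix p q assume "(p, q) \<in> pos (str z1)"
      moreover from this have "p \<in> Field (pos (str z1))" "q \<in> Field (pos (str z1))" by (auto simp: Field_def)
      moreover from calculation have "(il p, il q) \<in> pos (str z1 \<squnion> str z2)"
        unfolding il_def by (subst inl_inr_le[OF Z1(1) Z2(1)]) auto
      ultimately show "(\<lambda>p\<in>Field (pos (str z1)). lay y (pt a (il p))) p \<le> (\<lambda>p\<in>Field (pos (str z1)). lay y (pt a (il p))) q"
        using W(7)[of "il p" "il q"] ilF by simp
    qed (use Z1(1) W(4,5) ilF in \<open>force+\<close>)
    have x2: "x2 \<in> Lay_ob j"
      unfolding x2_def
    proof (rule LobjI)
      fix p q assume "(p, q) \<in> pos (str z2)"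
      moreover from this have "p \<in> Field (pos (str z2))" "q \<in> Field (pos (str z2))" by (auto simp: Field_def)
      moreover from calculation have "(ir p, ir q) \<in> pos (str z1 \<squnion> str z2)"
        unfolding ir_def by (subst inl_inr_le[OF Z1(1) Z2(1)]) auto
      ultimately show "(\<lambda>p\<in>Field (pos (str z2)). lay y (pt a (ir p))) p \<le> (\<lambda>p\<in>Field (pos (str z2)). lay y (pt a (ir p))) q"
        using W(7)[of "ir p" "ir q"] irF by simp
    qed (use Z2(1) W(4,5) irF in \<open>force+\<close>)
    note TX = Ltens_ob_simps[OF x1 x2]
    have str: "str x1 = str z1" "str x2 = str z2" by (simp_all add: x1_def x2_def)
    \<comment> \<open>Both functions are extensional on the same field, so agreement on the two
      summands makes the reassembled object equal to \<open>w\<close>, not just isomorphic.\<close>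
    have "lay (Ltens_ob R (x1, x2)) = lay w"
    proof (rule extensionalityI[of _ "Field (pos (str z1 \<squnion> str z2))"])
      show "lay (Ltens_ob R (x1, x2)) \<in> extensional (Field (pos (str z1 \<squnion> str z2)))" using TX(5) by (simp add: str)
      show "lay w \<in> extensional (Field (pos (str z1 \<squnion> str z2)))" by (simp add: w_def)
      fix v assume v: "v \<in> Field (pos (str z1 \<squnion> str z2))"
      then consider p where "p \<in> Field (pos (str z1))" "v = il p" | q where "q \<in> Field (pos (str z2))" "v = ir q"
        unfolding FF by blast
      then show "lay (Ltens_ob R (x1, x2)) v = lay w v"
      proof cases
        case 1
        then show ?thesis using TX(3)[of p] v by (simp add: str il_def[symmetric]) (simp add: w_def x1_def)
      next
        case 2
        then show ?thesis using TX(4)[of q] v by (simp add: str ir_def[symmetric]) (simp add: w_def x2_def)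
      qed
    qed
    then have w: "Ltens_ob R (x1, x2) = w"
      using TX(1,2) str by (intro prod_eqI) (auto simp: w_def)
    \<comment> \<open>The identity of the union is the tensor of two identities, so
      \<open>lov_tens\<close> splits the statement about \<open>w\<close> into statements about
      \<open>x1\<close> and \<open>x2\<close>.\<close>
    have "Ide C (str z1) \<in> hom C (str z1) (str x1)" "Ide C (str z2) \<in> hom C (str z2) (str x2)"
      using Z1(1) Z2(1) by (auto simp: str hom_iff)
    from lov_tens[OF g(1) z12 x1 x2 this]
    have "lov (Drs R) g z1 x1 (Ide C (str z1)) \<and> lov (Drs R) g z2 x2 (Ide C (str z2))"
      using F(2) Z1(1) Z2(1) w by (simp add: w_def)
    moreover have "lov (Drs R) (Ide Delta j) (Ltens_ob R (x1, x2)) y a"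
      using F(3) by (simp add: w w_def)
    ultimately show "\<exists>x\<in>Ob (Val (prod_sgpd (Lsgpd (Drs R)) (Lsgpd (Drs R))) j).
       map_prod str str x = map_prod str str z \<and>
       (lov (Drs R) g (fst z) (fst x) (fst (Ide (prod_cat C C) (map_prod str str z))) \<and>
        lov (Drs R) g (snd z) (snd x) (snd (Ide (prod_cat C C) (map_prod str str z)))) \<and>
       lov (Drs R) (Ide Delta j) (OM (Cpt (Ltens R) j) x) y a"
      using x1 x2 by (intro bexI[of _ "(x1, x2)"]) (auto simp: e str)
  qed
qed

lemma Lunit_Lobj: "Lunit_ob R \<in> Lay_ob n"
  unfolding Lunit_ob_def by (rule LobjI) (auto simp: pos_unit)

text \<open>With no points both conditions of \<open>lov\<close> are vacuous. This is why the same
  unit object serves in every degree and its identity lies over every operator.\<close>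

lemma Lunit_lov: "f \<in> Ar Delta \<Longrightarrow> lov (Drs R) f (Lunit_ob R) (Lunit_ob R) (Ide C (Unt (Dsj R)))"
  using Lunit_Lobj by (intro lovI) (auto simp: Lunit_ob_def pos_unit hom_iff)

lemma Lunit_ar: "(Lunit_ob R, Ide C (Unt (Dsj R)), Lunit_ob R) \<in> Ar (L n)"
  using Lunit_lov[of "Ide Delta n"] by (simp add: lov_Ide)

lemma str_Lunit: "str (Lunit_ob R) = Unt (Dsj R)"
  by (simp add: Lunit_ob_def)

lemma fibred_map_Lunit:
  "fibred_map unit_sgpd unit_cat id id (\<lambda>f z x a. f \<in> Ar Delta) (\<lambda>f x. ())
    (Lsgpd (Drs R)) C (\<lambda>x. str x) (\<lambda>\<alpha>. fst (snd \<alpha>)) (lov (Drs R)) (Llift (Drs R)) (Lunit R) (unit_ftor C (Dsj R))"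
proof (intro fibred_map.intro fibred_unit fibred_Lsgpd, unfold_locales, goal_cases)
  case 1 show ?case by (rule functorI) (auto simp: hom_iff)
next
  case (2 n) show ?case
    using Lunit_Lobj Lunit_ar by (intro functorI) (auto simp: Lunit_def hom_iff str_Lunit)
next
  case (3 x n) then show ?case by (simp add: Lunit_def str_Lunit)
next
  case (4 \<alpha> n) then show ?case by (simp add: Lunit_def)
next
  case (5 f i j z x a) then show ?case using Lunit_lov by (simp add: Lunit_def hom_iff)
next
  case 6 show ?case by (simp add: Lunit_def)
next
  case (7 f) then show ?case by simp
next
  case (8 f i j x)
  then have f: "f \<in> Ar Delta" "Src Delta f = i" "Tgt Delta f = j" by (auto simp: hom_iff)
  have "lov (Drs R) f (OM (Lact (Drs R) f) (Lunit_ob R)) (Lunit_ob R) (Llift (Drs R) f (Lunit_ob R))"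
    using Lunit_Lobj f by (intro Lact_lov) auto
  from fill_Ar[OF this Lunit_lov[OF f(1)], of i] show ?case
    using f by (simp add: Lunit_def Lcat_hom)
qed

lemma Lmsgpd_simps [simp]: "Base (Lmsgpd R) = Lsgpd (Drs R)" "PTns (Lmsgpd R) = Ltens R" "PUnt (Lmsgpd R) = Lunit R"
  by (simp_all add: Lmsgpd_def)

text \<open>What remains is that the constraints respect layerings. The associator is checked on the
  points of the three summands by \<open>pt_Asc\<close>; for the unitors only the points of
  \<open>x\<close> occur, as the unit has none.\<close>

lemma fibred_monoidal_Lmsgpd:
  "fibred_monoidal (Lmsgpd R) C (\<lambda>x. str x) (\<lambda>\<alpha>. fst (snd \<alpha>)) (lov (Drs R)) (Llift (Drs R)) (Dsj R)"
proof (intro fibred_monoidal.intro, unfold Lmsgpd_simps)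
  show "fibred (Lsgpd (Drs R)) C (\<lambda>x. str x) (\<lambda>\<alpha>. fst (snd \<alpha>)) (lov (Drs R)) (Llift (Drs R))"
    by (rule fibred_Lsgpd)
  show "moncat C (Dsj R)" by (rule M.moncat_axioms)
  show "fibred_map (prod_sgpd (Lsgpd (Drs R)) (Lsgpd (Drs R))) (prod_cat C C) (map_prod (\<lambda>x. str x) (\<lambda>x. str x))
    (map_prod (\<lambda>\<alpha>. fst (snd \<alpha>)) (\<lambda>\<alpha>. fst (snd \<alpha>)))
    (\<lambda>f z x a. lov (Drs R) f (fst z) (fst x) (fst a) \<and> lov (Drs R) f (snd z) (snd x) (snd a))
    (\<lambda>f x. (Llift (Drs R) f (fst x), Llift (Drs R) f (snd x)))
    (Lsgpd (Drs R)) C (\<lambda>x. str x) (\<lambda>\<alpha>. fst (snd \<alpha>)) (lov (Drs R)) (Llift (Drs R)) (Ltens R) (Tns (Dsj R))"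
    by (rule fibred_map_Ltens)
  show "fibred_map unit_sgpd unit_cat id id (\<lambda>f z x a. f \<in> Ar Delta) (\<lambda>f x. ())
    (Lsgpd (Drs R)) C (\<lambda>x. str x) (\<lambda>\<alpha>. fst (snd \<alpha>)) (lov (Drs R)) (Llift (Drs R)) (Lunit R) (unit_ftor C (Dsj R))"
    by (rule fibred_map_Lunit)
  have U: "Unt (mon_at (Lmsgpd R) n) = Lunit_ob R" "Tns (mon_at (Lmsgpd R) n) = Cpt (Ltens R) n" for n
    by (simp_all add: mon_at_def Lunit_def)
  show "fibred_monoidal_axioms (Lmsgpd R) (\<lambda>x. str x) (\<lambda>\<alpha>. fst (snd \<alpha>)) (Dsj R)"
  proof (unfold_locales, unfold Lmsgpd_simps Lsgpd_simps Lcat_simps U, goal_cases)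
    case (1 x n y z)
    note T = Ltens_ob_Lobj[OF 1(1,2)] Ltens_ob_Lobj[OF 1(2,3)]
    note T' = Ltens_ob_Lobj[OF T(1) 1(3)] Ltens_ob_Lobj[OF 1(1) T(2)]
    note S1 = Ltens_ob_simps[OF 1(1,2)] and S2 = Ltens_ob_simps[OF 1(2,3)]
    note S3 = Ltens_ob_simps[OF T(1) 1(3), unfolded S1(1)] and S4 = Ltens_ob_simps[OF 1(1) T(2), unfolded S2(1)]
    note X = LobjD(1)[OF 1(1)] LobjD(1)[OF 1(2)] LobjD(1)[OF 1(3)]
    have xy: "str x \<squnion> str y \<in> Ob C" "str y \<squnion> str z \<in> Ob C" using X by auto
    note A = pt_Asc[OF X]
    have "(Ltens_ob R (Ltens_ob R (x, y), z), Asc (Dsj R) (str x) (str y) (str z), Ltens_ob R (x, Ltens_ob R (y, z))) \<in> Ar (L n)"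
      unfolding Lcat_Ar
    proof (intro conjI ballI)
      fix v assume "v \<in> Field (fst (Ltens_ob R (Ltens_ob R (x, y), z)))"
      then have "v \<in> inl (str x \<squnion> str y) (str z) ` (inl (str x) (str y) ` Field (pos (str x)) \<union> inr (str x) (str y) ` Field (pos (str y)))
          \<union> inr (str x \<squnion> str y) (str z) ` Field (pos (str z))"
        unfolding S3(2) Field_tens[OF xy(1) X(3)] Field_tens[OF X(1,2)] .
      moreover have "inl (str x) (str y) p \<in> Field (pos (str x \<squnion> str y))" if "p \<in> Field (pos (str x))" for p
        using that Field_tens[OF X(1,2)] by auto
      moreover have "inr (str x) (str y) p \<in> Field (pos (str x \<squnion> str y))" if "p \<in> Field (pos (str y))" for p
        using that Field_tens[OF X(1,2)] by auto
      moreover have "inl (str y) (str z) p \<in> Field (pos (str y \<squnion> str z))" if "p \<in> Field (pos (str y))" for p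
        using that Field_tens[OF X(2,3)] by auto
      moreover have "inr (str y) (str z) p \<in> Field (pos (str y \<squnion> str z))" if "p \<in> Field (pos (str z))" for p
        using that Field_tens[OF X(2,3)] by auto
      ultimately show "lay (Ltens_ob R (x, Ltens_ob R (y, z))) (pt (Asc (Dsj R) (str x) (str y) (str z)) v) =
           lay (Ltens_ob R (Ltens_ob R (x, y), z)) v"
        by (auto simp: A S1(3,4) S2(3,4) S3(3,4) S4(3,4))
    qed (use T' X S3(1) S4(1) M.constraint_iso(1)[OF X] in \<open>auto simp: hom_iff\<close>)
    then show ?case
      using 1 T by (simp add: Lmsgpd_def Lcat_hom)
  next
    case (2 x n)
    note T = Ltens_ob_Lobj[OF Lunit_Lobj 2] and S = Ltens_ob_simps[OF Lunit_Lobj 2, unfolded str_Lunit] and X = LobjD(1)[OF 2]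
    have "(Ltens_ob R (Lunit_ob R, x), Lun (Dsj R) (str x), x) \<in> Ar (L n)"
      unfolding Lcat_Ar
    proof (intro conjI ballI)
      fix v assume "v \<in> Field (fst (Ltens_ob R (Lunit_ob R, x)))"
      then obtain p where "p \<in> Field (pos (str x))" "v = inr (Unt (Dsj R)) (str x) p"
        unfolding S(2) Field_tens[OF M.Unt_Ob X] by (auto simp: pos_unit)
      then show "lay x (pt (Lun (Dsj R) (str x)) v) = lay (Ltens_ob R (Lunit_ob R, x)) v"
        using pt_Lun[OF X] S(4) by simp
    qed (use T 2 X S(1) M.constraint_iso(2)[OF X] in \<open>auto simp: hom_iff\<close>)
    then show ?case using 2 Lunit_Lobj by (simp add: Lmsgpd_def Lcat_hom)
  next
    case (3 x n)
    note T = Ltens_ob_Lobj[OF 3 Lunit_Lobj] and S = Ltens_ob_simps[OF 3 Lunit_Lobj, unfolded str_Lunit] and X = LobjD(1)[OF 3]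
    have "(Ltens_ob R (x, Lunit_ob R), Run (Dsj R) (str x), x) \<in> Ar (L n)"
      unfolding Lcat_Ar
    proof (intro conjI ballI)
      fix v assume "v \<in> Field (fst (Ltens_ob R (x, Lunit_ob R)))"
      then obtain p where "p \<in> Field (pos (str x))" "v = inl (str x) (Unt (Dsj R)) p"
        unfolding S(2) Field_tens[OF X M.Unt_Ob] by (auto simp: pos_unit)
      then show "lay x (pt (Run (Dsj R) (str x)) v) = lay (Ltens_ob R (x, Lunit_ob R)) v"
        using pt_Run[OF X] S(3) by simp
    qed (use T 3 X S(1) M.constraint_iso(3)[OF X] in \<open>auto simp: hom_iff\<close>)
    then show ?case using 3 Lunit_Lobj by (simp add: Lmsgpd_def Lcat_hom)
  qed
qed

theorem monoidal_decomposition_space_Lmsgpd: "monoidal_decomposition_space (Lmsgpd R)"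
  unfolding monoidal_decomposition_space_def
  using decomposition_space_Lsgpd fibred_monoidal.monoidal_sgpd[OF fibred_monoidal_Lmsgpd] culf_Ltens by simp

end

section \<open>Morphisms of monoidal directed restriction species\<close>

locale monoidal_species_map = R': monoidal_species R' + R: monoidal_species R
  for R' :: "('v, 'o, 'a) mdrs" and R :: "('v, 'p, 'b) mdrs" +
  fixes \<phi> :: "('o, 'a, 'p, 'b) mftor"
  assumes strong_map: "strong_monoidal (Tot (Drs R')) (Dsj R') (Tot (Drs R)) (Dsj R) \<phi>"
    and drs_map: "drs_morphism (Drs R') (Drs R) (Und \<phi>)"
begin

sublocale S: species_map "Drs R'" "Drs R" "Und \<phi>"
  by (intro species_map.intro R'.species_axioms R.species_axioms species_map_axioms.intro drs_map)

lemma Mul_hom: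
  assumes "X \<in> Ob R'.C" "Y \<in> Ob R'.C"
  shows "Mul \<phi> (X, Y) \<in> Ar R.C" "Src R.C (Mul \<phi> (X, Y)) = OM (Und \<phi>) X \<otimes>\<^bsub>Dsj R\<^esub> OM (Und \<phi>) Y"
    "Tgt R.C (Mul \<phi> (X, Y)) = OM (Und \<phi>) (X \<otimes>\<^bsub>Dsj R'\<^esub> Y)" "is_iso R.C (Mul \<phi> (X, Y))"
  using strong_monoidalD(3,4)[OF strong_map assms] by (auto simp: hom_iff)

lemma pt_map: "a \<in> Ar R'.C \<Longrightarrow> R.pt (AM (Und \<phi>) a) = R'.pt a"
  by (simp add: S.Prj_map)

text \<open>By naturality, the constraints of \<open>\<phi>\<close> and of the projections can be compared after restriction to
  structures whose disjoint union has a single point, where there is no choice.\<close>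

lemma pt_Mul_restrict:
  assumes a: "a \<in> Ar R'.C" and b: "b \<in> Ar R'.C"
    and s: "s \<in> Field (dsum (R'.pos (Src R'.C a)) (R'.pos (Src R'.C b)))"
    and one: "Field (R'.pos (Src R'.C a \<otimes>\<^bsub>Dsj R'\<^esub> Src R'.C b)) = {s'}"
  shows "R.pt (Mul \<phi> (Tgt R'.C a, Tgt R'.C b))
      (R.pt (AM (Und \<phi>) a \<odot>\<^bsub>Dsj R\<^esub> AM (Und \<phi>) b) (fn (PrjMul R (OM (Und \<phi>) (Src R'.C a), OM (Und \<phi>) (Src R'.C b))) s))
    = R'.pt (a \<odot>\<^bsub>Dsj R'\<^esub> b) s'"
proof -
  let ?X = "Src R'.C a" and ?Y = "Src R'.C b"
  note m = S.map_simps(1-4)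
  have X: "?X \<in> Ob R'.C" "?Y \<in> Ob R'.C" "Tgt R'.C a \<in> Ob R'.C" "Tgt R'.C b \<in> Ob R'.C" using a b by auto
  define t where "t = fn (PrjMul R (OM (Und \<phi>) ?X, OM (Und \<phi>) ?Y)) s"
  have t: "t \<in> Field (R.pos (OM (Und \<phi>) ?X \<otimes>\<^bsub>Dsj R\<^esub> OM (Und \<phi>) ?Y))"
    using R.PrjMul_bij[of "OM (Und \<phi>) ?X" "OM (Und \<phi>) ?Y"] X m(1) s S.pos_map[OF X(1)] S.pos_map[OF X(2)]
    unfolding t_def bij_betw_def by auto
  have ab: "AM (Und \<phi>) a \<odot>\<^bsub>Dsj R\<^esub> AM (Und \<phi>) b \<in> Ar R.C"
    "Src R.C (AM (Und \<phi>) a \<odot>\<^bsub>Dsj R\<^esub> AM (Und \<phi>) b) = OM (Und \<phi>) ?X \<otimes>\<^bsub>Dsj R\<^esub> OM (Und \<phi>) ?Y"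
    "Tgt R.C (AM (Und \<phi>) a \<odot>\<^bsub>Dsj R\<^esub> AM (Und \<phi>) b) = OM (Und \<phi>) (Tgt R'.C a) \<otimes>\<^bsub>Dsj R\<^esub> OM (Und \<phi>) (Tgt R'.C b)"
    "a \<odot>\<^bsub>Dsj R'\<^esub> b \<in> Ar R'.C" "Src R'.C (a \<odot>\<^bsub>Dsj R'\<^esub> b) = ?X \<otimes>\<^bsub>Dsj R'\<^esub> ?Y"
    using a b m by simp_all
  note Mu = Mul_hom[OF X(1,2)] and Mv = Mul_hom[OF X(3,4)]
  \<comment> \<open>The value lies in a poset with the single point \<open>s'\<close>, so the
    constraint at the restricted structures has no freedom; naturality transports this to the given
    structures.\<close>
  have "R.pt (Mul \<phi> (?X, ?Y)) t \<in> Field (R.pos (OM (Und \<phi>) (?X \<otimes>\<^bsub>Dsj R'\<^esub> ?Y)))"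
    using R.pt_Field[OF Mu(1)] t Mu by simp
  then have s': "R.pt (Mul \<phi> (?X, ?Y)) t = s'"
    using one S.pos_map[of "?X \<otimes>\<^bsub>Dsj R'\<^esub> ?Y"] X by simp
  have "R.pt (Mul \<phi> (Tgt R'.C a, Tgt R'.C b)) (R.pt (AM (Und \<phi>) a \<odot>\<^bsub>Dsj R\<^esub> AM (Und \<phi>) b) t)
    = R.pt (Mul \<phi> (Tgt R'.C a, Tgt R'.C b) \<cdot>\<^bsub>R.C\<^esub> (AM (Und \<phi>) a \<odot>\<^bsub>Dsj R\<^esub> AM (Und \<phi>) b)) t"
    using ab Mv t by (intro R.pt_cmp[symmetric]) auto
  also have "\<dots> = R.pt (AM (Und \<phi>) (a \<odot>\<^bsub>Dsj R'\<^esub> b) \<cdot>\<^bsub>R.C\<^esub> Mul \<phi> (?X, ?Y)) t"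
    using strong_monoidalD(5)[OF strong_map a b] by simp
  also have "\<dots> = R.pt (AM (Und \<phi>) (a \<odot>\<^bsub>Dsj R'\<^esub> b)) (R.pt (Mul \<phi> (?X, ?Y)) t)"
    using ab Mu t m(2-4)[OF ab(4)] by (intro R.pt_cmp) auto
  finally show ?thesis using s' ab(4) by (simp add: t_def pt_map)
qed

text \<open>A subset with at most one point is convex by antisymmetry. Both the empty set and
  singletons occur below, to reduce a disjoint union to one point of one summand.\<close>

lemma point_restriction:
  assumes X: "X \<in> Ob R'.C" and K: "K \<subseteq> {p}" "K \<subseteq> Field (R'.pos X)"
  obtains a where "a \<in> Ar R'.C" "Tgt R'.C a = X" "Field (R'.pos (Src R'.C a)) = K" "\<And>v. v \<in> K \<Longrightarrow> R'.pt a v = v"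
proof -
  note P = R'.Partial_order_pos[OF X]
  have "v \<in> K" if "a \<in> K" "b \<in> K" "(a, v) \<in> R'.pos X" "(v, b) \<in> R'.pos X" for a b v
    using that K(1) Partial_order_simps(3)[OF P, of a v] by auto
  then have L: "rlift (Drs R') X K \<in> hom R'.C (restr (Drs R') X K) X"
    "AM (Prj (Drs R')) (rlift (Drs R') X K) = incl (R'.pos X) K" "R'.pos (restr (Drs R') X K) = Restr (R'.pos X) K"
    by (rule R'.rlift_props[OF X K(2)]; blast)+
  show thesis
    by (rule that[of "rlift (Drs R') X K"]) (use L Field_Restr[OF P K(2)] in \<open>auto simp: hom_iff incl_def\<close>)
qed

text \<open>Restrict the summand that contains the point to this point and the other summand to the
  empty set; their union then has a single point. So the constraints of the morphism match the
  identifications given by the two projections.\<close>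

lemma pt_Mul:
  assumes X: "X \<in> Ob R'.C" and Y: "Y \<in> Ob R'.C"
  shows "p \<in> Field (R'.pos X) \<Longrightarrow> R.pt (Mul \<phi> (X, Y)) (R.inl (OM (Und \<phi>) X) (OM (Und \<phi>) Y) p) = R'.inl X Y p"
    "q \<in> Field (R'.pos Y) \<Longrightarrow> R.pt (Mul \<phi> (X, Y)) (R.inr (OM (Und \<phi>) X) (OM (Und \<phi>) Y) q) = R'.inr X Y q"
proof -
  note m = S.map_simps(1-4)
  {
    assume p: "p \<in> Field (R'.pos X)"
    obtain a where a: "a \<in> Ar R'.C" "Tgt R'.C a = X" "Field (R'.pos (Src R'.C a)) = {p}" "\<And>v. v \<in> {p} \<Longrightarrow> R'.pt a v = v"
      by (rule point_restriction[OF X, of "{p}" p]) (use p in auto)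
    obtain b where b: "b \<in> Ar R'.C" "Tgt R'.C b = Y" "Field (R'.pos (Src R'.C b)) = {}"
      by (rule point_restriction[OF Y, of "{}" p]) auto
    have "Field (R'.pos (Src R'.C a \<otimes>\<^bsub>Dsj R'\<^esub> Src R'.C b)) = {R'.inl (Src R'.C a) (Src R'.C b) p}"
      using R'.Field_tens[of "Src R'.C a" "Src R'.C b"] a b by simp
    from pt_Mul_restrict[OF a(1) b(1) _ this, of "Lft p"]
    show "R.pt (Mul \<phi> (X, Y)) (R.inl (OM (Und \<phi>) X) (OM (Und \<phi>) Y) p) = R'.inl X Y p"
      using a b m(2-4)[OF a(1)] m(2-4)[OF b(1)] S.pos_map[of "Src R'.C a"] pt_map[OF a(1)]
        R.pt_tens(1)[of "AM (Und \<phi>) a" "AM (Und \<phi>) b" p] R'.pt_tens(1)[of a b p]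
      by (simp add: R.inl_def[symmetric])
  }
  {
    assume q: "q \<in> Field (R'.pos Y)"
    obtain a where a: "a \<in> Ar R'.C" "Tgt R'.C a = X" "Field (R'.pos (Src R'.C a)) = {}"
      by (rule point_restriction[OF X, of "{}" q]) auto
    obtain b where b: "b \<in> Ar R'.C" "Tgt R'.C b = Y" "Field (R'.pos (Src R'.C b)) = {q}" "\<And>v. v \<in> {q} \<Longrightarrow> R'.pt b v = v"
      by (rule point_restriction[OF Y, of "{q}" q]) (use q in auto)
    have "Field (R'.pos (Src R'.C a \<otimes>\<^bsub>Dsj R'\<^esub> Src R'.C b)) = {R'.inr (Src R'.C a) (Src R'.C b) q}"
      using R'.Field_tens[of "Src R'.C a" "Src R'.C b"] a b by simp
    from pt_Mul_restrict[OF a(1) b(1) _ this, of "Rgt q"]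
    show "R.pt (Mul \<phi> (X, Y)) (R.inr (OM (Und \<phi>) X) (OM (Und \<phi>) Y) q) = R'.inr X Y q"
      using a b m(2-4)[OF a(1)] m(2-4)[OF b(1)] S.pos_map[of "Src R'.C b"] pt_map[OF b(1)]
        R.pt_tens(2)[of "AM (Und \<phi>) a" "AM (Und \<phi>) b" q] R'.pt_tens(2)[of a b q]
      by (simp add: R.inr_def[symmetric])
  }
qed

text \<open>The layering is preserved because \<open>pt_Mul\<close> carries each summand to the same
  summand, point by point, and the morphism leaves layers unchanged.\<close>

lemma PMul_ar:
  assumes x: "x \<in> R'.Lay_ob n" and y: "y \<in> R'.Lay_ob n"
  shows "(Ltens_ob R (map_ob (Und \<phi>) x, map_ob (Und \<phi>) y), Mul \<phi> (str x, str y), map_ob (Und \<phi>) (Ltens_ob R' (x, y)))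
    \<in> Ar (R.L n)"
  unfolding Lcat_Ar
proof (intro conjI ballI)
  note X = R'.LobjD(1)[OF x] R'.LobjD(1)[OF y]
  note mx = S.map_ob_Lobj[OF x] S.map_ob_Lobj[OF y]
  note T = R'.Ltens_ob_simps[OF x y] and T' = R.Ltens_ob_simps[OF mx, unfolded S.map_ob_simps]
  show "Ltens_ob R (map_ob (Und \<phi>) x, map_ob (Und \<phi>) y) \<in> R.Lay_ob n" using mx by (rule R.Ltens_ob_Lobj)
  show "map_ob (Und \<phi>) (Ltens_ob R' (x, y)) \<in> R.Lay_ob n" using R'.Ltens_ob_Lobj[OF x y] by (rule S.map_ob_Lobj)
  show "Mul \<phi> (str x, str y) \<in> hom R.C (str (Ltens_ob R (map_ob (Und \<phi>) x, map_ob (Und \<phi>) y)))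
      (str (map_ob (Und \<phi>) (Ltens_ob R' (x, y))))"
    using Mul_hom[OF X] T(1) T'(1) by (simp add: hom_iff)
  show "is_iso R.C (Mul \<phi> (str x, str y))" using Mul_hom[OF X] by simp
  note pm = S.pos_map[OF X(1)] S.pos_map[OF X(2)]
  fix v assume "v \<in> Field (fst (Ltens_ob R (map_ob (Und \<phi>) x, map_ob (Und \<phi>) y)))"
  then have "v \<in> R.inl (OM (Und \<phi>) (str x)) (OM (Und \<phi>) (str y)) ` Field (R'.pos (str x))
      \<union> R.inr (OM (Und \<phi>) (str x)) (OM (Und \<phi>) (str y)) ` Field (R'.pos (str y))"
    unfolding T'(2) R.Field_tens[OF S.map_simps(1)[OF X(1)] S.map_simps(1)[OF X(2)]] pm .
  then show "lay (map_ob (Und \<phi>) (Ltens_ob R' (x, y))) (R.pt (Mul \<phi> (str x, str y)) v) =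
      lay (Ltens_ob R (map_ob (Und \<phi>) x, map_ob (Und \<phi>) y)) v"
    using pt_Mul[OF X] T(3,4) T'(3,4) pm by auto
qed

lemma PUni_ar: "(Lunit_ob R, Uni \<phi>, map_ob (Und \<phi>) (Lunit_ob R')) \<in> Ar (R.L n)"
  unfolding Lcat_Ar using R.Lunit_Lobj[of n] S.map_ob_Lobj[OF R'.Lunit_Lobj, of n] strong_monoidalD(6,7)[OF strong_map]
  by (auto simp: R.str_Lunit R'.str_Lunit) (auto simp: Lunit_ob_def R.pos_unit)

lemma fibred_monoidal_map_Lmmap:
  "fibred_monoidal_map (Lmsgpd R') R'.C (\<lambda>x. str x) (\<lambda>\<alpha>. fst (snd \<alpha>)) (lov (Drs R')) (Llift (Drs R')) (Dsj R')
    (Lmsgpd R) R.C (\<lambda>x. str x) (\<lambda>\<alpha>. fst (snd \<alpha>)) (lov (Drs R)) (Llift (Drs R)) (Dsj R) (Lmmap R' \<phi> R) \<phi>"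
proof (intro fibred_monoidal_map.intro R'.fibred_monoidal_Lmsgpd R.fibred_monoidal_Lmsgpd)
  show "fibred_map (Base (Lmsgpd R')) R'.C (\<lambda>x. str x) (\<lambda>\<alpha>. fst (snd \<alpha>)) (lov (Drs R')) (Llift (Drs R'))
    (Base (Lmsgpd R)) R.C (\<lambda>x. str x) (\<lambda>\<alpha>. fst (snd \<alpha>)) (lov (Drs R)) (Llift (Drs R)) (Smap (Lmmap R' \<phi> R)) (Und \<phi>)"
    using S.fibred_map_Lmap by (simp add: Lmmap_def)
  show "fibred_monoidal_map_axioms (Lmsgpd R') R'.C (\<lambda>x. str x) (Dsj R') (Lmsgpd R) R.C (\<lambda>\<alpha>. fst (snd \<alpha>)) (Dsj R)
     (Lmmap R' \<phi> R) \<phi>"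
  proof (unfold_locales, goal_cases)
    case 1 show ?case by (rule strong_map)
  next
    case (2 x n y)
    then have x: "x \<in> R'.Lay_ob n" "y \<in> R'.Lay_ob n" by simp_all
    show ?case
      using x PMul_ar[OF x] S.map_ob_Lobj[OF x(1)] S.map_ob_Lobj[OF x(2)] R'.Ltens_ob_Lobj[OF x]
      by (simp add: Lmmap_def S.Lmap_Cpt Lcat_hom)
  next
    case (3 n) show ?case by (simp add: Lmmap_def)
  next
    case (4 n) show ?case
      using PUni_ar[of n] R'.Lunit_Lobj[of n] by (simp add: Lmmap_def S.Lmap_Cpt Lcat_hom Lunit_def)
  qed
qed

lemma monoidal_sgmap_Lmmap: "monoidal_sgmap (Lmsgpd R') (Lmsgpd R) (Lmmap R' \<phi> R)"
  using fibred_monoidal_map.monoidal_sgmap[OF fibred_monoidal_map_Lmmap] .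

end

section \<open>Functoriality on monoidal species\<close>

lemma (in monoidal_species) Lmmap_id: "Lmmap R (id_mftor C (Dsj R)) R = id_msgmap (Lmsgpd R)"
proof -
  let ?I = "id_ftor C"
  have m: "map_ob ?I x = x" if "x \<in> Lay_ob n" for x n
    using LobjD(1)[OF that] by (cases x) (simp add: id_ftor_def)
  have "(Ltens_ob R (map_ob ?I x, map_ob ?I y), Mul (id_mftor C (Dsj R)) (str x, str y), map_ob ?I (Ltens_ob R (x, y)))
      = Ide (L n) (OM (Cpt (Ltens R) n) (x, y))" if xy: "x \<in> Lay_ob n" "y \<in> Lay_ob n" for n x y
    using m[OF xy(1)] m[OF xy(2)] m[OF Ltens_ob_Lobj[OF xy]] LobjD(1)[OF xy(1)] LobjD(1)[OF xy(2)] Ltens_ob_simps(1)[OF xy] xy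
    by (simp add: id_mftor_def del: map_ob.simps Ltens_ob.simps)
  then have "PMul (Lmmap R (id_mftor C (Dsj R)) R) = PMul (id_msgmap (Lmsgpd R))"
    by (auto simp: Lmmap_def id_msgmap_def id_mftor_def[of "L _"] id_mftor_def[of C, THEN arg_cong, of Und] mon_at_def
        simp del: map_ob.simps Ltens_ob.simps intro!: ext restrict_ext)
  moreover have "PUni (Lmmap R (id_mftor C (Dsj R)) R) = PUni (id_msgmap (Lmsgpd R))"
    using m[OF Lunit_Lobj] by (simp add: Lmmap_def id_msgmap_def id_mftor_def mon_at_def Lunit_def str_Lunit)
  moreover have "Smap (Lmmap R (id_mftor C (Dsj R)) R) = Smap (id_msgmap (Lmsgpd R))"
    by (simp add: Lmmap_def id_msgmap_def id_mftor_def Lmap_id)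
  ultimately show ?thesis by (intro msgmap.equality) auto
qed

lemma Lmmap_comp:
  assumes "monoidal_species_map R S \<phi>" "monoidal_species_map S T \<psi>"
  shows "Lmmap R (comp_mftor (Tot (Drs R)) (Tot (Drs T)) \<psi> \<phi>) T
    = comp_msgmap (Lmsgpd R) (Lmsgpd T) (Lmmap S \<psi> T) (Lmmap R \<phi> S)"
proof -
  interpret F: monoidal_species_map R S \<phi> by fact
  interpret G: monoidal_species_map S T \<psi> by fact
  let ?c = "comp_mftor (Tot (Drs R)) (Tot (Drs T)) \<psi> \<phi>"
  have U: "Und ?c = comp_ftor (Tot (Drs R)) (Und \<psi>) (Und \<phi>)" by (simp add: comp_mftor_def)
  have m: "map_ob (Und ?c) x = map_ob (Und \<psi>) (map_ob (Und \<phi>) x)" if "x \<in> F.R'.Lay_ob n" for x n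
    using F.R'.LobjD(1)[OF that] by (cases x) (simp add: U comp_ftor_OM)
  have Sm: "Smap (Lmmap Q \<chi> Q') = Lmap (Drs Q) (Und \<chi>) (Drs Q')" for Q Q' \<chi> by (simp add: Lmmap_def)
  have "PMul (Lmmap R ?c T) n xy = PMul (comp_msgmap (Lmsgpd R) (Lmsgpd T) (Lmmap S \<psi> T) (Lmmap R \<phi> S)) n xy"
    if "xy \<in> F.R'.Lay_ob n \<times> F.R'.Lay_ob n" for n xy
  proof -
    obtain x y where e: "xy = (x, y)" by (cases xy)
    have x: "x \<in> F.R'.Lay_ob n" "y \<in> F.R'.Lay_ob n" using that by (auto simp: e)
    note mx = F.S.map_ob_Lobj[OF x(1)] F.S.map_ob_Lobj[OF x(2)]
    have "PMul (Lmmap R ?c T) n xy = (Ltens_ob T (map_ob (Und \<psi>) (map_ob (Und \<phi>) x), map_ob (Und \<psi>) (map_ob (Und \<phi>) y)),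
        AM (Und \<psi>) (Mul \<phi> (str x, str y)) \<cdot>\<^bsub>Tot (Drs T)\<^esub> Mul \<psi> (OM (Und \<phi>) (str x), OM (Und \<phi>) (str y)),
        map_ob (Und \<psi>) (map_ob (Und \<phi>) (Ltens_ob R (x, y))))"
      using x m[OF x(1)] m[OF x(2)] m[OF F.R'.Ltens_ob_Lobj[OF x]] F.R'.LobjD(1)[OF x(1)] F.R'.LobjD(1)[OF x(2)]
      by (simp add: e Lmmap_def comp_mftor_def del: map_ob.simps Ltens_ob.simps)
    moreover have "PMul (comp_msgmap (Lmsgpd R) (Lmsgpd T) (Lmmap S \<psi> T) (Lmmap R \<phi> S)) n xy =
        AM (Cpt (Lmap (Drs S) (Und \<psi>) (Drs T)) n) (PMul (Lmmap R \<phi> S) n (x, y)) \<cdot>\<^bsub>Lcat (Drs T) n\<^esub>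
        PMul (Lmmap S \<psi> T) n (map_ob (Und \<phi>) x, map_ob (Und \<phi>) y)"
      using x by (simp add: e comp_msgmap_def comp_mftor_def map_at_def Sm F.S.Lmap_Cpt)
    moreover have "PMul (Lmmap R \<phi> S) n (x, y) = (Ltens_ob S (map_ob (Und \<phi>) x, map_ob (Und \<phi>) y), Mul \<phi> (str x, str y),
        map_ob (Und \<phi>) (Ltens_ob R (x, y)))"
      using x by (simp add: Lmmap_def del: map_ob.simps Ltens_ob.simps)
    moreover have "PMul (Lmmap S \<psi> T) n (map_ob (Und \<phi>) x, map_ob (Und \<phi>) y) =
      (Ltens_ob T (map_ob (Und \<psi>) (map_ob (Und \<phi>) x), map_ob (Und \<psi>) (map_ob (Und \<phi>) y)),
        Mul \<psi> (OM (Und \<phi>) (str x), OM (Und \<phi>) (str y)), map_ob (Und \<psi>) (Ltens_ob S (map_ob (Und \<phi>) x, map_ob (Und \<phi>) y)))"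
      using mx by (simp add: Lmmap_def del: map_ob.simps Ltens_ob.simps)
    ultimately show ?thesis
      using G.S.Lmap_Cpt(2)[OF F.PMul_ar[OF x]] by (simp del: map_ob.simps Ltens_ob.simps)
  qed
  then have "PMul (Lmmap R ?c T) n = PMul (comp_msgmap (Lmsgpd R) (Lmsgpd T) (Lmmap S \<psi> T) (Lmmap R \<phi> S)) n" for n
    by (intro extensionalityI[of _ "F.R'.Lay_ob n \<times> F.R'.Lay_ob n"])
      (auto simp: Lmmap_def comp_msgmap_def comp_mftor_def)
  then have "PMul (Lmmap R ?c T) = PMul (comp_msgmap (Lmsgpd R) (Lmsgpd T) (Lmmap S \<psi> T) (Lmmap R \<phi> S))"
    by (rule ext)
  moreover have "PUni (Lmmap R ?c T) = PUni (comp_msgmap (Lmsgpd R) (Lmsgpd T) (Lmmap S \<psi> T) (Lmmap R \<phi> S))"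
  proof
    fix n
    have "PUni (Lmmap R ?c T) n = (Lunit_ob T, AM (Und \<psi>) (Uni \<phi>) \<cdot>\<^bsub>Tot (Drs T)\<^esub> Uni \<psi>,
        map_ob (Und \<psi>) (map_ob (Und \<phi>) (Lunit_ob R)))"
      using m[OF F.R'.Lunit_Lobj] by (simp add: Lmmap_def) (simp add: comp_mftor_def)
    then show "PUni (Lmmap R ?c T) n = PUni (comp_msgmap (Lmsgpd R) (Lmsgpd T) (Lmmap S \<psi> T) (Lmmap R \<phi> S)) n"
      using G.S.Lmap_Cpt(2)[OF F.PUni_ar, of n] by (simp add: comp_msgmap_def comp_mftor_def map_at_def Sm) (simp add: Lmmap_def)
  qed
  moreover have "Smap (Lmmap R ?c T) = Smap (comp_msgmap (Lmsgpd R) (Lmsgpd T) (Lmmap S \<psi> T) (Lmmap R \<phi> S))"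
    using Lmap_comp[OF F.S.species_map_axioms G.S.species_map_axioms] by (simp add: Sm comp_msgmap_def U)
  ultimately show ?thesis by (intro msgmap.equality) auto
qed

lemma MDRS_simps [simp]:
  "R \<in> Ob MDRS \<longleftrightarrow> monoidal_drs R"
  "(R', \<phi>, R) \<in> Ar MDRS \<longleftrightarrow> monoidal_drs R' \<and> monoidal_drs R \<and>
     strong_monoidal (Tot (Drs R')) (Dsj R') (Tot (Drs R)) (Dsj R) \<phi> \<and> drs_morphism (Drs R') (Drs R) (Und \<phi>)"
  "Src MDRS (R', \<phi>, R) = R'" "Tgt MDRS (R', \<phi>, R) = R" "Ide MDRS R = (R, id_mftor (Tot (Drs R)) (Dsj R), R)"
  "(S', \<psi>, S) \<cdot>\<^bsub>MDRS\<^esub> (R', \<phi>, R) = (R', comp_mftor (Tot (Drs R')) (Tot (Drs S)) \<psi> \<phi>, S)"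
  by (auto simp: MDRS_def)

lemma MDcmp_simps [simp]:
  "X \<in> Ob MDcmp \<longleftrightarrow> monoidal_decomposition_space X"
  "(X, F, Y) \<in> Ar MDcmp \<longleftrightarrow> monoidal_decomposition_space X \<and> monoidal_decomposition_space Y \<and>
     culf (Base X) (Base Y) (Smap F) \<and> monoidal_sgmap X Y F"
  "Src MDcmp (X, F, Y) = X" "Tgt MDcmp (X, F, Y) = Y" "Ide MDcmp X = (X, id_msgmap X, X)"
  "(Y', G, Z) \<cdot>\<^bsub>MDcmp\<^esub> (X, F, Y) = (X, comp_msgmap X Z G F, Z)"
  by (auto simp: MDcmp_def)

lemma monoidal_speciesI: "monoidal_drs R \<Longrightarrow> monoidal_species R"
  by (rule monoidal_species.intro)

lemma monoidal_species_mapI: "(R', \<phi>, R) \<in> Ar MDRS \<Longrightarrow> monoidal_species_map R' R \<phi>"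
  by (simp add: monoidal_species_map_def monoidal_species_def monoidal_species_map_axioms_def)

lemma MDRS_id: "monoidal_drs R \<Longrightarrow> (R, id_mftor (Tot (Drs R)) (Dsj R), R) \<in> Ar MDRS"
  using strong_monoidal_id[of "Tot (Drs R)" "Dsj R"] drs_morphism_id[of "Drs R"]
  by (simp add: monoidal_drs_def id_mftor_def)

lemma MDRS_comp:
  assumes "(R, \<phi>, S) \<in> Ar MDRS" "(S, \<psi>, T) \<in> Ar MDRS"
  shows "(R, comp_mftor (Tot (Drs R)) (Tot (Drs T)) \<psi> \<phi>, T) \<in> Ar MDRS"
  using assms drs_morphism_comp[of "Drs R" "Drs S" "Und \<phi>" "Drs T" "Und \<psi>"]
    strong_monoidal_comp[of "Tot (Drs R)" "Dsj R" "Tot (Drs S)" "Dsj S" "Tot (Drs T)" "Dsj T" \<phi> \<psi>]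
  by (simp add: monoidal_drs_def comp_mftor_def[of _ _ \<psi> \<phi>, THEN arg_cong, of Und])

lemma MLay_ar:
  assumes "(R', \<phi>, R) \<in> Ar MDRS" shows "(Lmsgpd R', Lmmap R' \<phi> R, Lmsgpd R) \<in> Ar MDcmp"
proof -
  interpret monoidal_species_map R' R \<phi> by (rule monoidal_species_mapI) fact
  show ?thesis
    using R'.monoidal_decomposition_space_Lmsgpd R.monoidal_decomposition_space_Lmsgpd monoidal_sgmap_Lmmap S.culf_Lmap
    by (simp add: Lmmap_def)
qed

theorem MLay_functor: "is_functor MDRS MDcmp MLay"
proof (rule functorI)
  show "OM MLay R \<in> Ob MDcmp" if "R \<in> Ob MDRS" for R
    using that monoidal_species.monoidal_decomposition_space_Lmsgpd[OF monoidal_speciesI, of R] by (simp add: MLay_def)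
  show "AM MLay a \<in> hom MDcmp (OM MLay (Src MDRS a)) (OM MLay (Tgt MDRS a))" if "a \<in> Ar MDRS" for a
  proof -
    obtain R' \<phi> R where a: "a = (R', \<phi>, R)" by (cases a)
    show ?thesis using that MLay_ar[of R' \<phi> R] by (simp add: a MLay_def hom_iff)
  qed
  show "AM MLay (Ide MDRS R) = Ide MDcmp (OM MLay R)" if "R \<in> Ob MDRS" for R
    using that MDRS_id[of R] monoidal_species.Lmmap_id[OF monoidal_speciesI, of R] by (simp add: MLay_def)
  show "AM MLay (b \<cdot>\<^bsub>MDRS\<^esub> a) = AM MLay b \<cdot>\<^bsub>MDcmp\<^esub> AM MLay a"
    if ab: "a \<in> Ar MDRS" "b \<in> Ar MDRS" "Src MDRS b = Tgt MDRS a" for a b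
  proof -
    obtain R \<phi> S \<psi> T where e: "a = (R, \<phi>, S)" "b = (S, \<psi>, T)" using ab(3) by (cases a; cases b) auto
    show ?thesis
      using ab Lmmap_comp[OF monoidal_species_mapI monoidal_species_mapI, of R \<phi> S \<psi> T] MDRS_comp[of R \<phi> S \<psi> T]
      by (simp add: e MLay_def)
  qed
qed (auto simp: MLay_def)

text \<open>The last conjunct expresses that the second functor extends the first: forgetting
  monoidal structures before or after passing to layered structures gives the same functor. This is
  a strict equality because the base of \<open>Lmsgpd R\<close> and the simplicial map underlying
  \<open>Lmmap\<close> are the non-monoidal constructions themselves.\<close>

theorem proposition7p9:
  shows "is_functor DRS Dcmp (Lay :: (('v, 'o, 'a) drs, _, _, _) ftor) \<and>
    is_functor MDRS MDcmp (MLay :: (('v, 'o, 'a) mdrs, _, _, _) ftor) \<and>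
    comp_ftor MDRS forget_Dcmp (MLay :: (('v, 'o, 'a) mdrs, _, _, _) ftor) = comp_ftor MDRS Lay forget_DRS"
proof (intro conjI Lay_functor MLay_functor)
  have "OM forget_Dcmp (OM MLay R) = OM Lay (OM forget_DRS R)" if "R \<in> Ob MDRS" for R :: "('v, 'o, 'a) mdrs"
    using that functorD(1)[OF MLay_functor that]
    by (simp add: forget_Dcmp_def forget_DRS_def MLay_def Lay_def Lmsgpd_def monoidal_drs_def)
  moreover have "AM forget_Dcmp (AM MLay a) = AM Lay (AM forget_DRS a)" if "a \<in> Ar MDRS"
    for a :: "('v, 'o, 'a) mdrs \<times> ('o, 'a, 'o, 'a) mftor \<times> ('v, 'o, 'a) mdrs"
  proof -
    obtain R' \<phi> R where a: "a = (R', \<phi>, R)" by (cases a)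
    show ?thesis
      using that MLay_ar[of R' \<phi> R]
      by (simp add: a forget_Dcmp_def forget_DRS_def MLay_def Lay_def) (simp add: Lmsgpd_def Lmmap_def monoidal_drs_def)
  qed
  ultimately show "comp_ftor MDRS forget_Dcmp (MLay :: (('v, 'o, 'a) mdrs, _, _, _) ftor) = comp_ftor MDRS Lay forget_DRS"
    by (auto simp: comp_ftor_def compose_def fun_eq_iff)
qed

end
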